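(* Let $\delta\in(1/2,1)$ and $c_\delta(x)=\Big(\dfrac{|x|^2}{1+|x|^2}\Big)^{\delta}$ for $x\in\mathbb{R}$. Then $c_\delta$ is differentiable with $c_\delta'\in C^{2\delta-1}(\mathbb{R})$ (Hölder continuous of exponent $2\delta-1$). Let $H_0$ be the viscosity operator on $L_2(\mathbb{R})$ with coefficient $c_\delta$ and $S^{(0)}$ its semigroup. Then $H_0$ is subelliptic of order $1-\delta$, the operators $S^{(0)}_t$ have bounded kernels $K^{(0)}_t$, and nevertheless, for all $t>0$: the operator $S^{(0)}_t$ is not positivity improving; the kernel $K^{(0)}_t$ is not strictly positive; and the kernel $K^{(0)}_t$ is not continuous.
   Context: For a real-valued $c\in L_\infty(\mathbb{R})$ with $c\ge0$ a.e. and $\varepsilon\in(0,1]$, let $H_\varepsilon$ be the positive self-adjoint operator on $L_2(\mathbb{R})$ associated with the closed form $h_\varepsilon(\varphi)=\int_{\mathbb{R}}(c+\varepsilon)|\varphi'|^2$ with domain $W^{1,2}(\mathbb{R})$. As $\varepsilon\downarrow0$, $H_\varepsilon$ converges in the strong resolvent sense to a positive self-adjoint operator $H_0$, the viscosity operator with coefficient $c$; $S^{(0)}_t=e^{-tH_0}$ is the viscosity semigroup. With $\Delta=-d^2/dx^2$ the positive self-adjoint Laplacian on $L_2(\mathbb{R})$, $H_0$ is called subelliptic of order $\gamma\in(0,1]$ if there exist $\mu>0$, $\nu\ge0$ such that $D(H_0^{1/2})\subseteq D(\Delta^{\gamma/2})$ and $\|H_0^{1/2}\varphi\|_2^2+\nu\|\varphi\|_2^2\ge\mu\|\Delta^{\gamma/2}\varphi\|_2^2$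 for all $\varphi\in D(H_0^{1/2})$. The kernel $K^{(0)}_t$ is the function (defined a.e. on $\mathbb{R}\times\mathbb{R}$) with $(S^{(0)}_t\varphi)(x)=\int K^{(0)}_t(x;y)\varphi(y)\,dy$; "strictly positive" means $>0$ almost everywhere, and "not continuous" means that it is not a.e. equal to a continuous function. A bounded operator $S$ on $L_2(\mathbb{R})$ is positivity improving if $S\varphi>0$ almost everywhere whenever $\varphi\ge0$ and $\varphi\ne0$. *)

theory Defs
  imports "HOL-Analysis.Analysis" "HOL-Library.Complex_Order"
begin

section \<open>The Hilbert space of square-integrable functions on the line\<close>

text \<open>
  Elements of the complex Hilbert space are represented by Borel functions; equality of elements is
  equality almost everywhere (\<open>ae_eq\<close>). Unbounded operators are represented by their graphs, i.e.
  sets of pairs of representatives.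
\<close>

definition L2 :: "(real \<Rightarrow> complex) set" where
  "L2 = {\<phi> \<in> borel_measurable lborel. integrable lborel (\<lambda>x. (cmod (\<phi> x))\<^sup>2)}"

definition ae_eq :: "(real \<Rightarrow> complex) \<Rightarrow> (real \<Rightarrow> complex) \<Rightarrow> bool" where
  "ae_eq \<phi> \<psi> \<longleftrightarrow> (AE x in lborel. \<phi> x = \<psi> x)"

definition l2_inner :: "(real \<Rightarrow> complex) \<Rightarrow> (real \<Rightarrow> complex) \<Rightarrow> complex" where
  "l2_inner \<phi> \<psi> = (LINT x|lborel. \<phi> x * cnj (\<psi> x))"

definition l2_norm :: "(real \<Rightarrow> complex) \<Rightarrow> real" where
  "l2_norm \<phi> = sqrt (LINT x|lborel. (cmod (\<phi> x))\<^sup>2)"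

type_synonym l2_op = "((real \<Rightarrow> complex) \<times> (real \<Rightarrow> complex)) set"

definition densely_defined :: "l2_op \<Rightarrow> bool" where
  "densely_defined H \<longleftrightarrow>
     (\<forall>\<psi>\<in>L2. \<forall>e>0. \<exists>\<phi>\<in>Domain H. l2_norm (\<lambda>x. \<psi> x - \<phi> x) < e)"

definition adjoint_op :: "l2_op \<Rightarrow> l2_op" where
  "adjoint_op H =
     {(\<psi>, g) \<in> L2 \<times> L2. \<forall>(\<phi>, f)\<in>H. l2_inner f \<psi> = l2_inner \<phi> g}"

text \<open>
  Being an adjoint, a graph with \<open>H = adjoint_op H\<close> is a linear subspace of \<open>L2 \<times> L2\<close> that is
  closed under \<open>ae_eq\<close>; density of the domain makes it single-valued up to \<open>ae_eq\<close>.
\<close>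

definition self_adjoint_op :: "l2_op \<Rightarrow> bool" where
  "self_adjoint_op H \<longleftrightarrow> densely_defined H \<and> H = adjoint_op H"

definition positive_self_adjoint :: "l2_op \<Rightarrow> bool" where
  "positive_self_adjoint H \<longleftrightarrow> self_adjoint_op H \<and> (\<forall>(\<phi>, f)\<in>H. 0 \<le> Re (l2_inner f \<phi>))"


section \<open>Functional calculus of a self-adjoint operator\<close>

text \<open>Projection-valued measures on the Borel sets of the line.\<close>

definition pvm :: "(real set \<Rightarrow> (real \<Rightarrow> complex) \<Rightarrow> (real \<Rightarrow> complex)) \<Rightarrow> bool" where
  "pvm E \<longleftrightarrow>
     (\<forall>B\<in>sets borel. \<forall>\<phi>\<in>L2. E B \<phi> \<in> L2) \<and>
     (\<forall>B\<in>sets borel. \<forall>\<phi>\<in>L2. \<forall>\<psi>\<in>L2. l2_inner (E B \<phi>) \<psi> = l2_inner \<phi> (E B \<psi>)) \<and>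
     (\<forall>B\<in>sets borel. \<forall>C\<in>sets borel. \<forall>\<phi>\<in>L2. ae_eq (E (B \<inter> C) \<phi>) (E B (E C \<phi>))) \<and>
     (\<forall>\<phi>\<in>L2. ae_eq (E {} \<phi>) (\<lambda>x. 0)) \<and>
     (\<forall>\<phi>\<in>L2. ae_eq (E UNIV \<phi>) \<phi>) \<and>
     (\<forall>B::nat \<Rightarrow> real set. range B \<subseteq> sets borel \<longrightarrow> disjoint_family B \<longrightarrow>
        (\<forall>\<phi>\<in>L2. (\<lambda>n. l2_norm (\<lambda>x. E (\<Union>i. B i) \<phi> x - (\<Sum>i<n. E (B i) \<phi> x)))
                    \<longlonglongrightarrow> 0))"

definition spectral_measure ::
    "(real set \<Rightarrow> (real \<Rightarrow> complex) \<Rightarrow> (real \<Rightarrow> complex)) \<Rightarrow> (real \<Rightarrow> complex) \<Rightarrow> real measure" where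
  "spectral_measure E \<phi> = measure_of UNIV (sets borel) (\<lambda>B. ennreal ((l2_norm (E B \<phi>))\<^sup>2))"

definition spectral_domain ::
    "(real set \<Rightarrow> (real \<Rightarrow> complex) \<Rightarrow> (real \<Rightarrow> complex)) \<Rightarrow> (real \<Rightarrow> real)
       \<Rightarrow> (real \<Rightarrow> complex) set" where
  "spectral_domain E f = {\<phi> \<in> L2. integrable (spectral_measure E \<phi>) (\<lambda>s. (f s)\<^sup>2)}"

text \<open>
  The integral of \<open>f\<close> against the complex measure \<open>B \<mapsto> l2_inner (E B \<phi>) \<psi>\<close>, by polarization.
\<close>

definition spectral_form ::
    "(real set \<Rightarrow> (real \<Rightarrow> complex) \<Rightarrow> (real \<Rightarrow> complex)) \<Rightarrow> (real \<Rightarrow> real)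
       \<Rightarrow> (real \<Rightarrow> complex) \<Rightarrow> (real \<Rightarrow> complex) \<Rightarrow> complex" where
  "spectral_form E f \<phi> \<psi> =
     (\<Sum>k<4. \<i> ^ k * complex_of_real (LINT s|spectral_measure E (\<lambda>x. \<phi> x + \<i> ^ k * \<psi> x). f s)) / 4"

text \<open>The operator \<open>\<integral> f dE\<close>, for real Borel functions \<open>f\<close>.\<close>

definition spectral_op ::
    "(real set \<Rightarrow> (real \<Rightarrow> complex) \<Rightarrow> (real \<Rightarrow> complex)) \<Rightarrow> (real \<Rightarrow> real) \<Rightarrow> l2_op" where
  "spectral_op E f =
     {(\<phi>, g). \<phi> \<in> spectral_domain E f \<and> g \<in> L2 \<and>
        (\<forall>\<psi>\<in>spectral_domain E f. l2_inner g \<psi> = spectral_form E f \<phi> \<psi>)}"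

definition spectral_resolution ::
    "l2_op \<Rightarrow> (real set \<Rightarrow> (real \<Rightarrow> complex) \<Rightarrow> (real \<Rightarrow> complex)) \<Rightarrow> bool" where
  "spectral_resolution H E \<longleftrightarrow> pvm E \<and> H = spectral_op E (\<lambda>s. s)"

text \<open>
  By the spectral theorem the spectral resolution of a self-adjoint operator exists and is unique
  up to \<open>ae_eq\<close>, so the existential quantifiers over \<open>E\<close> below do not introduce ambiguity. The
  spectral resolution of a positive operator is supported in \<open>{0..}\<close>, so the values of \<open>powr\<close> at
  negative arguments do not matter.
\<close>

definition op_power :: "l2_op \<Rightarrow> real \<Rightarrow> l2_op" where
  "op_power H \<alpha> =
     {(\<phi>, f). \<exists>E. spectral_resolution H E \<and> (\<phi>, f) \<in> spectral_op E (\<lambda>s. s powr \<alpha>)}"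

definition is_exp_semigroup ::
    "l2_op \<Rightarrow> (real \<Rightarrow> (real \<Rightarrow> complex) \<Rightarrow> (real \<Rightarrow> complex)) \<Rightarrow> bool" where
  "is_exp_semigroup H S \<longleftrightarrow>
     (\<exists>E. spectral_resolution H E \<and>
        (\<forall>t\<ge>0. \<forall>\<phi>\<in>L2. (\<phi>, S t \<phi>) \<in> spectral_op E (\<lambda>s. exp (- t * s))))"


section \<open>Sobolev spaces and the Laplacian\<close>

definition test_function :: "(real \<Rightarrow> real) \<Rightarrow> bool" where
  "test_function \<eta> \<longleftrightarrow>
     (\<forall>n x. (deriv ^^ n) \<eta> differentiable (at x)) \<and> compact (closure {x. \<eta> x \<noteq> 0})"

definition weak_deriv :: "(real \<Rightarrow> complex) \<Rightarrow> (real \<Rightarrow> complex) \<Rightarrow> bool" where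
  "weak_deriv \<phi> g \<longleftrightarrow> \<phi> \<in> L2 \<and> g \<in> L2 \<and>
     (\<forall>\<eta>. test_function \<eta> \<longrightarrow>
        (LINT x|lborel. \<phi> x * complex_of_real (deriv \<eta> x)) =
        - (LINT x|lborel. g x * complex_of_real (\<eta> x)))"

definition W12 :: "(real \<Rightarrow> complex) set" where
  "W12 = {\<phi>. \<exists>g. weak_deriv \<phi> g}"

definition wderiv :: "(real \<Rightarrow> complex) \<Rightarrow> (real \<Rightarrow> complex)" where
  "wderiv \<phi> = (SOME g. weak_deriv \<phi> g)"

text \<open>The positive Laplacian, with domain the second-order Sobolev space.\<close>

definition laplacian :: "l2_op" where
  "laplacian = {(\<phi>, f). f \<in> L2 \<and> (\<exists>g. weak_deriv \<phi> g \<and> weak_deriv g (\<lambda>x. - f x))}"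


section \<open>Viscosity operators\<close>

definition visc_form ::
    "(real \<Rightarrow> real) \<Rightarrow> real \<Rightarrow> (real \<Rightarrow> complex) \<Rightarrow> (real \<Rightarrow> complex) \<Rightarrow> complex" where
  "visc_form c \<epsilon> \<phi> \<psi> =
     (LINT x|lborel. complex_of_real (c x + \<epsilon>) * wderiv \<phi> x * cnj (wderiv \<psi> x))"

definition form_op ::
    "(real \<Rightarrow> complex) set \<Rightarrow> ((real \<Rightarrow> complex) \<Rightarrow> (real \<Rightarrow> complex) \<Rightarrow> complex) \<Rightarrow> l2_op" where
  "form_op D h = {(\<phi>, f). \<phi> \<in> D \<and> f \<in> L2 \<and> (\<forall>\<psi>\<in>D. h \<phi> \<psi> = l2_inner f \<psi>)}"

definition visc_approx :: "(real \<Rightarrow> real) \<Rightarrow> real \<Rightarrow> l2_op" where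
  "visc_approx c \<epsilon> = form_op W12 (visc_form c \<epsilon>)"

text \<open>A representative of \<open>(r + H)\<^sup>-\<^sup>1 f\<close>.\<close>

definition resolvent :: "l2_op \<Rightarrow> real \<Rightarrow> (real \<Rightarrow> complex) \<Rightarrow> (real \<Rightarrow> complex)" where
  "resolvent H r f = (SOME \<phi>. (\<phi>, \<lambda>x. f x - complex_of_real r * \<phi> x) \<in> H)"

definition is_viscosity_operator :: "(real \<Rightarrow> real) \<Rightarrow> l2_op \<Rightarrow> bool" where
  "is_viscosity_operator c H \<longleftrightarrow> positive_self_adjoint H \<and>
     (\<forall>r>0. \<forall>f\<in>L2.
        ((\<lambda>\<epsilon>. l2_norm (\<lambda>x. resolvent (visc_approx c \<epsilon>) r f x - resolvent H r f x))
           \<longlongrightarrow> 0) (at_right 0))"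

definition subelliptic :: "l2_op \<Rightarrow> real \<Rightarrow> bool" where
  "subelliptic H \<gamma> \<longleftrightarrow> 0 < \<gamma> \<and> \<gamma> \<le> 1 \<and>
     (\<exists>\<mu>>0. \<exists>\<nu>\<ge>0. \<forall>(\<phi>, f)\<in>op_power H (1/2).
        \<exists>g. (\<phi>, g) \<in> op_power laplacian (\<gamma>/2) \<and>
            (l2_norm f)\<^sup>2 + \<nu> * (l2_norm \<phi>)\<^sup>2 \<ge> \<mu> * (l2_norm g)\<^sup>2)"


section \<open>Kernels and positivity\<close>

definition is_kernel ::
    "((real \<Rightarrow> complex) \<Rightarrow> (real \<Rightarrow> complex)) \<Rightarrow> (real \<times> real \<Rightarrow> complex) \<Rightarrow> bool" where
  "is_kernel T K \<longleftrightarrow> K \<in> borel_measurable lborel \<and>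
     (\<forall>\<phi>\<in>L2. AE x in lborel. integrable lborel (\<lambda>y. K (x, y) * \<phi> y) \<and>
        T \<phi> x = (LINT y|lborel. K (x, y) * \<phi> y))"

definition bounded_kernel :: "(real \<times> real \<Rightarrow> complex) \<Rightarrow> bool" where
  "bounded_kernel K \<longleftrightarrow> (\<exists>M. AE z in lborel. cmod (K z) \<le> M)"

text \<open>In \<open>Complex_Order\<close>, \<open>0 < z\<close> means that \<open>z\<close> is real and strictly positive.\<close>

definition strictly_positive_kernel :: "(real \<times> real \<Rightarrow> complex) \<Rightarrow> bool" where
  "strictly_positive_kernel K \<longleftrightarrow> (AE z in lborel. 0 < K z)"

definition continuous_kernel :: "(real \<times> real \<Rightarrow> complex) \<Rightarrow> bool" where
  "continuous_kernel K \<longleftrightarrow> (\<exists>G. continuous_on UNIV G \<and> (AE z in lborel. K z = G z))"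

definition positivity_improving :: "((real \<Rightarrow> complex) \<Rightarrow> (real \<Rightarrow> complex)) \<Rightarrow> bool" where
  "positivity_improving T \<longleftrightarrow>
     (\<forall>\<phi>\<in>L2. (AE x in lborel. 0 \<le> \<phi> x) \<longrightarrow> \<not> ae_eq \<phi> (\<lambda>x. 0) \<longrightarrow>
        (AE x in lborel. 0 < T \<phi> x))"


section \<open>The coefficient\<close>

definition c_coeff :: "real \<Rightarrow> real \<Rightarrow> real" where
  "c_coeff \<delta> x = (\<bar>x\<bar>\<^sup>2 / (1 + \<bar>x\<bar>\<^sup>2)) powr \<delta>"

definition holder_space :: "real \<Rightarrow> (real \<Rightarrow> real) set" where
  "holder_space \<alpha> =
     {f. bounded (range f) \<and> (\<exists>C. \<forall>x y. \<bar>f x - f y\<bar> \<le> C * \<bar>x - y\<bar> powr \<alpha>)}"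

end

(* Near 0 the coefficient behaves like |x|^(2 delta) with 2 delta > 1, so cutting a function off at
   the origin costs arbitrarily little energy: multiplication by the indicator of the half-line
   preserves the closure of the form, hence commutes with the resolvent and the semigroup. This
   excludes positivity. Applying the flux equation c u' = - integral of H u repeatedly improves the
   singularity of u at 0 by a fixed power each time, so functions in the range of the semigroup are
   bounded and the kernel exists. A continuous kernel would vanish at the origin; then all these
   functions have boundary value 0 there, and a Volterra iteration makes those of bounded spectral
   support vanish on (0, 1), which is absurd. Subellipticity is a Schur test for the Fourier
   transform of u' with weight |x|^delta. *)
theory Submission
  imports Defs
begin

text \<open>The operator is given only as a strong resolvent limit and its semigroup only through
  some spectral resolution. Both are tied to one concrete object, the closure \<open>M\<close> of
  the graph of u -> sqrt(c) u': the orthogonal projection of (f, 0) onto \<open>M\<close> gives the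
  resolvent at 1. The two bounds on \<delta> act in opposite directions. A cut-off of slope n on (0,
  1/n) costs sqrt(c) n, dominated by x^(\<delta> - 1), which is square integrable at 0 for \<delta>
  > 1/2. Two integrations gain 2 and the division by c loses 2 \<delta>, so the flux equation
  improves exponents for \<delta> < 1. The obstacle to refuting continuity is that the kernel is
  known to vanish only for x and y of opposite sign. Its value 0 at the origin becomes usable
  through S_t = S_(t/2) S_(t/2): the norm of S_(t/2) applied to the indicator of (0, r) is o(r),
  hence by duality functions in the range of S_(t/2) have averages o(1) over (0, r). This supplies
  the boundary value 0. The Fourier transform is an isometry determined by Gram matrices of step
  functions, so Plancherel is one scaled integral and inversion is Fubini for step
  functions.\<close>

abbreviation (input) cor :: "real => complex" where "cor == complex_of_real"

abbreviation (input) seq_tendsto :: "(nat => 'a::topological_space) => 'a => bool" (infix "---->" 60)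
 where "X ----> l == X \<longlonglongrightarrow> l"

section \<open>The Hilbert space of classes of square-integrable functions\<close>

lemma L2_measurable [measurable_dest]: "f \<in> L2 ==> f \<in> borel_measurable borel" by (simp add: L2_def)

lemma L2_integrable_square: "f \<in> L2 ==> integrable lborel (%x. (cmod (f x))\<^sup>2)" by (simp add: L2_def)

lemma L2I:
 "f \<in> borel_measurable borel ==> integrable lborel (%x. (cmod (f x))\<^sup>2) ==> f \<in> L2" by (simp add: L2_def)

lemma L2_dominated:
 assumes [measurable]: "g \<in> borel_measurable borel" and "f \<in> L2" and "AE x in lborel. cmod (g x) <= C * cmod (f x)"
 shows "g \<in> L2"
proof (rule L2I)
 show "integrable lborel (%x. (cmod (g x))\<^sup>2)" proof (rule Bochner_Integration.integrable_bound)
  show "integrable lborel (%x. C\<^sup>2 * (cmod (f x))\<^sup>2)" using L2_integrable_square[OF assms(2)] by simp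
  show "AE x in lborel. norm ((cmod (g x))\<^sup>2) <= norm (C\<^sup>2 * (cmod (f x))\<^sup>2)"
   using assms(3) by eventually_elim (auto simp flip: power_mult_distrib intro!: power_mono)
 qed measurable
qed fact

lemma L2_add:
 assumes f: "f \<in> L2" and g: "g \<in> L2"
 shows "(%x. f x + g x) \<in> L2"
proof (rule L2I)
 note [measurable] = L2_measurable[OF f] L2_measurable[OF g]
 show "(%x. f x + g x) \<in> borel_measurable borel" by measurable
 show "integrable lborel (%x. (cmod (f x + g x))\<^sup>2)" proof (rule Bochner_Integration.integrable_bound)
  show "integrable lborel (%x. 2 * (cmod (f x))\<^sup>2 + 2 * (cmod (g x))\<^sup>2)"
   using L2_integrable_square[OF f] L2_integrable_square[OF g] by simp
  have "(cmod (a + b))\<^sup>2 <= 2 * (cmod a)\<^sup>2 + 2 * (cmod b)\<^sup>2" for a b :: complex proof -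
   have "(cmod (a + b))\<^sup>2 <= (cmod a + cmod b)\<^sup>2" by (intro power_mono norm_triangle_ineq) auto
   also have "... <= 2 * (cmod a)\<^sup>2 + 2 * (cmod b)\<^sup>2"
    using sum_squares_bound[of "cmod a" "cmod b"] by (simp add: power2_sum)
   finally show ?thesis .
  qed
  then show "AE x in lborel. norm ((cmod (f x + g x))\<^sup>2)
    <= norm (2 * (cmod (f x))\<^sup>2 + 2 * (cmod (g x))\<^sup>2)" by simp
 qed measurable
qed

lemma L2_cmult: "f \<in> L2 ==> (%x. c * f x) \<in> L2"
 by (rule L2_dominated[where f = f and C = "cmod c"]) (auto simp: norm_mult dest: L2_measurable)

lemma L2_uminus: "f \<in> L2 ==> (%x. - f x) \<in> L2" using L2_cmult[of f "-1"] by simp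

lemma L2_diff: "f \<in> L2 ==> g \<in> L2 ==> (%x. f x - g x) \<in> L2" using L2_add[OF _ L2_uminus, of f g] by simp

lemma L2_zero [simp]: "(%x. 0) \<in> L2" by (simp add: L2_def)

lemma L2_mult_integrable:
 assumes f: "f \<in> L2" and g: "g \<in> L2"
 shows "integrable lborel (%x. f x * g x)"
proof (rule Bochner_Integration.integrable_bound)
 note [measurable] = L2_measurable[OF f] L2_measurable[OF g]
 show "integrable lborel (%x. (cmod (f x))\<^sup>2 + (cmod (g x))\<^sup>2)"
  using L2_integrable_square[OF f] L2_integrable_square[OF g] by simp
 show "(%x. f x * g x) \<in> borel_measurable lborel" by measurable
 have "cmod a * cmod b <= (cmod a)\<^sup>2 + (cmod b)\<^sup>2" for a b :: complex proof -
  have "0 <= cmod a * cmod b" by simp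
  then show ?thesis using sum_squares_bound[of "cmod a" "cmod b"] by linarith
 qed
 then show "AE x in lborel. norm (f x * g x) <= norm ((cmod (f x))\<^sup>2 + (cmod (g x))\<^sup>2)" by (simp add: norm_mult)
qed

lemma borel_measurable_cnj [measurable (raw)]:
 "f \<in> borel_measurable M ==> (%x. cnj (f x)) \<in> borel_measurable M"
 by (rule borel_measurable_continuous_on[where f = cnj]) (auto intro: continuous_intros)

lemma L2_cnj: "f \<in> L2 ==> (%x. cnj (f x)) \<in> L2" by (rule L2_dominated[where f = f and C = 1]) (auto dest: L2_measurable)

lemma l2_inner_integrable: "f \<in> L2 ==> g \<in> L2 ==> integrable lborel (%x. f x * cnj (g x))"
 by (intro L2_mult_integrable L2_cnj)

lemma l2_inner_cong_AE:
 assumes "f \<in> L2" "f' \<in> L2" "g \<in> L2" "g' \<in> L2" "ae_eq f f'" "ae_eq g g'"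
 shows "l2_inner f g = l2_inner f' g'" unfolding l2_inner_def
proof (rule integral_cong_AE)
 show "AE x in lborel. f x * cnj (g x) = f' x * cnj (g' x)"
  using assms(5,6) unfolding ae_eq_def by eventually_elim simp
qed (use assms(1-4) in measurable)

text \<open>A partial equivalence: functions outside \<open>L2\<close> are related to nothing, so
  the quotient consists exactly of the Hilbert space classes. A type is wanted because the classes
  \<open>real_inner\<close> and \<open>complete_space\<close> attach to types, not to sets of
  functions.\<close>

definition l2_rel :: "(real => complex) => (real => complex) => bool" where
 "l2_rel f g \<longleftrightarrow> f \<in> L2 & g \<in> L2 & ae_eq f g"

lemma part_equivp_l2_rel: "part_equivp l2_rel" proof (rule part_equivpI)
 show "\<exists>f. l2_rel f f" by (intro exI[of _ "%x. 0"]) (simp add: l2_rel_def ae_eq_def)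
 show "symp l2_rel" by (auto intro!: sympI simp: l2_rel_def ae_eq_def)
 show "transp l2_rel" by (auto intro!: transpI simp: l2_rel_def ae_eq_def elim!: AE_mp)
qed

quotient_type l2 = "real => complex" / partial: l2_rel
 morphisms fn abs_l2 by (rule part_equivp_l2_rel)

text \<open>Made total by sending everything outside \<open>L2\<close> to the zero class. On
  \<open>L2\<close>, passing to the class and back through \<open>fn\<close> changes a function on a
  null set only.\<close>

definition toL :: "(real => complex) => l2" where
 "toL f = (if f \<in> L2 then abs_l2 f else abs_l2 (%x. 0))"

lemma fn_L2 [simp, intro]: "fn u \<in> L2" using Quotient3_rel_rep[OF Quotient3_l2, of u u] by (simp add: l2_rel_def)

lemma fn_measurable [measurable]: "fn u \<in> borel_measurable borel" by (rule L2_measurable) simp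

lemma fn_toL: "f \<in> L2 ==> AE x in lborel. fn (toL f) x = f x"
 using rep_abs_rsp_left[OF Quotient3_l2, of f f] by (auto simp: toL_def l2_rel_def ae_eq_def)

lemma toL_fn [simp]: "toL (fn u) = u" by (simp add: toL_def Quotient3_abs_rep[OF Quotient3_l2])

lemma toL_eq_iff: "f \<in> L2 ==> g \<in> L2 ==> toL f = toL g \<longleftrightarrow> ae_eq f g"
 using Quotient3_rel[OF Quotient3_l2, of f g] by (auto simp: toL_def l2_rel_def ae_eq_def)

lemma toL_cong: "f \<in> L2 ==> g \<in> L2 ==> (AE x in lborel. f x = g x) ==> toL f = toL g" by (simp add: toL_eq_iff ae_eq_def)

lemma l2_eq_iff: "u = v \<longleftrightarrow> (AE x in lborel. fn u x = fn v x)" using toL_eq_iff[of "fn u" "fn v"] by (simp add: ae_eq_def)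

lemma toL_eqI: "f \<in> L2 ==> (AE x in lborel. fn u x = f x) ==> u = toL f"
 using toL_eq_iff[of "fn u" f] by (simp add: ae_eq_def)

text \<open>Linear in the first argument. The class instance below takes its real part as
  \<open>inner\<close>; the imaginary part is recovered by testing with
  \<open>cs \<i> v\<close>.\<close>

definition cip :: "l2 => l2 => complex" where
 "cip u v = l2_inner (fn u) (fn v)"

definition mlt :: "(real => complex) => l2 => l2" where
 "mlt m u = toL (%x. m x * fn u x)"

definition cs :: "complex => l2 => l2" where
 "cs c = mlt (%_. c)"

lemma cip_toL: "f \<in> L2 ==> g \<in> L2 ==> cip (toL f) (toL g) = l2_inner f g"
 unfolding cip_def by (rule l2_inner_cong_AE) (auto simp: ae_eq_def fn_toL)

instantiation l2 :: real_inner
begin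

definition "0 = toL (%x. 0)"
definition "u + v = toL (%x. fn u x + fn v x)"
definition "- u = toL (%x. - fn u x)"
definition "u - v = toL (%x. fn u x - fn v x)"
definition "scaleR r u = toL (%x. cor r * fn u x)"
definition inner_l2_def: "inner u v = Re (cip u v)"
definition "norm (u :: l2) = sqrt (inner u u)"
definition "sgn (u :: l2) = scaleR (inverse (norm u)) u"
definition dist_l2_def: "dist u v = norm (u - v :: l2)"
definition uniformity_l2_def:
 "(uniformity :: (l2 \<times> l2) filter) = (INF e\<in>{0<..}. principal {(x, y). dist x y < e})"
definition open_l2_def:
 "open (U :: l2 set) = (\<forall>x\<in>U. eventually (%(x', y). x' = x --> y \<in> U) uniformity)"

lemma fn_zero: "AE x in lborel. fn 0 x = 0" unfolding zero_l2_def by (rule fn_toL) simp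

lemma fn_add: "AE x in lborel. fn (u + v) x = fn u x + fn v x" unfolding plus_l2_def by (rule fn_toL) (simp add: L2_add)

lemma fn_uminus: "AE x in lborel. fn (- u) x = - fn u x" unfolding uminus_l2_def by (rule fn_toL) (simp add: L2_uminus)

lemma fn_diff: "AE x in lborel. fn (u - v) x = fn u x - fn v x"
 unfolding minus_l2_def by (rule fn_toL) (simp add: L2_diff)

lemma fn_scaleR: "AE x in lborel. fn (scaleR r u) x = cor r * fn u x"
 unfolding scaleR_l2_def by (rule fn_toL) (simp add: L2_cmult)

lemma cip_add_left: "cip (u + v) w = cip u w + cip v w" proof -
 have "cip (u + v) w = (LINT x|lborel. fn u x * cnj (fn w x) + fn v x * cnj (fn w x))" unfolding cip_def l2_inner_def
  by (rule integral_cong_AE) (use fn_add[of u v] in \<open>auto simp: algebra_simps elim!: AE_mp\<close>)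
 then show ?thesis by (simp add: l2_inner_integrable cip_def l2_inner_def)
qed

lemma cip_cnj: "cip v u = cnj (cip u v)" proof -
 have "cnj (cip u v) = (LINT x|lborel. cnj (fn u x * cnj (fn v x)))"
  unfolding cip_def l2_inner_def by (simp only: Bochner_Integration.integral_cnj)
 then show ?thesis by (simp add: cip_def l2_inner_def mult.commute)
qed

lemma cip_scaleR_left: "cip (scaleR r u) w = cor r * cip u w" proof -
 have "cip (scaleR r u) w = (LINT x|lborel. cor r * (fn u x * cnj (fn w x)))"
  unfolding cip_def l2_inner_def
  by (rule integral_cong_AE) (use fn_scaleR[of r u] in \<open>auto simp: algebra_simps elim!: AE_mp\<close>)
 then show ?thesis by (simp add: cip_def l2_inner_def)
qed

lemma cip_self: "cip u u = cor (LINT x|lborel. (cmod (fn u x))\<^sup>2)" unfolding cip_def l2_inner_def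
 by (simp add: complex_norm_square[symmetric] flip: of_real_power)

instance
proof
 fix u v w :: l2 and r s :: real and U :: "l2 set"
 show "u + v + w = u + (v + w)"
  unfolding l2_eq_iff using fn_add[of "u + v" w] fn_add[of u v] fn_add[of u "v + w"] fn_add[of v w]
  by eventually_elim simp
 show "u + v = v + u" unfolding l2_eq_iff using fn_add[of u v] fn_add[of v u] by eventually_elim simp
 show "0 + u = u" unfolding l2_eq_iff using fn_add[of 0 u] fn_zero by eventually_elim simp
 show "- u + u = 0" unfolding l2_eq_iff using fn_add[of "- u" u] fn_zero fn_uminus[of u] by eventually_elim simp
 show "u - v = u + - v"
  unfolding l2_eq_iff using fn_add[of u "- v"] fn_uminus[of v] fn_diff[of u v] by eventually_elim simp
 show "scaleR r (u + v) = scaleR r u + scaleR r v" unfolding l2_eq_iff using fn_scaleR[of r "u + v"] fn_add[of u v]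
   fn_add[of "scaleR r u" "scaleR r v"] fn_scaleR[of r u] fn_scaleR[of r v]
  by eventually_elim (simp add: algebra_simps)
 show "scaleR (r + s) u = scaleR r u + scaleR s u" unfolding l2_eq_iff using fn_scaleR[of "r + s" u]
   fn_add[of "scaleR r u" "scaleR s u"] fn_scaleR[of r u] fn_scaleR[of s u]
  by eventually_elim (simp add: algebra_simps)
 show "scaleR r (scaleR s u) = scaleR (r * s) u" unfolding l2_eq_iff
  using fn_scaleR[of r "scaleR s u"] fn_scaleR[of s u] fn_scaleR[of "r * s" u] by eventually_elim simp
 show "scaleR 1 u = u" unfolding l2_eq_iff using fn_scaleR[of 1 u] by eventually_elim simp
 show "dist u v = norm (u - v)" by (rule dist_l2_def)
 show "sgn u = scaleR (inverse (norm u)) u" by (rule sgn_l2_def)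
 show "(uniformity :: (l2 \<times> l2) filter) = (INF e\<in>{0<..}. principal {(x, y). dist x y < e})" by (rule uniformity_l2_def)
 show "open U = (\<forall>x\<in>U. eventually (%(x', y). x' = x --> y \<in> U) uniformity)" by (rule open_l2_def)
 show "inner u v = inner v u" unfolding inner_l2_def using cip_cnj[of u v] by simp
 show "inner (u + v) w = inner u w + inner v w" by (simp add: inner_l2_def cip_add_left)
 show "inner (scaleR r u) v = r * inner u v" by (simp add: inner_l2_def cip_scaleR_left)
 show "0 <= inner u u" by (simp add: inner_l2_def cip_self)
 have "(LINT x|lborel. (cmod (fn u x))\<^sup>2) = 0 \<longleftrightarrow> (AE x in lborel. (cmod (fn u x))\<^sup>2 = 0)"
  by (rule integral_nonneg_eq_0_iff_AE) (auto intro: L2_integrable_square)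
 also have "... \<longleftrightarrow> u = 0" proof -
  have "(AE x in lborel. fn u x = 0) \<longleftrightarrow> u = 0" unfolding l2_eq_iff using fn_zero by (auto elim: AE_mp)
  then show ?thesis by simp
 qed
 finally show "inner u u = 0 \<longleftrightarrow> u = 0" by (simp add: inner_l2_def cip_self)
 show "norm u = sqrt (inner u u)" by (rule norm_l2_def)
qed

end

lemma norm_l2_square: "(norm u)\<^sup>2 = (LINT x|lborel. (cmod (fn u x))\<^sup>2)"
 by (simp add: power2_norm_eq_inner inner_l2_def cip_self)

lemma norm_toL_square: "f \<in> L2 ==> (norm (toL f))\<^sup>2 = (LINT x|lborel. (cmod (f x))\<^sup>2)"
 unfolding norm_l2_square by (rule integral_cong_AE) (use fn_toL[of f] in auto)

lemma norm_toL: "f \<in> L2 ==> norm (toL f) = l2_norm f" unfolding l2_norm_def by (simp flip: norm_toL_square)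

lemma l2_norm_fn: "l2_norm (fn u) = norm u" using norm_toL[of "fn u"] by simp

lemma nn_integral_norm_l2: "(\<integral>\<^sup>+x. ennreal ((cmod (fn u x))\<^sup>2) \<partial>lborel) = ennreal ((norm u)\<^sup>2)"
 unfolding norm_l2_square by (rule nn_integral_eq_integral) (auto intro: L2_integrable_square)

lemma nn_integral_norm_toL:
 "f \<in> L2 ==> (\<integral>\<^sup>+x. ennreal ((cmod (f x))\<^sup>2) \<partial>lborel) = ennreal ((norm (toL f))\<^sup>2)"
 unfolding norm_toL_square by (rule nn_integral_eq_integral) (auto intro: L2_integrable_square)

lemma L2I_nn:
 assumes [measurable]: "f \<in> borel_measurable borel" and "(\<integral>\<^sup>+x. ennreal ((cmod (f x))\<^sup>2) \<partial>lborel) < \<infinity>"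
 shows "f \<in> L2" by (rule L2I) (use assms in \<open>auto intro!: integrableI_bounded\<close>)

lemma fn_mlt: "(%x. m x * fn u x) \<in> L2 ==> AE x in lborel. fn (mlt m u) x = m x * fn u x"
 unfolding mlt_def by (rule fn_toL)

lemma L2_mult_bounded:
 assumes "m \<in> borel_measurable borel" "!!x. cmod (m x) <= C" "f \<in> L2"
 shows "(%x. m x * f x) \<in> L2" by (rule L2_dominated[where f = f and C = C])
  (use assms in \<open>auto simp: norm_mult intro!: mult_right_mono\<close>)

lemma fn_mlt_bounded:
 assumes "m \<in> borel_measurable borel" "!!x. cmod (m x) <= C"
 shows "AE x in lborel. fn (mlt m u) x = m x * fn u x" by (intro fn_mlt L2_mult_bounded[OF assms]) simp

lemma fn_cs: "AE x in lborel. fn (cs c u) x = c * fn u x" unfolding cs_def by (rule fn_mlt_bounded) auto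

lemma toL_add: "f \<in> L2 ==> g \<in> L2 ==> toL (%x. f x + g x) = toL f + toL g" unfolding plus_l2_def
 by (rule toL_cong) (use fn_toL[of f] fn_toL[of g] in \<open>auto simp: L2_add\<close>)

lemma toL_diff: "f \<in> L2 ==> g \<in> L2 ==> toL (%x. f x - g x) = toL f - toL g" unfolding minus_l2_def
 by (rule toL_cong) (use fn_toL[of f] fn_toL[of g] in \<open>auto simp: L2_diff\<close>)

lemma toL_uminus: "f \<in> L2 ==> toL (%x. - f x) = - toL f" unfolding uminus_l2_def
 by (rule toL_cong) (use fn_toL[of f] in \<open>auto simp: L2_uminus\<close>)

lemma toL_cmult:
 assumes f: "f \<in> L2"
 shows "toL (%x. c * f x) = cs c (toL f)" unfolding cs_def mlt_def
proof (rule toL_cong)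
 show "AE x in lborel. c * f x = c * fn (toL f) x" using fn_toL[OF f] by eventually_elim simp
qed (simp_all add: f L2_cmult)

lemma toL_mult_bounded:
 assumes "m \<in> borel_measurable borel" "!!x. cmod (m x) <= C" "f \<in> L2"
 shows "toL (%x. m x * f x) = mlt m (toL f)" unfolding mlt_def
 by (rule toL_cong) (use fn_toL[of f] L2_mult_bounded[OF assms(1,2)] assms in auto)

lemma inner_toL: "f \<in> L2 ==> g \<in> L2 ==> inner (toL f) (toL g) = Re (l2_inner f g)" by (simp add: inner_l2_def cip_toL)

lemma cip_eq: "cip u v = (LINT x|lborel. fn u x * cnj (fn v x))" by (simp add: cip_def l2_inner_def)

lemma cip_toL_right: "g \<in> L2 ==> cip u (toL g) = (LINT x|lborel. fn u x * cnj (g x))"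
 using cip_toL[of "fn u" g] by (simp add: l2_inner_def)

lemma cip_add_right: "cip w (u + v) = cip w u + cip w v" by (metis cip_add_left cip_cnj complex_cnj_add)

lemma cip_cs_left: "cip (cs c u) w = c * cip u w" proof -
 have "cip (cs c u) w = (LINT x|lborel. c * (fn u x * cnj (fn w x)))" unfolding cip_eq
  by (rule integral_cong_AE) (use fn_cs[of c u] in \<open>auto simp: algebra_simps elim!: AE_mp\<close>)
 then show ?thesis by (simp add: cip_eq)
qed

lemma cip_cs_right: "cip w (cs c u) = cnj c * cip w u" by (metis cip_cs_left cip_cnj complex_cnj_mult)

lemma scaleR_eq_cs: "scaleR r u = cs (cor r) u"
 unfolding l2_eq_iff using fn_scaleR[of r u] fn_cs[of "cor r" u] by eventually_elim simp

lemma cip_eq_inner: "cip u v = Complex (inner u v) (inner u (cs \<i> v))"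
 by (simp add: inner_l2_def cip_cs_right complex_eq_iff)

lemma cs_add_right: "cs c (u + v) = cs c u + cs c v"
 unfolding l2_eq_iff using fn_cs[of c "u + v"] fn_add[of u v] fn_add[of "cs c u" "cs c v"]
  fn_cs[of c u] fn_cs[of c v] by eventually_elim (simp add: algebra_simps)

lemma cs_cs [simp]: "cs c (cs d u) = cs (c * d) u"
 unfolding l2_eq_iff using fn_cs[of c "cs d u"] fn_cs[of d u] fn_cs[of "c * d" u] by eventually_elim simp

lemma cs_1 [simp]: "cs 1 u = u" using scaleR_eq_cs[of 1 u] by simp

lemma norm_cs: "norm (cs c u) = cmod c * norm u" proof (rule power2_eq_imp_eq)
 have "(norm (cs c u))\<^sup>2 = (LINT x|lborel. (cmod c)\<^sup>2 * (cmod (fn u x))\<^sup>2)" unfolding norm_l2_square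
  by (rule integral_cong_AE) (use fn_cs[of c u] in \<open>auto simp: norm_mult power_mult_distrib elim!: AE_mp\<close>)
 then show "(norm (cs c u))\<^sup>2 = (cmod c * norm u)\<^sup>2" by (simp add: norm_l2_square power_mult_distrib)
qed auto

text \<open>Multiplying \<open>u\<close> by the conjugate sign of \<open>cip u v\<close> makes the
  pairing real and nonnegative, so the real Cauchy-Schwarz inequality gives the complex one without
  loss.\<close>

lemma norm_cip_le: "cmod (cip u v) <= norm u * norm v" proof (cases "cip u v = 0")
 case False
 define c where "c = cnj (sgn (cip u v))"
 have "cmod (cip u v) = Re (cip (cs c u) v)" using False
  by (simp add: cip_cs_left c_def sgn_div_norm scaleR_conv_of_real complex_cnj_mult
    mult.assoc complex_norm_square[symmetric] mult.commute[of "cnj _"] power2_eq_square)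
 also have "... <= norm (cs c u) * norm v"
  unfolding inner_l2_def[symmetric] using Cauchy_Schwarz_ineq2[of "cs c u" v] by simp
 also have "norm (cs c u) = norm u" using False by (simp add: norm_cs c_def norm_sgn)
 finally show ?thesis .
qed auto

lemma fn_sum: "finite I ==> AE x in lborel. fn (\<Sum>i\<in>I. u i) x = (\<Sum>i\<in>I. fn (u i) x)" proof (induction I rule: finite_induct)
 case empty
 then show ?case using fn_zero by simp
next
 case (insert i I)
 show ?case using insert.IH fn_add[of "u i" "sum u I"] insert.hyps by (auto elim!: AE_mp)
qed

section \<open>Almost everywhere limits and completeness\<close>

lemma l2_tendsto_AE_subseq:
 assumes "u ----> v"
 shows "\<exists>r. strict_mono r & (AE x in lborel. (%n. fn (u (r n)) x) ----> fn v x)"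
proof -
 have "(%n. (norm (u n - v))\<^sup>2) ----> 0\<^sup>2"
  using assms by (intro tendsto_power) (simp add: tendsto_norm_zero_iff LIM_zero_iff)
 then have "\<exists>r. strict_mono r & (AE x in lborel. (%n. (cmod (fn (u (r n) - v) x))\<^sup>2) ----> 0)"
  by (intro tendsto_L1_AE_subseq) (auto intro: L2_integrable_square simp: norm_l2_square)
 then obtain r where r: "strict_mono r" and ae: "AE x in lborel. (%n. (cmod (fn (u (r n) - v) x))\<^sup>2) ----> 0" by blast
 have "AE x in lborel. \<forall>n. fn (u (r n) - v) x = fn (u (r n)) x - fn v x"
  unfolding AE_all_countable using fn_diff by blast
 with ae have "AE x in lborel. (%n. fn (u (r n)) x) ----> fn v x" proof eventually_elim
  case (elim x)
  then have "(%n. sqrt ((cmod (fn (u (r n)) x - fn v x))\<^sup>2)) ----> sqrt 0" by (intro tendsto_real_sqrt) auto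
  then show ?case by (simp add: tendsto_norm_zero_iff LIM_zero_iff)
 qed
 with r show ?thesis by blast
qed

lemma toL_L2_tendsto:
 assumes f: "!!n. f n \<in> borel_measurable borel" and g: "g \<in> borel_measurable borel" and h: "h \<in> L2"
  and lim: "AE x in lborel. (%n. f n x) ----> g x" and dom: "!!n. AE x in lborel. cmod (f n x) <= C * cmod (h x)"
 shows "g \<in> L2" "(%n. toL (f n)) ----> toL g"
proof -
 have fL: "f n \<in> L2" for n by (rule L2_dominated[OF f h dom])
 have domg: "AE x in lborel. cmod (g x) <= C * cmod (h x)" proof -
  have "AE x in lborel. \<forall>n. cmod (f n x) <= C * cmod (h x)" unfolding AE_all_countable using dom by blast
  with lim show ?thesis proof eventually_elim
   case (elim x)
   show ?case by (rule LIMSEQ_le_const2[OF tendsto_norm[OF elim(1)]]) (use elim(2) in auto)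
  qed
 qed
 show gL: "g \<in> L2" by (rule L2_dominated[OF g h domg])
 have "(%n. LINT x|lborel. (cmod (f n x - g x))\<^sup>2) ----> (LINT x|(lborel :: real measure). 0)"
 proof (rule integral_dominated_convergence)
  show "integrable lborel (%x. (2 * C)\<^sup>2 * (cmod (h x))\<^sup>2)" using L2_integrable_square[OF h] by simp
  show "AE x in lborel. (%n. (cmod (f n x - g x))\<^sup>2) ----> 0" using lim proof eventually_elim
   case (elim x)
   have "(%n. (cmod (f n x - g x))\<^sup>2) ----> (cmod (g x - g x))\<^sup>2" by (intro tendsto_intros elim)
   then show ?case by simp
  qed
  show "AE x in lborel. norm ((cmod (f n x - g x))\<^sup>2) <= (2 * C)\<^sup>2 * (cmod (h x))\<^sup>2" for n using dom[of n] domg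
  proof eventually_elim
   case (elim x)
   have "cmod (f n x - g x) <= 2 * C * cmod (h x)" using norm_triangle_ineq4[of "f n x" "g x"] elim by linarith
   then have "(cmod (f n x - g x))\<^sup>2 <= (2 * C * cmod (h x))\<^sup>2" by (rule power_mono) simp
   then show ?case by (simp add: power_mult_distrib)
  qed
 qed (use f g in measurable)
 then have "(%n. (norm (toL (f n) - toL g))\<^sup>2) ----> 0" using fL gL by (simp add: norm_toL_square L2_diff flip: toL_diff)
 then have "(%n. sqrt ((norm (toL (f n) - toL g))\<^sup>2)) ----> sqrt 0" by (rule tendsto_real_sqrt)
 then show "(%n. toL (f n)) ----> toL g" by (simp add: tendsto_norm_zero_iff LIM_zero_iff)
qed

text \<open>The Riesz-Fischer argument. Weighting the squared increments by 2^n keeps their sum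
  integrable, with terms (1/2)^n, while Cauchy-Schwarz against the series of (1/2)^n still bounds
  the sum of the increments pointwise. This yields convergence almost everywhere together with a
  square-integrable majorant.\<close>

lemma l2_fast_Cauchy_convergent:
 fixes u :: "nat => l2"
 assumes fast: "!!n. (norm (u (Suc n) - u n))\<^sup>2 <= (1/4) ^ n"
 shows "convergent u"
proof -
 define d where "d n x = fn (u (Suc n)) x - fn (u n) x" for n x
 have [measurable]: "d n \<in> borel_measurable borel" for n unfolding d_def by measurable
 define W where "W x = (\<Sum>n. ennreal (2 ^ n * (cmod (d n x))\<^sup>2))" for x
 have Wm [measurable]: "W \<in> borel_measurable borel" unfolding W_def[abs_def] by measurable
 have "(\<integral>\<^sup>+x. W x \<partial>lborel) = (\<Sum>n. \<integral>\<^sup>+x. ennreal (2 ^ n * (cmod (d n x))\<^sup>2) \<partial>lborel)"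
  unfolding W_def by (rule nn_integral_suminf) measurable
 also have "... <= (\<Sum>n. ennreal ((1/2) ^ n))" proof (intro suminf_le allI)
  fix n
  have "(\<integral>\<^sup>+x. ennreal ((cmod (d n x))\<^sup>2) \<partial>lborel) = ennreal ((norm (u (Suc n) - u n))\<^sup>2)"
   unfolding nn_integral_norm_l2[symmetric]
   by (rule nn_integral_cong_AE) (use fn_diff[of "u (Suc n)" "u n"] in \<open>auto simp: d_def\<close>)
  then have "(\<integral>\<^sup>+x. ennreal (2 ^ n * (cmod (d n x))\<^sup>2) \<partial>lborel) = ennreal (2 ^ n) * ennreal ((norm (u (Suc n) - u n))\<^sup>2)"
   by (simp add: ennreal_mult nn_integral_cmult)
  also have "... <= ennreal (2 ^ n) * ennreal ((1/4) ^ n)" by (intro mult_left_mono ennreal_leI fast) auto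
  also have "... = ennreal ((1/2) ^ n)" by (simp flip: ennreal_mult power_mult_distrib)
  finally show "(\<integral>\<^sup>+x. ennreal (2 ^ n * (cmod (d n x))\<^sup>2) \<partial>lborel) <= ennreal ((1/2) ^ n)" .
 qed auto
 also have "... < \<infinity>" by (subst suminf_ennreal2) (auto simp: summable_geometric)
 finally have Wi: "(\<integral>\<^sup>+x. W x \<partial>lborel) < \<infinity>" .
 have ae: "AE x in lborel. W x \<noteq> \<infinity>" by (rule nn_integral_PInf_AE) (use Wi in auto)
 have part: "(\<Sum>i<n. cmod (d i x)) <= sqrt (2 * enn2real (W x))" if fin: "W x \<noteq> \<infinity>" for x n proof (rule real_le_rsqrt)
  have sm: "summable (%n. 2 ^ n * (cmod (d n x))\<^sup>2)" by (rule summable_suminf_not_top) (use fin in \<open>auto simp: W_def\<close>)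
  have "(\<Sum>i<n. cmod (d i x))\<^sup>2 = (\<Sum>i<n. sqrt ((1/2) ^ i) * (sqrt (2 ^ i) * cmod (d i x)))\<^sup>2" proof -
   have e: "sqrt ((1/2) ^ i) * (sqrt (2 ^ i) * y) = y" for i :: nat and y :: real
    unfolding mult.assoc[symmetric] real_sqrt_mult[symmetric] power_mult_distrib[symmetric] by simp
   show ?thesis by (simp only: e)
  qed
  also have "... <= (\<Sum>i<n. (sqrt ((1/2) ^ i))\<^sup>2) * (\<Sum>i<n. (sqrt (2 ^ i) * cmod (d i x))\<^sup>2)"
   by (rule Cauchy_Schwarz_ineq_sum)
  also have "... = (\<Sum>i<n. (1/2) ^ i) * (\<Sum>i<n. 2 ^ i * (cmod (d i x))\<^sup>2)" by (simp add: power_mult_distrib)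
  also have "... <= 2 * enn2real (W x)" proof (rule mult_mono)
   show "(\<Sum>i<n. (1/2::real) ^ i) <= 2"
    by (rule order_trans[OF sum_le_suminf[OF summable_geometric]]) (auto simp: suminf_geometric)
   have "(\<Sum>i<n. 2 ^ i * (cmod (d i x))\<^sup>2) <= (\<Sum>i. 2 ^ i * (cmod (d i x))\<^sup>2)" by (rule sum_le_suminf[OF sm]) auto
   moreover have "W x = ennreal (\<Sum>i. 2 ^ i * (cmod (d i x))\<^sup>2)" unfolding W_def by (rule suminf_ennreal2[OF _ sm]) simp
   ultimately show "(\<Sum>i<n. 2 ^ i * (cmod (d i x))\<^sup>2) <= enn2real (W x)" using suminf_nonneg[OF sm] by simp
  qed (auto intro: sum_nonneg)
  finally show "(\<Sum>i<n. cmod (d i x))\<^sup>2 <= 2 * enn2real (W x)" .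
 qed
 have tel: "(\<Sum>i<n. d i x) = fn (u n) x - fn (u 0) x" for n x unfolding d_def by (rule sum_lessThan_telescope)
 define h where "h x = cor (cmod (fn (u 0) x)) + cor (sqrt (2 * enn2real (W x)))" for x
 have hL: "h \<in> L2" unfolding h_def[abs_def] proof (rule L2_add)
  show "(%x. cor (cmod (fn (u 0) x))) \<in> L2" by (rule L2_dominated[where f = "fn (u 0)" and C = 1]) auto
  have "(\<integral>\<^sup>+x. ennreal ((cmod (cor (sqrt (2 * enn2real (W x)))))\<^sup>2) \<partial>lborel) = (\<integral>\<^sup>+x. 2 * W x \<partial>lborel)"
   using ae by (intro nn_integral_cong_AE) (auto elim!: eventually_mono simp: ennreal_mult top.not_eq_extremum)
  also have "... < \<infinity>" using Wi by (simp add: nn_integral_cmult ennreal_mult_less_top)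
  finally show "(%x. cor (sqrt (2 * enn2real (W x)))) \<in> L2" by (intro L2I_nn) auto
 qed
 have dom: "AE x in lborel. cmod (fn (u n) x) <= 1 * cmod (h x)" for n using ae proof eventually_elim
  case (elim x)
  have "cmod (fn (u n) x - fn (u 0) x) <= sqrt (2 * enn2real (W x))"
   unfolding tel[symmetric] by (rule order_trans[OF norm_sum part[OF elim]])
  moreover have "cmod (h x) = cmod (fn (u 0) x) + sqrt (2 * enn2real (W x))" by (simp add: h_def flip: of_real_add)
  ultimately show ?case using norm_triangle_sub[of "fn (u n) x" "fn (u 0) x"] by simp
 qed
 have lim: "AE x in lborel. (%n. fn (u n) x) ----> lim (%n. fn (u n) x)" using ae proof eventually_elim
  case (elim x)
  have "summable (%n. cmod (d n x))" by (rule summableI_nonneg_bounded[OF _ part[OF elim]]) simp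
  then have "convergent (%n. \<Sum>i<n. d i x)" by (simp add: summable_norm_cancel flip: summable_iff_convergent)
  then show ?case by (simp add: tel convergent_diff_const_right_iff convergent_LIMSEQ_iff)
 qed
 have "(%n. toL (fn (u n))) ----> toL (%x. lim (%n. fn (u n) x))" by (rule toL_L2_tendsto(2)[OF _ _ hL lim dom]) measurable
 then show ?thesis by (auto simp: convergent_def)
qed

instance l2 :: complete_space
proof
 fix u :: "nat => l2" assume cau: "Cauchy u"
 have "\<exists>N. \<forall>m\<ge>N. \<forall>n\<ge>N. norm (u m - u n) < (1/2) ^ k" for k using CauchyD[OF cau, of "(1/2) ^ k"] by auto
 then obtain N where N: "!!k m n. m \<ge> N k ==> n \<ge> N k ==> norm (u m - u n) < (1/2) ^ k" by metis
 \<comment> \<open>The \<open>max\<close> makes the chosen indices strictly increasing and at the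
   same time late enough for the tolerance (1/2)^k.\<close>
 define r where "r = rec_nat (N 0) (%k m. max (Suc m) (N (Suc k)))"
 have r0: "r 0 = N 0" and rS: "r (Suc k) = max (Suc (r k)) (N (Suc k))" for k by (simp_all add: r_def)
 have rN: "r k \<ge> N k" for k by (cases k) (auto simp: r0 rS)
 have sm: "strict_mono r" by (rule strict_monoI_Suc) (simp add: rS)
 have "(norm (u (r (Suc k)) - u (r k)))\<^sup>2 <= (1/4) ^ k" for k proof -
  have "norm (u (r (Suc k)) - u (r k)) < (1/2) ^ k"
   using rN[of k] strict_mono_leD[OF sm, of k "Suc k"] by (intro N) auto
  then have "(norm (u (r (Suc k)) - u (r k)))\<^sup>2 <= ((1/2) ^ k)\<^sup>2" by (intro power_mono) auto
  also have "... = (1/4 :: real) ^ k" by (simp add: power2_eq_square flip: power_mult_distrib)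
  finally show ?thesis .
 qed
 then have "convergent (%k. u (r k))" by (rule l2_fast_Cauchy_convergent)
 then obtain l where "(%k. u (r k)) ----> l" by (auto simp: convergent_def)
 then have "u ----> l" using Cauchy_converges_subseq[OF cau sm, of l] by (simp add: o_def)
 then show "convergent u" by (auto simp: convergent_def)
qed

section \<open>Integrands determined by their integrals over intervals\<close>

lemma AE_zero_of_interval_integrals:
 fixes g :: "real => complex"
 assumes g: "integrable lborel g" and zero: "!!a b. a <= b ==> (LINT x:{a..b}|lborel. g x) = 0"
 shows "AE x in lborel. g x = 0"
proof (rule sigma_finite_measure.density_unique_banach[OF sigma_finite_lborel g])
 have si: "set_integrable lborel A g" if "A \<in> sets borel" for A
  unfolding set_integrable_def using that by (intro integrable_mult_indicator g) auto
 have Un: "(\<Union>n. {- real n..real n}) = UNIV" proof (rule UNIV_eq_I[symmetric])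
  fix x :: real
  obtain n where "\<bar>x\<bar> <= real n" using real_arch_simple by blast
  then show "x \<in> (\<Union>n. {- real n..real n})" by (auto intro!: exI[of _ n])
 qed
 have "(%n. LINT x:{- real n..real n}|lborel. g x)
   ----> (LINT x:(\<Union>n. {- real n..real n})|lborel. g x)" by (rule set_integral_cont_up) (auto intro!: si simp: incseq_def)
 moreover have "(%n. LINT x:{- real n..real n}|lborel. g x) = (%n. 0)" using zero by auto
 ultimately have total: "(LINT x:UNIV|lborel. g x) = 0" unfolding Un by (simp add: LIMSEQ_const_iff)
 fix A :: "real set" assume "A \<in> sets lborel"
 then have "A \<in> sets borel" by simp
 \<comment> \<open>Borel sets arise from closed intervals by complements and disjoint unions; the
   complement case needs the integral over the whole line to vanish, which is why it is computed
   first.\<close>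
 then have "(LINT x:A|lborel. g x) = 0" proof (induction A rule: borel_set_induct)
  case (compl A)
  have "(LINT x:A \<union> - A|lborel. g x) = (LINT x:A|lborel. g x) + (LINT x:- A|lborel. g x)"
   using compl by (intro set_integral_Un) (auto intro: si)
  with compl total show ?case by simp
 next
  case (union f)
  have "(LINT x:(\<Union>i. f i)|lborel. g x) = (\<Sum>i. LINT x:f i|lborel. g x)" proof (rule lebesgue_integral_countable_add)
   show "f i \<inter> f j = {}" if "i \<noteq> j" for i j using union(1) that by (auto simp: disjoint_family_on_def)
  qed (use union in \<open>auto intro: si\<close>)
  with union show ?case by simp
 next
  case empty
  then show ?case by (simp add: set_lebesgue_integral_def)
 qed (rule zero)
 then show "(LINT x:A|lborel. g x) = (LINT x:A|lborel. 0)" by simp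
qed simp

lemma AE_zero_of_interval_integrals_local:
 fixes g :: "real => complex"
 assumes g: "set_integrable lborel {p..q} g" and zero: "!!a b. p <= a ==> a <= b ==> b <= q ==> (LINT x:{a..b}|lborel. g x) = 0"
 shows "AE x in lborel. x \<in> {p..q} --> g x = 0"
proof -
 have "AE x in lborel. indicator {p..q} x *\<^sub>R g x = 0" proof (rule AE_zero_of_interval_integrals)
  show "integrable lborel (%x. indicator {p..q} x *\<^sub>R g x)" using g by (simp add: set_integrable_def)
  fix a b :: real assume "a <= b"
  have "(LINT x:{a..b}|lborel. indicator {p..q} x *\<^sub>R g x) = (LINT x:{max a p..min b q}|lborel. g x)"
   unfolding set_lebesgue_integral_def by (rule Bochner_Integration.integral_cong) (auto simp: indicator_def)
  also have "... = 0"
   using zero[of "max a p" "min b q"] by (cases "max a p <= min b q") (auto simp: set_lebesgue_integral_def)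
  finally show "(LINT x:{a..b}|lborel. indicator {p..q} x *\<^sub>R g x) = 0" .
 qed
 then show ?thesis by eventually_elim (auto simp: indicator_def split: if_splits)
qed

lemma AE_zero_of_interval_integrals_pos:
 fixes g :: "real => complex"
 assumes g: "!!a b. 0 < a ==> a <= b ==> set_integrable lborel {a..b} g"
  and zero: "!!a b. 0 < a ==> a <= b ==> (LINT x:{a..b}|lborel. g x) = 0"
 shows "AE x in lborel. 0 < x --> g x = 0"
proof -
 have "AE x in lborel. x \<in> {1 / real (Suc n)..real (Suc n)} --> g x = 0" for n proof -
  have pos: "0 < 1 / real (Suc n)" and le: "1 / real (Suc n) <= real (Suc n)" by (simp_all add: field_simps)
  show ?thesis by (rule AE_zero_of_interval_integrals_local)
    (use le in \<open>auto intro!: g zero intro: less_le_trans[OF pos] simp del: of_nat_Suc\<close>)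
 qed
 then have "AE x in lborel. \<forall>n. x \<in> {1 / real (Suc n)..real (Suc n)} --> g x = 0" unfolding AE_all_countable by blast
 then show ?thesis proof (eventually_elim, intro impI)
  fix x :: real assume *: "\<forall>n. x \<in> {1 / real (Suc n)..real (Suc n)} --> g x = 0" and "0 < x"
  obtain n where n: "x + 1 / x <= real n" using real_arch_simple by blast
  have "1 / x <= real (Suc n)" "x <= real (Suc n)" using n \<open>0 < x\<close> by (smt (verit) divide_pos_pos of_nat_Suc)+
  then have "1 / real (Suc n) <= x" using \<open>0 < x\<close> by (simp add: field_simps)
  with \<open>x <= real (Suc n)\<close> * show "g x = 0" by auto
 qed
qed

text \<open>The set where the two functions differ is open and null, hence empty. It serves to read
  values at single points off relations known almost everywhere.\<close>

lemma continuous_AE_eq: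
 fixes f g :: "real => complex"
 assumes S: "open S" and f: "continuous_on S f" and g: "continuous_on S g"
  and ae: "AE x in lborel. x \<in> S --> f x = g x" and x: "x \<in> S"
 shows "f x = g x"
proof (rule ccontr)
 assume neq: "f x \<noteq> g x"
 define U where "U = {y \<in> S. f y - g y \<noteq> 0}"
 have "open U" proof -
  have "U = S \<inter> (%y. f y - g y) -` (- {0})" by (auto simp: U_def)
  also have "open ..." using continuous_on_open_vimage[OF S] continuous_on_diff[OF f g]
   by (metis Int_commute open_Compl closed_singleton)
  finally show ?thesis .
 qed
 moreover have "negligible U" proof -
  have "AE y in lebesgue. y \<notin> U" using ae by (auto simp: U_def elim: AE_mp intro!: AE_completion)
  then show ?thesis using \<open>open U\<close> by (simp add: negligible_iff_null_sets AE_iff_null_sets borel_open)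
 qed
 moreover have "x \<in> U" using neq x by (simp add: U_def)
 ultimately show False using open_not_negligible by blast
qed

section \<open>Projections and bounded bilinear forms in a Hilbert space\<close>

text \<open>First variation: moving \<open>p\<close> by t v with t = <f - p, v> / |v|^2 lowers the
  squared distance by <f - p, v>^2 / |v|^2, so this number must vanish at a minimizer.\<close>

lemma subspace_inner_min_orthogonal:
 fixes S :: "'h::real_inner set"
 assumes S: "subspace S" and "p \<in> S" and min: "!!s. s \<in> S ==> norm (f - p) <= norm (f - s)" and "v \<in> S"
 shows "inner (f - p) v = 0"
proof (rule ccontr)
 assume nz: "inner (f - p) v \<noteq> 0"
 define t where "t = inner (f - p) v / (norm v)\<^sup>2"
 have v: "norm v > 0" using nz by auto
 have "norm (f - p) <= norm (f - (p + t *\<^sub>R v))"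
  using S \<open>p \<in> S\<close> \<open>v \<in> S\<close> by (intro min) (simp add: subspace_add subspace_scale)
 then have "(norm (f - p))\<^sup>2 <= (norm ((f - p) - t *\<^sub>R v))\<^sup>2" by (intro power_mono) (simp_all add: algebra_simps)
 also have "... = (norm (f - p))\<^sup>2 - (inner (f - p) v)\<^sup>2 / (norm v)\<^sup>2" proof -
  have "(norm ((f - p) - t *\<^sub>R v))\<^sup>2
    = (norm (f - p))\<^sup>2 - 2 * t * inner (f - p) v + t\<^sup>2 * (norm v)\<^sup>2"
   unfolding power2_norm_eq_inner[of "f - p - t *\<^sub>R v"] inner_diff_left[of "f - p"]
    inner_diff_right[of _ "f - p"] by (simp add: inner_commute power2_eq_square flip: power2_norm_eq_inner)
  also have "... = (norm (f - p))\<^sup>2 - (inner (f - p) v)\<^sup>2 / (norm v)\<^sup>2" using v by (simp add: t_def power2_eq_square)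
  finally show ?thesis .
 qed
 finally show False using nz v by (smt (verit) divide_pos_pos zero_less_power2 zero_less_power)
qed

theorem orthogonal_projection_exists:
 fixes S :: "'h::{real_inner, complete_space} set"
 assumes S: "subspace S" and cl: "closed S"
 shows "\<exists>p\<in>S. \<forall>v\<in>S. inner (f - p) v = 0"
proof -
 define d where "d = Inf ((%s. (norm (f - s))\<^sup>2) ` S)"
 have ne: "(%s. (norm (f - s))\<^sup>2) ` S \<noteq> {}" using subspace_0[OF S] by auto
 have bdd: "bdd_below ((%s. (norm (f - s))\<^sup>2) ` S)" by (rule bdd_belowI[of _ 0]) auto
 have dle: "d <= (norm (f - s))\<^sup>2" if "s \<in> S" for s unfolding d_def by (rule cInf_lower[OF _ bdd]) (use that in auto)
 have "\<exists>s\<in>S. (norm (f - s))\<^sup>2 < d + 1 / real (Suc n)" for n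
  using cInf_lessD[OF ne, of "d + 1 / real (Suc n)"] unfolding d_def by auto
 then obtain s where sS: "!!n. s n \<in> S" and s: "!!n. (norm (f - s n))\<^sup>2 < d + 1 / real (Suc n)" by metis
 \<comment> \<open>By the parallelogram law the midpoint of two near-minimizers would beat the
   infimum unless they are close to each other.\<close>
 have par: "(norm (s m - s n))\<^sup>2 <= 2 / real (Suc m) + 2 / real (Suc n)" for m n proof -
  have "(1/2) *\<^sub>R (s m + s n) \<in> S" using S sS by (simp add: subspace_add subspace_scale)
  then have "d <= (norm (f - (1/2) *\<^sub>R (s m + s n)))\<^sup>2" by (rule dle)
  also have "... = (norm (f - s m))\<^sup>2 / 2 + (norm (f - s n))\<^sup>2 / 2 - (norm (s m - s n))\<^sup>2 / 4"
   by (simp add: power2_norm_eq_inner inner_diff_left inner_diff_right inner_add_left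
     inner_add_right inner_commute field_simps)
  finally show ?thesis using s[of m] s[of n] times_divide_eq_right[of 2 1 "real (Suc m)"]
    times_divide_eq_right[of 2 1 "real (Suc n)"] by linarith
 qed
 have "Cauchy s" proof (rule CauchyI)
  fix e :: real assume "e > 0"
  then obtain N where N: "inverse (real (Suc N)) < e\<^sup>2 / 4" using reals_Archimedean[of "e\<^sup>2 / 4"] by auto
  have "norm (s m - s n) < e" if "m \<ge> N" "n \<ge> N" for m n proof -
   have "1 / real (Suc m) <= 1 / real (Suc N)" "1 / real (Suc n) <= 1 / real (Suc N)"
    using that by (auto intro!: divide_left_mono)
   then have "(norm (s m - s n))\<^sup>2 < e\<^sup>2" using par[of m n] N by (simp add: inverse_eq_divide)
   then show ?thesis using \<open>e > 0\<close> by (auto intro: power2_less_imp_less)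
  qed
  then show "\<exists>M. \<forall>m\<ge>M. \<forall>n\<ge>M. norm (s m - s n) < e" by blast
 qed
 then obtain p where p: "s ----> p" using Cauchy_convergent convergent_def by blast
 have pS: "p \<in> S" using closed_sequentially[OF cl _ p] sS by blast
 have "(norm (f - p))\<^sup>2 <= d" proof (rule LIMSEQ_le)
  show "(%n. (norm (f - s n))\<^sup>2) ----> (norm (f - p))\<^sup>2" by (intro tendsto_intros p)
  show "(%n. d + 1 / real (Suc n)) ----> d" by (rule tendsto_eq_intros LIMSEQ_Suc[OF lim_1_over_n] refl | simp)+
  show "\<exists>N. \<forall>n\<ge>N. (norm (f - s n))\<^sup>2 <= d + 1 / real (Suc n)" using s less_imp_le by blast
 qed
 then have "norm (f - p) <= norm (f - v)" if "v \<in> S" for v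
  by (rule power2_le_imp_le[OF order_trans[OF _ dle[OF that]]]) auto
 then show ?thesis using subspace_inner_min_orthogonal[OF S pS] pS by blast
qed

lemma closed_subspace_eq_UNIV:
 fixes S :: "'h::{real_inner, complete_space} set"
 assumes S: "subspace S" "closed S" and orth: "!!f. (!!v. v \<in> S ==> inner f v = 0) ==> f = 0"
 shows "S = UNIV"
proof -
 have "f \<in> S" for f proof -
  obtain p where "p \<in> S" "\<forall>v\<in>S. inner (f - p) v = 0" using orthogonal_projection_exists[OF S] by blast
  then show ?thesis using orth[of "f - p"] by simp
 qed
 then show ?thesis by auto
qed

theorem Riesz_representation:
 fixes L :: "'h::{real_inner, complete_space} => real"
 assumes L: "bounded_linear L"
 shows "\<exists>!k. \<forall>u. L u = inner u k"
proof -
 interpret bounded_linear L by fact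
 define S where "S = {u. L u = 0}"
 have S: "subspace S" by (auto simp: S_def subspace_def add scale zero)
 have cl: "closed S"
  unfolding S_def by (intro closed_Collect_eq continuous_intros continuous_on_const linear_continuous_on L)
 have "\<exists>k. \<forall>u. L u = inner u k" proof (cases "\<forall>u. L u = 0")
  case True
  then show ?thesis by (intro exI[of _ 0]) simp
 next
  case False
  then obtain w where w: "L w \<noteq> 0" by blast
  obtain p where p: "p \<in> S" "\<forall>v\<in>S. inner (w - p) v = 0" using orthogonal_projection_exists[OF S cl] by blast
  \<comment> \<open>\<open>z\<close> is orthogonal to the kernel of L, and subtracting (L u / L z) z
    from u leaves a kernel vector; pairing that vector with \<open>z\<close> evaluates L u.\<close>
  define z where "z = w - p"
  have Lz: "L z = L w" using p(1) by (simp add: z_def diff S_def)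
  then have z: "inner z z \<noteq> 0" using w zero by auto
  have "L u = inner u ((L z / inner z z) *\<^sub>R z)" for u proof -
   have "u - (L u / L z) *\<^sub>R z \<in> S" using w Lz by (simp add: S_def diff scale)
   then have "inner z (u - (L u / L z) *\<^sub>R z) = 0" using p(2) by (simp add: z_def)
   then have "inner u z = (L u / L z) * inner z z" by (simp add: inner_diff_right inner_commute)
   then show ?thesis using z w Lz by (simp add: field_simps)
  qed
  then show ?thesis by blast
 qed
 moreover have "k = k'" if "\<forall>u. L u = inner u k" "\<forall>u. L u = inner u k'" for k k' proof -
  have "inner (k - k') (k - k') = 0" using that by (metis inner_diff_right cancel_comm_monoid_add_class.diff_cancel)
  then show ?thesis by simp
 qed
 ultimately show ?thesis by blast
qed

lemma inner_eq_imp_eq: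
 fixes u v :: "'h::real_inner"
 assumes "!!w. inner u w = inner v w"
 shows "u = v"
proof -
 have "inner (u - v) (u - v) = 0" using assms[of "u - v"] by (simp add: inner_diff_left)
 then show ?thesis by simp
qed

lemma bounded_form_operator:
 fixes B :: "'h::{real_inner, complete_space} => 'h => real"
 assumes B: "bounded_bilinear B"
 shows "\<exists>T. \<forall>u v. inner (T u) v = B u v"
proof -
 have "\<exists>k. \<forall>v. B u v = inner v k" for u
  using Riesz_representation[OF bounded_bilinear.bounded_linear_right[OF B]] by blast
 then obtain T where "!!u v. B u v = inner v (T u)" by metis
 then show ?thesis by (intro exI[of _ T]) (simp add: inner_commute)
qed

text \<open>Linearity is forced by an adjoint relation. \<open>pvm\<close> does not postulate it;
  the spectral projections, the functional calculus and the reflection become linear through this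
  lemma.\<close>

lemma symmetric_operator_linear:
 fixes P :: "'h::real_inner => 'h"
 assumes "!!u v. inner (P u) v = inner u (Q v)"
 shows "linear P" by (rule linearI; rule inner_eq_imp_eq) (simp_all add: assms inner_add_left)

section \<open>Functional calculus of a projection-valued measure\<close>

definition bounded_borel :: "(real => real) => bool" where
 "bounded_borel f \<longleftrightarrow> f \<in> borel_measurable borel & (\<exists>C. \<forall>x. \<bar>f x\<bar> <= C)"

lemma bounded_borelI: "f \<in> borel_measurable borel ==> (!!x. \<bar>f x\<bar> <= C) ==> bounded_borel f" by (auto simp: bounded_borel_def)

lemma bounded_borel_measurable [measurable_dest]:
 "bounded_borel f ==> f \<in> borel_measurable borel" by (simp add: bounded_borel_def)

lemma bounded_borel_bound:
 assumes "bounded_borel f" obtains C where "C > 0" "!!x. \<bar>f x\<bar> <= C"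
proof -
 obtain C where C: "!!x. \<bar>f x\<bar> <= C" using assms by (auto simp: bounded_borel_def)
 have "\<bar>f x\<bar> <= \<bar>C\<bar> + 1" for x using C[of x] by linarith
 then show thesis by (intro that[of "\<bar>C\<bar> + 1"]) auto
qed

lemma bounded_borel_indicator [intro]: "B \<in> sets borel ==> bounded_borel (indicator B)"
 by (rule bounded_borelI[of _ 1]) (auto simp: indicator_def)

lemma bounded_borel_const [intro]: "bounded_borel (%x. c)" by (rule bounded_borelI[of _ "\<bar>c\<bar>"]) auto

lemma bounded_borel_mult [intro]:
 assumes "bounded_borel f" "bounded_borel g" shows "bounded_borel (%x. f x * g x)"
proof -
 obtain C D where "!!x. \<bar>f x\<bar> <= C" "!!x. \<bar>g x\<bar> <= D" "C > 0" using bounded_borel_bound assms by metis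
 then show ?thesis using assms by (intro bounded_borelI[of _ "C * D"])
   (auto simp: abs_mult dest: bounded_borel_measurable intro!: mult_mono order_trans[OF abs_ge_zero])
qed

lemma bounded_borel_add [intro]:
 assumes "bounded_borel f" "bounded_borel g" shows "bounded_borel (%x. f x + g x)"
proof -
 obtain C D where *: "!!x. \<bar>f x\<bar> <= C" "!!x. \<bar>g x\<bar> <= D" using bounded_borel_bound assms by metis
 have "\<bar>f x + g x\<bar> <= C + D" for x using *(1)[of x] *(2)[of x] by linarith
 then show ?thesis using assms by (intro bounded_borelI[of _ "C + D"]) (auto dest: bounded_borel_measurable)
qed

lemma sum_lessThan_4: "(\<Sum>j<4. f j) = f 0 + f 1 + f 2 + f (3::nat)"
 for f :: "nat => 'x::comm_monoid_add" by (simp add: eval_nat_numeral)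

lemma polarization: "(norm (a + b))\<^sup>2 - (norm (a - b))\<^sup>2 = 4 * inner a b"
 for a b :: "'x::real_inner" by (simp add: power2_norm_eq_inner inner_add_left inner_add_right inner_diff_left
   inner_diff_right inner_commute)

text \<open>A version of \<open>pvm\<close> free of representatives and of complex scalars, so that
  the functional calculus can be developed with the real inner product alone.\<close>

locale spectral_family =
 fixes P :: "real set => 'h::{real_inner, complete_space} => 'h"
 assumes sym: "B \<in> sets borel ==> inner (P B u) v = inner u (P B v)"
  and Int: "B \<in> sets borel ==> C \<in> sets borel ==> P (B \<inter> C) u = P B (P C u)" and empty [simp]: "P {} u = 0"
  and total [simp]: "P UNIV u = u" and additive: "range A \<subseteq> sets borel ==> disjoint_family A ==>
   (%n. \<Sum>i<n. P (A i) u) ----> P (\<Union>i::nat. A i) u"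
begin

lemma P_add: "B \<in> sets borel ==> P B (u + v) = P B u + P B v"
 using symmetric_operator_linear[of "P B" "P B"] sym linear_add by blast

lemma P_scaleR: "B \<in> sets borel ==> P B (r *\<^sub>R u) = r *\<^sub>R P B u"
 using symmetric_operator_linear[of "P B" "P B"] sym linear_scale by blast

lemma P_diff: "B \<in> sets borel ==> P B (u - v) = P B u - P B v"
 using symmetric_operator_linear[of "P B" "P B"] sym linear_diff by blast

lemma norm_P_square: "B \<in> sets borel ==> (norm (P B u))\<^sup>2 = inner (P B u) u"
 using Int[of B B u] sym[of B "P B u" u] by (simp add: power2_norm_eq_inner inner_commute)

definition mu :: "'h => real measure" where
 "mu u = measure_of UNIV (sets borel) (%B. ennreal ((norm (P B u))\<^sup>2))"

lemma sets_mu [simp, measurable_cong]: "sets (mu u) = sets borel"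
 unfolding mu_def by (subst sets_measure_of) (use sets.sigma_sets_eq[of borel] in auto)

lemma space_mu [simp]: "space (mu u) = UNIV" using sets_eq_imp_space_eq[OF sets_mu[of u]] by simp

text \<open>As \<open>P B\<close> is a symmetric idempotent, the squared norm of
  \<open>P B u\<close> equals \<open>inner (P B u) u\<close>, which is additive in \<open>B\<close>;
  this turns strong additivity into countable additivity.\<close>

lemma emeasure_mu: "B \<in> sets borel ==> emeasure (mu u) B = ennreal ((norm (P B u))\<^sup>2)"
proof (rule emeasure_measure_of[OF mu_def])
 show "positive (sets (mu u)) (%B. ennreal ((norm (P B u))\<^sup>2))" by (simp add: positive_def)
 show "countably_additive (sets (mu u)) (%B. ennreal ((norm (P B u))\<^sup>2))" proof (rule countably_additiveI)
  fix A :: "nat => real set"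
  assume A: "range A \<subseteq> sets (mu u)" "disjoint_family A" "(\<Union>i. A i) \<in> sets (mu u)"
  have "(%n. inner (\<Sum>i<n. P (A i) u) u) ----> inner (P (\<Union>i. A i) u) u"
   using A by (intro tendsto_inner tendsto_const additive) auto
  then have "(%i. (norm (P (A i) u))\<^sup>2) sums (norm (P (\<Union>i. A i) u))\<^sup>2" using A unfolding sums_def
   by (subst norm_P_square) (auto simp: inner_sum_left norm_P_square subset_eq)
  then show "(\<Sum>i. ennreal ((norm (P (A i) u))\<^sup>2)) = ennreal ((norm (P (\<Union>i. A i) u))\<^sup>2)"
   by (intro suminf_ennreal_eq) auto
 qed
qed auto

lemma finite_measure_mu [simp]: "finite_measure (mu u)" by (rule finite_measureI) (simp add: emeasure_mu)

lemma measure_mu: "B \<in> sets borel ==> measure (mu u) B = (norm (P B u))\<^sup>2" by (simp add: measure_def emeasure_mu)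

lemma integrable_mu:
 assumes "bounded_borel f" shows "integrable (mu u) f"
proof -
 obtain C where "!!x. \<bar>f x\<bar> <= C" using bounded_borel_bound assms by metis
 then show ?thesis using assms by (intro finite_measure.integrable_const_bound[OF finite_measure_mu, of _ C])
   (auto dest: bounded_borel_measurable)
qed

lemma abs_integral_mu_le:
 assumes "f \<in> borel_measurable borel" "!!x. \<bar>f x\<bar> <= C"
 shows "\<bar>\<integral>x. f x \<partial>mu u\<bar> <= C * (norm u)\<^sup>2"
proof -
 have i: "integrable (mu u) f" using assms by (intro integrable_mu bounded_borelI)
 have "\<bar>\<integral>x. f x \<partial>mu u\<bar> <= (\<integral>x. \<bar>f x\<bar> \<partial>mu u)" using integral_norm_bound[of "mu u" f] by simp
 also have "... <= (\<integral>x. C \<partial>mu u)" using assms i by (intro integral_mono) (auto intro: finite_measure.integrable_const)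
 also have "... = C * (norm u)\<^sup>2" using measure_mu[of UNIV u] by simp
 finally show ?thesis .
qed

text \<open>Carries a linear identity between finitely many spectral measures from indicators to
  every bounded Borel \<open>f\<close>, by uniform approximation. The weights \<open>w j\<close>
  allow different integrands in one identity; the product rule needs this, since there some of the
  measures carry an extra factor.\<close>

lemma weighted_integrals_zero:
 assumes f: "bounded_borel f" and w: "!!j. bounded_borel (w j)" and "finite J"
  and zero: "!!B. B \<in> sets borel ==> (\<Sum>j\<in>J. a j * (\<integral>x. w j x * indicator B x \<partial>mu (U j))) = 0"
 shows "(\<Sum>j\<in>J. a j * (\<integral>x. w j x * f x \<partial>mu (U j))) = 0" (is "?S = 0")
proof -
 note [measurable] = bounded_borel_measurable[OF f]
 obtain C where C: "!!x. \<bar>f x\<bar> <= C" using bounded_borel_bound f by metis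
 have "\<exists>C. \<forall>x. \<bar>w j x\<bar> <= C" for j using w[of j] by (simp add: bounded_borel_def)
 then obtain D where D: "!!j x. \<bar>w j x\<bar> <= D j" by metis
 have D0: "0 <= D j" for j using D[of j 0] by linarith
 define b where "b = (\<Sum>j\<in>J. \<bar>a j\<bar> * (D j * (norm (U j))\<^sup>2))"
 have b0: "0 <= b" unfolding b_def using D0 by (intro sum_nonneg) auto
 have "\<bar>?S\<bar> <= b * e" if e: "0 < e" for e proof -
  \<comment> \<open>Rounding \<open>f\<close> down to a multiple of \<open>e\<close> gives a
    function within \<open>e\<close> of \<open>f\<close> with finitely many level sets, so the
    assumption on indicators applies to it.\<close>
  define h where "h x = e * of_int \<lfloor>f x / e\<rfloor>" for x
  have hf: "\<bar>f x - h x\<bar> <= e" for x proof -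
   have "\<bar>f x / e - of_int \<lfloor>f x / e\<rfloor>\<bar> <= 1" by linarith
   then have "e * \<bar>f x / e - of_int \<lfloor>f x / e\<rfloor>\<bar> <= e * 1" using e by (intro mult_left_mono) auto
   then show ?thesis using e abs_mult[of e "f x / e - of_int \<lfloor>f x / e\<rfloor>"] by (simp add: h_def right_diff_distrib)
  qed
  define I where "I = {\<lfloor>- C / e\<rfloor>..\<lfloor>C / e\<rfloor>}"
  define B where "B k = {x. \<lfloor>f x / e\<rfloor> = k}" for k
  have Bs: "B k \<in> sets borel" for k unfolding B_def by measurable
  have hs: "h x = (\<Sum>k\<in>I. (e * of_int k) * indicator (B k) x)" for x proof -
   have "\<lfloor>f x / e\<rfloor> \<in> I" proof -
    have "- C <= f x" "f x <= C" using C[of x] by auto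
    from this[THEN divide_right_mono, of e] have "- C / e <= f x / e" "f x / e <= C / e" using e by simp_all
    then show ?thesis unfolding I_def by (simp add: floor_mono del: divide_minus_left)
   qed
   then have "h x = (\<Sum>k\<in>I. if k = \<lfloor>f x / e\<rfloor> then e * of_int k else 0)" by (simp add: h_def I_def)
   also have "... = (\<Sum>k\<in>I. (e * of_int k) * indicator (B k) x)" by (rule sum.cong) (auto simp: B_def indicator_def)
   finally show ?thesis .
  qed
  have ii: "integrable (mu (U j)) (%x. w j x * indicator (B k) x)" for j k
   by (intro integrable_mu bounded_borel_mult w bounded_borel_indicator Bs)
  have hb: "bounded_borel h" proof (rule bounded_borelI)
   show "h \<in> borel_measurable borel" unfolding h_def[abs_def] by measurable
   show "\<bar>h x\<bar> <= C + e" for x using hf[of x] C[of x] by linarith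
  qed
  have "(\<integral>x. w j x * h x \<partial>mu (U j)) = (\<Sum>k\<in>I. (e * of_int k) * (\<integral>x. w j x * indicator (B k) x \<partial>mu (U j)))" for j
   unfolding hs sum_distrib_left mult.left_commute[of "w j _"] using ii by (simp add: Bochner_Integration.integral_sum)
  then have "(\<Sum>j\<in>J. a j * (\<integral>x. w j x * h x \<partial>mu (U j)))
    = (\<Sum>k\<in>I. (e * of_int k) * (\<Sum>j\<in>J. a j * (\<integral>x. w j x * indicator (B k) x \<partial>mu (U j))))"
   by (simp add: sum_distrib_left mult.left_commute sum.swap[of _ I])
  then have "?S = (\<Sum>j\<in>J. a j * (\<integral>x. w j x * f x \<partial>mu (U j))) - (\<Sum>j\<in>J. a j * (\<integral>x. w j x * h x \<partial>mu (U j)))"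
   by (simp add: zero[OF Bs])
  also have "... = (\<Sum>j\<in>J. a j * (\<integral>x. w j x * (f x - h x) \<partial>mu (U j)))"
   using integrable_mu[OF bounded_borel_mult[OF w f]] integrable_mu[OF bounded_borel_mult[OF w hb]]
   by (simp add: right_diff_distrib flip: sum_subtractf)
  also have "\<bar>...\<bar> <= (\<Sum>j\<in>J. \<bar>a j\<bar> * (D j * e * (norm (U j))\<^sup>2))" proof (intro order_trans[OF sum_abs] sum_mono)
   fix j
   have "\<bar>\<integral>x. w j x * (f x - h x) \<partial>mu (U j)\<bar> <= D j * e * (norm (U j))\<^sup>2" proof (rule abs_integral_mu_le)
    show "(%x. w j x * (f x - h x)) \<in> borel_measurable borel"
     using bounded_borel_measurable[OF hb] bounded_borel_measurable[OF w[of j]] by measurable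
    show "\<bar>w j x * (f x - h x)\<bar> <= D j * e" for x using D hf D0 by (auto simp: abs_mult intro!: mult_mono)
   qed
   then show "\<bar>a j * (\<integral>x. w j x * (f x - h x) \<partial>mu (U j))\<bar> <= \<bar>a j\<bar> * (D j * e * (norm (U j))\<^sup>2)"
    unfolding abs_mult by (rule mult_left_mono) simp
  qed
  also have "... = b * e" unfolding b_def sum_distrib_right by (rule sum.cong) (simp_all add: mult_ac)
  finally show ?thesis .
 qed
 note le = this
 have "\<bar>?S\<bar> <= 0" proof (rule field_le_epsilon)
  fix e :: real assume e: "0 < e"
  have "b * (e / (b + 1)) <= e" using b0 e by (simp add: field_simps)
  then show "\<bar>?S\<bar> <= 0 + e" using le[of "e / (b + 1)"] b0 e by simp
 qed
 then show ?thesis by simp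
qed

lemma integrals_zero:
 assumes "bounded_borel f" "finite J" and "!!B. B \<in> sets borel ==> (\<Sum>j\<in>J. a j * (norm (P B (U j)))\<^sup>2) = 0"
 shows "(\<Sum>j\<in>J. a j * (\<integral>x. f x \<partial>mu (U j))) = 0"
 using weighted_integrals_zero[of f "%_ _. 1" J a U] assms by (auto simp: measure_mu)

section \<open>The bounded functional calculus by polarization\<close>

definition form :: "(real => real) => 'h => 'h => real" where
 "form f u v = ((\<integral>x. f x \<partial>mu (u + v)) - (\<integral>x. f x \<partial>mu (u - v))) / 4"

lemma mu_minus: "mu (u - v) = mu (v - u)" proof (rule measure_eqI)
 fix B assume "B \<in> sets (mu (u - v))"
 then show "emeasure (mu (u - v)) B = emeasure (mu (v - u)) B" by (simp add: emeasure_mu P_diff norm_minus_commute)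
qed simp

lemma form_sym: "form f u v = form f v u" by (simp add: form_def mu_minus add.commute)

text \<open>The claim is the vanishing of a signed sum over six spectral measures. For an indicator
  this sum is a polynomial identity between inner products of \<open>P B u\<close>,
  \<open>P B u'\<close> and \<open>P B v\<close>. The homogeneity and diagonal rules use the same
  device with other lists.\<close>

lemma form_add:
 assumes "bounded_borel f"
 shows "form f (u + u') v = form f u v + form f u' v"
proof -
 define U where "U j = [u + u' + v, u + u' - v, u + v, u - v, u' + v, u' - v] ! j" for j
 define a where "a j = [1, -1, -1, 1, -1, 1 :: real] ! j" for j
 have "(\<Sum>j<6. a j * (\<integral>x. f x \<partial>mu (U j))) = 0" proof (rule integrals_zero[OF assms])
  fix B :: "real set" assume B: "B \<in> sets borel"
  show "(\<Sum>j<6. a j * (norm (P B (U j)))\<^sup>2) = 0" unfolding power2_norm_eq_inner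
   by (simp add: eval_nat_numeral a_def U_def P_add[OF B] P_diff[OF B] inner_add_left inner_add_right inner_diff_left inner_diff_right inner_commute)
 qed simp
 then show ?thesis by (simp add: eval_nat_numeral a_def U_def form_def field_simps)
qed

lemma form_scaleR:
 assumes "bounded_borel f"
 shows "form f (r *\<^sub>R u) v = r * form f u v"
proof -
 define U where "U j = [r *\<^sub>R u + v, r *\<^sub>R u - v, u + v, u - v] ! j" for j
 define a where "a j = [1, -1, -r, r :: real] ! j" for j
 have "(\<Sum>j<4. a j * (\<integral>x. f x \<partial>mu (U j))) = 0" proof (rule integrals_zero[OF assms])
  fix B :: "real set" assume B: "B \<in> sets borel"
  show "(\<Sum>j<4. a j * (norm (P B (U j)))\<^sup>2) = 0" unfolding power2_norm_eq_inner
   by (simp add: eval_nat_numeral a_def U_def P_add[OF B] P_diff[OF B] P_scaleR[OF B]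
     inner_add_left inner_add_right inner_diff_left inner_diff_right inner_commute algebra_simps)
 qed simp
 then show ?thesis by (simp add: eval_nat_numeral a_def U_def form_def field_simps)
qed

lemma form_self:
 assumes "bounded_borel f"
 shows "form f u u = (\<integral>x. f x \<partial>mu u)"
proof -
 define U where "U j = [u + u, u - u, u] ! j" for j
 define a where "a j = [1, -1, -4 :: real] ! j" for j
 have "(\<Sum>j<3. a j * (\<integral>x. f x \<partial>mu (U j))) = 0" proof (rule integrals_zero[OF assms])
  fix B :: "real set" assume B: "B \<in> sets borel"
  show "(\<Sum>j<3. a j * (norm (P B (U j)))\<^sup>2) = 0" using P_scaleR[OF B, of 0 u] unfolding power2_norm_eq_inner
   by (simp add: eval_nat_numeral a_def U_def P_add[OF B] P_diff[OF B] inner_add_left inner_add_right inner_diff_left inner_diff_right inner_commute)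
 qed simp
 then show ?thesis by (simp add: eval_nat_numeral a_def U_def form_def field_simps)
qed

text \<open>For unit vectors the two spectral integrals are controlled by the squared norms of u + v
  and u - v, which the parallelogram law adds up; homogeneity extends the bound to all
  vectors.\<close>

lemma bounded_bilinear_form:
 assumes f: "bounded_borel f"
 shows "bounded_bilinear (form f)"
proof -
 obtain C where C: "!!x. \<bar>f x\<bar> <= C" "C > 0" using bounded_borel_bound f by metis
 have fm: "f \<in> borel_measurable borel" using f by (rule bounded_borel_measurable)
 have unit: "\<bar>form f u v\<bar> <= C" if "norm u = 1" "norm v = 1" for u v proof -
  have "\<bar>form f u v\<bar> <= (\<bar>\<integral>x. f x \<partial>mu (u + v)\<bar> + \<bar>\<integral>x. f x \<partial>mu (u - v)\<bar>) / 4"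
   unfolding form_def by (simp add: abs_triangle_ineq4)
  also have "... <= (C * (norm (u + v))\<^sup>2 + C * (norm (u - v))\<^sup>2) / 4"
   using abs_integral_mu_le[OF fm C(1)] by (intro divide_right_mono add_mono) auto
  also have "... = C * ((norm u)\<^sup>2 + (norm v)\<^sup>2) / 2"
   by (simp add: power2_norm_eq_inner inner_add_left inner_add_right inner_diff_left
     inner_diff_right inner_commute algebra_simps)
  finally show ?thesis using that by simp
 qed
 have scr: "form f u (r *\<^sub>R v) = r * form f u v" for u v r using form_scaleR[OF f] form_sym by metis
 have bound: "norm (form f u v) <= norm u * norm v * C" for u v proof (cases "u = 0 \<or> v = 0")
  case True
  then show ?thesis using form_scaleR[OF f, of 0 u v] scr[of u 0 v] by auto
 next
  case False
  define u' v' where "u' = (1 / norm u) *\<^sub>R u" and "v' = (1 / norm v) *\<^sub>R v"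
  have uv: "u = norm u *\<^sub>R u'" "v = norm v *\<^sub>R v'" "norm u' = 1" "norm v' = 1"
   using False by (auto simp: u'_def v'_def)
  have "form f u v = norm u * (norm v * form f u' v')" by (subst uv(1), subst uv(2)) (simp add: form_scaleR[OF f] scr)
  then show ?thesis using unit[OF uv(3,4)] by (simp add: abs_mult mult.assoc mult_left_mono)
 qed
 show ?thesis proof
  show "\<exists>K. \<forall>a b. norm (form f a b) <= norm a * norm b * K" using bound by blast
  show "form f a (b + b') = form f a b + form f a b'" for a b b' using form_add[OF f] form_sym by metis
 qed (simp_all add: form_add[OF f] form_scaleR[OF f] scr)
qed

definition T :: "(real => real) => 'h => 'h" where
 "T f = (SOME T. \<forall>u v. inner (T u) v = form f u v)"

lemma inner_T: "bounded_borel f ==> inner (T f u) v = form f u v"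
 using someI_ex[OF bounded_form_operator[OF bounded_bilinear_form]] unfolding T_def by blast

lemma inner_T_self: "bounded_borel f ==> inner (T f u) u = (\<integral>x. f x \<partial>mu u)" by (simp add: inner_T form_self)

lemma T_sym: "bounded_borel f ==> inner (T f u) v = inner u (T f v)" by (metis inner_T form_sym inner_commute)

lemma T_linear: "bounded_borel f ==> linear (T f)" using symmetric_operator_linear T_sym by blast

lemma T_indicator:
 assumes B: "B \<in> sets borel" shows "T (indicator B) u = P B u"
proof (rule inner_eq_imp_eq)
 fix v
 have "inner (T (indicator B) u) v = ((norm (P B (u + v)))\<^sup>2 - (norm (P B (u - v)))\<^sup>2) / 4"
  using B by (simp add: inner_T bounded_borel_indicator form_def measure_mu)
 also have "... = inner (P B u) (P B v)" by (simp add: P_add[OF B] P_diff[OF B] power2_norm_eq_inner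
    inner_add_left inner_add_right inner_diff_left inner_diff_right inner_commute)
 also have "... = inner (P B u) v" using Int[OF B B, of u] sym[OF B, of "P B u" v] by simp
 finally show "inner (T (indicator B) u) v = inner (P B u) v" .
qed

lemma T_1 [simp]: "T (%_. 1) u = u"
 using T_indicator[of UNIV u] by (simp add: indicator_UNIV[abs_def] flip: indicator_def)

lemma T_add:
 assumes "bounded_borel f" "bounded_borel g"
 shows "T (%x. f x + g x) u = T f u + T g u" using assms by (rule_tac inner_eq_imp_eq)
  (simp add: inner_T bounded_borel_add inner_add_left form_def integrable_mu field_simps)

lemma T_cmult:
 assumes "bounded_borel f"
 shows "T (%x. c * f x) u = c *\<^sub>R T f u" using assms by (rule_tac inner_eq_imp_eq)
  (simp add: inner_T bounded_borel_mult bounded_borel_const form_def field_simps)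

text \<open>Two passes over indicators: first the inner factor is an indicator and \<open>f\<close>
  general, where the claim reduces to multiplicativity of \<open>P\<close>; then \<open>g\<close> is
  general and the first pass supplies the identity on indicators.\<close>

lemma T_mult:
 assumes f: "bounded_borel f" and g: "bounded_borel g"
 shows "T f (T g u) = T (%x. f x * g x) u"
proof -
 have fB: "T f (P B u) = T (%x. indicator B x * f x) u" if B: "B \<in> sets borel" for B u proof (rule inner_eq_imp_eq)
  fix v
  define U where "U j = [P B u + v, P B u - v, u + v, u - v] ! j" for j
  define w where "w j = [%_. 1, %_. 1, indicator B, indicator B :: real => real] ! j" for j
  define a where "a j = [1, -1, -1, 1 :: real] ! j" for j
  \<comment> \<open>\<open>weighted_integrals_zero\<close> asks for bounded weights at every index,
    so the list of four entries is continued by the constant 1.\<close>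
  define w' where "w' j = (if j < 4 then w j else (%_. 1))" for j
  have w': "bounded_borel (w' j)" for j proof -
   consider "j = 0" | "j = 1" | "j = 2" | "j = 3" | "j \<ge> 4" by linarith
   then show ?thesis using B by cases (auto simp: w'_def w_def)
  qed
  have "(\<Sum>j<4. a j * (\<integral>x. w' j x * f x \<partial>mu (U j))) = 0" proof (rule weighted_integrals_zero[OF f w'])
   fix C :: "real set" assume C: "C \<in> sets borel"
   have BC: "B \<inter> C \<in> sets borel" using B C by auto
   have e: "P C (P B u) = P (B \<inter> C) u" using Int[OF C B] by (simp add: Int_commute)
   have ind: "(\<integral>x. indicator B x * indicator C x \<partial>mu y) = (norm (P (B \<inter> C) y))\<^sup>2" for y
    using BC by (simp add: measure_mu flip: indicator_inter_arith)
   have e2: "inner (P (B \<inter> C) u) (P C v) = inner (P (B \<inter> C) u) (P (B \<inter> C) v)"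
    using Int[OF C BC, of u] Int[OF BC BC, of u] sym[OF C] sym[OF BC] by (metis inf.absorb_iff2 inf_le2)
   show "(\<Sum>j<4. a j * (\<integral>x. w' j x * indicator C x \<partial>mu (U j))) = 0"
    using C polarization[of "P (B \<inter> C) u" "P C v"] polarization[of "P (B \<inter> C) u" "P (B \<inter> C) v"] e2
    by (simp add: sum_lessThan_4 a_def U_def w'_def w_def ind measure_mu
      P_add[OF C] P_diff[OF C] P_add[OF BC] P_diff[OF BC] e)
  qed simp
  then show "inner (T f (P B u)) v = inner (T (%x. indicator B x * f x) u) v" using f B
   by (simp add: sum_lessThan_4 a_def U_def w'_def w_def inner_T form_def bounded_borel_mult
     bounded_borel_indicator)
 qed
 show ?thesis proof (rule inner_eq_imp_eq)
  fix v
  define y where "y = T f v"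
  define U where "U j = [u + y, u - y, u + v, u - v] ! j" for j
  define w where "w j = [%_. 1, %_. 1, f, f] ! j" for j
  define a where "a j = [1, -1, -1, 1 :: real] ! j" for j
  define w' where "w' j = (if j < 4 then w j else (%_. 1))" for j
  have w': "bounded_borel (w' j)" for j proof -
   consider "j = 0" | "j = 1" | "j = 2" | "j = 3" | "j \<ge> 4" by linarith
   then show ?thesis using f by cases (auto simp: w'_def w_def)
  qed
  have "(\<Sum>j<4. a j * (\<integral>x. w' j x * g x \<partial>mu (U j))) = 0" proof (rule weighted_integrals_zero[OF g w'])
   fix C :: "real set" assume C: "C \<in> sets borel"
   have "form (indicator C) u y = inner (P C u) y"
    using C by (simp add: inner_T[symmetric] bounded_borel_indicator T_indicator)
   also have "... = inner (T f (P C u)) v" by (simp add: y_def T_sym[OF f])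
   also have "... = form (%x. indicator C x * f x) u v"
    using f C by (simp add: fB inner_T bounded_borel_mult bounded_borel_indicator)
   also have "(%x. indicator C x * f x) = (%x. f x * indicator C x)" by (rule ext) (rule mult.commute)
   finally show "(\<Sum>j<4. a j * (\<integral>x. w' j x * indicator C x \<partial>mu (U j))) = 0"
    by (simp add: sum_lessThan_4 a_def U_def w'_def w_def form_def)
  qed simp
  then have "form g u y = form (%x. f x * g x) u v" by (simp add: sum_lessThan_4 a_def U_def w'_def w_def form_def)
  then show "inner (T f (T g u)) v = inner (T (%x. f x * g x) u) v"
   using f g by (simp add: T_sym[OF f] inner_T[OF g] inner_T bounded_borel_mult flip: y_def)
 qed
qed

lemma norm_T_square: "bounded_borel f ==> (norm (T f u))\<^sup>2 = (\<integral>x. (f x)\<^sup>2 \<partial>mu u)" proof -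
 assume f: "bounded_borel f"
 have "(norm (T f u))\<^sup>2 = inner (T f (T f u)) u" by (simp add: power2_norm_eq_inner T_sym[OF f] inner_commute)
 also have "... = (\<integral>x. (f x)\<^sup>2 \<partial>mu u)" using f by (simp add: T_mult inner_T_self bounded_borel_mult power2_eq_square)
 finally show ?thesis .
qed

lemma norm_T_le:
 assumes "f \<in> borel_measurable borel" "!!x. \<bar>f x\<bar> <= C"
 shows "norm (T f u) <= C * norm u"
proof -
 have C: "0 <= C" using assms(2)[of 0] by linarith
 have "(norm (T f u))\<^sup>2 <= C\<^sup>2 * (norm u)\<^sup>2" unfolding norm_T_square[OF bounded_borelI[OF assms]]
 proof (rule order_trans[OF abs_ge_self abs_integral_mu_le])
  show "\<bar>(f x)\<^sup>2\<bar> <= C\<^sup>2" for x using power_mono[OF assms(2)[of x] abs_ge_zero, of 2] by simp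
 qed (use assms(1) in measurable)
 then show ?thesis using C by (auto simp: power_mult_distrib intro: power2_le_imp_le)
qed

text \<open>The complements decrease to the empty set, and \<open>mu u\<close> is a finite
  measure.\<close>

lemma P_incseq_tendsto:
 assumes B: "!!n. B n \<in> sets borel" and inc: "incseq B" and Un: "(\<Union>n. B n) = UNIV"
 shows "(%n. P (B n) u) ----> u"
proof -
 have *: "P (- B n) u = u - P (B n) u" for n proof -
  have "P (B n) u + P (- B n) u = T (%x. indicator (B n) x + indicator (- B n) x) u"
   using B[of n] by (subst T_add) (auto simp: T_indicator bounded_borel_indicator)
  also have "... = T (%_. 1) u" by (rule arg_cong[of _ _ "%f. T f u"]) (auto simp: indicator_def)
  finally show ?thesis by (simp add: algebra_simps)
 qed
 have "(%n. measure (mu u) (- B n)) ----> measure (mu u) (\<Inter>n. - B n)"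
  by (rule finite_measure.finite_Lim_measure_decseq[OF finite_measure_mu])
   (use B inc in \<open>auto simp: decseq_def incseq_def\<close>)
 moreover have "(\<Inter>n. - B n) = {}" using Un by auto
 ultimately have "(%n. (norm (u - P (B n) u))\<^sup>2) ----> 0" using B by (simp add: measure_mu * borel_comp)
 then have "(%n. sqrt ((norm (u - P (B n) u))\<^sup>2)) ----> sqrt 0" by (rule tendsto_real_sqrt)
 then have "(%n. norm (P (B n) u - u)) ----> 0" by (simp add: norm_minus_commute)
 then show ?thesis by (simp add: tendsto_norm_zero_iff LIM_zero_iff)
qed

text \<open>Large values are replaced by 0, not by the bound: thus \<open>trunc f N\<close> is
  \<open>f\<close> times the indicator of a level set, and truncating an operator amounts to
  applying a spectral projection.\<close>

definition trunc :: "(real => real) => nat => real => real" where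
 "trunc f N x = (if \<bar>f x\<bar> <= real N then f x else 0)"

lemma level_sets: "f \<in> borel_measurable borel ==> {x. \<bar>f x\<bar> <= real N} \<in> sets borel"
 using borel_measurable_le[of "%x. \<bar>f x\<bar>" borel "%_. real N"] by simp

lemma trunc_measurable [measurable (raw)]:
 assumes [measurable]: "f \<in> borel_measurable borel" shows "trunc f N \<in> borel_measurable borel"
 unfolding trunc_def[abs_def] by measurable

lemma abs_trunc_le: "\<bar>trunc f N x\<bar> <= real N" "\<bar>trunc f N x\<bar> <= \<bar>f x\<bar>" by (auto simp: trunc_def)

lemma bounded_borel_trunc [intro]: "f \<in> borel_measurable borel ==> bounded_borel (trunc f N)"
 by (rule bounded_borelI[of _ "real N"]) (auto simp: abs_trunc_le)

lemma trunc_tendsto: "(%N. trunc f N x) ----> f x" proof (rule tendsto_eventually)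
 obtain N where "\<bar>f x\<bar> <= real N" using real_arch_simple by blast
 then show "\<forall>\<^sub>F N in sequentially. trunc f N x = f x"
  by (auto simp: eventually_sequentially trunc_def intro!: exI[of _ N])
qed

definition dom :: "(real => real) => 'h set" where
 "dom f = {u. integrable (mu u) (%s. (f s)\<^sup>2)}"

text \<open>The integrals of the truncated squares are the squared norms of
  \<open>T (trunc f N) u\<close>, so one direction is monotonicity and the other Fatou. In this form
  the domain is visibly closed under addition.\<close>

lemma dom_iff:
 assumes [measurable]: "f \<in> borel_measurable borel"
 shows "u \<in> dom f \<longleftrightarrow> (\<exists>K. \<forall>N. norm (T (trunc f N) u) <= K)"
proof
 assume "u \<in> dom f"
 then have i: "integrable (mu u) (%s. (f s)\<^sup>2)" by (simp add: dom_def)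
 have "norm (T (trunc f N) u) <= sqrt (\<integral>s. (f s)\<^sup>2 \<partial>mu u)" for N proof (rule real_le_rsqrt)
  show "(norm (T (trunc f N) u))\<^sup>2 <= (\<integral>s. (f s)\<^sup>2 \<partial>mu u)" unfolding norm_T_square[OF bounded_borel_trunc[OF assms]]
   by (rule integral_mono'[OF i]) (use abs_trunc_le(2)[of f N] in \<open>auto simp: abs_le_square_iff\<close>)
 qed
 then show "\<exists>K. \<forall>N. norm (T (trunc f N) u) <= K" by blast
next
 assume "\<exists>K. \<forall>N. norm (T (trunc f N) u) <= K"
 then obtain K where K: "!!N. norm (T (trunc f N) u) <= K" by blast
 have "(\<integral>\<^sup>+s. ennreal ((f s)\<^sup>2) \<partial>mu u) = (\<integral>\<^sup>+s. liminf (%N. ennreal ((trunc f N s)\<^sup>2)) \<partial>mu u)"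
 proof (rule nn_integral_cong)
  fix s
  have "(%N. ennreal ((trunc f N s)\<^sup>2)) ----> ennreal ((f s)\<^sup>2)" by (intro tendsto_ennrealI tendsto_intros trunc_tendsto)
  from lim_imp_Liminf[OF _ this]
  show "ennreal ((f s)\<^sup>2) = liminf (%N. ennreal ((trunc f N s)\<^sup>2))" by simp
 qed
 also have "... <= liminf (%N. \<integral>\<^sup>+s. ennreal ((trunc f N s)\<^sup>2) \<partial>mu u)" by (rule nn_integral_liminf) measurable
 also have "... <= ennreal (K\<^sup>2)" proof (intro Liminf_le always_eventually allI)
  fix N
  have "integrable (mu u) (%s. (trunc f N s)\<^sup>2)"
   using bounded_borel_mult[OF bounded_borel_trunc[OF assms] bounded_borel_trunc[OF assms], of N N]
   unfolding power2_eq_square by (rule integrable_mu)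
  then have "(\<integral>\<^sup>+s. ennreal ((trunc f N s)\<^sup>2) \<partial>mu u) = ennreal ((norm (T (trunc f N) u))\<^sup>2)"
   using assms by (subst norm_T_square) (auto intro!: nn_integral_eq_integral)
  then show "(\<integral>\<^sup>+s. ennreal ((trunc f N s)\<^sup>2) \<partial>mu u) <= ennreal (K\<^sup>2)"
   using K[of N] by (simp add: ennreal_leI power_mono)
 qed simp
 finally show "u \<in> dom f" unfolding dom_def by (auto intro!: integrableI_bounded simp: top_unique order.strict_iff_not)
qed

lemma dom_add:
 assumes f: "f \<in> borel_measurable borel" and "u \<in> dom f" "v \<in> dom f"
 shows "u + v \<in> dom f"
proof -
 obtain K L where K: "!!N. norm (T (trunc f N) u) <= K" and L: "!!N. norm (T (trunc f N) v) <= L"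
  using assms by (auto simp: dom_iff)
 have "norm (T (trunc f N) (u + v)) <= K + L" for N
  using norm_triangle_ineq[of "T (trunc f N) u" "T (trunc f N) v"] K[of N] L[of N]
  by (simp add: linear_add[OF T_linear[OF bounded_borel_trunc[OF f]]])
 then show ?thesis using f by (auto simp: dom_iff)
qed

lemma dom_diff:
 assumes f: "f \<in> borel_measurable borel" and "u \<in> dom f" "v \<in> dom f"
 shows "u - v \<in> dom f"
proof -
 have "mu (- v) = mu v" using mu_minus[of 0 v] by simp
 then have "- v \<in> dom f" using assms by (simp add: dom_def)
 with dom_add[OF f \<open>u \<in> dom f\<close>, of "- v"] show ?thesis by simp
qed

lemma form_trunc_tendsto:
 assumes f [measurable]: "f \<in> borel_measurable borel" and "u \<in> dom f" "v \<in> dom f"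
 shows "(%N. form (trunc f N) u v) ----> form f u v"
proof -
 have "(%N. \<integral>x. trunc f N x \<partial>mu y) ----> (\<integral>x. f x \<partial>mu y)" if "y \<in> dom f" for y proof (rule integral_dominated_convergence)
  show "integrable (mu y) (%x. 1 + (f x)\<^sup>2)"
   using that finite_measure.integrable_const[OF finite_measure_mu, of y "1 :: real"]
   by (intro Bochner_Integration.integrable_add) (auto simp: dom_def)
  show "AE x in mu y. norm (trunc f N x) <= 1 + (f x)\<^sup>2" for N proof (rule AE_I2)
   fix x
   have "\<bar>f x\<bar> <= 1 + (f x)\<^sup>2" using sum_squares_bound[of "\<bar>f x\<bar>" 1] by simp
   then show "norm (trunc f N x) <= 1 + (f x)\<^sup>2" using abs_trunc_le(2)[of f N x] by simp
  qed
 qed (auto intro: trunc_tendsto)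
 then show ?thesis unfolding form_def using dom_add[OF assms] dom_diff[OF assms] by (intro tendsto_intros) auto
qed

definition sop :: "(real => real) => ('h \<times> 'h) set" where
 "sop f = {(u, g). u \<in> dom f & (\<forall>v\<in>dom f. inner g v = form f u v)}"

text \<open>The unbounded operator is determined by its bounded pieces: vectors in the range of a
  level projection lie in the domain, and against them the forms of the truncations are eventually
  constant. Conversely the projected right-hand sides converge to \<open>g\<close>.\<close>

theorem sop_iff:
 assumes f: "f \<in> borel_measurable borel"
 shows "(u, g) \<in> sop f \<longleftrightarrow> (\<forall>N. P {x. \<bar>f x\<bar> <= real N} g = T (trunc f N) u)"
proof
 let ?B = "%N. {x. \<bar>f x\<bar> <= real N}"
 note B = level_sets[OF f] and bt = bounded_borel_trunc[OF f]
 assume ug: "(u, g) \<in> sop f"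
 show "\<forall>N. P (?B N) g = T (trunc f N) u" proof (rule allI, rule inner_eq_imp_eq)
  fix N v
  have tr: "P (?B N) (T (trunc f M) w) = T (trunc f N) w" if "M \<ge> N" for M w proof -
   have "P (?B N) (T (trunc f M) w) = T (%x. indicator (?B N) x * trunc f M x) w"
    unfolding T_indicator[OF B, symmetric] by (rule T_mult) (use B bt in auto)
   also have "(%x. indicator (?B N) x * trunc f M x) = trunc f N"
    using that by (auto simp: trunc_def indicator_def fun_eq_iff)
   finally show ?thesis .
  qed
  have "norm (T (trunc f M) (P (?B N) v)) <= real N * norm v" for M proof -
   have "T (trunc f M) (P (?B N) v) = T (%x. trunc f M x * indicator (?B N) x) v"
    unfolding T_indicator[OF B, symmetric] by (rule T_mult) (use B bt in auto)
   also have "norm ... <= real N * norm v" using f B[of N] by (intro norm_T_le) (auto simp: trunc_def indicator_def)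
   finally show ?thesis .
  qed
  then have dv: "P (?B N) v \<in> dom f" using f by (auto simp: dom_iff)
  have lim: "(%M. form (trunc f M) u (P (?B N) v)) ----> form f u (P (?B N) v)"
   using ug dv by (intro form_trunc_tendsto f) (auto simp: sop_def)
  have ev: "\<forall>\<^sub>F M in sequentially. form (trunc f M) u (P (?B N) v) = inner (T (trunc f N) u) v"
   unfolding eventually_sequentially
  proof (intro exI[of _ N] allI impI)
   fix M assume "N <= M"
   have "form (trunc f M) u (P (?B N) v) = inner (P (?B N) (T (trunc f M) u)) v"
    by (simp add: inner_T[OF bt, symmetric] sym[OF B])
   then show "form (trunc f M) u (P (?B N) v) = inner (T (trunc f N) u) v" using tr[OF \<open>N <= M\<close>] by simp
  qed
  have "form f u (P (?B N) v) = inner (T (trunc f N) u) v" by (rule LIMSEQ_unique[OF lim tendsto_eventually[OF ev]])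
  then show "inner (P (?B N) g) v = inner (T (trunc f N) u) v" using ug dv by (simp add: sop_def sym[OF B])
 qed
next
 let ?B = "%N. {x. \<bar>f x\<bar> <= real N}"
 note B = level_sets[OF f] and bt = bounded_borel_trunc[OF f]
 assume *: "\<forall>N. P (?B N) g = T (trunc f N) u"
 have "norm (T (trunc f N) u) <= norm g" for N
  using norm_T_le[of "indicator (?B N)" 1 g] B[of N] * by (simp add: T_indicator)
 then have du: "u \<in> dom f" using f by (auto simp: dom_iff)
 have Pg: "(%N. P (?B N) g) ----> g" proof (rule P_incseq_tendsto[OF B])
  show "incseq ?B" by (auto simp: incseq_def)
  show "(\<Union>n. ?B n) = UNIV" using real_arch_simple by auto
 qed
 have "inner g v = form f u v" if "v \<in> dom f" for v proof (rule LIMSEQ_unique)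
  show "(%N. inner (P (?B N) g) v) ----> inner g v" by (intro tendsto_inner Pg tendsto_const)
  show "(%N. inner (P (?B N) g) v) ----> form f u v"
   using form_trunc_tendsto[OF f du that] * by (simp add: inner_T[OF bt])
 qed
 with du show "(u, g) \<in> sop f" by (simp add: sop_def)
qed

lemma T_in_sop:
 assumes f: "f \<in> borel_measurable borel" and h: "bounded_borel h" and fh: "bounded_borel (%x. f x * h x)"
 shows "(T h u, T (%x. f x * h x) u) \<in> sop f" unfolding sop_iff[OF f]
proof
 fix N
 note B = level_sets[OF f, of N]
 have "P {x. \<bar>f x\<bar> <= real N} (T (%x. f x * h x) u)
   = T (%x. indicator {x. \<bar>f x\<bar> <= real N} x * (f x * h x)) u"
  unfolding T_indicator[OF B, symmetric] by (rule T_mult) (use B fh in auto)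
 also have "(%x. indicator {x. \<bar>f x\<bar> <= real N} x * (f x * h x)) = (%x. trunc f N x * h x)"
  by (auto simp: trunc_def indicator_def)
 also have "T ... u = T (trunc f N) (T h u)" using f h by (simp add: T_mult bounded_borel_trunc)
 finally show "P {x. \<bar>f x\<bar> <= real N} (T (%x. f x * h x) u) = T (trunc f N) (T h u)" .
qed

text \<open>Positivity, tested on the spectral subspace of [-n, 0), gives a nonnegative integral of
  s over a set where s is negative; so that set is null for \<open>mu u\<close>.\<close>

lemma P_negative_zero:
 assumes pos: "!!u g. (u, g) \<in> sop (%s. s) ==> 0 <= inner g u"
 shows "P {..<0} u = 0"
proof -
 have "emeasure (mu u) {- real n..<0} = 0" for n proof -
  let ?B = "{- real n..<0}"
  have bi: "bounded_borel (indicator ?B)" by auto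
  have bs: "bounded_borel (%s. s * indicator ?B s)" by (rule bounded_borelI[of _ "real n"]) (auto simp: indicator_def)
  have "0 <= inner (T (%s. s * indicator ?B s) u) (T (indicator ?B) u)" by (intro pos T_in_sop bi bs) auto
  also have "... = inner (T (%s. indicator ?B s * (s * indicator ?B s)) u) u"
   by (simp only: T_sym[OF bi, symmetric] T_mult[OF bi bs])
  also have "... = (\<integral>s. s * indicator ?B s \<partial>mu u)" unfolding inner_T_self[OF bounded_borel_mult[OF bi bs]]
   by (rule Bochner_Integration.integral_cong) (auto simp: indicator_def)
  finally have "(\<integral>s. - (s * indicator ?B s) \<partial>mu u) <= 0" by simp
  moreover have "0 <= (\<integral>s. - (s * indicator ?B s) \<partial>mu u)" by (rule integral_nonneg_AE) (auto simp: indicator_def)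
  ultimately have "(\<integral>s. - (s * indicator ?B s) \<partial>mu u) = 0" by linarith
  then have "AE s in mu u. - (s * indicator ?B s) = 0" using integrable_mu[OF bs]
   by (subst (asm) integral_nonneg_eq_0_iff_AE) (auto simp: indicator_def)
  then have "AE s in mu u. s \<notin> ?B" by eventually_elim (auto simp: indicator_def split: if_splits)
  then show ?thesis using AE_iff_measurable[of ?B "mu u" "%s. s \<notin> ?B"] by (simp del: atLeastLessThan_iff)
 qed
 then have "emeasure (mu u) (\<Union>n. {- real n..<0}) = 0" by (intro emeasure_UN_eq_0) auto
 moreover have "(\<Union>n. {- real n..<0}) = {..<0}" proof (intro equalityI subsetI)
  fix x :: real assume "x \<in> {..<0}"
  moreover obtain n where "- x <= real n" using real_arch_simple by blast
  ultimately show "x \<in> (\<Union>n. {- real n..<0})" by (auto intro!: exI[of _ n])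
 qed auto
 ultimately show ?thesis by (simp add: emeasure_mu)
qed

text \<open>The indicator of the closed half-line acts as the identity once the negative spectral
  projection vanishes, so both functions may be multiplied by it. Values at negative arguments can
  thus be chosen freely.\<close>

lemma T_cong_nonneg:
 assumes neg: "!!u. P {..<0} u = 0" and f: "bounded_borel f" and g: "bounded_borel g" and eq: "!!s. 0 <= s ==> f s = g s"
 shows "T f u = T g u"
proof -
 have "T (%s. indicator {0..} s + indicator {..<0} s) u = P {0..} u + P {..<0} u"
  by (subst T_add) (auto simp: T_indicator)
 moreover have "(%s::real. indicator {0..} s + indicator {..<0} s) = (%_. 1 :: real)"
  by (auto simp: indicator_def fun_eq_iff)
 ultimately have u: "P {0..} u = u" using neg by simp
 have "T f (P {0..} u) = T (%s. f s * indicator {0..} s) u"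
  unfolding T_indicator[of "{0..}", symmetric, simplified] by (rule T_mult) (use f in auto)
 also have "(%s. f s * indicator {0..} s) = (%s. g s * indicator {0..} s)" using eq by (auto simp: indicator_def)
 also have "T ... u = T g (P {0..} u)" unfolding T_indicator[of "{0..}", symmetric, simplified]
  by (rule T_mult[symmetric]) (use g in auto)
 finally show ?thesis by (simp add: u)
qed

end

subsection \<open>Spectral resolutions on the line\<close>

lemma L2_add_cmult: "f \<in> L2 ==> g \<in> L2 ==> (%x. f x + c * g x) \<in> L2" by (intro L2_add L2_cmult)

definition lift_family :: "(real set => (real => complex) => (real => complex)) => real set => l2 => l2" where
 "lift_family E B u = toL (E B (fn u))"

locale l2_pvm =
 fixes E :: "real set => (real => complex) => (real => complex)"
 assumes pvm: "pvm E"
begin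

abbreviation "P \<equiv> lift_family E"

lemma E_L2: "B \<in> sets borel ==> phi \<in> L2 ==> E B phi \<in> L2" using pvm by (simp add: pvm_def)

lemma E_sym: "B \<in> sets borel ==> phi \<in> L2 ==> psi \<in> L2 ==> l2_inner (E B phi) psi = l2_inner phi (E B psi)"
 using pvm by (simp add: pvm_def)

lemma cip_toL_E:
 "B \<in> sets borel ==> phi \<in> L2 ==> cip (toL (E B phi)) v = cip (toL phi) (P B v)"
 using cip_toL[OF E_L2, of B phi "fn v"] cip_toL[OF _ E_L2, of phi B "fn v"] E_sym[of B phi "fn v"]
 by (simp add: lift_family_def)

text \<open>\<open>E B\<close> acts on functions and could depend on the representative; moving it
  to the other side of the inner product shows that the class of its value does not.\<close>

lemma toL_E:
 assumes B: "B \<in> sets borel" and phi: "phi \<in> L2"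
 shows "toL (E B phi) = P B (toL phi)"
proof (rule inner_eq_imp_eq)
 fix v
 show "inner (toL (E B phi)) v = inner (P B (toL phi)) v" using cip_toL_E[OF B phi, of v] cip_toL_E[OF B, of "fn (toL phi)" v]
  by (simp add: inner_l2_def lift_family_def)
qed

lemma cip_P: "B \<in> sets borel ==> cip (P B u) v = cip u (P B v)"
 using cip_toL_E[of B "fn u" v] by (simp add: lift_family_def)

sublocale spectral_family P
proof
 fix B C :: "real set" and u v :: l2
 assume B: "B \<in> sets borel"
 show "inner (P B u) v = inner u (P B v)" using cip_P[OF B] by (simp add: inner_l2_def)
 assume C: "C \<in> sets borel"
 have "ae_eq (E (B \<inter> C) (fn u)) (E B (E C (fn u)))" using pvm B C by (simp add: pvm_def)
 then have "toL (E (B \<inter> C) (fn u)) = toL (E B (E C (fn u)))" using B C by (simp add: toL_eq_iff E_L2)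
 then show "P (B \<inter> C) u = P B (P C u)" using B C by (simp add: toL_E E_L2)
next
 fix u
 have "ae_eq (E {} (fn u)) (%x. 0)" "ae_eq (E UNIV (fn u)) (fn u)" using pvm by (simp_all add: pvm_def)
 then have "toL (E {} (fn u)) = toL (%x. 0)" "toL (E UNIV (fn u)) = toL (fn u)"
  by (simp_all add: toL_eq_iff E_L2 del: toL_fn)
 then show "P {} u = 0" "P UNIV u = u" by (simp_all add: lift_family_def zero_l2_def)
next
 fix B :: "nat => real set" and u
 assume B: "range B \<subseteq> sets borel" "disjoint_family B"
 have lim: "(%n. l2_norm (%x. E (\<Union>i. B i) (fn u) x - (\<Sum>i<n. E (B i) (fn u) x))) ----> 0" using pvm B by (simp add: pvm_def)
 have sum: "(%x. \<Sum>i<n. E (B i) (fn u) x) \<in> L2 &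
   toL (%x. \<Sum>i<n. E (B i) (fn u) x) = (\<Sum>i<n. P (B i) u)" for n
 proof (induction n)
  case 0
  then show ?case by (simp add: zero_l2_def)
 next
  case (Suc n)
  have "E (B n) (fn u) \<in> L2" using B by (intro E_L2) auto
  then show ?case using Suc by (simp add: L2_add toL_add lift_family_def)
 qed
 have "E (\<Union>i. B i) (fn u) \<in> L2" using B by (intro E_L2) auto
 then have "l2_norm (%x. E (\<Union>i. B i) (fn u) x - (\<Sum>i<n. E (B i) (fn u) x))
   = norm (P (\<Union>i. B i) u - (\<Sum>i<n. P (B i) u))" for n
  using sum[of n] by (subst norm_toL[symmetric]) (simp_all add: L2_diff toL_diff lift_family_def)
 then have "(%n. norm ((\<Sum>i<n. P (B i) u) - P (\<Union>i. B i) u)) ----> 0" using lim by (simp add: norm_minus_commute)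
 then show "(%n. \<Sum>i<n. P (B i) u) ----> P (\<Union>i. B i) u" by (simp add: tendsto_norm_zero_iff LIM_zero_iff)
qed

lemma spectral_measure_eq:
 assumes phi: "phi \<in> L2" shows "spectral_measure E phi = mu (toL phi)" unfolding spectral_measure_def mu_def
proof (rule measure_of_eq)
 fix B :: "real set" assume "B \<in> sigma_sets UNIV (sets borel)"
 then have B: "B \<in> sets borel" using sets.sigma_sets_eq[of "borel :: real measure"] by simp
 show "ennreal ((l2_norm (E B phi))\<^sup>2) = ennreal ((norm (P B (toL phi)))\<^sup>2)"
  using norm_toL[OF E_L2[OF B phi]] by (simp add: toL_E[OF B phi])
qed auto

lemma P_cs:
 assumes B: "B \<in> sets borel" shows "P B (cs c u) = cs c (P B u)"
proof (rule inner_eq_imp_eq)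
 fix v
 show "inner (P B (cs c u)) v = inner (cs c (P B u)) v" by (simp add: inner_l2_def cip_P[OF B] cip_cs_left)
qed

lemma mu_cs: "cmod c = 1 ==> mu (cs c u) = mu u" by (rule measure_eqI) (simp_all add: emeasure_mu P_cs norm_cs)

lemma dom_cs: "cmod c = 1 ==> cs c u \<in> dom f \<longleftrightarrow> u \<in> dom f" by (simp add: dom_def mu_cs)

lemma spectral_domain_iff: "phi \<in> spectral_domain E f \<longleftrightarrow> phi \<in> L2 & toL phi \<in> dom f"
 by (auto simp: spectral_domain_def dom_def spectral_measure_eq)

text \<open>In the polarization sum the terms with 1 and -1 give the real part, and those with i and
  -i give the same real form against \<open>cs \<i>\<close> of the second argument.\<close>

lemma spectral_form_eq:
 assumes phi: "phi \<in> L2" and psi: "psi \<in> L2"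
 shows "spectral_form E f phi psi = Complex (form f (toL phi) (toL psi)) (form f (toL phi) (cs \<i> (toL psi)))"
proof -
 have m: "spectral_measure E (%x. phi x + c * psi x) = mu (toL phi + cs c (toL psi))" for c
  using assms by (simp add: spectral_measure_eq L2_add_cmult toL_add L2_cmult toL_cmult)
 have neg: "cs (- c) v = - cs c v" for c v using cs_cs[of "-1" c v] scaleR_eq_cs[of "-1" "cs c v"] by simp
 show ?thesis using m[of 1] m[of \<i>] m[of "-1"] m[of "-\<i>"]
  by (simp add: spectral_form_def eval_nat_numeral form_def complex_eq_iff neg)
qed

text \<open>The complex identity in \<open>spectral_op\<close> and the real one in
  \<open>sop\<close> agree because the domain is stable under multiplication by i. This moves
  statements about graphs of representatives into the Hilbert space type.\<close>

theorem spectral_op_iff: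
 "(phi, g) \<in> spectral_op E f \<longleftrightarrow> phi \<in> L2 & g \<in> L2 & (toL phi, toL g) \<in> sop f"
proof -
 have "(\<forall>psi\<in>spectral_domain E f. l2_inner g psi = spectral_form E f phi psi)
   \<longleftrightarrow> (\<forall>v\<in>dom f. inner (toL g) v = form f (toL phi) v)" (is "?L \<longleftrightarrow> ?R")
  if phi: "phi \<in> L2" and g: "g \<in> L2"
 proof
  assume L: ?L
  show ?R proof
   fix v assume "v \<in> dom f"
   then have "l2_inner g (fn v) = spectral_form E f phi (fn v)" using L by (simp add: spectral_domain_iff)
   then show "inner (toL g) v = form f (toL phi) v"
    using inner_toL[OF g, of "fn v"] spectral_form_eq[OF phi, of "fn v" f] by simp
  qed
 next
  assume R: ?R
  show ?L proof
   fix psi assume "psi \<in> spectral_domain E f"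
   then have psi: "psi \<in> L2" "toL psi \<in> dom f" by (simp_all add: spectral_domain_iff)
   then have "cs \<i> (toL psi) \<in> dom f" by (simp add: dom_cs)
   then show "l2_inner g psi = spectral_form E f phi psi"
    using R psi cip_toL[OF g psi(1)] by (simp add: spectral_form_eq[OF phi psi(1)] cip_eq_inner)
  qed
 qed
 then show ?thesis by (auto simp: spectral_op_def spectral_domain_iff sop_def)
qed

end

section \<open>Absolutely continuous functions and weak derivatives\<close>

lemma integrable_indicator_Icc: "integrable lborel (indicator {a..b} :: real => real)"
 by (simp add: integrable_indicator_iff emeasure_lborel_Icc_eq)

text \<open>Local absolute continuity with density \<open>g\<close>, encoded through the fundamental
  theorem of calculus on compact subintervals of \<open>S\<close>. The density may blow up at the
  boundary of \<open>S\<close>, as those involving 1 / c may do at 0 when \<open>S\<close> is the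
  open half-line.\<close>

definition ac_on :: "real set => (real => complex) => (real => complex) => bool" where
 "ac_on S u g \<longleftrightarrow> (\<forall>a b. a <= b --> {a..b} \<subseteq> S -->
   set_integrable lborel {a..b} g & u b - u a = (LINT x:{a..b}|lborel. g x))"

lemma ac_onD:
 assumes "ac_on S u g" "a <= b" "{a..b} \<subseteq> S"
 shows "set_integrable lborel {a..b} g" "u b - u a = (LINT x:{a..b}|lborel. g x)" using assms by (auto simp: ac_on_def)

lemma lborel_pair_integrable_mult:
 fixes g k :: "real => complex"
 assumes g: "integrable lborel g" and k: "integrable lborel k"
 shows "integrable (lborel \<Otimes>\<^sub>M lborel) (%(s, r). g s * k r)"
proof (rule lborel_pair.Fubini_integrable)
 note [measurable] = borel_measurable_integrable[OF g] borel_measurable_integrable[OF k]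
 show "(%(s, r). g s * k r) \<in> borel_measurable (lborel \<Otimes>\<^sub>M lborel)" by measurable
 show "integrable lborel (%s. LINT r|lborel. norm (case (s, r) of (s, r) => g s * k r))"
  using g by (simp add: norm_mult)
 show "AE s in lborel. integrable lborel (%r. case (s, r) of (s, r) => g s * k r)" using k by simp
qed

lemma set_integral_split:
 fixes g :: "real => complex"
 assumes g: "set_integrable lborel {a..c} g" and "a <= b" "b <= c"
 shows "(LINT t:{a..c}|lborel. g t) = (LINT t:{a..b}|lborel. g t) + (LINT t:{b..c}|lborel. g t)"
proof -
 have 1: "set_integrable lborel {a..b} g" "set_integrable lborel {b..c} g"
  using assms by (auto intro: set_integrable_subset[OF g])
 have "(LINT t:{a..c}|lborel. g t) = (LINT t:{a..b} \<union> {b..c}|lborel. g t)"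
  using assms by (simp add: ivl_disj_un_two_touch(4))
 also have "... = (LINT t:{a..b}|lborel. g t) + (LINT t:{b..c}|lborel. g t)" proof (rule set_integral_Un_AE[OF _ _ _ 1])
  show "AE x in lborel. \<not> (x \<in> {a..b} & x \<in> {b..c})" using AE_lborel_singleton[of b] by eventually_elim auto
 qed auto
 finally show ?thesis .
qed

lemma integral_eq_set_integral:
 fixes f :: "real => 'a::{banach, second_countable_topology}"
 assumes "!!x. x \<notin> A ==> f x = 0"
 shows "(LINT x|lborel. f x) = (LINT x:A|lborel. f x)" unfolding set_lebesgue_integral_def
 by (rule Bochner_Integration.integral_cong) (use assms in \<open>auto simp: indicator_def\<close>)

text \<open>Fubini for g(t) k(r) on the triangle r <= t: integrating in r first gives g (v - v a),
  in t first gives (u b - u) k, and the product rule expresses the equality of the two.\<close>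

lemma integration_by_parts_ac:
 fixes g k u v :: "real => complex"
 assumes ab: "a <= b" and g: "set_integrable lborel {a..b} g" and k: "set_integrable lborel {a..b} k"
  and u: "!!x. a <= x ==> x <= b ==> u x = u a + (LINT t:{a..x}|lborel. g t)"
  and v: "!!x. a <= x ==> x <= b ==> v x = v a + (LINT t:{a..x}|lborel. k t)"
 shows "set_integrable lborel {a..b} (%t. g t * v t + u t * k t)"
  and "(LINT t:{a..b}|lborel. g t * v t + u t * k t) = u b * v b - u a * v a"
proof -
 define g' where "g' t = indicator {a..b} t *\<^sub>R g t" for t
 define k' where "k' t = indicator {a..b} t *\<^sub>R k t" for t
 have gi: "integrable lborel g'" and ki: "integrable lborel k'"
  using g k by (simp_all add: g'_def[abs_def] k'_def[abs_def] set_integrable_def)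
 note [measurable] = borel_measurable_integrable[OF gi] borel_measurable_integrable[OF ki]
 have I: "(LINT t|lborel. g' t) = u b - u a" "(LINT t|lborel. k' t) = v b - v a"
  using u[of b] v[of b] ab by (simp_all add: g'_def[abs_def] k'_def[abs_def] set_lebesgue_integral_def)
 let ?h = "%t r. g' t * k' r * indicator {..t} r"
 have hi: "integrable (lborel \<Otimes>\<^sub>M lborel) (%(t, r). ?h t r)"
  by (rule Bochner_Integration.integrable_bound[OF lborel_pair_integrable_mult[OF gi ki]]) (auto simp: indicator_def)
 have e1: "(LINT r|lborel. ?h t r) = g' t * (v t - v a)" for t proof (cases "t \<in> {a..b}")
  case True
  have "(LINT r|lborel. k' r * indicator {..t} r) = (LINT r:{a..t}|lborel. k r)" unfolding set_lebesgue_integral_def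
   by (rule Bochner_Integration.integral_cong) (use True in \<open>auto simp: k'_def indicator_def\<close>)
  then show ?thesis using v[of t] True by (simp add: mult.assoc)
 qed (simp add: g'_def)
 have e2: "(LINT t|lborel. ?h t r) = (u b - u r) * k' r" for r proof (cases "r \<in> {a..b}")
  case True
  have "(LINT t|lborel. ?h t r) = (LINT t|lborel. (indicator {r..b} t *\<^sub>R g t) * k' r)"
   by (rule Bochner_Integration.integral_cong) (use True in \<open>auto simp: g'_def indicator_def\<close>)
  also have "... = (LINT t:{r..b}|lborel. g t) * k' r"
   unfolding set_lebesgue_integral_def by (rule integral_mult_left_zero)
  finally show ?thesis using set_integral_split[OF g, of r] u[of b] u[of r] True ab by simp
 qed (simp add: k'_def)
 have iK: "integrable lborel (%t. g' t * (v t - v a))" using lborel_pair.integrable_fst'[OF hi] by (simp add: e1)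
 have iG: "integrable lborel (%r. (u b - u r) * k' r)" using lborel_pair.integrable_snd[OF hi] by (simp add: e2)
 have F: "(LINT r|lborel. (u b - u r) * k' r) = (LINT t|lborel. g' t * (v t - v a))"
  using lborel_pair.Fubini_integral[OF hi] by (simp add: e1 e2)
 have eq: "indicator {a..b} t *\<^sub>R (g t * v t + u t * k t)
   = g' t * (v t - v a) + v a * g' t + (u b * k' t - (u b - u t) * k' t)" for t
  by (simp add: g'_def k'_def indicator_def algebra_simps)
 show "set_integrable lborel {a..b} (%t. g t * v t + u t * k t)"
  unfolding set_integrable_def eq using gi ki iK iG by auto
 have "(LINT t|lborel. g' t * (v t - v a) + v a * g' t + (u b * k' t - (u b - u t) * k' t))
   = v a * (u b - u a) + u b * (v b - v a)" using gi ki iK iG by (simp add: I F)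
 then show "(LINT t:{a..b}|lborel. g t * v t + u t * k t) = u b * v b - u a * v a"
  unfolding set_lebesgue_integral_def eq by (simp add: algebra_simps)
qed

lemma ac_on_mult:
 assumes u: "ac_on S u g" and v: "ac_on S v k"
 shows "ac_on S (%t. u t * v t) (%t. g t * v t + u t * k t)" unfolding ac_on_def
proof (intro allI impI)
 fix a b :: real assume ab: "a <= b" "{a..b} \<subseteq> S"
 have sub: "{a..x} \<subseteq> S" if "x <= b" for x using ab(2) that by auto
 have "u x = u a + (LINT t:{a..x}|lborel. g t)" "v x = v a + (LINT t:{a..x}|lborel. k t)"
  if "a <= x" "x <= b" for x using ac_onD(2)[OF u that(1) sub[OF that(2)]] ac_onD(2)[OF v that(1) sub[OF that(2)]]
  by (simp_all add: algebra_simps)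
 from integration_by_parts_ac[OF ab(1) ac_onD(1)[OF u ab] ac_onD(1)[OF v ab], of u v, OF this]
 show "set_integrable lborel {a..b} (%t. g t * v t + u t * k t) &
   u b * v b - u a * v a = (LINT x:{a..b}|lborel. g x * v x + u x * k x)" by simp
qed

lemma ac_on_of_deriv:
 fixes v :: "real => complex"
 assumes cont: "continuous_on UNIV v" and fin: "finite X" and der: "!!x. x \<notin> X ==> (v has_vector_derivative k x) (at x)"
  and [measurable]: "k \<in> borel_measurable borel" and bd: "!!a b. \<exists>C. \<forall>x\<in>{a..b}. cmod (k x) <= C"
 shows "ac_on UNIV v k" unfolding ac_on_def
proof (intro allI impI conjI)
 fix a b :: real assume ab: "a <= b"
 obtain C where C: "!!x. x \<in> {a..b} ==> cmod (k x) <= C" using bd by blast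
 show si: "set_integrable lborel {a..b} k" unfolding set_integrable_def
 proof (rule Bochner_Integration.integrable_bound)
  show "integrable lborel (%x. C * indicator {a..b} x :: real)" using integrable_indicator_Icc by simp
  show "AE x in lborel. norm (indicator {a..b} x *\<^sub>R k x) <= norm (C * indicator {a..b} x)"
   using C by (auto simp: indicator_def intro: order_trans[OF _ abs_ge_self])
 qed measurable
 have "(k has_integral v b - v a) {a..b}" by (rule fundamental_theorem_of_calculus_interior_strong[OF fin ab])
   (auto intro: der continuous_on_subset[OF cont])
 then show "v b - v a = (LINT x:{a..b}|lborel. k x)"
  using set_borel_integral_eq_integral(2)[OF si] by (simp add: integral_unique)
qed

lemma ac_on_continuous:
 assumes ac: "ac_on S u g" and S: "open S"
 shows "continuous_on S u"
proof (rule continuous_at_imp_continuous_on, rule ballI)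
 fix x assume "x \<in> S"
 then obtain e where e: "e > 0" "cball x e \<subseteq> S" using S open_contains_cball by blast
 define a where "a = x - e"
 define b where "b = x + e"
 have ab: "a <= b" "{a..b} \<subseteq> S" "a < x" "x < b" using e by (auto simp: a_def b_def cball_eq_atLeastAtMost)
 note gi = ac_onD(1)[OF ac ab(1,2)]
 have eq: "u y = u a + integral {a..y} g" if "y \<in> {a..b}" for y proof -
  have sub: "{a..y} \<subseteq> S" using that ab by auto
  have "set_integrable lborel {a..y} g" using ac_onD(1)[OF ac _ sub] that by simp
  then show ?thesis using ac_onD(2)[OF ac _ sub] that set_borel_integral_eq_integral(2)[of "{a..y}" g]
   by (simp add: algebra_simps)
 qed
 have "continuous_on {a..b} (%y. u a + integral {a..y} g)"
  by (intro continuous_intros indefinite_integral_continuous_1 set_borel_integral_eq_integral(1)[OF gi])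
 then have "continuous_on {a..b} u" by (rule continuous_on_eq) (simp add: eq[symmetric])
 then have "continuous_on {a<..<b} u" by (rule continuous_on_subset) auto
 then show "isCont u x" using ab by (simp add: continuous_on_eq_continuous_at)
qed

lemma L2_set_integrable:
 assumes f: "f \<in> L2"
 shows "set_integrable lborel {a..b} f"
proof -
 have "(indicator {a..b} :: real => complex) \<in> L2" proof (rule L2I)
  have "(cmod (indicator {a..b} x))\<^sup>2 = indicat_real {a..b} x" for x by (auto simp: indicator_def)
  then show "integrable lborel (%x. (cmod (indicator {a..b} x))\<^sup>2)" using integrable_indicator_Icc by simp
 qed measurable
 from L2_mult_integrable[OF this f] show ?thesis
  by (simp add: set_integrable_def scaleR_conv_of_real of_real_indicator)
qed

subsection \<open>Smooth functions with compact support\<close>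

text \<open>The functions p(1/x) exp(-1/x), extended by 0, form a class closed under differentiation
  when \<open>p\<close> ranges over polynomials; \<open>flat 1\<close> is the standard smooth
  function that is flat at 0.\<close>

definition flat :: "real poly => real => real" where
 "flat p x = (if x <= 0 then 0 else poly p (1 / x) * exp (- (1 / x)))"

lemma poly_exp_tendsto_0: "((%y::real. poly p y * exp (- y)) \<longlongrightarrow> 0) at_top" proof -
 have "((%y::real. \<Sum>i\<le>degree p. coeff p i * (y ^ i / exp y)) \<longlongrightarrow> (\<Sum>i\<le>degree p. coeff p i * 0)) at_top"
  by (intro tendsto_intros tendsto_power_div_exp_0)
 then show ?thesis by (simp add: poly_altdef sum_divide_distrib exp_minus field_simps)
qed

lemma flat_deriv_0: "(flat p has_real_derivative 0) (at 0)" proof -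
 have "((%x. flat p x / x) \<longlongrightarrow> 0) (at_right 0)" proof -
  have "((%x. poly (pCons 0 p) (inverse x) * exp (- inverse x)) \<longlongrightarrow> 0) (at_right (0::real))"
   by (rule filterlim_compose[OF poly_exp_tendsto_0 filterlim_inverse_at_top_right])
  then show ?thesis by (rule Lim_transform_eventually)
    (auto simp: eventually_at_filter flat_def divide_inverse mult_ac)
 qed
 moreover have "((%x. flat p x / x) \<longlongrightarrow> 0) (at_left 0)" by (rule Lim_transform_eventually[OF tendsto_const])
   (auto simp: eventually_at_filter flat_def)
 ultimately have "((%x. flat p x / x) \<longlongrightarrow> 0) (at 0)" by (rule filterlim_split_at_real[rotated])
 then show ?thesis by (simp add: has_field_derivative_iff flat_def)
qed

text \<open>With y = 1/x one has dy/dx = -y^2, so p(y) exp(-y) has derivative y^2 (p(y) - p'(y))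
  exp(-y), which explains the new polynomial.\<close>

lemma flat_deriv:
 "(flat p has_real_derivative flat (monom 1 2 * (p - pderiv p)) x) (at x)"
proof -
 consider "x < 0" | "x = 0" | "x > 0" by linarith
 then show ?thesis proof cases
  case 1
  have "((%_. 0) has_real_derivative 0) (at x)" by simp
  then have "(flat p has_real_derivative 0) (at x)"
   by (rule has_field_derivative_transform_within_open[of _ _ _ "{..<0}"]) (use 1 in \<open>auto simp: flat_def\<close>)
  with 1 show ?thesis by (simp add: flat_def)
 next
  case 2
  then show ?thesis using flat_deriv_0[of p] by (simp add: flat_def)
 next
  case 3
  have "((%x. poly p (1 / x) * exp (- (1 / x))) has_real_derivative
    poly (monom 1 2 * (p - pderiv p)) (1 / x) * exp (- (1 / x))) (at x)"
   using 3 by (auto intro!: derivative_eq_intros DERIV_chain'[OF _ poly_DERIV]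
     simp: poly_monom field_simps power2_eq_square)
  then have "(flat p has_real_derivative
    poly (monom 1 2 * (p - pderiv p)) (1 / x) * exp (- (1 / x))) (at x)"
   by (rule has_field_derivative_transform_within_open[of _ _ _ "{0<..}"]) (use 3 in \<open>auto simp: flat_def\<close>)
  with 3 show ?thesis by (simp add: flat_def)
 qed
qed

text \<open>A class of functions that is closed under differentiation, hence consists of smooth functions.\<close>

inductive smooth_fn :: "(real => real) => bool" where
 flat: "smooth_fn (%x. flat p (c * x + d))"
| add: "smooth_fn f ==> smooth_fn g ==> smooth_fn (%x. f x + g x)"
| mult: "smooth_fn f ==> smooth_fn g ==> smooth_fn (%x. f x * g x)"
| cmult: "smooth_fn f ==> smooth_fn (%x. c * f x)"
| antideriv: "smooth_fn f ==> (!!x. (F has_real_derivative f x) (at x)) ==> smooth_fn F"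

lemma smooth_fn_deriv:
 "smooth_fn f ==> \<exists>f'. smooth_fn f' & (\<forall>x. (f has_real_derivative f' x) (at x))"
proof (induction rule: smooth_fn.induct)
 case (flat p c d)
 have "((%x. flat p (c * x + d)) has_real_derivative
   c * flat (monom 1 2 * (p - pderiv p)) (c * x + d)) (at x)" for x
 proof -
  have "((%x. c * x + d) has_real_derivative c) (at x)" by (auto intro!: derivative_eq_intros)
  from DERIV_chain2[OF flat_deriv this] show ?thesis by (simp add: mult.commute)
 qed
 then show ?case using smooth_fn.cmult[OF smooth_fn.flat] by blast
next
 case (add f g)
 then obtain f' g' where *: "smooth_fn f'" "smooth_fn g'"
  "!!x. (f has_real_derivative f' x) (at x)" "!!x. (g has_real_derivative g' x) (at x)" by blast
 then show ?case by (intro exI[of _ "%x. f' x + g' x"]) (auto intro: smooth_fn.add DERIV_add)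
next
 case (mult f g)
 then obtain f' g' where *: "smooth_fn f'" "smooth_fn g'"
  "!!x. (f has_real_derivative f' x) (at x)" "!!x. (g has_real_derivative g' x) (at x)" by blast
 have "((%x. f x * g x) has_real_derivative f' x * g x + f x * g' x) (at x)" for x
  using DERIV_mult'[OF *(3)[of x] *(4)[of x]] by (simp add: add.commute)
 moreover have "smooth_fn (%x. f' x * g x + f x * g' x)" using * mult by (intro smooth_fn.add smooth_fn.mult)
 ultimately show ?case by blast
next
 case (cmult f c)
 then obtain f' where *: "smooth_fn f'" "!!x. (f has_real_derivative f' x) (at x)" by blast
 then show ?case by (intro exI[of _ "%x. c * f' x"]) (auto intro: smooth_fn.cmult DERIV_cmult)
next
 case (antideriv f F)
 then show ?case by blast
qed

lemma smooth_fn_iterated_deriv: "smooth_fn f ==> smooth_fn ((deriv ^^ n) f)" proof (induction n)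
 case (Suc n)
 then obtain f' where f': "smooth_fn f'" "!!x. ((deriv ^^ n) f has_real_derivative f' x) (at x)"
  using smooth_fn_deriv by blast
 then have "deriv ((deriv ^^ n) f) = f'" by (intro ext DERIV_imp_deriv)
 with f' show ?case by simp
qed simp

lemma smooth_fn_continuous: "smooth_fn f ==> continuous_on S f"
 using smooth_fn_deriv[of f] DERIV_isCont continuous_at_imp_continuous_on by blast

lemma test_functionI:
 assumes f: "smooth_fn f" and supp: "!!x. x \<notin> {L..R} ==> f x = 0"
 shows "test_function f" unfolding test_function_def
proof (intro conjI allI)
 fix n x
 show "(deriv ^^ n) f differentiable (at x)" using smooth_fn_deriv[OF smooth_fn_iterated_deriv[OF f, of n]]
  by (auto simp: real_differentiable_def)
 have "closure {x. f x \<noteq> 0} \<subseteq> {L..R}" by (rule closure_minimal) (use supp in blast, simp)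
 then show "compact (closure {x. f x \<noteq> 0})"
  by (meson bounded_subset bounded_closed_interval closed_closure compact_eq_bounded_closed)
qed

text \<open>Mean zero makes the primitive vanish to the right of the support as well. This is how
  functions of mean zero become derivatives of test functions in the du Bois-Reymond
  argument.\<close>

lemma test_function_antiderivative:
 assumes theta: "smooth_fn theta" and supp: "!!x. x \<notin> {L..R} ==> theta x = 0" and int: "integral {L..R} theta = 0" and LR: "L <= R"
 shows "\<exists>eta. test_function eta & (\<forall>x. (eta has_real_derivative theta x) (at x)) & (\<forall>x. x \<notin> {L..R} --> eta x = 0)"
proof -
 note cont = smooth_fn_continuous[OF theta]
 \<comment> \<open>The support assumption says nothing about the endpoint \<open>L\<close> itself;
   continuity settles it.\<close>
 have thetaL: "theta x = 0" if "x <= L" for x proof (cases "x = L")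
  case True
  have "(theta \<longlongrightarrow> theta L) (at_left L)"
   using cont[of UNIV] by (simp add: continuous_on_eq_continuous_at continuous_at_imp_continuous_at_within
     flip: continuous_within)
  moreover have "(theta \<longlongrightarrow> 0) (at_left L)"
   by (rule Lim_transform_eventually[OF tendsto_const]) (use supp in \<open>auto simp: eventually_at_filter\<close>)
  ultimately show ?thesis using True tendsto_unique trivial_limit_at_left_real by blast
 qed (use that supp in auto)
 define eta where "eta x = integral {L - 1..x} theta" for x
 have i: "theta integrable_on {a..b}" for a b by (rule integrable_continuous_real[OF cont])
 have eta0: "eta x = 0" if "x <= L" for x unfolding eta_def using that thetaL by (intro integral_unique has_integral_is_0) auto
 have etaR: "eta x = 0" if "R <= x" for x proof -
  have "eta x = integral {L - 1..L} theta + (integral {L..R} theta + integral {R..x} theta)" unfolding eta_def using that LR i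
   by (simp add: Henstock_Kurzweil_Integration.integral_combine)
  moreover have "integral {L - 1..L} theta = 0" using eta0[of L] by (simp add: eta_def)
  moreover have "integral {R..x} theta = 0"
  proof (rule integral_unique, rule has_integral_spike_finite[where S = "{R}" and f = "%_. 0"])
   show "theta y = 0" if "y \<in> {R..x} - {R}" for y using supp that by auto
  qed auto
  ultimately show ?thesis using int by simp
 qed
 have der: "(eta has_real_derivative theta x) (at x)" for x proof (cases "x < L")
  case True
  have "((%_. 0) has_real_derivative 0) (at x)" by simp
  then have "(eta has_real_derivative 0) (at x)" by (rule has_field_derivative_transform_within_open[of _ _ _ "{..<L}"])
    (use True eta0 in auto)
  with True thetaL show ?thesis by simp
 next
  case False
  have "(eta has_real_derivative theta x) (at x within {L - 1..x + 1})" unfolding eta_def[abs_def]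
   using integral_has_real_derivative[of "L - 1" "x + 1" theta x] cont False by auto
  moreover have "at x within {L - 1..x + 1} = at x"
   using False by (intro at_within_interior) (auto simp: interior_atLeastAtMost_real)
  ultimately show ?thesis by simp
 qed
 have sm: "smooth_fn eta" using theta der by (rule smooth_fn.antideriv)
 have "eta x = 0" if "x \<notin> {L..R}" for x using eta0 etaR that by force
 then show ?thesis using test_functionI[OF sm] der by blast
qed

text \<open>A smooth approximation of the indicator of (a, b) from inside: \<open>flat 1\<close> of
  n times the distance d to an endpoint is exp(-1/(n d)), which tends to 1.\<close>

definition bump :: "real => real => nat => real => real" where
 "bump a b n x = flat 1 (real n * x + - (real n * a)) * flat 1 (- real n * x + real n * b)"

lemma smooth_bump: "smooth_fn (bump a b n)" unfolding bump_def[abs_def] by (intro smooth_fn.mult smooth_fn.flat)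

lemma flat_1_bounds: "0 <= flat 1 x" "flat 1 x <= 1" by (auto simp: flat_def)

lemma bump_bounds: "0 <= bump a b n x" "bump a b n x <= 1"
 unfolding bump_def using flat_1_bounds by (simp_all add: mult_le_one)

lemma bump_measurable [measurable]: "bump a b n \<in> borel_measurable borel"
 by (intro borel_measurable_continuous_onI smooth_fn_continuous smooth_bump)

lemma bump_outside: "x \<notin> {a<..<b} ==> bump a b n x = 0" proof -
 assume "x \<notin> {a<..<b}"
 then have "real n * (x - a) <= 0 \<or> real n * (b - x) <= 0" by (auto simp: mult_nonneg_nonpos)
 then show ?thesis by (auto simp: bump_def flat_def algebra_simps)
qed

lemma bump_tendsto: "(%n. bump a b n x) ----> indicator {a<..<b} x" proof (cases "x \<in> {a<..<b}")
 case True
 have *: "(%n. flat 1 (real n * d)) ----> 1" if "d > 0" for d proof -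
  have "(%n. exp (- ((1 / d) * (1 / real n)))) ----> exp (- ((1 / d) * 0))" by (intro tendsto_intros lim_1_over_n)
  then have "(%n. exp (- ((1 / d) * (1 / real n)))) ----> 1" by simp
  then show ?thesis by (rule Lim_transform_eventually)
    (use that in \<open>auto simp: flat_def eventually_sequentially field_simps mult_le_0_iff intro!: exI[of _ 1]\<close>)
 qed
 have "(%n. flat 1 (real n * (x - a)) * flat 1 (real n * (b - x))) ----> 1 * 1" using True by (intro tendsto_mult *) auto
 then show ?thesis using True by (simp add: bump_def algebra_simps)
qed (simp add: bump_outside)

subsection \<open>Weak derivatives\<close>

lemma test_function_properties:
 assumes "test_function eta"
 obtains R where "R > 0" "!!x. \<bar>x\<bar> \<ge> R ==> eta x = 0" "!!x. \<bar>x\<bar> \<ge> R ==> deriv eta x = 0"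
  "!!x. (eta has_real_derivative deriv eta x) (at x)" "continuous_on UNIV (deriv eta)"
proof -
 have d0: "(deriv ^^ n) eta differentiable (at x)" for n x using assms by (simp add: test_function_def)
 have der: "(eta has_real_derivative deriv eta x) (at x)" for x
  using d0[of 0 x] DERIV_deriv_iff_real_differentiable by simp
 have cont: "continuous_on UNIV (deriv eta)"
  by (intro continuous_at_imp_continuous_on ballI differentiable_imp_continuous_within) (use d0[of 1] in simp)
 have "bounded {x. eta x \<noteq> 0}"
  using assms bounded_subset[OF compact_imp_bounded closure_subset] by (auto simp: test_function_def)
 then obtain B where B: "!!x. eta x \<noteq> 0 ==> \<bar>x\<bar> <= B" unfolding bounded_iff by auto
 have z: "eta x = 0" if "\<bar>x\<bar> \<ge> \<bar>B\<bar> + 1" for x using B[of x] that by force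
 have "deriv eta x = 0" if "\<bar>x\<bar> \<ge> \<bar>B\<bar> + 1" for x proof (rule DERIV_imp_deriv)
  have "((%_. 0) has_real_derivative 0) (at x)" by simp
  then show "(eta has_real_derivative 0) (at x)"
   by (rule has_field_derivative_transform_within_open[of _ _ _ "{x. \<bar>B\<bar> < \<bar>x\<bar>}"])
    (use that B in \<open>force intro!: open_Collect_less continuous_intros\<close>)+
 qed
 with z der cont show thesis by (intro that[of "\<bar>B\<bar> + 1"]) auto
qed

lemma ac_on_of_real_deriv:
 assumes "!!x. (eta has_real_derivative eta' x) (at x)" "continuous_on UNIV eta'"
 shows "ac_on UNIV (%x. cor (eta x)) (%x. cor (eta' x))"
proof (rule ac_on_of_deriv[of _ "{}"])
 show "continuous_on UNIV (%x. cor (eta x))"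
  using assms(1) by (intro continuous_intros continuous_at_imp_continuous_on ballI DERIV_isCont)
 show "((%x. cor (eta x)) has_vector_derivative cor (eta' x)) (at x)" for x
  using assms(1)[of x] by (intro has_vector_derivative_of_real)
   (simp add: has_real_derivative_iff_has_vector_derivative)
 show "(%x. cor (eta' x)) \<in> borel_measurable borel"
  using assms(2) by (intro borel_measurable_continuous_onI continuous_intros)
 fix a b :: real
 have "bounded ((%x. cor (eta' x)) ` {a..b})"
  by (intro compact_imp_bounded compact_continuous_image continuous_intros
    continuous_on_subset[OF assms(2)]) auto
 then show "\<exists>C. \<forall>x\<in>{a..b}. cmod (cor (eta' x)) <= C" unfolding bounded_iff by blast
qed simp

lemma ac_test_function_parts:
 assumes u: "ac_on UNIV u g" and der: "!!x. (eta has_real_derivative eta' x) (at x)" and cont: "continuous_on UNIV eta'"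
  and R: "!!x. \<bar>x\<bar> \<ge> R ==> eta x = 0" "!!x. \<bar>x\<bar> \<ge> R ==> eta' x = 0" "R > 0"
  and u': "set_integrable lborel {-R..R} (%x. u x * cor (eta' x))"
 shows "(LINT x|lborel. u x * cor (eta' x)) = - (LINT x|lborel. g x * cor (eta x))"
proof -
 let ?I = "{-R..R}"
 have ac: "ac_on UNIV (%x. u x * cor (eta x))
   (%x. g x * cor (eta x) + u x * cor (eta' x))"
  by (intro ac_on_mult u ac_on_of_real_deriv der cont)
 have i: "set_integrable lborel ?I (%x. g x * cor (eta x) + u x * cor (eta' x))"
  using ac_onD(1)[OF ac, of "-R" R] R(3) by simp
 have g': "set_integrable lborel ?I (%x. g x * cor (eta x))" using set_integral_diff(1)[OF i u'] by simp
 have "0 = (LINT x:?I|lborel. g x * cor (eta x) + u x * cor (eta' x))"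
  using ac_onD(2)[OF ac, of "-R" R] R by simp
 also have "... = (LINT x:?I|lborel. g x * cor (eta x))
   + (LINT x:?I|lborel. u x * cor (eta' x))" by (rule set_integral_add(2)[OF g' u'])
 also have "(LINT x:?I|lborel. g x * cor (eta x)) = (LINT x|lborel. g x * cor (eta x))"
  by (rule integral_eq_set_integral[symmetric]) (use R in auto)
 also have "(LINT x:?I|lborel. u x * cor (eta' x)) = (LINT x|lborel. u x * cor (eta' x))"
  by (rule integral_eq_set_integral[symmetric]) (use R in auto)
 finally show ?thesis by (simp add: add_eq_0_iff)
qed

lemma set_integrable_mult_continuous:
 fixes f h :: "real => complex"
 assumes f: "set_integrable lborel {a..b} f" and h: "continuous_on UNIV h"
 shows "set_integrable lborel {a..b} (%x. f x * h x)"
proof -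
 have [measurable]: "h \<in> borel_measurable borel" using h by (rule borel_measurable_continuous_onI)
 have [measurable]: "(%x. indicator {a..b} x *\<^sub>R f x) \<in> borel_measurable lborel"
  using f by (auto simp: set_integrable_def dest: borel_measurable_integrable)
 have "bounded (h ` {a..b})" by (intro compact_imp_bounded compact_continuous_image continuous_on_subset[OF h]) auto
 then obtain C where C: "!!x. x \<in> {a..b} ==> cmod (h x) <= C" unfolding bounded_iff by blast
 have "integrable lborel (%x. (indicator {a..b} x *\<^sub>R f x) * h x)" proof (rule Bochner_Integration.integrable_bound)
  show "integrable lborel (%x. C * norm (indicator {a..b} x *\<^sub>R f x))"
   using f by (auto simp: set_integrable_def simp del: norm_scaleR)
  show "AE x in lborel. norm ((indicator {a..b} x *\<^sub>R f x) * h x)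
    <= norm (C * norm (indicator {a..b} x *\<^sub>R f x))"
  proof (rule AE_I2)
   fix x
   show "norm ((indicator {a..b} x *\<^sub>R f x) * h x) <= norm (C * norm (indicator {a..b} x *\<^sub>R f x))"
    using C[of x] mult_left_mono[OF C, of x "cmod (f x)"]
    by (cases "x \<in> {a..b}") (auto simp: norm_mult abs_mult mult_ac intro: order_trans[OF _ mult_right_mono[OF abs_ge_self]])
  qed
 qed measurable
 then show ?thesis by (simp add: set_integrable_def)
qed

lemma ac_imp_weak_deriv:
 assumes u: "ac_on UNIV u g" and uL: "u \<in> L2" and gL: "g \<in> L2"
 shows "weak_deriv u g" unfolding weak_deriv_def
proof (intro conjI allI impI uL gL)
 fix eta assume "test_function eta"
 then obtain R where R: "R > 0" "!!x. \<bar>x\<bar> \<ge> R ==> eta x = 0" "!!x. \<bar>x\<bar> \<ge> R ==> deriv eta x = 0"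
  and der: "!!x. (eta has_real_derivative deriv eta x) (at x)" and cont: "continuous_on UNIV (deriv eta)"
  using test_function_properties by blast
 have "set_integrable lborel {-R..R} (%x. u x * cor (deriv eta x))"
  by (intro set_integrable_mult_continuous L2_set_integrable uL continuous_intros cont)
 then show "(LINT x|lborel. u x * cor (deriv eta x)) = - (LINT x|lborel. g x * cor (eta x))"
  by (intro ac_test_function_parts[OF u der cont R(2,3,1)])
qed

lemma weak_deriv_cong:
 assumes w: "weak_deriv u g" and "u' \<in> L2" "g' \<in> L2" "ae_eq u u'" "ae_eq g g'"
 shows "weak_deriv u' g'" unfolding weak_deriv_def
proof (intro conjI allI impI assms(2,3))
 fix eta assume t: "test_function eta"
 then obtain R where der: "!!x. (eta has_real_derivative deriv eta x) (at x)" and cont: "continuous_on UNIV (deriv eta)"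
  using test_function_properties by blast
 have "continuous_on UNIV eta" using der by (intro continuous_at_imp_continuous_on ballI DERIV_isCont)
 then have [measurable]: "eta \<in> borel_measurable borel" "deriv eta \<in> borel_measurable borel"
  using cont by (auto intro: borel_measurable_continuous_onI)
 have [measurable]: "u \<in> borel_measurable borel" "g \<in> borel_measurable borel"
  "u' \<in> borel_measurable borel" "g' \<in> borel_measurable borel"
  using w assms(2,3) by (auto simp: weak_deriv_def dest: L2_measurable)
 have "(LINT x|lborel. u' x * cor (deriv eta x)) = (LINT x|lborel. u x * cor (deriv eta x))"
  using assms(4) unfolding ae_eq_def by (intro integral_cong_AE) (auto elim!: eventually_mono)
 also have "... = - (LINT x|lborel. g x * cor (eta x))" using w t by (simp add: weak_deriv_def)
 also have "(LINT x|lborel. g x * cor (eta x)) = (LINT x|lborel. g' x * cor (eta x))"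
  using assms(5) unfolding ae_eq_def by (intro integral_cong_AE) (auto elim!: eventually_mono)
 finally show "(LINT x|lborel. u' x * cor (deriv eta x)) = - (LINT x|lborel. g' x * cor (eta x))" .
qed

definition primitive :: "(real => complex) => real => complex" where
 "primitive g x = (if 0 <= x then (LINT t:{0..x}|lborel. g t) else - (LINT t:{x..0}|lborel. g t))"

lemma ac_on_primitive:
 assumes g: "!!a b. set_integrable lborel {a..b} g"
 shows "ac_on UNIV (primitive g) g" unfolding ac_on_def
proof (intro allI impI conjI g)
 fix a b :: real assume "a <= b"
 then consider "0 <= a" | "a < 0" "0 <= b" | "b < 0" by linarith
 then show "primitive g b - primitive g a = (LINT x:{a..b}|lborel. g x)" proof cases
  case 1
  then show ?thesis using set_integral_split[OF g, of 0 a b] \<open>a <= b\<close> by (simp add: primitive_def)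
 next
  case 2
  then show ?thesis using set_integral_split[OF g, of a 0 b] by (simp add: primitive_def)
 next
  case 3
  then show ?thesis using set_integral_split[OF g, of a b 0] \<open>a <= b\<close> by (simp add: primitive_def)
 qed
qed

text \<open>The du Bois-Reymond lemma. The difference \<open>d\<close> of \<open>phi\<close> and a
  primitive of \<open>g\<close> annihilates the smooth compactly supported functions of mean zero,
  hence is constant almost everywhere.\<close>

lemma weak_deriv_imp_ac:
 assumes w: "weak_deriv phi g"
 shows "\<exists>u. ac_on UNIV u g & ae_eq phi u"
proof -
 have phiL: "phi \<in> L2" and gL: "g \<in> L2" using w by (auto simp: weak_deriv_def)
 define v where "v = primitive g"
 have v: "ac_on UNIV v g" unfolding v_def by (intro ac_on_primitive L2_set_integrable gL)
 have vc: "continuous_on UNIV v" by (rule ac_on_continuous[OF v]) simp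
 have [measurable]: "v \<in> borel_measurable borel" "phi \<in> borel_measurable borel"
  using vc phiL by (auto intro: borel_measurable_continuous_onI dest: L2_measurable)
 define d where "d x = phi x - v x" for x
 have vi: "set_integrable lborel {a..b} v" for a b
  by (rule borel_integrable_atLeastAtMost') (rule continuous_on_subset[OF vc], simp)
 have di: "set_integrable lborel {a..b} d" for a b
  unfolding d_def[abs_def] by (intro set_integral_diff L2_set_integrable phiL vi)
 have [measurable]: "d \<in> borel_measurable borel" unfolding d_def[abs_def] by measurable
 have zero: "(LINT x|lborel. d x * cor (theta x)) = 0"
  if theta: "smooth_fn theta" and supp: "!!x. x \<notin> {L..R} ==> theta x = 0"
   and int0: "(LINT x|lborel. theta x) = 0" and LR: "L <= R" for theta L R
 proof -
  have "set_integrable lborel {L..R} theta" by (intro borel_integrable_atLeastAtMost' smooth_fn_continuous theta)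
  then have int: "integral {L..R} theta = 0"
   using set_borel_integral_eq_integral(2)[of "{L..R}" theta] integral_eq_set_integral[of "{L..R}" theta] supp int0 by auto
  obtain eta where eta: "test_function eta" "!!x. (eta has_real_derivative theta x) (at x)"
   "!!x. x \<notin> {L..R} ==> eta x = 0" using test_function_antiderivative[OF theta supp int LR] by blast
  have deq: "deriv eta = theta" using eta(2) by (intro ext DERIV_imp_deriv)
  obtain R' where R': "R' > 0" "!!x. \<bar>x\<bar> \<ge> R' ==> eta x = 0" "!!x. \<bar>x\<bar> \<ge> R' ==> theta x = 0" and cont: "continuous_on UNIV theta"
   using test_function_properties[OF eta(1)] unfolding deq by metis
  have i: "set_integrable lborel {-R'..R'} (%x. v x * cor (theta x))"
   "set_integrable lborel {-R'..R'} (%x. phi x * cor (theta x))"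
   by (intro set_integrable_mult_continuous vi L2_set_integrable phiL continuous_intros cont)+
  have "(LINT x|lborel. d x * cor (theta x)) = (LINT x:{-R'..R'}|lborel. d x * cor (theta x))"
   by (rule integral_eq_set_integral) (use R' in auto)
  also have "... = (LINT x:{-R'..R'}|lborel. phi x * cor (theta x)) - (LINT x:{-R'..R'}|lborel. v x * cor (theta x))"
   unfolding d_def left_diff_distrib by (rule set_integral_diff(2)[OF i(2,1)])
  also have "(LINT x:{-R'..R'}|lborel. phi x * cor (theta x)) = (LINT x|lborel. phi x * cor (theta x))"
   by (rule integral_eq_set_integral[symmetric]) (use R' in auto)
  also have "(LINT x:{-R'..R'}|lborel. v x * cor (theta x)) = (LINT x|lborel. v x * cor (theta x))"
   by (rule integral_eq_set_integral[symmetric]) (use R' in auto)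
  also have "(LINT x|lborel. phi x * cor (theta x)) = - (LINT x|lborel. g x * cor (eta x))"
   using w eta(1) deq by (auto simp: weak_deriv_def)
  also have "(LINT x|lborel. v x * cor (theta x)) = - (LINT x|lborel. g x * cor (eta x))"
   by (intro ac_test_function_parts[OF v eta(2) cont R'(2,3,1) i(1)])
  finally show ?thesis by simp
 qed
 have bc: "continuous_on UNIV (%x. cor (bump a b n x))" for a b n
  by (intro continuous_intros smooth_fn_continuous smooth_bump)
 have ib: "indicator {a..b} x *\<^sub>R (f x * cor (bump a b n x)) = f x * cor (bump a b n x)" for f a b n x
  using bump_outside[of x a b n] by (auto simp: indicator_def)
 have bi: "integrable lborel (%x. f x * cor (bump a b n x))"
  if "!!a b. set_integrable lborel {a..b} f" for f a b n
  using set_integrable_mult_continuous[OF that bc, of a b a b n] unfolding set_integrable_def ib .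
 have lim: "(%n. LINT x|lborel. f x * cor (bump a b n x)) ----> (LINT x:{a..b}|lborel. f x)"
  if fi: "!!a b. set_integrable lborel {a..b} f" and [measurable]: "f \<in> borel_measurable borel" for f :: "real => complex" and a b
 proof -
  have "(%n. LINT x|lborel. f x * cor (bump a b n x)) ----> (LINT x|lborel. f x * cor (indicator {a<..<b} x))"
  proof (rule integral_dominated_convergence)
   show "integrable lborel (%x. norm (indicator {a..b} x *\<^sub>R f x))"
    using fi[of a b] by (simp add: set_integrable_def del: norm_scaleR)
   show "AE x in lborel. (%n. f x * cor (bump a b n x)) ----> f x * cor (indicator {a<..<b} x)"
    by (intro AE_I2 tendsto_intros bump_tendsto)
   show "AE x in lborel. norm (f x * cor (bump a b n x)) <= norm (indicator {a..b} x *\<^sub>R f x)" for n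
    using bump_bounds[of a b n] bump_outside[of _ a b n]
    by (intro AE_I2) (auto simp: norm_mult indicator_def mult_left_le)
  qed measurable
  also have "(LINT x|lborel. f x * cor (indicator {a<..<b} x)) = (LINT x:{a..b}|lborel. f x)"
   unfolding set_lebesgue_integral_def
  proof (rule integral_cong_AE)
   show "AE x in lborel. f x * cor (indicator {a<..<b} x) = indicator {a..b} x *\<^sub>R f x"
    using AE_lborel_singleton[of a] AE_lborel_singleton[of b] by eventually_elim (auto simp: indicator_def)
  qed measurable
  finally show ?thesis .
 qed
 have one: "set_integrable lborel {a..b} (%_. 1 :: complex)" for a b :: real by (rule borel_integrable_atLeastAtMost') simp
 define r where "r a b n = (LINT x|lborel. bump a b n x)" for a b n
 have rlim: "(%n. cor (r a b n)) ----> cor (b - a)" if "a <= b" for a b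
  using lim[OF one, of a b] that by (simp add: r_def set_lebesgue_integral_def scaleR_conv_of_real)
 have bri: "integrable lborel (bump a b n)" for a b n
  using bi[OF one, of a b n] by (simp add: complex_of_real_integrable_eq)
 \<comment> \<open>A fixed bump on (0, 1) with nonzero integral; subtracting a multiple of it turns
   any other bump into a function of mean zero.\<close>
 have "\<exists>m. r 0 1 m \<noteq> 0" proof (rule ccontr)
  assume "\<not> ?thesis"
  then have "(%n. cor (r 0 1 n)) = (%_. 0)" by auto
  with rlim[of 0 1] show False by (simp add: LIMSEQ_const_iff)
 qed
 then obtain m where m: "r 0 1 m \<noteq> 0" by blast
 define J where "J f = (LINT x|lborel. d x * cor (f x))" for f
 define \<kappa> where "\<kappa> = J (bump 0 1 m) / cor (r 0 1 m)"
 have bumpint: "J (bump a b n) = \<kappa> * cor (r a b n)" for a b n proof -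
  define c where "c = r a b n / r 0 1 m"
  define theta where "theta x = bump a b n x + (- c) * bump 0 1 m x" for x
  have "J theta = 0" unfolding J_def proof (rule zero[of theta "min a 0" "max b 1"])
   show "smooth_fn theta" unfolding theta_def[abs_def] by (intro smooth_fn.add smooth_fn.cmult smooth_bump)
   show "theta x = 0" if "x \<notin> {min a 0..max b 1}" for x proof -
    have "x \<notin> {a<..<b}" "x \<notin> {0<..<1}" using that by auto
    from this[THEN bump_outside] show ?thesis by (simp add: theta_def)
   qed
   show "(LINT x|lborel. theta x) = 0" unfolding theta_def using bri m by (simp add: c_def flip: r_def)
  qed auto
  moreover have "J theta = J (bump a b n) - cor c * J (bump 0 1 m)" proof -
   have "(%x. d x * cor (theta x)) = (%x. d x * cor (bump a b n x) - cor c * (d x * cor (bump 0 1 m x)))"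
    by (auto simp: theta_def algebra_simps)
   then show ?thesis using bi[OF di] by (simp add: J_def)
  qed
  ultimately show ?thesis using m by (simp add: c_def \<kappa>_def)
 qed
 \<comment> \<open>As n grows in \<open>bumpint\<close>, bumps become interval indicators:
   \<open>d\<close> and the constant \<kappa> have the same integral over every interval.\<close>
 have "AE x in lborel. \<forall>n::nat. x \<in> {- real n..real n} --> d x - \<kappa> = 0" unfolding AE_all_countable
 proof (intro allI AE_zero_of_interval_integrals_local)
  have \<kappa>i: "set_integrable lborel {a..b} (%_. \<kappa>)" for a b :: real by (rule borel_integrable_atLeastAtMost') simp
  then show "set_integrable lborel {a..b} (%x. d x - \<kappa>)" for a b by (intro set_integral_diff di)
  fix a b :: real assume ab: "a <= b"
  have "(%n. \<kappa> * cor (r a b n)) ----> (LINT x:{a..b}|lborel. d x)"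
   using lim[OF di, of a b] by (simp add: bumpint flip: J_def)
  then have "(LINT x:{a..b}|lborel. d x) = \<kappa> * cor (b - a)"
   by (rule LIMSEQ_unique) (intro tendsto_intros rlim ab)
  moreover have "(LINT x:{a..b}|lborel. \<kappa>) = \<kappa> * cor (b - a)"
   using ab by (simp add: set_lebesgue_integral_def scaleR_conv_of_real mult.commute)
  ultimately show "(LINT x:{a..b}|lborel. d x - \<kappa>) = 0" by (simp only: set_integral_diff(2)[OF di \<kappa>i] diff_self)
 qed
 then have "ae_eq phi (%x. v x + \<kappa>)" unfolding ae_eq_def proof eventually_elim
  fix x assume *: "\<forall>n::nat. x \<in> {- real n..real n} --> d x - \<kappa> = 0"
  obtain n where "\<bar>x\<bar> <= real n" using real_arch_simple by blast
  with * have "d x - \<kappa> = 0" by (auto simp: abs_le_iff)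
  then show "phi x = v x + \<kappa>" by (simp add: d_def algebra_simps)
 qed
 moreover have "ac_on UNIV (%x. v x + \<kappa>) g" using v by (simp add: ac_on_def)
 ultimately show ?thesis by blast
qed

lemma weak_deriv_unique:
 assumes "weak_deriv phi g" "weak_deriv phi g'"
 shows "ae_eq g g'"
proof -
 have gL: "g \<in> L2" "g' \<in> L2" using assms by (auto simp: weak_deriv_def)
 obtain u u' where u: "ac_on UNIV u g" "ae_eq phi u" and u': "ac_on UNIV u' g'" "ae_eq phi u'"
  using weak_deriv_imp_ac assms by metis
 have "u x = u' x" for x by (rule continuous_AE_eq[of UNIV])
   (use u u' in \<open>auto simp: ae_eq_def intro: ac_on_continuous elim: AE_mp\<close>)
 then have eq: "(LINT x:{a..b}|lborel. g x) = (LINT x:{a..b}|lborel. g' x)" if "a <= b" for a b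
  using ac_onD(2)[OF u(1) that] ac_onD(2)[OF u'(1) that] by simp
 have "AE x in lborel. \<forall>n::nat. x \<in> {- real n..real n} --> g x - g' x = 0" unfolding AE_all_countable proof
  fix n :: nat
  show "AE x in lborel. x \<in> {- real n..real n} --> g x - g' x = 0" by (rule AE_zero_of_interval_integrals_local)
    (auto intro!: set_integral_diff L2_set_integrable gL simp: set_integral_diff(2) L2_set_integrable gL eq)
 qed
 then show ?thesis unfolding ae_eq_def proof eventually_elim
  fix x assume *: "\<forall>n::nat. x \<in> {- real n..real n} --> g x - g' x = 0"
  obtain n where "\<bar>x\<bar> <= real n" using real_arch_simple by blast
  with * show "g x = g' x" by (auto simp: abs_le_iff)
 qed
qed

lemma weak_deriv_wderiv: "phi \<in> W12 ==> weak_deriv phi (wderiv phi)"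
 using someI_ex[of "weak_deriv phi"] by (auto simp: W12_def wderiv_def)

lemma wderiv_L2: "phi \<in> W12 ==> wderiv phi \<in> L2" using weak_deriv_wderiv by (simp add: weak_deriv_def)

lemma W12_L2: "phi \<in> W12 ==> phi \<in> L2" using weak_deriv_wderiv by (simp add: weak_deriv_def)

lemma wderiv_eq: "weak_deriv phi g ==> ae_eq (wderiv phi) g" using weak_deriv_unique weak_deriv_wderiv W12_def by blast

section \<open>The Fourier transform on the line\<close>

subsection \<open>Extension of isometries\<close>

lemma subspace_closure:
 fixes S :: "'a::real_normed_vector set"
 assumes S: "subspace S" shows "subspace (closure S)" unfolding subspace_def
proof (intro conjI ballI allI)
 show "0 \<in> closure S" using subspace_0[OF S] closure_subset by blast
next
 fix x y assume "x \<in> closure S" "y \<in> closure S"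
 then obtain f g where "!!n. f n \<in> S" "f ----> x" "!!n. g n \<in> S" "g ----> y" unfolding closure_sequential by blast
 then have "!!n. f n + g n \<in> S" "(%n. f n + g n) ----> x + y" using subspace_add[OF S] by (auto intro: tendsto_add)
 then show "x + y \<in> closure S" unfolding closure_sequential by (intro exI[of _ "%n. f n + g n"]) simp
next
 fix c x assume "x \<in> closure S"
 then obtain f where "!!n. f n \<in> S" "f ----> x" unfolding closure_sequential by blast
 then have "!!n. c *\<^sub>R f n \<in> S" "(%n. c *\<^sub>R f n) ----> c *\<^sub>R x" using subspace_scale[OF S] by (auto intro: tendsto_scaleR)
 then show "c *\<^sub>R x \<in> closure S" unfolding closure_sequential by (intro exI[of _ "%n. c *\<^sub>R f n"]) simp
qed

text \<open>The map is obtained as a graph, the closure of the span of the pairs (e i, E i). Equal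
  Gram matrices make both components equally long, so the graph is single-valued, and its first
  projection is closed because a sequence that is Cauchy in one component is Cauchy in the
  other.\<close>

theorem isometry_extension:
 fixes e E :: "'i => 'h::{real_inner, complete_space}"
 assumes gram: "!!i j. inner (e i) (e j) = inner (E i) (E j)" and total: "!!f. (!!i. inner f (e i) = 0) ==> f = 0"
 shows "\<exists>F. linear F & (\<forall>u. norm (F u) = norm u) & (\<forall>i. F (e i) = E i)"
proof -
 define S where "S = span (range (%i. (e i, E i)))"
 define G where "G = closure S"
 have subS: "subspace S" by (simp add: S_def)
 have subG: "subspace G" unfolding G_def by (rule subspace_closure[OF subS])
 have inner_eq: "inner (fst p) (fst q) = inner (snd p) (snd q)" if "p \<in> S" "q \<in> S" for p q proof -
  have *: "inner (fst p) (e j) = inner (snd p) (E j)" for j using \<open>p \<in> S\<close> unfolding S_def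
   by (induction rule: span_induct_alt) (auto simp: inner_add_left gram)
  show ?thesis using \<open>q \<in> S\<close> unfolding S_def by (induction rule: span_induct_alt) (auto simp: inner_add_right *)
 qed
 have normeq: "norm (fst p) = norm (snd p)" if "p \<in> G" for p proof -
  have "closed {p :: 'h \<times> 'h. norm (fst p) = norm (snd p)}" by (intro closed_Collect_eq continuous_intros)
  moreover have "S \<subseteq> {p. norm (fst p) = norm (snd p)}" using inner_eq by (auto simp: norm_eq_sqrt_inner)
  ultimately have "G \<subseteq> {p. norm (fst p) = norm (snd p)}" unfolding G_def by (intro closure_minimal)
  then show ?thesis using that by auto
 qed
 have fstG: "fst ` G = UNIV" proof (rule closed_subspace_eq_UNIV)
  show "subspace (fst ` G)" using subG by (rule linear_subspace_image[OF linear_fst])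
  show "closed (fst ` G)" unfolding closed_sequential_limits proof (intro allI impI, elim conjE)
   fix x l assume x: "\<forall>n. x n \<in> fst ` G" "x ----> l"
   have "\<exists>q. q \<in> G & x n = fst q" for n using x(1)[rule_format, of n] by (elim imageE) blast
   then obtain p where p: "!!n. p n \<in> G" "!!n. x n = fst (p n)" by metis
   have dist: "norm (snd (p m) - snd (p n)) = norm (x m - x n)" for m n
    using normeq[OF subspace_diff[OF subG p(1)[of m] p(1)[of n]]] by (simp add: p(2))
   have "Cauchy (%n. snd (p n))" using LIMSEQ_imp_Cauchy[OF x(2)] unfolding Cauchy_def dist_norm dist .
   then obtain v where "(%n. snd (p n)) ----> v" using Cauchy_convergent convergent_def by blast
   then have "(%n. (fst (p n), snd (p n))) ----> (l, v)"
    using x(2) by (intro tendsto_Pair) (simp_all add: p(2)[symmetric])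
   then have "(l, v) \<in> G" using closed_sequentially[of G p "(l, v)"] p(1) by (simp add: G_def)
   then show "l \<in> fst ` G" by force
  qed
  fix f assume f: "!!v. v \<in> fst ` G ==> inner f v = 0"
  have "e i \<in> fst ` G" for i proof -
   have "(e i, E i) \<in> G" unfolding G_def S_def by (rule subsetD[OF closure_subset], rule span_base) simp
   then show ?thesis by force
  qed
  then show "f = 0" using f by (intro total) auto
 qed
 have "\<exists>v. (u, v) \<in> G" for u proof -
  have "u \<in> fst ` G" using fstG by simp
  then show ?thesis by force
 qed
 then obtain F where F: "!!u. (u, F u) \<in> G" by metis
 have uniq: "v = w" if "(u, v) \<in> G" "(u, w) \<in> G" for u v w using normeq[OF subspace_diff[OF subG that]] by simp
 have "linear F" proof (rule linearI)
  fix u v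
  show "F (u + v) = F u + F v" using subspace_add[OF subG F[of u] F[of v]] by (intro uniq[OF F]) simp
 next
  fix r u
  show "F (r *\<^sub>R u) = r *\<^sub>R F u" using subspace_scale[OF subG F[of u], of r] by (intro uniq[OF F]) simp
 qed
 moreover have "norm (F u) = norm u" for u using normeq[OF F[of u]] by simp
 moreover have "F (e i) = E i" for i proof (rule uniq[OF F])
  show "(e i, E i) \<in> G" unfolding G_def S_def by (rule subsetD[OF closure_subset], rule span_base) simp
 qed
 ultimately show ?thesis by blast
qed

lemma isometry_inner:
 fixes F :: "'h::real_inner => 'k::real_inner"
 assumes "linear F" "!!u. norm (F u) = norm u"
 shows "inner (F u) (F v) = inner u v"
 using polarization[of "F u" "F v"] polarization[of u v] assms(2)[of "u + v"] assms(2)[of "u - v"]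
 by (simp add: linear_add[OF assms(1)] linear_diff[OF assms(1)])

lemma isometry_continuous:
 fixes F :: "'h::real_normed_vector => 'k::real_normed_vector"
 assumes "linear F" "!!u. norm (F u) = norm u"
 shows "continuous_on S F"
proof -
 have "bounded_linear F" using assms by (intro bounded_linear_intro[where K = 1]) (auto simp: linear_add linear_scale)
 then show ?thesis by (intro linear_continuous_on)
qed

subsection \<open>Step functions\<close>

text \<open>Signed indicator of the interval between 0 and y: pairing with it yields the primitive
  at y for either sign of y, and differences are indicators of arbitrary intervals up to null
  sets.\<close>

definition e_step :: "real => real => complex" where
 "e_step y x = indicator {0..y} x - indicator {y..0} x"

lemma e_step_measurable [measurable]: "e_step y \<in> borel_measurable borel" unfolding e_step_def[abs_def] by measurable

lemma indicator_L2: "emeasure lborel A < \<infinity> ==> A \<in> sets borel ==> (indicator A :: real => complex) \<in> L2" proof (rule L2I)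
 assume A: "emeasure lborel A < \<infinity>" "A \<in> sets borel"
 have "(cmod (indicator A x))\<^sup>2 = indicat_real A x" for x by (auto simp: indicator_def)
 then show "integrable lborel (%x. (cmod (indicator A x))\<^sup>2)" using A by (simp add: integrable_indicator_iff)
qed auto

lemma e_step_L2 [simp, intro]: "e_step y \<in> L2" unfolding e_step_def[abs_def]
 by (intro L2_diff indicator_L2) (auto simp: emeasure_lborel_Icc_eq)

lemma e_step_integrable:
 fixes f :: "real => complex"
 assumes f: "!!a b. set_integrable lborel {a..b} f"
 shows "integrable lborel (%x. e_step y x * f x)"
proof -
 have "(%x. e_step y x * f x) = (%x. indicator {0..y} x *\<^sub>R f x - indicator {y..0} x *\<^sub>R f x)"
  by (auto simp: e_step_def indicator_def)
 then show ?thesis using f by (simp add: set_integrable_def)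
qed

lemma e_step_integral:
 fixes f :: "real => complex"
 assumes f: "!!a b. set_integrable lborel {a..b} f"
 shows "(LINT x|lborel. e_step y x * f x) = primitive f y"
proof -
 have "(LINT x|lborel. e_step y x * f x)
   = (LINT x|lborel. indicator {0..y} x *\<^sub>R f x - indicator {y..0} x *\<^sub>R f x)"
  by (rule Bochner_Integration.integral_cong) (auto simp: e_step_def indicator_def)
 also have "... = (LINT x:{0..y}|lborel. f x) - (LINT x:{y..0}|lborel. f x)"
  using f by (simp add: set_integrable_def set_lebesgue_integral_def)
 also have "... = primitive f y" proof -
  have n: "(LINT x:{a..b}|lborel. f x) = 0" if "b <= a" for a b proof -
   have "AE x in lborel. indicator {a..b} x *\<^sub>R f x = 0"
    using AE_lborel_singleton[of a] by eventually_elim (use that in \<open>auto simp: indicator_def\<close>)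
   then show ?thesis unfolding set_lebesgue_integral_def by (rule integral_eq_zero_AE)
  qed
  show ?thesis using n[of 0 y] n[of y 0] by (auto simp: primitive_def)
 qed
 finally show ?thesis .
qed

definition e_L2 :: "real => l2" where "e_L2 y = toL (e_step y)"

lemma cip_e_L2: "cip u (e_L2 y) = primitive (fn u) y" proof -
 have "cip u (e_L2 y) = (LINT x|lborel. e_step y x * fn u x)" unfolding e_L2_def cip_toL_right[OF e_step_L2]
  by (rule Bochner_Integration.integral_cong) (auto simp: e_step_def indicator_def)
 also have "... = primitive (fn u) y" by (rule e_step_integral) (simp add: L2_set_integrable)
 finally show ?thesis .
qed

lemma e_L2_total:
 assumes "!!y. cip u (e_L2 y) = 0" shows "u = 0"
proof -
 have ac: "ac_on UNIV (primitive (fn u)) (fn u)" by (rule ac_on_primitive) (simp add: L2_set_integrable)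
 have z: "(LINT x:{a..b}|lborel. fn u x) = 0" if "a <= b" for a b
  using ac_onD(2)[OF ac that] assms by (simp add: cip_e_L2)
 have "AE x in lborel. \<forall>n::nat. x \<in> {- real n..real n} --> fn u x = 0" unfolding AE_all_countable
  by (intro allI AE_zero_of_interval_integrals_local z L2_set_integrable) auto
 then have "AE x in lborel. fn u x = fn 0 x" using fn_zero proof eventually_elim
  case (elim x)
  obtain n where "\<bar>x\<bar> <= real n" using real_arch_simple by blast
  with elim show ?case by (auto simp: abs_le_iff)
 qed
 then show ?thesis by (simp add: l2_eq_iff)
qed

lemma inner_e_L2_total:
 assumes "!!c y. inner u (cs c (e_L2 y)) = 0" shows "u = 0"
 using assms[of 1] assms[of \<i>] by (intro e_L2_total) (simp add: cip_eq_inner complex_eq_iff)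

lemma closed_subspace_e_L2:
 assumes "subspace S" "closed S" "!!c y. cs c (e_L2 y) \<in> S"
 shows "u \<in> S"
proof -
 have "S = UNIV" using assms inner_e_L2_total by (intro closed_subspace_eq_UNIV) auto
 then show ?thesis by simp
qed

subsection \<open>The transforms of step functions\<close>

text \<open>The Fourier integral of \<open>e_step y\<close>.\<close>

definition K :: "real => real => complex" where
 "K y xi = primitive (%x. cis (- (x * xi))) y"

lemma cis_set_integrable: "set_integrable lborel {a..b} (%x. cis (- (x * xi)))"
 by (intro borel_integrable_atLeastAtMost') (auto intro!: continuous_intros)

lemma K_eq: "\<i> * cor xi * K y xi = 1 - cis (- (y * xi))" proof -
 define v where "v x = (1 - cis (- (x * xi)))" for x :: real
 have v: "ac_on UNIV v (%x. \<i> * cor xi * cis (- (x * xi)))" proof (rule ac_on_of_deriv[of _ "{}"])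
  show "continuous_on UNIV v" unfolding v_def[abs_def] by (intro continuous_intros)
  show "(v has_vector_derivative \<i> * cor xi * cis (- (x * xi))) (at x)" for x proof -
   have "((%x. exp (- \<i> * cor xi * cor x)) has_vector_derivative
     (- \<i> * cor xi) * exp (- \<i> * cor xi * cor x)) (at x)"
    by (rule has_vector_derivative_real_field) (auto intro!: derivative_eq_intros)
   from has_vector_derivative_diff[OF has_vector_derivative_const[of 1] this]
   show ?thesis unfolding v_def[abs_def] by (simp add: cis_conv_exp mult_ac)
  qed
  show "\<exists>C. \<forall>x\<in>{a..b}. cmod (\<i> * cor xi * cis (- (x * xi))) <= C" for a b
   by (intro exI[of _ "\<bar>xi\<bar>"]) (simp add: norm_mult)
 qed (auto intro!: borel_measurable_continuous_onI continuous_intros)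
 have pr: "ac_on UNIV (primitive (%x. cis (- (x * xi)))) (%x. cis (- (x * xi)))"
  by (rule ac_on_primitive[OF cis_set_integrable])
 have diff: "\<i> * cor xi * (primitive (%x. cis (- (x * xi))) b - primitive (%x. cis (- (x * xi))) a) = v b - v a"
  if "a <= b" for a b using ac_onD(2)[OF v that] ac_onD(2)[OF pr that] by simp
 have "(LINT x|lborel. e_step 0 x * cis (- (x * xi))) = 0" by (rule integral_eq_zero_AE) (simp add: e_step_def)
 then have p0: "primitive (%x. cis (- (x * xi))) 0 = 0" using e_step_integral[OF cis_set_integrable, of 0 xi] by simp
 have v0: "v 0 = 0" by (simp add: v_def)
 have "\<i> * cor xi * K y xi = v y" proof (cases "0 <= y")
  case True
  then show ?thesis using diff[of 0 y] by (simp add: K_def p0 v0)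
 next
  case False
  then show ?thesis using diff[of y 0] by (simp add: K_def p0 v0)
 qed
 then show ?thesis by (simp add: v_def)
qed

lemma K_altdef: "xi \<noteq> 0 ==> K y xi = (1 - cis (- (y * xi))) / (\<i> * cor xi)"
 using K_eq[of xi y] by (simp add: field_simps)

text \<open>The closed form of \<open>K\<close>, with 0 in place of the value y at xi = 0. The two
  agree off a null set, and the explicit formula makes norms and reflections computable.\<close>

definition K0 :: "real => real => complex" where
 "K0 y xi = (if xi = 0 then 0 else (1 - cis (- (y * xi))) / (\<i> * cor xi))"

lemma K0_measurable [measurable]: "K0 y \<in> borel_measurable borel" proof -
 have [measurable]: "cis \<in> borel_measurable borel" by (intro borel_measurable_continuous_onI continuous_intros)
 show ?thesis unfolding K0_def[abs_def] by measurable
qed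

lemma K0_minus: "K0 y (- xi) = cnj (K0 y xi)" by (simp add: K0_def cis_cnj)

lemma norm_1_minus_cis: "(cmod (1 - cis t))\<^sup>2 = 2 * (1 - cos t)" proof -
 have "(cmod (1 - cis t))\<^sup>2 = (1 - cos t)\<^sup>2 + (sin t)\<^sup>2" by (simp add: cmod_power2)
 then show ?thesis using sin_cos_squared_add[of t] by (simp add: power2_eq_square algebra_simps)
qed

lemma norm_K0_square: "(cmod (K0 y xi))\<^sup>2 = 2 * ((1 - cos (y * xi)) / xi\<^sup>2)" using norm_1_minus_cis[of "- (y * xi)"]
 by (auto simp: K0_def norm_divide norm_mult power_divide)

lemma norm_K0_diff_square: "(cmod (K0 a xi - K0 b xi))\<^sup>2 = 2 * ((1 - cos ((a - b) * xi)) / xi\<^sup>2)" proof (cases "xi = 0")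
 case False
 have "K0 a xi - K0 b xi = cis (- (b * xi)) * ((1 - cis (- ((a - b) * xi))) / (\<i> * cor xi))"
  using False by (simp add: K0_def diff_divide_distrib[symmetric] algebra_simps cis_mult)
 then have "(cmod (K0 a xi - K0 b xi))\<^sup>2 = (cmod (1 - cis (- ((a - b) * xi))))\<^sup>2 / xi\<^sup>2"
  by (simp add: norm_mult norm_divide power_divide)
 then show ?thesis using norm_1_minus_cis[of "- ((a - b) * xi)"] by simp
qed (simp add: K0_def)

lemma cos_quadratic_bound: "1 - cos t <= t\<^sup>2 / 2" for t :: real proof -
 have "1 - cos t = 2 * (sin (t / 2))\<^sup>2" using cos_double_sin[of "t / 2"] by simp
 also have "(sin (t / 2))\<^sup>2 <= (t / 2)\<^sup>2" using abs_sin_x_le_abs_x[of "t / 2"] unfolding abs_le_square_iff .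
 finally show ?thesis by (simp add: power_divide)
qed

lemma integrable_inverse_1_plus_square: "integrable lborel (%x::real. 1 / (1 + x\<^sup>2))" proof -
 define h where "h x = indicator {0..} x * (1 / (1 + x\<^sup>2))" for x :: real
 have pos: "0 < 1 + x\<^sup>2" for x :: real by (simp add: add_pos_nonneg)
 have [measurable]: "h \<in> borel_measurable borel" unfolding h_def[abs_def] by measurable
 have "(\<integral>\<^sup>+x. ennreal (1 / (1 + x\<^sup>2)) * indicator {0..} x \<partial>lborel) = ennreal (pi / 2 - arctan 0)"
 proof (rule nn_integral_FTC_atLeast)
  show "(arctan has_real_derivative 1 / (1 + x\<^sup>2)) (at x)" for x
   using DERIV_arctan[of x] by (simp add: divide_inverse)
  show "(arctan \<longlongrightarrow> pi / 2) at_top" by (rule tendsto_arctan_at_top)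
 qed (use pos in \<open>auto simp: less_imp_le\<close>)
 moreover have "(\<integral>\<^sup>+x. ennreal (1 / (1 + x\<^sup>2)) * indicator {0..} x \<partial>lborel) = (\<integral>\<^sup>+x. ennreal (norm (h x)) \<partial>lborel)"
  by (rule nn_integral_cong) (auto simp: h_def indicator_def less_imp_le[OF pos])
 ultimately have hi: "integrable lborel h" by (intro integrableI_bounded) auto
 then have "integrable lborel (%x. h x + h (- x))" using lborel_integrable_real_affine[OF hi, of "-1" 0] by simp
 then show ?thesis by (rule Bochner_Integration.integrable_bound) (auto simp: h_def indicator_def less_imp_le[OF pos])
qed

lemma integrable_cos_kernel: "integrable lborel (%xi::real. (1 - cos (y * xi)) / xi\<^sup>2)"
proof (rule Bochner_Integration.integrable_bound)
 define C where "C = y\<^sup>2 + 2"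
 show "integrable lborel (%x::real. 2 * C * (1 / (1 + x\<^sup>2)))"
  using integrable_inverse_1_plus_square by (rule integrable_mult_right)
 show "AE xi in lborel. norm ((1 - cos (y * xi)) / xi\<^sup>2) <= norm (2 * C * (1 / (1 + xi\<^sup>2)))" proof (rule AE_I2)
  fix xi :: real
  have pos: "0 < 1 + xi\<^sup>2" by (simp add: add_pos_nonneg)
  have nn: "0 <= 1 - cos (y * xi)" by simp
  have "(1 - cos (y * xi)) * (1 + xi\<^sup>2) <= 2 * C * xi\<^sup>2" proof -
   have "(1 - cos (y * xi)) * (1 + xi\<^sup>2) = (1 - cos (y * xi)) + (1 - cos (y * xi)) * xi\<^sup>2" by (simp add: algebra_simps)
   also have "... <= (y * xi)\<^sup>2 / 2 + 2 * xi\<^sup>2" using cos_ge_minus_one[of "y * xi"]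
    by (intro add_mono cos_quadratic_bound mult_right_mono) auto
   also have "... <= 2 * C * xi\<^sup>2" by (simp add: C_def power_mult_distrib algebra_simps)
   finally show ?thesis .
  qed
  then have "xi \<noteq> 0 ==> (1 - cos (y * xi)) / xi\<^sup>2 <= 2 * C * (1 / (1 + xi\<^sup>2))" using pos by (simp add: field_simps)
  moreover have "0 <= 2 * C * (1 / (1 + xi\<^sup>2))" using pos by (simp add: C_def)
  moreover have "0 <= (1 - cos (y * xi)) / xi\<^sup>2" using nn by simp
  ultimately show "norm ((1 - cos (y * xi)) / xi\<^sup>2) <= norm (2 * C * (1 / (1 + xi\<^sup>2)))"
   unfolding real_norm_def by (cases "xi = 0") (simp_all only: abs_of_nonneg, simp_all)
 qed
qed measurable

text \<open>Classically pi; kept as an unevaluated positive constant. Dividing by sqrt(2 *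
  cos_const) is the usual normalization of the transform.\<close>

definition cos_const :: real where
 "cos_const = (LINT xi|lborel. (1 - cos xi) / xi\<^sup>2)"

lemma cos_const_pos: "cos_const > 0" proof -
 have i: "integrable lborel (%xi::real. (1 - cos xi) / xi\<^sup>2)" using integrable_cos_kernel[of 1] by simp
 have "1 - cos 1 > (0::real)" using cos_monotone_0_pi[of 0 1] pi_gt3 by simp
 then have "0 < (1 - cos 1) / 4 * (LINT xi|lborel. indicator {1..2::real} xi :: real)" by simp
 also have "... = (LINT xi|lborel. (1 - cos 1) / 4 * indicator {1..2::real} xi :: real)" by simp
 also have "... <= cos_const" unfolding cos_const_def proof (rule integral_mono)
  show "integrable lborel (%xi. (1 - cos 1) / 4 * indicator {1..2::real} xi :: real)" by simp
  fix xi :: real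
  show "(1 - cos 1) / 4 * indicator {1..2} xi <= (1 - cos xi) / xi\<^sup>2" proof (cases "xi \<in> {1..2}")
   case True
   then have "cos xi <= cos 1" using pi_gt3 by (intro cos_monotone_0_pi_le) auto
   moreover have "xi\<^sup>2 <= 2\<^sup>2" using True by (intro power_mono) auto
   ultimately have "(1 - cos 1) / 4 <= (1 - cos xi) / xi\<^sup>2" using True by (intro frac_le) auto
   then show ?thesis using True by simp
  qed auto
 qed (rule i)
 finally show ?thesis .
qed

lemma cos_kernel_integral: "(LINT xi|lborel. (1 - cos (y * xi)) / xi\<^sup>2) = \<bar>y\<bar> * cos_const" proof (cases "y = 0")
 case False
 have "cos_const = \<bar>y\<bar> *\<^sub>R (LINT xi|lborel. (1 - cos (0 + y * xi)) / (0 + y * xi)\<^sup>2)"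
  unfolding cos_const_def using False by (rule lborel_integral_real_affine)
 also have "... = \<bar>y\<bar> * ((LINT xi|lborel. (1 - cos (y * xi)) / xi\<^sup>2) / y\<^sup>2)" proof -
  have "(%xi. (1 - cos (0 + y * xi)) / (0 + y * xi)\<^sup>2) = (%xi. (1 - cos (y * xi)) / xi\<^sup>2 / y\<^sup>2)"
   by (simp add: power_mult_distrib mult.commute)
  then show ?thesis by (simp only: integral_divide_zero real_scaleR_def)
 qed
 finally have *: "cos_const = \<bar>y\<bar> * ((LINT xi|lborel. (1 - cos (y * xi)) / xi\<^sup>2) / y\<^sup>2)" .
 have "y\<^sup>2 = \<bar>y\<bar> * \<bar>y\<bar>" by (simp add: power2_eq_square)
 then have "cos_const = (LINT xi|lborel. (1 - cos (y * xi)) / xi\<^sup>2) / \<bar>y\<bar>"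
  using * False by (simp only:) (simp del: abs_mult_self_eq)
 then show ?thesis using False by (simp add: field_simps)
qed simp

definition E_step :: "real => real => complex" where
 "E_step y xi = K0 y xi / cor (sqrt (2 * cos_const))"

lemma E_step_measurable [measurable]: "E_step y \<in> borel_measurable borel" unfolding E_step_def[abs_def] by measurable

lemma norm_E_step_diff:
 "(cmod (E_step a xi - E_step b xi))\<^sup>2 = inverse cos_const * ((1 - cos ((a - b) * xi)) / xi\<^sup>2)"
proof -
 have "(cmod (E_step a xi - E_step b xi))\<^sup>2 = (cmod (K0 a xi - K0 b xi))\<^sup>2 / (2 * cos_const)"
  using cos_const_pos by (simp add: E_step_def norm_divide power_divide flip: diff_divide_distrib)
 also have "... = inverse cos_const * ((1 - cos ((a - b) * xi)) / xi\<^sup>2)"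
  unfolding norm_K0_diff_square by (simp only: mult_divide_mult_cancel_left_if divide_inverse inverse_mult_distrib) simp
 finally show ?thesis .
qed

lemma E_step_0 [simp]: "E_step 0 xi = 0" by (simp add: E_step_def K0_def)

lemma E_step_zero_fun: "E_step 0 = (%_. 0)" by (rule ext) simp

lemma E_step_L2 [simp, intro]: "E_step y \<in> L2" proof (rule L2I)
 show "integrable lborel (%xi. (cmod (E_step y xi))\<^sup>2)"
  using norm_E_step_diff[of y _ 0] integrable_mult_right[OF integrable_cos_kernel[of y], of "inverse cos_const"]
  by (simp del: times_divide_eq_right)
qed measurable

lemma cnj_E_step: "cnj (E_step y xi) = E_step y (- xi)" by (simp add: E_step_def K0_minus)

definition E_L2 :: "real => l2" where "E_L2 y = toL (E_step y)"
definition E'_L2 :: "real => l2" where "E'_L2 y = toL (%xi. E_step y (- xi))"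

lemma E'_step_L2 [simp, intro]: "(%xi. E_step y (- xi)) \<in> L2" using L2_cnj[OF E_step_L2[of y]] by (simp add: cnj_E_step)

lemma norm_E_L2_diff: "(norm (E_L2 a - E_L2 b))\<^sup>2 = \<bar>a - b\<bar>" proof -
 have "(norm (E_L2 a - E_L2 b))\<^sup>2 = (LINT xi|lborel. (cmod (E_step a xi - E_step b xi))\<^sup>2)"
  by (simp add: E_L2_def norm_toL_square L2_diff flip: toL_diff)
 also have "... = (LINT xi|lborel. inverse cos_const * ((1 - cos ((a - b) * xi)) / xi\<^sup>2))" by (simp only: norm_E_step_diff)
 also have "... = \<bar>a - b\<bar>" using cos_kernel_integral[of "a - b"] cos_const_pos by (simp del: times_divide_eq_right)
 finally show ?thesis .
qed

lemma norm_E'_L2_diff: "(norm (E'_L2 a - E'_L2 b))\<^sup>2 = \<bar>a - b\<bar>" proof -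
 have "(norm (E'_L2 a - E'_L2 b))\<^sup>2 = (LINT xi|lborel. (cmod (E_step a (- xi) - E_step b (- xi)))\<^sup>2)"
  by (simp add: E'_L2_def norm_toL_square L2_diff flip: toL_diff)
 also have "... = (LINT xi|lborel. inverse cos_const * ((1 - cos ((a - b) * xi)) / xi\<^sup>2))"
  by (simp only: norm_E_step_diff mult_minus_right cos_minus power2_minus)
 also have "... = \<bar>a - b\<bar>" using cos_kernel_integral[of "a - b"] cos_const_pos by (simp del: times_divide_eq_right)
 finally show ?thesis .
qed

lemma norm_e_L2_diff: "(norm (e_L2 a - e_L2 b))\<^sup>2 = \<bar>a - b\<bar>" proof -
 have "(norm (e_L2 a - e_L2 b))\<^sup>2 = (LINT x|lborel. (cmod (e_step a x - e_step b x))\<^sup>2)"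
  by (simp add: e_L2_def norm_toL_square L2_diff flip: toL_diff)
 also have "... = (LINT x|lborel. indicator {min a b..max a b} x)" proof (rule integral_cong_AE)
  show "AE x in lborel. (cmod (e_step a x - e_step b x))\<^sup>2 = indicator {min a b..max a b} x"
   using AE_lborel_singleton[of 0] AE_lborel_singleton[of a] AE_lborel_singleton[of b]
  proof eventually_elim
   case (elim x)
   then show ?case
    by (cases "0 < x"; cases "x < a"; cases "x < b") (simp_all add: e_step_def indicator_def min_def max_def)
  qed
 qed measurable
 also have "... = \<bar>a - b\<bar>" by (simp add: abs_if)
 finally show ?thesis .
qed

lemma zero_L2: "e_L2 0 = 0" "E_L2 0 = 0" "E'_L2 0 = 0"
 by (simp_all add: E_L2_def E'_L2_def zero_l2_def e_L2_def e_step_def[abs_def] E_step_zero_fun)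

lemma inner_from_norms: "2 * inner x y = (norm x)\<^sup>2 + (norm y)\<^sup>2 - (norm (x - y))\<^sup>2"
 for x y :: "'x::real_inner" by (simp add: power2_norm_eq_inner inner_diff_left inner_diff_right inner_commute)

text \<open>All three families pass through 0 and have squared distance |a - b| between their
  members at a and b; inner products are determined by these distances.\<close>

lemma inner_L2_eq: "inner (E_L2 a) (E_L2 b) = inner (e_L2 a) (e_L2 b)"
 "inner (E'_L2 a) (E'_L2 b) = inner (e_L2 a) (e_L2 b)"
 using inner_from_norms[of "E_L2 a" "E_L2 b"] inner_from_norms[of "E'_L2 a" "E'_L2 b"]
  inner_from_norms[of "e_L2 a" "e_L2 b"]
  norm_e_L2_diff[of a 0] norm_e_L2_diff[of b 0] norm_e_L2_diff[of a b]
  norm_E_L2_diff[of a 0] norm_E_L2_diff[of b 0] norm_E_L2_diff[of a b]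
  norm_E'_L2_diff[of a 0] norm_E'_L2_diff[of b 0] norm_E'_L2_diff[of a b] by (simp_all add: zero_L2)

text \<open>For the transformed families, replacing xi by -xi exchanges the pairing with its
  conjugate, so it is real.\<close>

lemma Im_cip_L2: "Im (cip (E_L2 a) (E_L2 b)) = 0" "Im (cip (E'_L2 a) (E'_L2 b)) = 0"
 "Im (cip (e_L2 a) (e_L2 b)) = 0"
proof -
 have 1: "cip (E_L2 a) (E_L2 b) = (LINT xi|lborel. E_step a xi * E_step b (- xi))"
  by (simp add: E_L2_def cip_toL l2_inner_def cnj_E_step)
 have 2: "cip (E'_L2 a) (E'_L2 b) = (LINT xi|lborel. E_step a (- xi) * E_step b xi)"
  by (simp add: E'_L2_def cip_toL l2_inner_def cnj_E_step)
 have "(LINT xi|lborel. E_step a xi * E_step b (- xi)) = (LINT xi|lborel. E_step a (- xi) * E_step b xi)"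
  using lborel_integral_real_affine[of "-1" "%xi. E_step a xi * E_step b (- xi)" 0] by simp
 moreover have "cnj (cip (E_L2 a) (E_L2 b)) = (LINT xi|lborel. E_step a (- xi) * E_step b xi)"
  unfolding 1 Bochner_Integration.integral_cnj[symmetric] by (simp add: cnj_E_step)
 ultimately have "cnj (cip (E_L2 a) (E_L2 b)) = cip (E_L2 a) (E_L2 b)"
  and eq: "cip (E'_L2 a) (E'_L2 b) = cip (E_L2 a) (E_L2 b)" using 1 2 by simp_all
 then show "Im (cip (E_L2 a) (E_L2 b)) = 0" "Im (cip (E'_L2 a) (E'_L2 b)) = 0" by (simp_all add: complex_eq_iff)
 have "Im (LINT x|lborel. e_step a x * cnj (e_step b x)) = (LINT x|lborel. Im (e_step a x * cnj (e_step b x)))"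
  by (rule Bochner_Integration.integral_Im[symmetric]) (rule l2_inner_integrable; simp)
 also have "... = 0" by (rule integral_eq_zero_AE) (auto simp: e_step_def indicator_def)
 finally show "Im (cip (e_L2 a) (e_L2 b)) = 0" by (simp add: e_L2_def cip_toL l2_inner_def)
qed

lemma cip_L2_eq: "cip (E_L2 a) (E_L2 b) = cip (e_L2 a) (e_L2 b)"
 "cip (E'_L2 a) (E'_L2 b) = cip (e_L2 a) (e_L2 b)"
 using inner_L2_eq[of a b] Im_cip_L2[of a b] by (simp_all add: inner_l2_def complex_eq_iff)

subsection \<open>The unitary operators\<close>

definition is_Fourier :: "(real => l2) => (l2 => l2) => bool" where
 "is_Fourier E F \<longleftrightarrow> linear F & (\<forall>u. norm (F u) = norm u) & (\<forall>c y. F (cs c (e_L2 y)) = cs c (E y))"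

lemma is_Fourier_exists:
 assumes "!!a b. cip (E a) (E b) = cip (e_L2 a) (e_L2 b)"
 shows "\<exists>F. is_Fourier E F"
proof -
 have "\<exists>F. linear F & (\<forall>u. norm (F u) = norm u) & (\<forall>i. F (cs (fst i) (e_L2 (snd i))) = cs (fst i) (E (snd i)))"
 proof (rule isometry_extension)
  show "inner (cs (fst i) (e_L2 (snd i))) (cs (fst j) (e_L2 (snd j)))
    = inner (cs (fst i) (E (snd i))) (cs (fst j) (E (snd j)))" for i j
   by (simp add: inner_l2_def cip_cs_left cip_cs_right assms)
  show "f = 0" if "!!i. inner f (cs (fst i) (e_L2 (snd i))) = 0" for f
   by (rule inner_e_L2_total) (use that[of "(_, _)"] in simp)
 qed
 then obtain F where "linear F" "\<forall>u. norm (F u) = norm u"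
  "!!i. F (cs (fst i) (e_L2 (snd i))) = cs (fst i) (E (snd i))" by blast
 then show ?thesis unfolding is_Fourier_def by (metis fst_conv snd_conv)
qed

definition Fo :: "l2 => l2" where "Fo = (SOME F. is_Fourier E_L2 F)"
definition Fo' :: "l2 => l2" where "Fo' = (SOME F. is_Fourier E'_L2 F)"

lemma is_Fourier_Fo: "is_Fourier E_L2 Fo" "is_Fourier E'_L2 Fo'"
 using someI_ex[OF is_Fourier_exists[of E_L2]] someI_ex[OF is_Fourier_exists[of E'_L2]] cip_L2_eq
 unfolding Fo_def Fo'_def by blast+

lemma Fo_linear: "linear Fo" "linear Fo'" and Fo_norm [simp]: "norm (Fo u) = norm u" "norm (Fo' u) = norm u"
 and Fo_e: "Fo (cs c (e_L2 y)) = cs c (E_L2 y)" "Fo' (cs c (e_L2 y)) = cs c (E'_L2 y)"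
 using is_Fourier_Fo by (auto simp: is_Fourier_def)

lemma Fo_inner: "inner (Fo u) (Fo v) = inner u v" "inner (Fo' u) (Fo' v) = inner u v"
 by (intro isometry_inner Fo_linear Fo_norm)+

lemma Fo_continuous: "continuous_on S Fo" "continuous_on S Fo'" by (intro isometry_continuous Fo_linear Fo_norm)+

text \<open>The multiplication formula, which moves the transform from one factor to the other, on
  step functions: Fubini for their integrable product with the exponential.\<close>

lemma cip_E_e: "cip (E_L2 a) (e_L2 b) = cip (e_L2 a) (E'_L2 b)" proof -
 define N where "N = cor (sqrt (2 * cos_const))"
 have h: "integrable (lborel \<Otimes>\<^sub>M lborel) (%(xi, x). (e_step b xi * e_step a x) * cis (- (x * xi)))"
 proof (rule Bochner_Integration.integrable_bound)
  have "integrable lborel (e_step y)" for y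
   using e_step_integrable[of "%_. 1" y] by (simp add: borel_integrable_atLeastAtMost')
  then show "integrable (lborel \<Otimes>\<^sub>M lborel) (%(xi, x). e_step b xi * e_step a x)" by (intro lborel_pair_integrable_mult)
  have [measurable]: "cis \<in> borel_measurable borel" by (intro borel_measurable_continuous_onI continuous_intros)
  show "(%(xi, x). (e_step b xi * e_step a x) * cis (- (x * xi))) \<in> borel_measurable (lborel \<Otimes>\<^sub>M lborel)" by measurable
 qed (auto simp: norm_mult)
 have K0K: "AE xi in lborel. K0 y xi = K y xi" for y
  using AE_lborel_singleton[of 0] by eventually_elim (simp add: K0_def K_altdef)
 have Kint: "K y xi = (LINT x|lborel. e_step y x * cis (- (x * xi)))" for y xi
  unfolding K_def by (rule e_step_integral[symmetric]) (rule cis_set_integrable)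
 have meas: "(%xi. K y xi) \<in> borel_measurable borel" for y proof -
  have [measurable]: "cis \<in> borel_measurable borel" by (intro borel_measurable_continuous_onI continuous_intros)
  show ?thesis unfolding Kint by measurable
 qed
 have "cip (E_L2 a) (e_L2 b) = (LINT xi|lborel. E_step a xi * e_step b xi)"
  unfolding E_L2_def e_L2_def cip_toL[OF E_step_L2 e_step_L2] l2_inner_def
  by (rule Bochner_Integration.integral_cong) (auto simp: e_step_def indicator_def)
 also have "... = (LINT xi|lborel. (e_step b xi * K a xi) / N)" proof (rule integral_cong_AE)
  show "AE xi in lborel. E_step a xi * e_step b xi = e_step b xi * K a xi / N"
   using K0K[of a] by eventually_elim (simp add: E_step_def N_def)
 qed (use meas in measurable)
 also have "... = (LINT xi|lborel. (LINT x|lborel. (e_step b xi * e_step a x) * cis (- (x * xi)))) / N"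
  by (simp add: Kint mult.assoc)
 also have "(LINT xi|lborel. (LINT x|lborel. (e_step b xi * e_step a x) * cis (- (x * xi))))
   = (LINT x|lborel. (LINT xi|lborel. (e_step b xi * e_step a x) * cis (- (x * xi))))"
  using lborel_pair.Fubini_integral[OF h] by simp
 also have "... = (LINT x|lborel. e_step a x * (LINT xi|lborel. e_step b xi * cis (- (xi * x))))"
  by (simp add: mult_ac flip: integral_mult_right_zero)
 also have "... / N = (LINT x|lborel. (e_step a x * K b x) / N)" by (simp add: Kint)
 also have "... = (LINT x|lborel. e_step a x * E_step b x)" proof (rule integral_cong_AE)
  show "AE x in lborel. e_step a x * K b x / N = e_step a x * E_step b x"
   using K0K[of b] by eventually_elim (simp add: E_step_def N_def)
 qed (use meas in measurable)
 also have "... = cip (e_L2 a) (E'_L2 b)" by (simp add: e_L2_def E'_L2_def cip_toL l2_inner_def cnj_E_step)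
 finally show ?thesis .
qed

text \<open>In each variable the identity is stable under real combinations and limits, and complex
  multiples of step functions span a dense subspace.\<close>

lemma Fo_adjoint: "inner (Fo u) v = inner u (Fo' v)" proof -
 have 1: "inner (Fo u) (cs d (e_L2 b)) = inner u (Fo' (cs d (e_L2 b)))" for u d b proof -
  have "u \<in> {u. inner (Fo u) (cs d (e_L2 b)) = inner u (Fo' (cs d (e_L2 b)))}" proof (rule closed_subspace_e_L2)
   show "subspace {u. inner (Fo u) (cs d (e_L2 b)) = inner u (Fo' (cs d (e_L2 b)))}"
    using Fo_linear by (auto simp: subspace_def linear_0 linear_add linear_scale inner_add_left)
   show "closed {u. inner (Fo u) (cs d (e_L2 b)) = inner u (Fo' (cs d (e_L2 b)))}"
    by (intro closed_Collect_eq continuous_intros Fo_continuous)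
  qed (simp add: Fo_e inner_l2_def cip_cs_left cip_cs_right cip_E_e)
  then show ?thesis by simp
 qed
 have "v \<in> {v. inner (Fo u) v = inner u (Fo' v)}" proof (rule closed_subspace_e_L2)
  show "subspace {v. inner (Fo u) v = inner u (Fo' v)}"
   using Fo_linear by (auto simp: subspace_def linear_0 linear_add linear_scale inner_add_right)
  show "closed {v. inner (Fo u) v = inner u (Fo' v)}" by (intro closed_Collect_eq continuous_intros Fo_continuous)
 qed (simp add: 1)
 then show ?thesis by simp
qed

text \<open>Both operators are isometries and they are adjoint to each other, which makes them
  mutually inverse; this takes the place of an inversion formula.\<close>

lemma Fo'_Fo [simp]: "Fo' (Fo u) = u" by (rule inner_eq_imp_eq) (metis Fo_adjoint Fo_inner(1) inner_commute)

lemma Fo_Fo' [simp]: "Fo (Fo' u) = u" by (rule inner_eq_imp_eq) (metis Fo_adjoint Fo_inner(2))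

text \<open>By construction the extension is only real linear; complex homogeneity is inherited from
  the step functions by density.\<close>

lemma Fo_cs: "Fo (cs c u) = cs c (Fo u)" proof -
 have csl: "linear (cs c)" by (rule linearI) (simp_all add: cs_add_right scaleR_eq_cs mult.commute)
 have "bounded_linear (cs c)"
  using csl by (intro bounded_linear_intro[where K = "cmod c"]) (auto simp: linear_add linear_scale norm_cs mult.commute)
 then have csc: "continuous_on S (cs c)" for S by (intro linear_continuous_on)
 have "u \<in> {u. Fo (cs c u) = cs c (Fo u)}" proof (rule closed_subspace_e_L2)
  show "subspace {u. Fo (cs c u) = cs c (Fo u)}"
   using Fo_linear csl by (auto simp: subspace_def linear_0 linear_add linear_scale)
  show "closed {u. Fo (cs c u) = cs c (Fo u)}"
   by (intro closed_Collect_eq continuous_on_compose2[OF Fo_continuous(1)[of UNIV] csc]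
     continuous_on_compose2[OF csc[of UNIV] Fo_continuous(1)]) auto
 qed (simp add: Fo_e)
 then show ?thesis by simp
qed

lemma Fo_cip: "cip (Fo u) (Fo v) = cip u v" by (simp add: cip_eq_inner Fo_inner flip: Fo_cs)

lemma Fo_e_L2: "Fo (e_L2 y) = E_L2 y" using Fo_e(1)[of 1 y] by simp

section \<open>The coefficient\<close>

text \<open>After division by b^s this reads 1 <= x^s + (1 - x)^s with x = a / b, which holds
  because x <= x^s on [0, 1].\<close>

lemma powr_diff_le:
 fixes a b s :: real
 assumes "0 <= a" "a <= b" "0 < s" "s <= 1"
 shows "b powr s - a powr s <= (b - a) powr s"
proof (cases "a = 0 \<or> a = b")
 case True
 then show ?thesis using assms by auto
next
 case False
 with assms have ab: "0 < a" "a < b" by auto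
 define x where "x = a / b"
 have x: "0 < x" "x < 1" using ab by (auto simp: x_def)
 have "x <= x powr s" "1 - x <= (1 - x) powr s" using powr_mono'[of s 1 x] powr_mono'[of s 1 "1 - x"] x assms by auto
 then have "1 <= x powr s + (1 - x) powr s" by linarith
 then have "b powr s * 1 <= b powr s * (x powr s + (1 - x) powr s)" by (rule mult_left_mono) simp
 also have "... = a powr s + (b - a) powr s" proof -
  have "b * x = a" "b * (1 - x) = b - a" using ab by (simp_all add: x_def right_diff_distrib)
  then have "a powr s = b powr s * x powr s" "(b - a) powr s = b powr s * (1 - x) powr s"
   using ab x by (simp_all flip: powr_mult)
  then show ?thesis by (simp add: distrib_left)
 qed
 finally show ?thesis by simp
qed

text \<open>For equal signs this follows from \<open>powr_diff_le\<close>; for opposite signs |x -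
  y| = |x| + |y| dominates each argument, which costs the factor 2.\<close>

lemma odd_powr_holder:
 fixes s :: real
 assumes s: "0 < s" "s <= 1"
 shows "\<bar>sgn x * \<bar>x\<bar> powr s - sgn y * \<bar>y\<bar> powr s\<bar> <= 2 * \<bar>x - y\<bar> powr s"
proof -
 have same: "\<bar>a powr s - b powr s\<bar> <= 2 * \<bar>a - b\<bar> powr s" if "0 <= a" "0 <= b" for a b :: real proof (cases "a <= b")
  case True
  then show ?thesis using powr_diff_le[of a b s] powr_mono2[of s a b] s that by (simp add: abs_minus_commute)
 next
  case False
  then show ?thesis using powr_diff_le[of b a s] powr_mono2[of s b a] s that by simp
 qed
 have opp: "a powr s + b powr s <= 2 * (a + b) powr s" if "0 <= a" "0 <= b" for a b :: real
  using powr_mono2[of s a "a + b"] powr_mono2[of s b "a + b"] s that by simp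
 consider "0 <= x" "0 <= y" | "x <= 0" "y <= 0" | "0 <= x" "y <= 0" | "x <= 0" "0 <= y" by linarith
 then show ?thesis proof cases
  case 1
  then have e: "sgn x * \<bar>x\<bar> powr s = x powr s" "sgn y * \<bar>y\<bar> powr s = y powr s" by (auto simp: sgn_if)
  show ?thesis unfolding e using same[of x y] 1 by simp
 next
  case 2
  then have e: "sgn x * \<bar>x\<bar> powr s = - ((-x) powr s)" "sgn y * \<bar>y\<bar> powr s = - ((-y) powr s)" by (auto simp: sgn_if)
  show ?thesis unfolding e using same[of "-x" "-y"] 2 by (simp add: abs_minus_commute)
 next
  case 3
  then have e: "sgn x * \<bar>x\<bar> powr s = x powr s" "sgn y * \<bar>y\<bar> powr s = - ((-y) powr s)" by (auto simp: sgn_if)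
  show ?thesis unfolding e using opp[of x "-y"] 3 by simp
 next
  case 4
  then have e: "sgn x * \<bar>x\<bar> powr s = - ((-x) powr s)" "sgn y * \<bar>y\<bar> powr s = y powr s" by (auto simp: sgn_if)
  show ?thesis unfolding e abs_minus_commute[of "- ((- x) powr s)"]
   using opp[of y "-x"] 4 by (simp add: abs_minus_commute)
 qed
qed

locale coefficient =
 fixes \<delta> :: real
 assumes \<delta>: "1/2 < \<delta>" "\<delta> < 1"
begin

abbreviation c :: "real => real" where "c \<equiv> c_coeff \<delta>"

lemma c_eq: "c x = (x\<^sup>2) powr \<delta> * (1 + x\<^sup>2) powr (- \<delta>)" proof -
 have "(x\<^sup>2 / (1 + x\<^sup>2)) powr \<delta> = (x\<^sup>2) powr \<delta> / (1 + x\<^sup>2) powr \<delta>" by (rule powr_divide)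
 then show ?thesis by (simp add: c_coeff_def powr_minus divide_inverse)
qed

lemma square_powr: "(x\<^sup>2) powr \<delta> = \<bar>x\<bar> powr (2 * \<delta>)" for x :: real using powr_powr[of "\<bar>x\<bar>" 2 \<delta>] by simp

lemma c_nonneg: "0 <= c x" by (simp add: c_coeff_def)

lemma c_pos: "x \<noteq> 0 ==> 0 < c x" using add_pos_nonneg[of 1 "x\<^sup>2"] by (auto simp: c_coeff_def)

lemma c_zero [simp]: "c 0 = 0" by (simp add: c_coeff_def)

lemma c_le_1: "c x <= 1" proof -
 have "x\<^sup>2 / (1 + x\<^sup>2) <= 1" by (simp add: add_pos_nonneg)
 then have "(x\<^sup>2 / (1 + x\<^sup>2)) powr \<delta> <= 1 powr \<delta>" using \<delta> by (intro powr_mono2) auto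
 then show ?thesis by (simp add: c_coeff_def)
qed

lemma c_minus [simp]: "c (- x) = c x" by (simp add: c_coeff_def)

lemma c_le_powr: "c x <= \<bar>x\<bar> powr (2 * \<delta>)" proof -
 have "(1 + x\<^sup>2) powr (- \<delta>) <= 1" using \<delta> powr_mono_both'[of 0 \<delta> 1 "1 + x\<^sup>2"] ge_one_powr_ge_zero[of "1 + x\<^sup>2" \<delta>]
  by (simp add: powr_minus inverse_le_1_iff)
 then show ?thesis unfolding c_eq square_powr by (intro mult_left_le) auto
qed

lemma c_lower_near: "\<bar>x\<bar> <= 1 ==> \<bar>x\<bar> powr (2 * \<delta>) / 2 <= c x" proof -
 assume "\<bar>x\<bar> <= 1"
 then have "x\<^sup>2 <= 1" by (simp add: abs_square_le_1)
 then have "(1 + x\<^sup>2) powr \<delta> <= 2 powr \<delta>" using \<delta> by (intro powr_mono2) auto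
 also have "... <= 2 powr 1" using \<delta> by (intro powr_mono) auto
 finally have "(1 + x\<^sup>2) powr \<delta> <= 2" by simp
 then have "1 / 2 <= (1 + x\<^sup>2) powr (- \<delta>)" using le_imp_inverse_le[of "(1 + x\<^sup>2) powr \<delta>" 2] add_pos_nonneg[of 1 "x\<^sup>2"]
  by (auto simp: powr_minus)
 then have "\<bar>x\<bar> powr (2 * \<delta>) * (1/2) <= \<bar>x\<bar> powr (2 * \<delta>) * (1 + x\<^sup>2) powr (- \<delta>)" by (intro mult_left_mono) auto
 then show ?thesis by (simp add: c_eq square_powr)
qed

lemma c_lower_far: "1 <= \<bar>x\<bar> ==> 1 / 2 <= c x" proof -
 assume "1 <= \<bar>x\<bar>"
 then have "1 <= x\<^sup>2" by (simp add: abs_square_eq_1 one_le_power[of "\<bar>x\<bar>" 2, simplified])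
 then have h: "1 / 2 <= x\<^sup>2 / (1 + x\<^sup>2)" by (simp add: field_simps add_pos_nonneg)
 have "1 / 2 = (1/2 :: real) powr 1" by simp
 also have "... <= (1/2) powr \<delta>" using \<delta> by (intro powr_mono') auto
 also have "... <= (x\<^sup>2 / (1 + x\<^sup>2)) powr \<delta>" using \<delta> h by (intro powr_mono2) auto
 finally show ?thesis by (simp add: c_coeff_def)
qed

lemma c_continuous: "continuous_on S c" proof -
 have "1 + x\<^sup>2 \<noteq> 0" for x :: real by (metis add.commute add_nonneg_eq_0_iff zero_le_one zero_le_power2 zero_neq_one)
 then show ?thesis unfolding c_coeff_def[abs_def] using \<delta> by (intro continuous_on_powr' continuous_intros) auto
qed

lemma c_measurable [measurable]: "c \<in> borel_measurable borel" by (rule borel_measurable_continuous_onI[OF c_continuous])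

definition c' :: "real => real" where
 "c' x = 2 * \<delta> * (sgn x * \<bar>x\<bar> powr (2 * \<delta> - 1)) * (1 + x\<^sup>2) powr (- \<delta> - 1)"

lemma c_has_deriv: "(c has_real_derivative c' x) (at x)" proof (cases "x = 0")
 case False
 have p: "x\<^sup>2 > 0" "1 + x\<^sup>2 > 0" using False by (auto intro: add_pos_nonneg)
 have "((%x. (x\<^sup>2) powr \<delta> * (1 + x\<^sup>2) powr (- \<delta>)) has_real_derivative
   ((x\<^sup>2) powr \<delta> * (- \<delta> * (1 + x\<^sup>2) powr (- \<delta> - 1) * (2 * x))
    + \<delta> * (x\<^sup>2) powr (\<delta> - 1) * (2 * x) * (1 + x\<^sup>2) powr (- \<delta>))) (at x)"
  by (rule derivative_eq_intros DERIV_fun_powr p refl | use p in simp)+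
 also have "(x\<^sup>2) powr \<delta> * (- \<delta> * (1 + x\<^sup>2) powr (- \<delta> - 1) * (2 * x))
    + \<delta> * (x\<^sup>2) powr (\<delta> - 1) * (2 * x) * (1 + x\<^sup>2) powr (- \<delta>)
   = 2 * \<delta> * x * (x\<^sup>2) powr (\<delta> - 1) * (1 + x\<^sup>2) powr (- \<delta> - 1)"
 proof -
  have "(x\<^sup>2) powr \<delta> = x\<^sup>2 * (x\<^sup>2) powr (\<delta> - 1)" "(1 + x\<^sup>2) powr (- \<delta>) = (1 + x\<^sup>2) * (1 + x\<^sup>2) powr (- \<delta> - 1)"
   using p by (simp_all add: powr_mult_base)
  then show ?thesis by (simp add: algebra_simps)
 qed
 also have "... = c' x" proof -
  have "(x\<^sup>2) powr (\<delta> - 1) = (\<bar>x\<bar> powr 2) powr (\<delta> - 1)" using False by simp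
  also have "... = \<bar>x\<bar> powr (2 * \<delta> - 2)" unfolding powr_powr by (simp add: algebra_simps)
  finally have "x * (x\<^sup>2) powr (\<delta> - 1) = sgn x * (\<bar>x\<bar> * \<bar>x\<bar> powr (2 * \<delta> - 2))"
   by (simp add: sgn_mult_abs mult.assoc[symmetric])
  also have "\<bar>x\<bar> * \<bar>x\<bar> powr (2 * \<delta> - 2) = \<bar>x\<bar> powr (2 * \<delta> - 1)" using False by (simp add: powr_mult_base)
  finally show ?thesis by (simp add: c'_def mult.assoc)
 qed
 finally show ?thesis by (simp add: c_eq[abs_def])
next
 case True
 \<comment> \<open>The difference quotient is at most |h|^(2 \<delta> - 1), and 2 \<delta> >
   1.\<close>
 have "((%h. c h / h) \<longlongrightarrow> 0) (at 0)" proof (rule Lim_null_comparison)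
  show "\<forall>\<^sub>F h in at 0. norm (c h / h) <= \<bar>h\<bar> powr (2 * \<delta> - 1)"
  proof (simp add: eventually_at_filter, intro always_eventually allI impI)
   fix h :: real assume "h \<noteq> 0"
   have "\<bar>h\<bar> powr (2 * \<delta>) = \<bar>h\<bar> * \<bar>h\<bar> powr (2 * \<delta> - 1)" using \<open>h \<noteq> 0\<close> by (simp add: powr_mult_base)
   then show "\<bar>c h\<bar> / \<bar>h\<bar> <= \<bar>h\<bar> powr (2 * \<delta> - 1)"
    using c_le_powr[of h] c_nonneg[of h] \<open>h \<noteq> 0\<close> by (simp add: field_simps)
  qed
  have "((%h. \<bar>h\<bar> powr (2 * \<delta> - 1)) \<longlongrightarrow> \<bar>0\<bar> powr (2 * \<delta> - 1)) (at (0::real))"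
   using \<delta> by (intro tendsto_powr' tendsto_intros) auto
  then show "((%h. \<bar>h\<bar> powr (2 * \<delta> - 1)) \<longlongrightarrow> 0) (at (0::real))" by simp
 qed
 with True show ?thesis by (simp add: has_field_derivative_iff c'_def)
qed

lemma deriv_c: "deriv c = c'" using c_has_deriv by (intro ext DERIV_imp_deriv)

text \<open>In terms of \<open>Y = x / sqrt (1 + x\<^sup>2)\<close> the derivative is a product of bounded Hoelder functions.\<close>

lemma c'_holder: "c' \<in> holder_space (2 * \<delta> - 1)" proof -
 define s where "s = 2 * \<delta> - 1"
 have s: "0 < s" "s < 1" using \<delta> by (auto simp: s_def)
 define p where "p x = sgn x * \<bar>x\<bar> powr s" for x :: real
 define Y where "Y x = x * (1 + x\<^sup>2) powr (- (1/2))" for x :: real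
 define w where "w x = (1 + x\<^sup>2) powr (- (3/2))" for x :: real
 have pos: "1 <= 1 + x\<^sup>2" "0 < 1 + x\<^sup>2" for x :: real by (auto intro: add_pos_nonneg)
 \<comment> \<open>The factor (1 + x^2)^(-\<delta> - 1) splits into (1 + x^2)^(-s/2), which belongs
   to |Y|^s, and the (1 + x^2)^(-3/2) of \<open>w\<close>, where s = 2 \<delta> - 1.\<close>
 have ceq: "c' x = 2 * \<delta> * (p (Y x) * w x)" for x proof -
  have "\<bar>Y x\<bar> powr s * w x = \<bar>x\<bar> powr s * ((1 + x\<^sup>2) powr (- (1/2) * s) * (1 + x\<^sup>2) powr (- (3/2)))"
   using pos[of x] by (simp add: Y_def w_def abs_mult powr_mult powr_powr)
  also have "(1 + x\<^sup>2) powr (- (1/2) * s) * (1 + x\<^sup>2) powr (- (3/2)) = (1 + x\<^sup>2) powr (- \<delta> - 1)" proof -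
   have "- (1/2) * s + - (3/2) = - \<delta> - 1" by (simp add: s_def) argo
   then show ?thesis by (simp only: powr_add[symmetric])
  qed
  finally have "\<bar>Y x\<bar> powr s * w x = \<bar>x\<bar> powr s * (1 + x\<^sup>2) powr (- \<delta> - 1)" .
  moreover have "sgn (Y x) = sgn x" using pos[of x] by (simp add: Y_def sgn_mult)
  ultimately show ?thesis by (simp add: c'_def p_def s_def)
 qed
 have w01: "0 <= w x" "w x <= 1" for x using powr_mono[of "- (3/2)" 0 "1 + x\<^sup>2"] pos[of x] by (auto simp: w_def)
 have Y1: "\<bar>p (Y x)\<bar> <= 1" for x proof -
  have "\<bar>x\<bar> <= (1 + x\<^sup>2) powr (1/2)" using pos[of x] by (simp add: powr_half_sqrt real_le_rsqrt)
  then have "\<bar>x\<bar> * (1 + x\<^sup>2) powr (- (1/2)) <= (1 + x\<^sup>2) powr (1/2) * (1 + x\<^sup>2) powr (- (1/2))"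
   by (rule mult_right_mono) simp
  also have "... = 1" unfolding powr_add[symmetric] using pos[of x] by simp
  finally have "\<bar>Y x\<bar> powr s <= 1" using s by (intro powr_le1) (auto simp: Y_def abs_mult)
  then show ?thesis by (auto simp: p_def abs_mult sgn_if)
 qed
 have der: "((%x. (1 + x\<^sup>2) powr r) has_real_derivative r * (1 + x\<^sup>2) powr (r - 1) * (2 * x)) (at x)" for r x :: real
  using DERIV_fun_powr[of "%x. 1 + x\<^sup>2" "2 * x" x r] pos(2)[of x] by (auto intro!: derivative_eq_intros)
 have Yl: "\<bar>Y x - Y y\<bar> <= \<bar>x - y\<bar>" for x y proof -
  have "norm (Y x - Y y) <= 1 * norm (x - y)" proof (rule field_differentiable_bound[where S = UNIV])
   fix z :: real
   have "(1 + z\<^sup>2) powr (- (1/2)) = (1 + z\<^sup>2) * w z"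
    using powr_mult_base[of "1 + z\<^sup>2" "- (3/2)"] pos[of z] by (simp add: w_def)
   then have "1 * (1 + z\<^sup>2) powr (- (1/2)) + - (1/2) * (1 + z\<^sup>2) powr (- (1/2) - 1) * (2 * z) * z = w z"
    by (simp add: w_def algebra_simps power2_eq_square)
   then show "(Y has_field_derivative w z) (at z within UNIV)"
    using DERIV_mult[OF DERIV_ident der[of "- (1/2)" z]] unfolding Y_def[abs_def] by simp
   show "norm (w z) <= 1" using w01[of z] by simp
  qed auto
  then show ?thesis by simp
 qed
 have wl: "\<bar>w x - w y\<bar> <= 3 * \<bar>x - y\<bar>" for x y proof -
  have "norm (w x - w y) <= 3 * norm (x - y)" proof (rule field_differentiable_bound[where S = UNIV])
   fix z :: real
   let ?d = "- (3/2) * (1 + z\<^sup>2) powr (- (3/2) - 1) * (2 * z)"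
   show "(w has_field_derivative ?d) (at z within UNIV)" using der[of "- (3/2)" z] by (simp add: w_def[abs_def])
   have "2 * \<bar>z\<bar> <= z\<^sup>2 + 1" using sum_squares_bound[of "\<bar>z\<bar>" 1] by simp
   then have "(2 * \<bar>z\<bar>) * (1 + z\<^sup>2) powr (- (3/2) - 1) <= (1 + z\<^sup>2) * (1 + z\<^sup>2) powr (- (3/2) - 1)"
    by (intro mult_right_mono) auto
   also have "... = w z" using powr_mult_base[of "1 + z\<^sup>2" "- (3/2) - 1"] pos[of z] by (simp add: w_def)
   finally show "norm ?d <= 3" using w01[of z] by (simp add: abs_mult mult.commute)
  qed auto
  then show ?thesis by simp
 qed
 \<comment> \<open>A bounded Lipschitz function is Hoelder of exponent s: the Lipschitz bound serves
   distances up to 1, boundedness the others.\<close>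
 have wh: "\<bar>w x - w y\<bar> <= 3 * \<bar>x - y\<bar> powr s" for x y proof (cases "\<bar>x - y\<bar> <= 1")
  case True
  have "\<bar>x - y\<bar> <= \<bar>x - y\<bar> powr s" using powr_mono'[of s 1 "\<bar>x - y\<bar>"] s True by (cases "x = y") auto
  then show ?thesis using wl[of x y] by simp
 next
  case False
  then have "1 <= \<bar>x - y\<bar> powr s" using s by (intro ge_one_powr_ge_zero) auto
  then show ?thesis using w01[of x] w01[of y] by linarith
 qed
 \<comment> \<open>The odd power gives 2 and \<open>w\<close> gives 3, together 5 for the product;
   the factor 2 \<delta> is at most 2.\<close>
 have "\<bar>c' x - c' y\<bar> <= 10 * \<bar>x - y\<bar> powr s" for x y proof -
  have "\<bar>p (Y x) - p (Y y)\<bar> <= 2 * \<bar>Y x - Y y\<bar> powr s" using odd_powr_holder[of s "Y x" "Y y"] s by (simp add: p_def)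
  also have "... <= 2 * \<bar>x - y\<bar> powr s" using Yl[of x y] s by (intro mult_left_mono powr_mono2) auto
  finally have "\<bar>p (Y x) - p (Y y)\<bar> * w x + \<bar>p (Y y)\<bar> * \<bar>w x - w y\<bar> <= 2 * \<bar>x - y\<bar> powr s * 1 + 1 * (3 * \<bar>x - y\<bar> powr s)"
   using w01 Y1 wh by (intro add_mono mult_mono) auto
  moreover have "p (Y x) * w x - p (Y y) * w y = (p (Y x) - p (Y y)) * w x + p (Y y) * (w x - w y)" by (simp add: algebra_simps)
  then have "\<bar>p (Y x) * w x - p (Y y) * w y\<bar> <= \<bar>p (Y x) - p (Y y)\<bar> * w x + \<bar>p (Y y)\<bar> * \<bar>w x - w y\<bar>"
   using abs_triangle_ineq[of "(p (Y x) - p (Y y)) * w x" "p (Y y) * (w x - w y)"] w01[of x] by (simp add: abs_mult)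
  ultimately have b: "\<bar>p (Y x) * w x - p (Y y) * w y\<bar> <= 5 * \<bar>x - y\<bar> powr s" by linarith
  have "\<bar>c' x - c' y\<bar> = 2 * \<delta> * \<bar>p (Y x) * w x - p (Y y) * w y\<bar>"
   using \<delta> by (simp add: ceq abs_mult flip: right_diff_distrib)
  also have "... <= 2 * (5 * \<bar>x - y\<bar> powr s)" using \<delta> b by (intro mult_mono) auto
  finally show ?thesis by simp
 qed
 moreover have "\<bar>c' x\<bar> <= 2" for x proof -
  have "2 * \<delta> * (\<bar>p (Y x)\<bar> * w x) <= 2 * (1 * 1)" using \<delta> w01 Y1 by (intro mult_mono) auto
  then show ?thesis using \<delta> w01[of x] by (simp add: ceq abs_mult)
 qed
 then have "bounded (range c')" unfolding bounded_iff by (intro exI[of _ 2]) auto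
 ultimately show ?thesis unfolding holder_space_def s_def by blast
qed

end

section \<open>Multiplication operators and convergence in the Hilbert space\<close>

definition bdd_mult :: "(real => complex) => bool" where
 "bdd_mult m \<longleftrightarrow> m \<in> borel_measurable borel & (\<exists>C. \<forall>x. cmod (m x) <= C)"

lemma bdd_multI: "m \<in> borel_measurable borel ==> (!!x. cmod (m x) <= C) ==> bdd_mult m" by (auto simp: bdd_mult_def)

lemma bdd_mult_measurable: "bdd_mult m ==> m \<in> borel_measurable borel" by (simp add: bdd_mult_def)

lemma bdd_mult_bound: assumes "bdd_mult m" obtains C where "C \<ge> 0" "!!x. cmod (m x) <= C" proof -
 obtain C where C: "!!x. cmod (m x) <= C" using assms by (auto simp: bdd_mult_def)
 have "0 <= C" using C[of 0] norm_ge_zero[of "m 0"] by linarith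
 with C show thesis using that by blast
qed

lemma bdd_mult_L2: assumes "bdd_mult m" "f \<in> L2" shows "(%x. m x * f x) \<in> L2" proof -
 obtain C where "!!x. cmod (m x) <= C" using assms bdd_mult_bound by metis
 then show ?thesis using assms by (intro L2_mult_bounded) (auto simp: bdd_mult_def)
qed

lemma fn_mlt_bdd: "bdd_mult m ==> AE x in lborel. fn (mlt m u) x = m x * fn u x" by (intro fn_mlt bdd_mult_L2) auto

lemma toL_mlt_bdd: assumes "bdd_mult m" "f \<in> L2" shows "toL (%x. m x * f x) = mlt m (toL f)" proof -
 obtain C where "!!x. cmod (m x) <= C" using assms bdd_mult_bound by metis
 then show ?thesis using assms by (intro toL_mult_bounded) (auto simp: bdd_mult_def)
qed

lemma bdd_mult_mult: assumes "bdd_mult m" "bdd_mult n" shows "bdd_mult (%x. m x * n x)" proof -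
 obtain C D where "!!x. cmod (m x) <= C" "!!x. cmod (n x) <= D" "C \<ge> 0" using assms bdd_mult_bound by metis
 then show ?thesis using assms by (intro bdd_multI[of _ "C * D"]) (auto simp: norm_mult bdd_mult_def intro!: mult_mono)
qed

lemma bdd_mult_cnj: "bdd_mult m ==> bdd_mult (%x. cnj (m x))" by (auto simp: bdd_mult_def)

lemma mlt_mlt: assumes "bdd_mult m" "bdd_mult n" shows "mlt m (mlt n u) = mlt (%x. m x * n x) u" unfolding l2_eq_iff
 using fn_mlt_bdd[OF assms(1), of "mlt n u"] fn_mlt_bdd[OF assms(2), of u]
  fn_mlt_bdd[OF bdd_mult_mult[OF assms], of u] by eventually_elim simp

lemma mlt_add: assumes "bdd_mult m" shows "mlt m (u + v) = mlt m u + mlt m v" unfolding l2_eq_iff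
 using fn_mlt_bdd[OF assms, of "u + v"] fn_mlt_bdd[OF assms, of u] fn_mlt_bdd[OF assms, of v]
  fn_add[of u v] fn_add[of "mlt m u" "mlt m v"] by eventually_elim (simp add: algebra_simps)

lemma mlt_cs: assumes "bdd_mult m" shows "mlt m (cs c u) = cs c (mlt m u)" unfolding l2_eq_iff
 using fn_mlt_bdd[OF assms, of "cs c u"] fn_mlt_bdd[OF assms, of u] fn_cs[of c u] fn_cs[of c "mlt m u"]
 by eventually_elim simp

lemma mlt_linear: assumes "bdd_mult m" shows "linear (mlt m)"
 by (rule linearI) (simp_all add: assms mlt_add mlt_cs scaleR_eq_cs)

lemma norm_mlt_le:
 assumes m: "m \<in> borel_measurable borel" "!!x. cmod (m x) <= C" shows "norm (mlt m u) <= C * norm u"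
proof -
 have b: "bdd_mult m" using assms by (rule bdd_multI)
 have C: "0 <= C" using m(2)[of 0] norm_ge_zero[of "m 0"] by linarith
 have "(norm (mlt m u))\<^sup>2 = (LINT x|lborel. (cmod (m x * fn u x))\<^sup>2)"
  unfolding mlt_def by (rule norm_toL_square) (simp add: bdd_mult_L2 b)
 also have "... <= (LINT x|lborel. C\<^sup>2 * (cmod (fn u x))\<^sup>2)" proof (rule integral_mono)
  show "integrable lborel (%x. (cmod (m x * fn u x))\<^sup>2)" by (intro L2_integrable_square bdd_mult_L2 b) simp
  show "integrable lborel (%x. C\<^sup>2 * (cmod (fn u x))\<^sup>2)" using L2_integrable_square[of "fn u"] by simp
  show "(cmod (m x * fn u x))\<^sup>2 <= C\<^sup>2 * (cmod (fn u x))\<^sup>2" for x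
   using m(2)[of x] by (auto simp: norm_mult power_mult_distrib intro!: mult_right_mono power_mono)
 qed
 also have "... = (C * norm u)\<^sup>2" by (simp add: norm_l2_square power_mult_distrib)
 finally show ?thesis by (rule power2_le_imp_le) (use C in simp)
qed

lemma mlt_bounded_linear: assumes "bdd_mult m" shows "bounded_linear (mlt m)" proof -
 obtain C where C: "!!x. cmod (m x) <= C" using assms bdd_mult_bound by metis
 show ?thesis using mlt_linear[OF assms] norm_mlt_le[OF bdd_mult_measurable[OF assms] C]
  by (intro bounded_linear_intro[where K = C]) (auto simp: linear_add linear_scale mult.commute)
qed

lemma mlt_tendsto: "bdd_mult m ==> u ----> v ==> (%n. mlt m (u n)) ----> mlt m v"
 by (rule bounded_linear.tendsto[OF mlt_bounded_linear])

lemma cip_mlt: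
 assumes "bdd_mult m" shows "cip (mlt m u) v = cip u (mlt (%x. cnj (m x)) v)"
proof -
 have bc: "bdd_mult (%x. cnj (m x))" using assms by (rule bdd_mult_cnj)
 show ?thesis unfolding cip_eq proof (rule integral_cong_AE)
  show "AE x in lborel. fn (mlt m u) x * cnj (fn v x) = fn u x * cnj (fn (mlt (%x. cnj (m x)) v) x)"
   using fn_mlt_bdd[OF assms, of u] fn_mlt_bdd[OF bc, of v] by eventually_elim simp
 qed measurable
qed

lemma inner_mlt_real:
 assumes "bdd_mult m" "!!x. cnj (m x) = m x" shows "inner (mlt m u) v = inner u (mlt m v)"
 using cip_mlt[OF assms(1), of u v] assms(2) by (simp add: inner_l2_def)

lemma inner_cs: "inner (cs a u) v = inner u (cs (cnj a) v)" by (simp add: inner_l2_def cip_cs_left cip_cs_right)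

lemma test_function_L2:
 assumes "test_function eta"
 shows "(%x. cor (eta x)) \<in> L2" "(%x. cor (deriv eta x)) \<in> L2"
  "weak_deriv (%x. cor (eta x)) (%x. cor (deriv eta x))"
proof -
 obtain R where R: "R > 0" "!!x. \<bar>x\<bar> \<ge> R ==> eta x = 0" "!!x. \<bar>x\<bar> \<ge> R ==> deriv eta x = 0"
  and der: "!!x. (eta has_real_derivative deriv eta x) (at x)" and cont: "continuous_on UNIV (deriv eta)"
  using test_function_properties[OF assms] by metis
 have c: "continuous_on UNIV eta" using der by (intro continuous_at_imp_continuous_on ballI DERIV_isCont)
 have L: "(%x. cor (f x)) \<in> L2" if f: "continuous_on UNIV f" "!!x. \<bar>x\<bar> \<ge> R ==> f x = 0" for f proof -
  have "bounded (f ` {-R..R})"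
   by (intro compact_imp_bounded compact_continuous_image continuous_on_subset[OF f(1)]) auto
  then obtain C where "\<forall>y\<in>f ` {-R..R}. norm y <= C" unfolding bounded_iff by blast
  then have C: "!!x. x \<in> {-R..R} ==> norm (f x) <= C" by blast
  show ?thesis proof (rule L2_dominated[where f = "indicator {-R..R}" and C = C])
   show "(%x. cor (f x)) \<in> borel_measurable borel"
    using f(1) by (intro borel_measurable_continuous_onI continuous_intros)
   show "(indicator {-R..R} :: real => complex) \<in> L2" by (rule indicator_L2) (auto simp: emeasure_lborel_Icc_eq)
   show "AE x in lborel. cmod (cor (f x)) <= C * cmod (indicator {- R..R} x)" proof (rule AE_I2)
    fix x
    show "cmod (cor (f x)) <= C * cmod (indicator {- R..R} x)"
     using C[of x] f(2)[of x] by (cases "x \<in> {-R..R}") auto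
   qed
  qed
 qed
 show 1: "(%x. cor (eta x)) \<in> L2" "(%x. cor (deriv eta x)) \<in> L2" using L c cont R by blast+
 show "weak_deriv (%x. cor (eta x)) (%x. cor (deriv eta x))"
  by (intro ac_imp_weak_deriv ac_on_of_real_deriv der cont 1)
qed

section \<open>The Fourier transform of a derivative\<close>

lemma indicator_Ioo_L2: "(indicator {a<..<b} :: real => complex) \<in> L2" proof -
 have "emeasure lborel {a<..<b} <= emeasure lborel {a..b}" by (rule emeasure_mono) auto
 then have "emeasure lborel {a<..<b} < \<infinity>" by (rule le_less_trans) (simp add: emeasure_lborel_Icc_eq)
 then show ?thesis by (intro indicator_L2) auto
qed

definition ramp :: "real => real => real => complex" where
 "ramp p q x = cor (max 0 (min (q - p) (x - p)))"

lemma ac_ramp: assumes pq: "p < q" shows "ac_on UNIV (ramp p q) (indicator {p<..<q})"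
proof (rule ac_on_of_deriv[of _ "{p, q}"])
 show "continuous_on UNIV (ramp p q)" unfolding ramp_def[abs_def] by (intro continuous_intros)
 fix x assume x: "x \<notin> {p, q}"
 consider "x < p" | "p < x" "x < q" | "q < x" using x by fastforce
 then show "(ramp p q has_vector_derivative indicator {p<..<q} x) (at x)" proof cases
  case 1
  then have "((%_. 0) has_vector_derivative indicator {p<..<q} x) (at x)" by simp
  then show ?thesis
   by (rule has_vector_derivative_transform_within_open[of _ _ _ "{..<p}"]) (use 1 pq in \<open>auto simp: ramp_def\<close>)
 next
  case 2
  then have "((%x. cor (x - p)) has_vector_derivative indicator {p<..<q} x) (at x)"
   by (auto intro!: has_vector_derivative_of_real derivative_eq_intros
     simp flip: has_real_derivative_iff_has_vector_derivative)
  then show ?thesis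
   by (rule has_vector_derivative_transform_within_open[of _ _ _ "{p<..<q}"]) (use 2 pq in \<open>auto simp: ramp_def\<close>)
 next
  case 3
  then have "((%_. cor (q - p)) has_vector_derivative indicator {p<..<q} x) (at x)" by simp
  then show ?thesis
   by (rule has_vector_derivative_transform_within_open[of _ _ _ "{q<..}"]) (use 3 pq in \<open>auto simp: ramp_def\<close>)
 qed
next
 show "\<exists>C. \<forall>x\<in>{a..b}. cmod (indicator {p<..<q} x) <= C" for a b by (intro exI[of _ 1]) (auto simp: indicator_def)
qed measurable

lemma ac_on_diff: "ac_on S u g ==> ac_on S v k ==> ac_on S (%x. u x - v x) (%x. g x - k x)"
 by (simp add: ac_on_def algebra_simps set_integral_diff)

lemma ac_on_cmult: "ac_on S u g ==> ac_on S (%x. a * u x) (%x. a * g x)" for a :: complex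
 unfolding ac_on_def by (metis set_integral_mult_right set_integrable_mult_right right_diff_distrib)

text \<open>A trapezoid with plateau [-a, a] of height b - a and slopes of modulus 1. With b = a + 1
  it is a cut-off at infinity; with general a < b its derivative averages over (a, b), which
  extracts the flux from the weak equation.\<close>

definition trap :: "real => real => real => complex" where
 "trap a b x = cor (max 0 (min (b - a) (b - \<bar>x\<bar>)))"

definition trap' :: "real => real => real => complex" where
 "trap' a b x = indicator {-b<..<-a} x - indicator {a<..<b} x"

lemma ac_trap: assumes ab: "0 < a" "a < b" shows "ac_on UNIV (trap a b) (trap' a b)" proof -
 have "trap a b = (%x. ramp (-b) (-a) x - ramp a b x)"
  using ab by (auto simp: fun_eq_iff trap_def ramp_def min_def max_def simp flip: of_real_diff)
 then show ?thesis unfolding trap'_def[abs_def] using ab by (simp add: ac_on_diff ac_ramp)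
qed

lemma trap_bounds: "cmod (trap a (a + 1) x) <= 1" "cmod (trap' a b x) <= 1"
 by (auto simp: trap_def trap'_def indicator_def)

lemma trap_measurable [measurable]: "trap a b \<in> borel_measurable borel" "trap' a b \<in> borel_measurable borel"
 unfolding trap_def[abs_def] trap'_def[abs_def] by measurable

lemma trap_L2: "trap a b \<in> L2" "trap' a b \<in> L2" proof -
 show "trap' a b \<in> L2" unfolding trap'_def[abs_def] by (intro L2_diff indicator_Ioo_L2)
 show "trap a b \<in> L2" by (rule L2_dominated[where C = "\<bar>b - a\<bar>", OF trap_measurable(1) indicator_Ioo_L2[of "-b" b]])
   (auto simp: trap_def indicator_def min_def max_def intro!: AE_I2)
qed

lemma cis_measurable [measurable]: "cis \<in> borel_measurable borel"
 by (intro borel_measurable_continuous_onI continuous_intros)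

lemma cip_Fo: "cip (Fo u) v = cip u (Fo' v)" using Fo_cip[of u "Fo' v"] by simp

lemma AE_zero_of_all_interval_integrals:
 fixes g :: "real => complex"
 assumes g: "!!a b. set_integrable lborel {a..b} g" and zero: "!!a b. a <= b ==> (LINT x:{a..b}|lborel. g x) = 0"
 shows "AE x in lborel. g x = 0"
proof -
 have "AE x in lborel. x \<in> {- real n..real n} --> g x = 0" for n by (rule AE_zero_of_interval_integrals_local[OF g zero])
 then have "AE x in lborel. \<forall>n. x \<in> {- real n..real n} --> g x = 0" unfolding AE_all_countable by blast
 then show ?thesis proof eventually_elim
  case (elim x)
  obtain n where "\<bar>x\<bar> <= real n" using real_arch_simple by blast
  then show ?case using elim by (auto simp: abs_le_iff)
 qed
qed

lemma K0_diff:
 assumes "a <= b" "xi \<noteq> 0" shows "K0 b xi - K0 a xi = (LINT t:{a..b}|lborel. cis (- (t * xi)))"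
proof -
 have "K0 y xi = primitive (%t. cis (- (t * xi))) y" for y
  using K_altdef[OF assms(2)] assms(2) by (simp add: K0_def K_def[symmetric])
 then show ?thesis using ac_onD(2)[OF ac_on_primitive[of "%t. cis (- (t * xi))"] assms(1)] cis_set_integrable by simp
qed

text \<open>Both sides are integrated over [a, b]. On the left the transform moves to step
  functions, whose transforms are explicit, and Fubini exchanges the integrals. This ties the
  abstract isometry to the Fourier integral.\<close>

lemma Fo_integrable:
 assumes f: "f \<in> L2" and i: "integrable lborel f"
 shows "AE t in lborel. fn (Fo (toL f)) t = (LINT y|lborel. f y * cis (- (t * y))) / cor (sqrt (2 * cos_const))"
proof -
 let ?N = "cor (sqrt (2 * cos_const))"
 have N: "?N \<noteq> 0" using cos_const_pos by simp
 define F where "F t = (LINT y|lborel. f y * cis (- (t * y)))" for t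
 note [measurable] = L2_measurable[OF f]
 have Fm [measurable]: "F \<in> borel_measurable borel"
  unfolding F_def[abs_def] by (rule lborel.borel_measurable_lebesgue_integral) measurable
 have Fb: "cmod (F t) <= (LINT y|lborel. cmod (f y))" for t
  unfolding F_def by (rule order_trans[OF integral_norm_bound]) (simp add: norm_mult)
 have Fi: "set_integrable lborel {a..b} F" for a b unfolding set_integrable_def
 proof (rule Bochner_Integration.integrable_bound)
  show "integrable lborel (%x. indicator {a..b} x * (LINT y|lborel. cmod (f y)))"
   by (intro integrable_mult_left integrable_indicator_Icc)
  show "AE x in lborel. cmod (indicator {a..b} x *\<^sub>R F x) <= norm (indicator {a..b} x * (LINT y|lborel. cmod (f y)))"
   using Fb by (intro AE_I2) (auto simp: indicator_def intro: order_trans[OF _ abs_ge_self])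
 qed measurable
 have gi: "set_integrable lborel {a..b} (%t. fn (Fo (toL f)) t)" for a b by (rule L2_set_integrable) simp
 have "AE t in lborel. fn (Fo (toL f)) t - F t / ?N = 0" proof (rule AE_zero_of_all_interval_integrals)
  show "set_integrable lborel {a..b} (%t. fn (Fo (toL f)) t - F t / ?N)" for a b
   by (intro set_integral_diff gi set_integrable_divide Fi)
  fix a b :: real assume ab: "a <= b"
  have conv: "primitive (fn (Fo (toL f))) b' = (LINT y|lborel. f y * E_step b' y)" for b' proof -
   have "primitive (fn (Fo (toL f))) b' = cip (toL f) (E'_L2 b')"
    unfolding cip_e_L2[symmetric] cip_Fo using Fo_e(2)[of 1 b'] by simp
   then show ?thesis by (simp add: E'_L2_def cip_toL f l2_inner_def cnj_E_step)
  qed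
  have Ei: "integrable lborel (%y. f y * E_step b' y)" for b' by (intro L2_mult_integrable f) simp
  have "(LINT t:{a..b}|lborel. fn (Fo (toL f)) t) = primitive (fn (Fo (toL f))) b - primitive (fn (Fo (toL f))) a"
   using ac_onD(2)[OF ac_on_primitive[OF gi] ab] by simp
  also have "... = (LINT y|lborel. f y * E_step b y - f y * E_step a y)"
   unfolding conv by (rule Bochner_Integration.integral_diff[symmetric]; rule Ei)
  also have "... = (LINT y|lborel. (LINT t|lborel. indicator {a..b} t *\<^sub>R (f y * cis (- (t * y)))) / ?N)"
  proof (rule integral_cong_AE)
   show "AE y in lborel. f y * E_step b y - f y * E_step a y = (LINT t|lborel. indicator {a..b} t *\<^sub>R (f y * cis (- (t * y)))) / ?N"
    using AE_lborel_singleton[of 0]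
   proof eventually_elim
    case (elim y)
    have "f y * E_step b y - f y * E_step a y = f y * (K0 b y - K0 a y) / ?N"
     by (simp add: E_step_def right_diff_distrib diff_divide_distrib)
    also have "f y * (K0 b y - K0 a y) = (LINT t|lborel. indicator {a..b} t *\<^sub>R (f y * cis (- (t * y))))"
     unfolding K0_diff[OF ab elim] set_lebesgue_integral_def integral_mult_right_zero[symmetric]
     by (simp only: mult_scaleR_right)
    finally show ?case .
   qed
  qed measurable
  also have "... = (LINT y|lborel. (LINT t|lborel. indicator {a..b} t *\<^sub>R (f y * cis (- (t * y))))) / ?N" by simp
  also have "(LINT y|lborel. (LINT t|lborel. indicator {a..b} t *\<^sub>R (f y * cis (- (t * y)))))
    = (LINT t|lborel. (LINT y|lborel. indicator {a..b} t *\<^sub>R (f y * cis (- (t * y)))))"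
  proof (rule lborel_pair.Fubini_integral)
   show "integrable (lborel \<Otimes>\<^sub>M lborel) (%(t, y). indicator {a..b} t *\<^sub>R (f y * cis (- (t * y))))"
   proof (rule Bochner_Integration.integrable_bound)
    show "integrable (lborel \<Otimes>\<^sub>M lborel) (%(t, y). cor (indicator {a..b} t) * f y)"
     by (intro lborel_pair_integrable_mult integrable_of_real integrable_indicator_Icc i)
    show "AE z in lborel \<Otimes>\<^sub>M lborel. norm (case z of (t, y) => indicator {a..b} t *\<^sub>R (f y * cis (- (t * y))))
      <= norm (case z of (t, y) => cor (indicator {a..b} t) * f y)"
     by (intro AE_I2) (auto simp: norm_mult indicator_def)
   qed measurable
  qed
  also have "... = (LINT t:{a..b}|lborel. F t)" by (simp add: set_lebesgue_integral_def F_def)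
  finally have e: "(LINT t:{a..b}|lborel. fn (Fo (toL f)) t) = (LINT t:{a..b}|lborel. F t / ?N)"
   by (simp add: set_integral_divide_zero)
  have d: "set_integrable lborel {a..b} (%t. F t / ?N)" by (intro set_integrable_divide Fi)
  show "(LINT t:{a..b}|lborel. fn (Fo (toL f)) t - F t / ?N) = 0" unfolding set_integral_diff(2)[OF gi d] e by simp
 qed
 then show ?thesis by eventually_elim (simp add: F_def)
qed

lemma L2_compact_integrable:
 assumes f: "f \<in> L2" and s: "!!x. x \<notin> {-r..r} ==> f x = 0" shows "integrable lborel f"
proof -
 have "(%x. indicator {-r..r} x *\<^sub>R f x) = f" using s by (auto simp: indicator_def fun_eq_iff)
 then show ?thesis using L2_set_integrable[OF f, of "-r" r] by (simp add: set_integrable_def)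
qed

text \<open>Integration by parts against the primitive e of the exponential, which satisfies cis = 1
  - i xi e; the term with the constant 1 drops out because q has integral 0.\<close>

lemma fourier_integral_deriv:
 assumes ac: "ac_on UNIV p q" and L: "p \<in> L2" "q \<in> L2" and r: "0 < r"
  and s: "!!x. x \<notin> {-r<..<r} ==> p x = 0" "!!x. x \<notin> {-r<..<r} ==> q x = 0"
 shows "(LINT y|lborel. q y * cis (- (xi * y))) = \<i> * cor xi * (LINT y|lborel. p y * cis (- (xi * y)))"
proof -
 define e where "e = primitive (%y. cis (- (y * xi)))"
 have ace: "ac_on UNIV e (%y. cis (- (y * xi)))" unfolding e_def by (intro ac_on_primitive cis_set_integrable)
 have ce: "cis (- (y * xi)) = 1 - \<i> * cor xi * e y" for y using K_eq[of xi y] by (simp add: e_def K_def)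
 have ec: "continuous_on UNIV e" by (rule ac_on_continuous[OF ace]) simp
 let ?A = "{-r..r}"
 have cc: "continuous_on UNIV (%y. cis (- (y * xi)))" by (intro continuous_intros)
 have i: "set_integrable lborel ?A q" "set_integrable lborel ?A (%y. q y * e y)" "set_integrable lborel ?A (%y. p y * cis (- (y * xi)))"
  by (intro set_integrable_mult_continuous L2_set_integrable L ec cc)+
 have "(LINT y:?A|lborel. q y * e y + p y * cis (- (y * xi))) = p r * e r - p (-r) * e (-r)"
  using ac_onD(2)[OF ac_on_mult[OF ac ace], of "-r" r] r by simp
 then have 1: "(LINT y:?A|lborel. q y * e y) = - (LINT y:?A|lborel. p y * cis (- (y * xi)))"
  using s(1)[of r] s(1)[of "-r"] by (simp add: set_integral_add(2)[OF i(2,3)] eq_neg_iff_add_eq_0)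
 have 2: "(LINT y:?A|lborel. q y) = 0" using ac_onD(2)[OF ac, of "-r" r] r s(1)[of r] s(1)[of "-r"] by simp
 have "(LINT y|lborel. q y * cis (- (y * xi))) = (LINT y:?A|lborel. q y - \<i> * cor xi * (q y * e y))"
  unfolding ce by (subst integral_eq_set_integral[of ?A]) (auto simp: s algebra_simps)
 also have "... = \<i> * cor xi * (LINT y:?A|lborel. p y * cis (- (y * xi)))"
  using i by (simp add: set_integral_diff 1 2)
 also have "(LINT y:?A|lborel. p y * cis (- (y * xi))) = (LINT y|lborel. p y * cis (- (y * xi)))"
  by (rule integral_eq_set_integral[symmetric]) (use s(1) in force)
 finally show ?thesis by (simp only: mult.commute[of xi])
qed

text \<open>Compactly supported truncations are covered by \<open>fourier_integral_deriv\<close>;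
  they and their derivatives converge in norm, and the multiplier relation survives along a
  subsequence that converges almost everywhere.\<close>

theorem Fo_weak_deriv:
 assumes w: "weak_deriv phi g"
 shows "AE xi in lborel. fn (Fo (toL g)) xi = \<i> * cor xi * fn (Fo (toL phi)) xi"
proof -
 have phi: "phi \<in> L2" and g: "g \<in> L2" using w by (auto simp: weak_deriv_def)
 obtain v where v: "ac_on UNIV v g" "ae_eq phi v" using weak_deriv_imp_ac[OF w] by blast
 have "continuous_on UNIV v" by (rule ac_on_continuous[OF v(1)]) simp
 then have vm [measurable]: "v \<in> borel_measurable borel" by (rule borel_measurable_continuous_onI)
 note [measurable] = L2_measurable[OF g]
 have vL: "v \<in> L2" by (rule L2_dominated[OF vm phi, of 1]) (use v(2) in \<open>auto simp: ae_eq_def elim: eventually_mono\<close>)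
 have tv: "toL phi = toL v" using v(2) phi vL by (simp add: toL_eq_iff)
 define h where "h x = cor (cmod (g x)) + cor (cmod (v x))" for x
 have hL: "h \<in> L2" unfolding h_def[abs_def] proof (rule L2_add)
  show "(%x. cor (cmod (g x))) \<in> L2" by (rule L2_dominated[where f = g and C = 1]) (use g in auto)
  show "(%x. cor (cmod (v x))) \<in> L2" by (rule L2_dominated[where f = v and C = 1]) (use vL in auto)
 qed
 define a where "a n = real (Suc n)" for n
 define p where "p n x = v x * trap (a n) (a n + 1) x" for n x
 define q where "q n x = g x * trap (a n) (a n + 1) x + v x * trap' (a n) (a n + 1) x" for n x
 have hn: "cmod (h x) = cmod (g x) + cmod (v x)" for x by (simp add: h_def flip: of_real_add)
 have pb: "cmod (p n x) <= 1 * cmod (h x)" for n x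
  unfolding hn p_def norm_mult using mult_left_mono[OF trap_bounds(1)[of "a n" x], of "cmod (v x)"] by (simp add: add_increasing)
 have qb: "cmod (q n x) <= 1 * cmod (h x)" for n x
  unfolding hn q_def using mult_left_mono[OF trap_bounds(1)[of "a n" x], of "cmod (g x)"]
   mult_left_mono[OF trap_bounds(2)[of "a n" "a n + 1" x], of "cmod (v x)"]
  by (intro order_trans[OF norm_triangle_ineq]) (simp add: norm_mult)
 have pqm: "p n \<in> borel_measurable borel" "q n \<in> borel_measurable borel" for n
  unfolding p_def[abs_def] q_def[abs_def] by measurable
 have L: "p n \<in> L2" "q n \<in> L2" for n
  using L2_dominated[OF pqm(1) hL AE_I2[OF pb]] L2_dominated[OF pqm(2) hL AE_I2[OF qb]] by auto
 have eq: "AE xi in lborel. fn (Fo (toL (q n))) xi = \<i> * cor xi * fn (Fo (toL (p n))) xi" for n proof -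
  have supp: "p n x = 0" "q n x = 0" if "x \<notin> {- (a n + 1)<..<a n + 1}" for x
   using that by (auto simp: p_def q_def trap_def trap'_def indicator_def a_def)
  have i: "integrable lborel (p n)" "integrable lborel (q n)"
   by (rule L2_compact_integrable[where r = "a n + 1"], rule L, rule supp, force)+
  have ac: "ac_on UNIV (p n) (q n)"
   unfolding p_def[abs_def] q_def[abs_def] by (intro ac_on_mult v ac_trap) (auto simp: a_def)
  have d: "(LINT y|lborel. q n y * cis (- (xi * y))) = \<i> * cor xi * (LINT y|lborel. p n y * cis (- (xi * y)))" for xi
   by (rule fourier_integral_deriv[OF ac L, where r = "a n + 1"]; (rule supp, assumption)?) (simp add: a_def)
  show ?thesis using Fo_integrable[OF L(1) i(1)] Fo_integrable[OF L(2) i(2)] by eventually_elim (simp add: d)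
 qed
 have ev: "\<forall>\<^sub>F n in sequentially. p n x = v x & q n x = g x" for x proof -
  obtain N where N: "\<bar>x\<bar> <= real N" using real_arch_simple by blast
  show ?thesis unfolding eventually_sequentially
   by (intro exI[of _ N]) (use N in \<open>auto simp: p_def q_def trap_def trap'_def indicator_def a_def min_def max_def\<close>)
 qed
 have lim: "(%n. p n x) ----> v x" "(%n. q n x) ----> g x" for x
  using ev[of x] by (auto intro!: tendsto_eventually elim: eventually_mono)
 have "(%n. toL (p n)) ----> toL v" "(%n. toL (q n)) ----> toL g"
  using toL_L2_tendsto(2)[OF pqm(1) vm hL AE_I2[OF lim(1)] AE_I2[OF pb]]
   toL_L2_tendsto(2)[OF pqm(2) L2_measurable[OF g] hL AE_I2[OF lim(2)] AE_I2[OF qb]] by auto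
 then have Fp: "(%n. Fo (toL (p n))) ----> Fo (toL v)" and Fq: "(%n. Fo (toL (q n))) ----> Fo (toL g)"
  using continuous_on_tendsto_compose[OF Fo_continuous(1)[of UNIV]] by auto
 obtain r where r: "strict_mono r" "AE xi in lborel. (%n. fn (Fo (toL (p (r n)))) xi) ----> fn (Fo (toL v)) xi"
  using l2_tendsto_AE_subseq[OF Fp] by blast
 obtain s where s: "strict_mono s" "AE xi in lborel. (%n. fn (Fo (toL (q (r (s n))))) xi) ----> fn (Fo (toL g)) xi"
  using l2_tendsto_AE_subseq[OF LIMSEQ_subseq_LIMSEQ[OF Fq r(1), unfolded o_def]] by blast
 have "AE xi in lborel. \<forall>n. fn (Fo (toL (q n))) xi = \<i> * cor xi * fn (Fo (toL (p n))) xi"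
  unfolding AE_all_countable using eq by blast
 with r(2) s(2) show ?thesis unfolding tv proof eventually_elim
  case (elim xi)
  have "(%n. fn (Fo (toL (p (r (s n))))) xi) ----> fn (Fo (toL v)) xi"
   using LIMSEQ_subseq_LIMSEQ[OF elim(1) s(1)] by (simp add: o_def)
  from tendsto_mult_left[OF this, of "\<i> * cor xi"] elim show ?case by (simp add: LIMSEQ_unique)
 qed
qed

section \<open>Fourier transform of derivatives and the Laplacian\<close>

text \<open>Plancherel against test functions, whose own derivative relation on the Fourier side is
  already known.\<close>

theorem weak_deriv_of_Fo:
 assumes phi: "phi \<in> L2" and g: "g \<in> L2"
  and eq: "AE xi in lborel. fn (Fo (toL g)) xi = \<i> * cor xi * fn (Fo (toL phi)) xi"
 shows "weak_deriv phi g" unfolding weak_deriv_def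
proof (intro conjI allI impI phi g)
 fix eta assume t: "test_function eta"
 define h where "h = toL (%x. cor (eta x))"
 define k where "k = toL (%x. cor (deriv eta x))"
 have "(LINT x|lborel. phi x * cor (deriv eta x)) = cip (toL phi) k"
  using test_function_L2[OF t] by (simp add: k_def cip_toL phi l2_inner_def)
 also have "... = cip (Fo (toL phi)) (Fo k)" by (simp add: Fo_cip)
 also have "... = (LINT xi|lborel. - (fn (Fo (toL g)) xi * cnj (fn (Fo h) xi)))" unfolding cip_eq
 proof (rule integral_cong_AE)
  show "AE xi in lborel. fn (Fo (toL phi)) xi * cnj (fn (Fo k) xi) = - (fn (Fo (toL g)) xi * cnj (fn (Fo h) xi))"
   using eq Fo_weak_deriv[OF test_function_L2(3)[OF t]] unfolding h_def k_def by eventually_elim simp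
 qed measurable
 also have "... = - cip (toL g) h" by (simp add: cip_eq[symmetric] Fo_cip)
 also have "cip (toL g) h = (LINT x|lborel. g x * cor (eta x))"
  using test_function_L2[OF t] by (simp add: h_def cip_toL g l2_inner_def)
 finally show "(LINT x|lborel. phi x * cor (deriv eta x)) = - (LINT x|lborel. g x * cor (eta x))" .
qed

subsection \<open>The spectral resolution of the Laplacian\<close>

text \<open>The function f of the Laplacian, as the Fourier multiplier with symbol f(xi^2).\<close>

definition sq_mult :: "(real => real) => l2 => l2" where
 "sq_mult f u = Fo' (mlt (%xi. cor (f (xi\<^sup>2))) (Fo u))"

definition EL :: "real set => (real => complex) => (real => complex)" where
 "EL B phi = fn (sq_mult (indicator B) (toL phi))"

lemma bdd_mult_sq: "bounded_borel f ==> bdd_mult (%xi. cor (f (xi\<^sup>2)))"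
 by (auto simp: bdd_mult_def bounded_borel_def)

lemma sq_mult_sym: "bounded_borel f ==> cip (sq_mult f u) v = cip u (sq_mult f v)" proof -
 assume f: "bounded_borel f"
 have "cip (sq_mult f u) v = cip (mlt (%xi. cor (f (xi\<^sup>2))) (Fo u)) (Fo v)"
  using Fo_cip[of "sq_mult f u" v] by (simp add: sq_mult_def)
 also have "... = cip (Fo u) (mlt (%xi. cor (f (xi\<^sup>2))) (Fo v))"
  using cip_mlt[OF bdd_mult_sq[OF f], of "Fo u" "Fo v"] by simp
 also have "... = cip u (sq_mult f v)" using Fo_cip[of u "sq_mult f v"] by (simp add: sq_mult_def)
 finally show ?thesis .
qed

lemma sq_mult_mult: "bounded_borel f ==> bounded_borel g ==> sq_mult f (sq_mult g u) = sq_mult (%s. f s * g s) u"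
 by (simp add: sq_mult_def mlt_mlt bdd_mult_sq)

lemma norm_sq_mult: "norm (sq_mult f u) = norm (mlt (%xi. cor (f (xi\<^sup>2))) (Fo u))" by (simp add: sq_mult_def)

lemma sq_mult_linear: "bounded_borel f ==> linear (sq_mult f)" unfolding sq_mult_def[abs_def]
 using linear_compose[OF linear_compose[OF Fo_linear(1) mlt_linear[OF bdd_mult_sq]] Fo_linear(2)] by (simp add: o_def)

lemma sq_mult_add:
 assumes "bounded_borel f" "bounded_borel g"
 shows "sq_mult (%s. f s + g s) u = sq_mult f u + sq_mult g u"
proof -
 have "mlt (%xi. cor (f (xi\<^sup>2) + g (xi\<^sup>2))) (Fo u)
   = mlt (%xi. cor (f (xi\<^sup>2))) (Fo u) + mlt (%xi. cor (g (xi\<^sup>2))) (Fo u)" unfolding l2_eq_iff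
  using fn_mlt_bdd[OF bdd_mult_sq[OF bounded_borel_add[OF assms]], of "Fo u"]
   fn_mlt_bdd[OF bdd_mult_sq[OF assms(1)], of "Fo u"] fn_mlt_bdd[OF bdd_mult_sq[OF assms(2)], of "Fo u"]
   fn_add[of "mlt (%xi. cor (f (xi\<^sup>2))) (Fo u)" "mlt (%xi. cor (g (xi\<^sup>2))) (Fo u)"]
  by eventually_elim (simp add: algebra_simps)
 then show ?thesis by (simp add: sq_mult_def linear_add[OF Fo_linear(2)])
qed

lemma sq_mult_const: "sq_mult (%_. 1) u = u" "sq_mult (%_. 0) u = 0" proof -
 have "mlt (%_. 1) v = v" for v unfolding cs_def[symmetric] by simp
 then show "sq_mult (%_. 1) u = u" by (simp add: sq_mult_def)
 have "cs 0 v = 0" for v using scaleR_eq_cs[of 0 v] by simp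
 then show "sq_mult (%_. 0) u = 0" by (simp add: sq_mult_def linear_0[OF Fo_linear(2)] flip: cs_def)
qed

lemma pvm_EL: "pvm EL" unfolding pvm_def proof (intro conjI ballI allI impI)
 fix B C :: "real set" and phi psi assume B: "B \<in> sets borel" and phi: "phi \<in> L2"
 show "EL B phi \<in> L2" by (simp add: EL_def)
 { assume psi: "psi \<in> L2"
  show "l2_inner (EL B phi) psi = l2_inner phi (EL B psi)"
   using sq_mult_sym[of "indicator B" "toL phi" "toL psi"] B cip_toL[of "EL B phi" psi] cip_toL[of phi "EL B psi"] phi psi
   by (auto simp: EL_def) }
 assume C: "C \<in> sets borel"
 have "(%s. indicator B s * indicator C s :: real) = indicator (B \<inter> C)" by (auto simp: indicator_def fun_eq_iff)
 then have "sq_mult (indicator (B \<inter> C)) (toL phi) = sq_mult (indicator B) (sq_mult (indicator C) (toL phi))"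
  using B C by (simp add: sq_mult_mult bounded_borel_indicator)
 then show "ae_eq (EL (B \<inter> C) phi) (EL B (EL C phi))" by (simp add: EL_def ae_eq_def)
next
 fix phi assume phi: "phi \<in> L2"
 have i: "indicator {} = (%_. 0 :: real)" "indicator UNIV = (%_. 1 :: real)" by (auto simp: fun_eq_iff)
 show "ae_eq (EL {} phi) (%x. 0)" using fn_zero by (simp add: EL_def i sq_mult_const ae_eq_def)
 show "ae_eq (EL UNIV phi) phi" using fn_toL[OF phi] by (simp add: EL_def i sq_mult_const ae_eq_def)
next
 fix B :: "nat => real set" and phi assume B: "range B \<subseteq> sets borel" "disjoint_family B" and phi: "phi \<in> L2"
 define u where "u = toL phi"
 have Bn: "B n \<in> sets borel" for n using B by auto
 have bi: "bounded_borel (%s. \<Sum>i<n. indicator (B i) s)" for n proof (induction n)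
  case (Suc n)
  then show ?case using bounded_borel_add[OF Suc bounded_borel_indicator[OF Bn]] by simp
 qed (simp add: bounded_borel_const)
 have sum: "sq_mult (%s. \<Sum>i<n. indicator (B i) s) u = (\<Sum>i<n. sq_mult (indicator (B i)) u)" for n proof (induction n)
  case (Suc n)
  then show ?case using sq_mult_add[OF bi bounded_borel_indicator[OF Bn], of n n u] by simp
 qed (simp add: sq_mult_const)
 have sumind: "(\<Sum>i<n. indicator (B i) s) = (indicator (\<Union>i<n. B i) s :: real)" for n s
  using B(2) by (subst indicator_UN_disjoint) (auto simp: disjoint_family_on_def)
 have "(%n. sq_mult (%s. \<Sum>i<n. indicator (B i) s) u) ----> sq_mult (indicator (\<Union>i. B i)) u" unfolding sq_mult_def
 proof (rule continuous_on_tendsto_compose[OF Fo_continuous(2)[of UNIV]])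
  show "(%n. mlt (%xi. cor (\<Sum>i<n. indicator (B i) (xi\<^sup>2))) (Fo u))
    ----> mlt (%xi. cor (indicator (\<Union>i. B i) (xi\<^sup>2))) (Fo u)" unfolding mlt_def
  proof (rule toL_L2_tendsto(2)[where h = "fn (Fo u)" and C = 1])
   show "AE xi in lborel. (%n. cor (\<Sum>i<n. indicator (B i) (xi\<^sup>2)) * fn (Fo u) xi)
     ----> cor (indicator (\<Union>i. B i) (xi\<^sup>2)) * fn (Fo u) xi"
   proof (intro AE_I2 tendsto_intros)
    fix xi :: real
    show "(%n. (\<Sum>i<n. indicator (B i) (xi\<^sup>2))) ----> (indicator (\<Union>i. B i) (xi\<^sup>2) :: real)"
     unfolding sumind by (rule LIMSEQ_indicator_UN)
   qed
   show "AE xi in lborel. cmod (cor (\<Sum>i<n. indicator (B i) (xi\<^sup>2)) * fn (Fo u) xi) <= 1 * cmod (fn (Fo u) xi)" for n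
    unfolding sumind by (auto simp: norm_mult indicator_def)
   show "(%xi. cor (\<Sum>i<n. indicator (B i) (xi\<^sup>2)) * fn (Fo u) xi) \<in> borel_measurable borel" for n
    using bdd_mult_measurable[OF bdd_mult_sq[OF bi]] by measurable
   have "(\<Union>i. B i) \<in> sets borel" using Bn by auto
   then show "(%xi. cor (indicator (\<Union>i. B i) (xi\<^sup>2)) * fn (Fo u) xi) \<in> borel_measurable borel"
    using bdd_mult_measurable[OF bdd_mult_sq[OF bounded_borel_indicator]] by measurable
  qed simp
 qed auto
 then have lim: "(%n. norm (sq_mult (indicator (\<Union>i. B i)) u - (\<Sum>i<n. sq_mult (indicator (B i)) u))) ----> 0"
  unfolding sum by (subst norm_minus_commute) (simp add: tendsto_norm_zero_iff LIM_zero_iff)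
 have "l2_norm (%x. EL (\<Union>i. B i) phi x - (\<Sum>i<n. EL (B i) phi x))
   = norm (sq_mult (indicator (\<Union>i. B i)) u - (\<Sum>i<n. sq_mult (indicator (B i)) u))" for n
 proof -
  let ?w = "sq_mult (indicator (\<Union>i. B i)) u - (\<Sum>i<n. sq_mult (indicator (B i)) u)"
  have ae: "AE x in lborel. fn ?w x = EL (\<Union>i. B i) phi x - (\<Sum>i<n. EL (B i) phi x)"
   using fn_diff[of "sq_mult (indicator (\<Union>i. B i)) u" "\<Sum>i<n. sq_mult (indicator (B i)) u"]
    fn_sum[of "{..<n}" "%i. sq_mult (indicator (B i)) u"] by (auto simp: EL_def u_def elim!: AE_mp)
  have "(LINT x|lborel. (cmod (EL (\<Union>i. B i) phi x - (\<Sum>i<n. EL (B i) phi x)))\<^sup>2) = (LINT x|lborel. (cmod (fn ?w x))\<^sup>2)"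
  proof (rule integral_cong_AE)
   show "AE x in lborel. (cmod (EL (\<Union>i. B i) phi x - (\<Sum>i<n. EL (B i) phi x)))\<^sup>2 = (cmod (fn ?w x))\<^sup>2"
    using ae by eventually_elim simp
  qed (simp_all add: EL_def)
  then show ?thesis by (simp add: l2_norm_def norm_l2_square[symmetric])
 qed
 then show "(%n. l2_norm (%x. EL (\<Union>i. B i) phi x - (\<Sum>i<n. EL (B i) phi x))) ----> 0" using lim by simp
qed

interpretation EL: l2_pvm EL by unfold_locales (rule pvm_EL)

lemma EL_P: "B \<in> sets borel ==> EL.P B u = sq_mult (indicator B) u" by (simp add: lift_family_def EL_def)

text \<open>The spectral measure of u is the image of |Fo u|^2 d xi under the map xi ->
  xi^2.\<close>

lemma EL_mu_integral:
 assumes f: "bounded_borel f"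
 shows "(\<integral>s. f s \<partial>EL.mu u) = inner (sq_mult f u) u"
proof -
 note [measurable] = bounded_borel_measurable[OF f]
 define d where "d = density lborel (%xi. ennreal ((cmod (fn (Fo u) xi))\<^sup>2))"
 have "EL.mu u = distr d borel (%xi. xi\<^sup>2)" proof (rule measure_eqI)
  fix B assume "B \<in> sets (EL.mu u)"
  then have B [measurable]: "B \<in> sets borel" by simp
  have bm: "bdd_mult (%xi. cor (indicator B (xi\<^sup>2)))" using bdd_mult_sq[OF bounded_borel_indicator[OF B]] .
  have "emeasure (EL.mu u) B = ennreal ((norm (mlt (%xi. cor (indicator B (xi\<^sup>2))) (Fo u)))\<^sup>2)"
   by (simp add: EL.emeasure_mu B EL_P norm_sq_mult)
  also have "... = (\<integral>\<^sup>+xi. ennreal ((cmod (fn (mlt (%xi. cor (indicator B (xi\<^sup>2))) (Fo u)) xi))\<^sup>2) \<partial>lborel)"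
   by (rule nn_integral_norm_l2[symmetric])
  also have "... = (\<integral>\<^sup>+xi. ennreal ((cmod (fn (Fo u) xi))\<^sup>2) * indicator ((%xi. xi\<^sup>2) -` B) xi \<partial>lborel)"
   by (rule nn_integral_cong_AE) (use fn_mlt_bdd[OF bm, of "Fo u"] in eventually_elim, auto simp: indicator_def)
  also have "... = emeasure d ((%xi. xi\<^sup>2) -` B)"
   unfolding d_def using measurable_sets[of "%xi::real. xi\<^sup>2" borel borel B] B by (subst emeasure_density) auto
  also have "... = emeasure (distr d borel (%xi. xi\<^sup>2)) B" by (subst emeasure_distr) (auto simp: d_def)
  finally show "emeasure (EL.mu u) B = emeasure (distr d borel (%xi. xi\<^sup>2)) B" .
 qed simp
 then have "(\<integral>s. f s \<partial>EL.mu u) = (\<integral>xi. f (xi\<^sup>2) \<partial>d)" by (simp add: integral_distr d_def)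
 also have "... = (LINT xi|lborel. (cmod (fn (Fo u) xi))\<^sup>2 * f (xi\<^sup>2))" unfolding d_def by (subst integral_density) auto
 also have "... = (LINT xi|lborel. Re (fn (mlt (%xi. cor (f (xi\<^sup>2))) (Fo u)) xi * cnj (fn (Fo u) xi)))"
 proof (rule integral_cong_AE)
  show "AE xi in lborel. (cmod (fn (Fo u) xi))\<^sup>2 * f (xi\<^sup>2)
    = Re (fn (mlt (%xi. cor (f (xi\<^sup>2))) (Fo u)) xi * cnj (fn (Fo u) xi))"
   using fn_mlt_bdd[OF bdd_mult_sq[OF f], of "Fo u"]
  proof eventually_elim
   case (elim xi)
   have "fn (mlt (%xi. cor (f (xi\<^sup>2))) (Fo u)) xi * cnj (fn (Fo u) xi)
     = cor (f (xi\<^sup>2) * (cmod (fn (Fo u) xi))\<^sup>2)"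
    unfolding elim by (simp only: mult.assoc complex_norm_square[symmetric] of_real_mult of_real_power)
   then show ?case by simp
  qed
 qed measurable
 also have "... = inner (mlt (%xi. cor (f (xi\<^sup>2))) (Fo u)) (Fo u)" unfolding inner_l2_def cip_eq
  by (rule Bochner_Integration.integral_Re) (rule l2_inner_integrable; simp)
 also have "... = inner (sq_mult f u) u" using Fo_inner(1)[of "sq_mult f u" u] by (simp add: sq_mult_def)
 finally show ?thesis .
qed

lemma EL_T:
 assumes f: "bounded_borel f" shows "EL.T f u = sq_mult f u"
proof (rule inner_eq_imp_eq)
 fix v
 have sym: "inner (sq_mult f v) u = inner (sq_mult f u) v" proof -
  have "inner (sq_mult f v) u = inner v (sq_mult f u)" using sq_mult_sym[OF f, of v u] by (simp only: inner_l2_def)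
  then show ?thesis by (simp only: inner_commute)
 qed
 note l = sq_mult_linear[OF f]
 have "inner (EL.T f u) v = (inner (sq_mult f (u + v)) (u + v) - inner (sq_mult f (u - v)) (u - v)) / 4"
  by (simp add: EL.inner_T f EL.form_def EL_mu_integral)
 also have "... = inner (sq_mult f u) v"
  using sym by (simp add: linear_add[OF l] linear_diff[OF l] inner_add_left inner_add_right inner_diff_left inner_diff_right)
 finally show "inner (EL.T f u) v = inner (sq_mult f u) v" .
qed

text \<open>On each level set of f the criterion \<open>sop_iff\<close> is a pointwise identity of
  multipliers, and countably many level sets cover the line.\<close>

theorem EL_sop_iff:
 assumes f [measurable]: "f \<in> borel_measurable borel"
 shows "(u, g) \<in> EL.sop f \<longleftrightarrow> (AE xi in lborel. fn (Fo g) xi = cor (f (xi\<^sup>2)) * fn (Fo u) xi)"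
proof -
 have step: "EL.P {x. \<bar>f x\<bar> <= real N} g = EL.T (EL.trunc f N) u \<longleftrightarrow>
   (AE xi in lborel. \<bar>f (xi\<^sup>2)\<bar> <= real N --> fn (Fo g) xi = cor (f (xi\<^sup>2)) * fn (Fo u) xi)" for N
 proof -
  have b1: "bdd_mult (%xi. cor (indicator {x. \<bar>f x\<bar> <= real N} (xi\<^sup>2)))"
   by (rule bdd_mult_sq[OF bounded_borel_indicator[OF EL.level_sets[OF f]]])
  have b2: "bdd_mult (%xi. cor (EL.trunc f N (xi\<^sup>2)))"
   by (rule bdd_mult_sq[OF EL.bounded_borel_trunc[OF f]])
  have inj: "Fo' a = Fo' b \<longleftrightarrow> a = b" for a b by (metis Fo_Fo')
  have "EL.P {x. \<bar>f x\<bar> <= real N} g = EL.T (EL.trunc f N) u \<longleftrightarrow>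
    mlt (%xi. cor (indicator {x. \<bar>f x\<bar> <= real N} (xi\<^sup>2))) (Fo g)
    = mlt (%xi. cor (EL.trunc f N (xi\<^sup>2))) (Fo u)"
   by (simp only: EL_P[OF EL.level_sets[OF f]] EL_T[OF EL.bounded_borel_trunc[OF f]] sq_mult_def inj)
  also have "... \<longleftrightarrow> (AE xi in lborel. cor (indicator {x. \<bar>f x\<bar> <= real N} (xi\<^sup>2)) * fn (Fo g) xi
    = cor (EL.trunc f N (xi\<^sup>2)) * fn (Fo u) xi)"
   unfolding mlt_def by (subst toL_eq_iff) (auto simp: ae_eq_def intro!: bdd_mult_L2 b1 b2)
  also have "... \<longleftrightarrow> (AE xi in lborel. \<bar>f (xi\<^sup>2)\<bar> <= real N --> fn (Fo g) xi = cor (f (xi\<^sup>2)) * fn (Fo u) xi)"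
   by (rule arg_cong[of _ _ "%P. AE xi in lborel. P xi"], rule ext) (simp add: indicator_def EL.trunc_def)
  finally show ?thesis .
 qed
 have "(u, g) \<in> EL.sop f \<longleftrightarrow> (AE xi in lborel. \<forall>N::nat. \<bar>f (xi\<^sup>2)\<bar> <= real N --> fn (Fo g) xi = cor (f (xi\<^sup>2)) * fn (Fo u) xi)"
  unfolding EL.sop_iff[OF f] step AE_all_countable ..
 also have "... \<longleftrightarrow> (AE xi in lborel. fn (Fo g) xi = cor (f (xi\<^sup>2)) * fn (Fo u) xi)"
 proof (rule arg_cong[of _ _ "%P. AE xi in lborel. P xi"], rule ext)
  fix xi
  obtain N :: nat where "\<bar>f (xi\<^sup>2)\<bar> <= real N" using real_arch_simple by blast
  then show "(\<forall>N::nat. \<bar>f (xi\<^sup>2)\<bar> <= real N --> fn (Fo g) xi = cor (f (xi\<^sup>2)) * fn (Fo u) xi)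
    = (fn (Fo g) xi = cor (f (xi\<^sup>2)) * fn (Fo u) xi)" by auto
 qed
 finally show ?thesis .
qed

text \<open>On the Fourier side two weak derivatives multiply by (i xi)^2 = -xi^2. Conversely the
  intermediate derivative is defined by the multiplier i xi, square integrable because |xi| <= 1 +
  xi^2.\<close>

theorem spectral_resolution_laplacian: "spectral_resolution laplacian EL" proof -
 have "(phi, f) \<in> laplacian \<longleftrightarrow> (phi, f) \<in> spectral_op EL (%s. s)" for phi f proof
  assume "(phi, f) \<in> laplacian"
  then obtain g where g: "f \<in> L2" "weak_deriv phi g" "weak_deriv g (%x. - f x)" by (auto simp: laplacian_def)
  have phi: "phi \<in> L2" using g(2) by (simp add: weak_deriv_def)
  have "toL (%x. - f x) = - toL f" using g(1) by (rule toL_uminus)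
  then have m: "Fo (toL (%x. - f x)) = - Fo (toL f)" by (simp add: linear_neg[OF Fo_linear(1)])
  have "AE xi in lborel. fn (Fo (toL f)) xi = cor (xi\<^sup>2) * fn (Fo (toL phi)) xi"
   using Fo_weak_deriv[OF g(2)] Fo_weak_deriv[OF g(3)] fn_uminus[of "Fo (toL f)"] unfolding m
  proof eventually_elim
   case (elim xi)
   have "fn (Fo (toL f)) xi = - (\<i> * cor xi * (\<i> * cor xi * fn (Fo (toL phi)) xi))"
    using elim by (metis minus_minus)
   then show ?case by (simp add: power2_eq_square mult_ac)
  qed
  then show "(phi, f) \<in> spectral_op EL (%s. s)" using phi g(1) by (simp add: EL.spectral_op_iff EL_sop_iff)
 next
  assume "(phi, f) \<in> spectral_op EL (%s. s)"
  then have phi: "phi \<in> L2" and f: "f \<in> L2"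
   and eq: "AE xi in lborel. fn (Fo (toL f)) xi = cor (xi\<^sup>2) * fn (Fo (toL phi)) xi"
   by (auto simp: EL.spectral_op_iff EL_sop_iff)
  define h where "h xi = \<i> * cor xi * fn (Fo (toL phi)) xi" for xi
  have hm [measurable]: "h \<in> borel_measurable borel" unfolding h_def[abs_def] by measurable
  define k where "k xi = cor (cmod (fn (Fo (toL phi)) xi)) + cor (cmod (fn (Fo (toL f)) xi))" for xi
  have cl: "(%xi. cor (cmod (fn w xi))) \<in> L2" for w by (rule L2_dominated[where f = "fn w" and C = 1]) auto
  have kL: "k \<in> L2" unfolding k_def[abs_def] by (intro L2_add cl)
  have hL: "h \<in> L2" proof (rule L2_dominated[OF hm kL, where C = 1])
   show "AE xi in lborel. cmod (h xi) <= 1 * cmod (k xi)" using eq proof eventually_elim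
    case (elim xi)
    have "\<bar>xi\<bar> <= 1 + xi\<^sup>2" using sum_squares_bound[of "\<bar>xi\<bar>" 1] by simp
    then have "\<bar>xi\<bar> * cmod (fn (Fo (toL phi)) xi) <= (1 + xi\<^sup>2) * cmod (fn (Fo (toL phi)) xi)" by (rule mult_right_mono) simp
    also have "... = cmod (k xi)" unfolding k_def elim of_real_add[symmetric] norm_of_real
     by (simp add: norm_mult norm_power algebra_simps)
    finally show ?case by (simp add: h_def norm_mult)
   qed
  qed
  define g where "g = fn (Fo' (toL h))"
  have g: "g \<in> L2" by (simp add: g_def)
  have Fg: "AE xi in lborel. fn (Fo (toL g)) xi = h xi" using fn_toL[OF hL] by (simp add: g_def)
  have w1: "weak_deriv phi g" by (rule weak_deriv_of_Fo[OF phi g]) (use Fg in \<open>simp add: h_def\<close>)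
  have "toL (%x. - f x) = - toL f" using f by (rule toL_uminus)
  then have m: "Fo (toL (%x. - f x)) = - Fo (toL f)" by (simp add: linear_neg[OF Fo_linear(1)])
  have w2: "weak_deriv g (%x. - f x)" proof (rule weak_deriv_of_Fo[OF g L2_uminus[OF f]])
   show "AE xi in lborel. fn (Fo (toL (%x. - f x))) xi = \<i> * cor xi * fn (Fo (toL g)) xi"
    unfolding m using Fg eq fn_uminus[of "Fo (toL f)"] by eventually_elim (simp add: h_def power2_eq_square mult_ac)
  qed
  show "(phi, f) \<in> laplacian" using f w1 w2 by (auto simp: laplacian_def)
 qed
 then have "laplacian = spectral_op EL (%s. s)" by (auto simp: set_eq_iff)
 then show ?thesis using pvm_EL by (simp add: spectral_resolution_def)
qed

text \<open>\<open>EL\<close> is the witness for the spectral resolution that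
  \<open>op_power\<close> quantifies over.\<close>

theorem op_power_laplacianI:
 assumes phi: "phi \<in> L2" and L: "(%xi. cor ((xi\<^sup>2) powr \<alpha>) * fn (Fo (toL phi)) xi) \<in> L2" (is "?h \<in> L2")
 shows "\<exists>g. (phi, g) \<in> op_power laplacian \<alpha> & (l2_norm g)\<^sup>2 = (norm (toL ?h))\<^sup>2"
proof -
 define g where "g = fn (Fo' (toL ?h))"
 have "(phi, g) \<in> spectral_op EL (%s. s powr \<alpha>)" using phi fn_toL[OF L] by (simp add: EL.spectral_op_iff EL_sop_iff g_def)
 then have "(phi, g) \<in> op_power laplacian \<alpha>" using spectral_resolution_laplacian by (auto simp: op_power_def)
 moreover have "(l2_norm g)\<^sup>2 = (norm (toL ?h))\<^sup>2" by (simp add: g_def l2_norm_fn)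
 ultimately show ?thesis by blast
qed

section \<open>The viscosity form\<close>

definition W :: "(l2 \<times> l2) set" where
 "W = {(u, g). weak_deriv (fn u) (fn g)}"

lemma W_toL:
 assumes "phi \<in> L2" "g \<in> L2"
 shows "(toL phi, toL g) \<in> W \<longleftrightarrow> weak_deriv phi g"
proof
 assume "(toL phi, toL g) \<in> W"
 then have w: "weak_deriv (fn (toL phi)) (fn (toL g))" by (simp add: W_def)
 show "weak_deriv phi g" by (rule weak_deriv_cong[OF w]) (use assms fn_toL in \<open>auto simp: ae_eq_def\<close>)
next
 assume w: "weak_deriv phi g"
 have "AE x in lborel. phi x = fn (toL phi) x" "AE x in lborel. g x = fn (toL g) x"
  using fn_toL[OF assms(1)] fn_toL[OF assms(2)] by (auto elim: eventually_mono)
 then have "weak_deriv (fn (toL phi)) (fn (toL g))" by (intro weak_deriv_cong[OF w]) (auto simp: ae_eq_def)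
 then show "(toL phi, toL g) \<in> W" by (simp add: W_def)
qed

text \<open>Turns the weak derivative into a family of real linear equations, continuous in (u, g):
  letting \<open>c\<close> run over the complex numbers recovers a complex identity from real parts.
  Linearity and closedness of \<open>W\<close> follow at once.\<close>

lemma W_iff:
 "(u, g) \<in> W \<longleftrightarrow> (\<forall>eta c. test_function eta -->
   inner u (cs c (toL (%x. cor (deriv eta x)))) + inner g (cs c (toL (%x. cor (eta x)))) = 0)"
proof -
 have *: "(LINT x|lborel. fn u x * cor (deriv eta x)) = - (LINT x|lborel. fn g x * cor (eta x))
   \<longleftrightarrow> (\<forall>c. inner u (cs c (toL (%x. cor (deriv eta x)))) + inner g (cs c (toL (%x. cor (eta x)))) = 0)"
  if t: "test_function eta" for eta
 proof -
  define z where "z = cip u (toL (%x. cor (deriv eta x))) + cip g (toL (%x. cor (eta x)))"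
  have 1: "(LINT x|lborel. fn u x * cor (deriv eta x)) = - (LINT x|lborel. fn g x * cor (eta x)) \<longleftrightarrow> z = 0"
   using test_function_L2[OF t] by (simp add: z_def cip_toL_right eq_neg_iff_add_eq_0)
  have 2: "inner u (cs c (toL (%x. cor (deriv eta x)))) + inner g (cs c (toL (%x. cor (eta x)))) = Re (cnj c * z)" for c
   by (simp add: z_def inner_l2_def cip_cs_right distrib_left)
  have "z = 0 \<longleftrightarrow> (\<forall>c. Re (cnj c * z) = 0)" proof
   assume *: "\<forall>c. Re (cnj c * z) = 0"
   then show "z = 0" using *[rule_format, of 1] *[rule_format, of \<i>] by (simp add: complex_eq_iff)
  qed simp
  then show ?thesis unfolding 1 2 .
 qed
 then show ?thesis by (auto simp: W_def weak_deriv_def)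
qed

lemma W_subspace: "subspace W" unfolding subspace_def proof (intro conjI ballI allI)
 show "0 \<in> W" by (simp add: zero_prod_def W_iff)
next
 fix p q assume "p \<in> W" "q \<in> W"
 then show "p + q \<in> W" by (cases p; cases q) (simp add: W_iff inner_add_left add_eq_0_iff)
next
 fix r p assume "p \<in> W"
 then show "r *\<^sub>R p \<in> W" by (cases p) (simp add: W_iff flip: distrib_left)
qed

lemma W_cs: "(u, g) \<in> W ==> (cs a u, cs a g) \<in> W" unfolding W_iff inner_cs cs_cs by blast

lemma W_closed: "closed W" proof -
 have "W = (\<Inter>eta\<in>{eta. test_function eta}. \<Inter>c. {p. inner (fst p) (cs c (toL (%x. cor (deriv eta x))))
   + inner (snd p) (cs c (toL (%x. cor (eta x)))) = 0})" by (auto simp: W_iff)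
 also have "closed ..." by (intro closed_INT ballI closed_Collect_eq continuous_intros)
 finally show ?thesis .
qed

lemma W_ac:
 assumes "(u, g) \<in> W"
 shows "\<exists>v. ac_on UNIV v (fn g) & (AE x in lborel. fn u x = v x)"
 using weak_deriv_imp_ac[of "fn u" "fn g"] assms by (auto simp: W_def ae_eq_def)

lemma W_I_ac:
 assumes "ac_on UNIV v g" "v \<in> L2" "g \<in> L2"
 shows "(toL v, toL g) \<in> W" using ac_imp_weak_deriv[OF assms] assms by (simp add: W_toL)

text \<open>The graph of u -> s u'. With s the square root of the coefficient, the squared norm of a
  pair is the form plus the squared norm of u.\<close>

definition gr :: "(real => complex) => (l2 \<times> l2) set" where
 "gr s = (%(u, g). (u, mlt s g)) ` W"

lemma gr_subspace: assumes "bdd_mult s" shows "subspace (gr s)" proof -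
 have "linear (%(u, g). (u, mlt s g))"
  by (rule linearI) (auto simp: linear_add[OF mlt_linear[OF assms]] linear_scale[OF mlt_linear[OF assms]])
 then show ?thesis unfolding gr_def by (rule linear_subspace_image[OF _ W_subspace])
qed

text \<open>Multiplication by the bounded inverse of s carries the graph back to the closed set
  \<open>W\<close>.\<close>

lemma gr_closed:
 assumes s: "bdd_mult s" and i: "bdd_mult (%x. 1 / s x)" and nz: "!!x. s x \<noteq> 0"
 shows "closed (gr s)" unfolding closed_sequential_limits
proof (intro allI impI, elim conjE)
 fix z l assume z: "\<forall>n. z n \<in> gr s" and lim: "z ----> l"
 have inv: "mlt (%x. 1 / s x) (mlt s g) = g" "mlt s (mlt (%x. 1 / s x) g) = g" for g
  using mlt_mlt[OF i s, of g] mlt_mlt[OF s i, of g] nz cs_1[of g] by (simp_all add: cs_def)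
 have "(fst (z n), mlt (%x. 1 / s x) (snd (z n))) \<in> W" for n using z[rule_format, of n] by (auto simp: gr_def inv)
 moreover have "(%n. (fst (z n), mlt (%x. 1 / s x) (snd (z n)))) ----> (fst l, mlt (%x. 1 / s x) (snd l))"
  by (intro tendsto_Pair tendsto_fst lim mlt_tendsto[OF i] tendsto_snd)
 ultimately have "(fst l, mlt (%x. 1 / s x) (snd l)) \<in> W" by (rule closed_sequentially[OF W_closed])
 then have "(fst l, mlt s (mlt (%x. 1 / s x) (snd l))) \<in> gr s" by (force simp: gr_def)
 then show "l \<in> gr s" by (simp add: inv)
qed

lemma norm_pair_square: "(norm (a, b))\<^sup>2 = (norm a)\<^sup>2 + (norm b)\<^sup>2"
 for a :: "'a::real_normed_vector" and b :: "'b::real_normed_vector" by (simp add: norm_Pair)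

lemma pythagoras: "inner x y = 0 ==> (norm (x + y))\<^sup>2 = (norm x)\<^sup>2 + (norm y)\<^sup>2"
 for x y :: "'a::real_inner" by (simp add: power2_norm_eq_inner inner_add_left inner_add_right inner_commute)

context coefficient
begin

definition sc :: "real => complex" where "sc x = cor (sqrt (c x))"

definition sce :: "real => real => complex" where "sce eps x = cor (sqrt (c x + eps))"

lemma bdd_sc: "bdd_mult sc" by (rule bdd_multI[of _ 1]) (auto simp: sc_def[abs_def] c_nonneg c_le_1)

lemma bdd_sce: "0 <= eps ==> bdd_mult (sce eps)" proof (rule bdd_multI[of _ "sqrt (1 + eps)"])
 assume "0 <= eps"
 then show "cmod (sce eps x) <= sqrt (1 + eps)" for x using c_nonneg[of x] c_le_1[of x] by (simp add: sce_def)
qed (simp add: sce_def[abs_def])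

lemma bdd_inv_sce: assumes "0 < eps" shows "bdd_mult (%x. 1 / sce eps x)" "sce eps x \<noteq> 0" proof -
 have pos: "0 < c x + eps" for x using c_nonneg[of x] assms by linarith
 show "sce eps x \<noteq> 0" using less_imp_neq[OF pos[of x]] by (auto simp: sce_def)
 show "bdd_mult (%x. 1 / sce eps x)" proof (rule bdd_multI[of _ "1 / sqrt eps"])
  show "cmod (1 / sce eps x) <= 1 / sqrt eps" for x
   using pos[of x] c_nonneg[of x] assms by (auto simp: sce_def norm_divide intro!: divide_left_mono)
 qed (simp add: sce_def[abs_def])
qed

text \<open>The closure of the limit form, kept as a closed subspace of the product: orthogonal
  projection of (f, 0) onto it is the variational form of u + H u = f.\<close>

definition M :: "(l2 \<times> l2) set" where "M = closure (gr sc)"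

lemma M_subspace: "subspace M" unfolding M_def by (intro subspace_closure gr_subspace bdd_sc)

lemma M_closed: "closed M" by (simp add: M_def)

lemma gr_M: "(u, g) \<in> W ==> (u, mlt sc g) \<in> M" unfolding M_def by (rule subsetD[OF closure_subset]) (force simp: gr_def)

definition Dv :: "(real => complex) => l2" where "Dv phi = toL (wderiv phi)"

lemma W_Dv: "phi \<in> W12 ==> (toL phi, Dv phi) \<in> W" by (simp add: Dv_def W_toL W12_L2 wderiv_L2 weak_deriv_wderiv)

lemma W_imp_W12: "(v, k) \<in> W ==> fn v \<in> W12 & Dv (fn v) = k" proof -
 assume "(v, k) \<in> W"
 then have w: "weak_deriv (fn v) (fn k)" by (simp add: W_def)
 then have "fn v \<in> W12" by (auto simp: W12_def)
 moreover have "Dv (fn v) = toL (fn k)"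
  unfolding Dv_def using wderiv_eq[OF w] wderiv_L2[OF calculation] by (simp add: toL_eq_iff del: toL_fn)
 ultimately show ?thesis by simp
qed

lemma visc_form_eq:
 assumes "phi \<in> W12" "psi \<in> W12" "0 <= eps"
 shows "visc_form c eps phi psi = cip (mlt (sce eps) (Dv phi)) (mlt (sce eps) (Dv psi))"
proof -
 note b = bdd_sce[OF assms(3)]
 note L = wderiv_L2[OF assms(1)] wderiv_L2[OF assms(2)]
 have "cip (mlt (sce eps) (Dv phi)) (mlt (sce eps) (Dv psi)) = l2_inner (%x. sce eps x * wderiv phi x) (%x. sce eps x * wderiv psi x)"
  unfolding Dv_def toL_mlt_bdd[OF b L(1), symmetric] toL_mlt_bdd[OF b L(2), symmetric]
  by (rule cip_toL) (intro bdd_mult_L2 b L)+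
 also have "... = visc_form c eps phi psi" unfolding l2_inner_def visc_form_def proof (rule Bochner_Integration.integral_cong)
  fix x
  have "sce eps x * cnj (sce eps x) = cor (c x + eps)"
   using c_nonneg[of x] assms(3) by (simp add: sce_def flip: of_real_mult of_real_add)
  then show "sce eps x * wderiv phi x * cnj (sce eps x * wderiv psi x) = cor (c x + eps) * wderiv phi x * cnj (wderiv psi x)"
   by (simp add: mult_ac)
 qed simp
 finally show ?thesis by simp
qed

lemma toL_resolvent_rhs: "f \<in> L2 ==> phi \<in> L2 ==> toL (%x. f x - cor 1 * phi x) = toL f - toL phi"
 by (simp add: toL_diff)

lemma visc_approx_iff:
 assumes f: "f \<in> L2" and e: "0 < eps"
 shows "(phi, %x. f x - cor 1 * phi x) \<in> visc_approx c eps \<longleftrightarrow>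
  phi \<in> W12 & (\<forall>(v, k)\<in>W. inner (mlt (sce eps) (Dv phi)) (mlt (sce eps) k) = inner (toL f - toL phi) v)"
proof (cases "phi \<in> W12")
 case True
 have phiL: "phi \<in> L2" using True by (rule W12_L2)
 have L: "(%x. f x - cor 1 * phi x) \<in> L2" using f phiL by (simp add: L2_diff)
 note b = bdd_sce[OF less_imp_le[OF e]]
 have eq: "l2_inner (%x. f x - cor 1 * phi x) (fn v) = cip (toL f - toL phi) v" for v
  using cip_toL[OF L, of "fn v"] toL_resolvent_rhs[OF f phiL] by simp
 have vf: "visc_form c eps phi (fn v) = cip (mlt (sce eps) (Dv phi)) (mlt (sce eps) k)" if "(v, k) \<in> W" for v k
  using W_imp_W12[OF that] visc_form_eq[OF True _ less_imp_le[OF e], of "fn v"] by simp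
 have "(\<forall>psi\<in>W12. visc_form c eps phi psi = l2_inner (%x. f x - cor 1 * phi x) psi)
   \<longleftrightarrow> (\<forall>(v, k)\<in>W. inner (mlt (sce eps) (Dv phi)) (mlt (sce eps) k) = inner (toL f - toL phi) v)" (is "?A \<longleftrightarrow> ?B")
 proof
  assume ?A
  show ?B proof (intro ballI, clarify)
   fix v k assume "(v, k) \<in> W"
   then show "inner (mlt (sce eps) (Dv phi)) (mlt (sce eps) k) = inner (toL f - toL phi) v"
    using \<open>?A\<close> W_imp_W12[of v k] vf[of v k] eq[of v] by (simp add: inner_l2_def)
  qed
 next
  assume B: ?B
  show ?A proof
   fix psi assume psi: "psi \<in> W12"
   have w: "(toL psi, Dv psi) \<in> W" "(cs \<i> (toL psi), cs \<i> (Dv psi)) \<in> W" using W_Dv[OF psi] W_cs by auto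
   have "cip (mlt (sce eps) (Dv phi)) (mlt (sce eps) (Dv psi)) = cip (toL f - toL phi) (toL psi)"
    using B w by (auto simp: cip_eq_inner mlt_cs[OF b, symmetric])
   then show "visc_form c eps phi psi = l2_inner (%x. f x - cor 1 * phi x) psi"
    using visc_form_eq[OF True psi less_imp_le[OF e]] cip_toL[OF L W12_L2[OF psi]] toL_resolvent_rhs[OF f phiL] by simp
  qed
 qed
 then show ?thesis using True L by (simp add: visc_approx_def form_op_def)
qed (simp add: visc_approx_def form_op_def)

text \<open>The resolvent equation says that (f, 0) minus (u, sqrt(c + eps) u') is orthogonal to the
  graph, which is closed for eps > 0. A projection therefore provides the solution that the choice
  in \<open>resolvent\<close> presupposes.\<close>

lemma resolvent_visc:
 assumes f: "f \<in> L2" and e: "0 < eps"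
 defines "phi \<equiv> resolvent (visc_approx c eps) 1 f"
 shows "phi \<in> W12" and "(v, k) \<in> W ==> inner (mlt (sce eps) (Dv phi)) (mlt (sce eps) k) = inner (toL f - toL phi) v"
proof -
 note b = bdd_sce[OF less_imp_le[OF e]]
 have "\<exists>p\<in>gr (sce eps). \<forall>v\<in>gr (sce eps). inner ((toL f, 0) - p) v = 0"
  by (intro orthogonal_projection_exists gr_subspace gr_closed b bdd_inv_sce e)
 then obtain p where p: "p \<in> gr (sce eps)" "\<forall>v\<in>gr (sce eps). inner ((toL f, 0) - p) v = 0" by blast
 then obtain u g where ug: "(u, g) \<in> W" and pe: "p = (u, mlt (sce eps) g)" by (auto simp: gr_def)
 have orth: "inner ((toL f, 0) - (u, mlt (sce eps) g)) (v, mlt (sce eps) k) = 0" if "(v, k) \<in> W" for v k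
  using p(2) that unfolding pe gr_def by force
 have "(fn u, %x. f x - cor 1 * fn u x) \<in> visc_approx c eps" unfolding visc_approx_iff[OF f e]
 proof (intro conjI ballI, goal_cases)
  case (2 z)
  obtain v k where z: "z = (v, k)" by (cases z)
  show ?case using W_imp_W12[OF ug] orth[of v k] 2 by (simp add: z inner_diff_left)
 qed (simp add: W_imp_W12[OF ug])
 then have "(phi, %x. f x - cor 1 * phi x) \<in> visc_approx c eps" unfolding phi_def resolvent_def
  by (rule someI[of "%phi. (phi, %x. f x - cor 1 * phi x) \<in> visc_approx c eps"])
 then show "phi \<in> W12" "(v, k) \<in> W ==> inner (mlt (sce eps) (Dv phi)) (mlt (sce eps) k) = inner (toL f - toL phi) v"
  unfolding visc_approx_iff[OF f e] by auto
qed

lemma norm_mlt_sce: "0 <= eps ==> (norm (mlt (sce eps) k))\<^sup>2 = (norm (mlt sc k))\<^sup>2 + eps * (norm k)\<^sup>2" proof -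
 assume e: "0 <= eps"
 have L: "(%x. sce eps x * fn k x) \<in> L2" "(%x. sc x * fn k x) \<in> L2" by (intro bdd_mult_L2 bdd_sc bdd_sce e fn_L2)+
 have "(norm (mlt (sce eps) k))\<^sup>2 = (LINT x|lborel. (cmod (sce eps x * fn k x))\<^sup>2)"
  unfolding mlt_def by (rule norm_toL_square[OF L(1)])
 also have "... = (LINT x|lborel. (cmod (sc x * fn k x))\<^sup>2 + eps * (cmod (fn k x))\<^sup>2)"
 proof (rule Bochner_Integration.integral_cong)
  fix x
  show "(cmod (sce eps x * fn k x))\<^sup>2 = (cmod (sc x * fn k x))\<^sup>2 + eps * (cmod (fn k x))\<^sup>2"
   using e c_nonneg[of x] by (simp add: sce_def sc_def norm_mult power_mult_distrib algebra_simps)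
 qed simp
 also have "... = (LINT x|lborel. (cmod (sc x * fn k x))\<^sup>2) + eps * (norm k)\<^sup>2"
  using L2_integrable_square[OF L(2)] L2_integrable_square[of "fn k"] by (simp add: norm_l2_square)
 also have "(LINT x|lborel. (cmod (sc x * fn k x))\<^sup>2) = (norm (mlt sc k))\<^sup>2"
  unfolding mlt_def by (rule norm_toL_square[OF L(2), symmetric])
 finally show ?thesis .
qed

text \<open>The resolvent of an approximating operator minimizes the perturbed form, and its energy
 dominates that of the limit form; so it is almost a minimizer of the limit problem.\<close>

theorem visc_resolvent_tendsto:
 assumes f: "f \<in> L2" and p: "(u0, G0) \<in> M" and orth: "!!v H. (v, H) \<in> M ==> inner (toL f - u0) v = inner G0 H"
 shows "((%eps. norm (toL (resolvent (visc_approx c eps) 1 f) - u0)) \<longlongrightarrow> 0) (at_right 0)"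
proof (rule tendstoI)
 fix \<kappa> :: real assume \<kappa>: "\<kappa> > 0"
 \<comment> \<open>Chosen so that two errors of size d^2 together stay below \<kappa>^2.\<close>
 define d where "d = \<kappa> / 2"
 have "d > 0" using \<kappa> by (simp add: d_def)
 then have "\<exists>m\<in>gr sc. dist m (u0, G0) < d" using p unfolding M_def closure_approachable by blast
 then obtain v k where vk: "(v, k) \<in> W" and close: "norm ((v, mlt sc k) - (u0, G0)) < d"
  by (auto simp: gr_def dist_norm)
 \<comment> \<open>Keeps eps times the squared norm of \<open>k\<close> below d^2; the added 1
   avoids a division by 0.\<close>
 define eps0 where "eps0 = d\<^sup>2 / (1 + (norm k)\<^sup>2)"
 have eps0: "eps0 > 0" using \<kappa> by (simp add: eps0_def d_def add_pos_nonneg)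
 have bound: "norm (toL (resolvent (visc_approx c eps) 1 f) - u0) < \<kappa>" if e: "0 < eps" "eps < eps0" for eps proof -
  define phi where "phi = resolvent (visc_approx c eps) 1 f"
  note b = bdd_sce[OF less_imp_le[OF e(1)]]
  have W12: "phi \<in> W12" unfolding phi_def by (rule resolvent_visc(1)[OF f e(1)])
  have eq: "inner (mlt (sce eps) (Dv phi)) (mlt (sce eps) k') = inner (toL f - toL phi) v'" if "(v', k') \<in> W" for v' k'
   unfolding phi_def by (rule resolvent_visc(2)[OF f e(1) that])
  define X where "X = (toL f, 0 :: l2)"
  define Y where "Y = (toL phi, mlt (sce eps) (Dv phi))"
  define Z where "Z = (v, mlt (sce eps) k)"
  define m where "m = (toL phi, mlt sc (Dv phi))"
  define m' where "m' = (v, mlt sc k)"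
  have wd: "(toL phi - v, Dv phi - k) \<in> W" using subspace_diff[OF W_subspace W_Dv[OF W12] vk] by simp
  have "inner (X - Y) (Y - Z) = 0" using eq[OF wd] linear_diff[OF mlt_linear[OF b]] by (simp add: X_def Y_def Z_def)
  then have XYZ: "(norm (X - Y))\<^sup>2 <= (norm (X - Z))\<^sup>2" using pythagoras[of "X - Y" "Y - Z"] by simp
  have "m \<in> M" "m' \<in> M" unfolding m_def m'_def by (intro gr_M W_Dv W12 vk)+
  have o: "inner (X - (u0, G0)) ((u0, G0) - q) = 0" if "q \<in> M" for q proof -
   obtain a b where q: "q = (a, b)" by (cases q)
   have "(u0 - a, G0 - b) \<in> M" using subspace_diff[OF M_subspace p that] by (simp add: q)
   from orth[OF this] show ?thesis by (simp add: X_def q)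
  qed
  have Xq: "(norm (X - q))\<^sup>2 = (norm (X - (u0, G0)))\<^sup>2 + (norm ((u0, G0) - q))\<^sup>2" if "q \<in> M" for q
   using pythagoras[OF o[OF that]] by simp
  \<comment> \<open>Dropping eps decreases the energy, so the perturbed minimizer does almost as
    well in the limit problem as \<open>m'\<close>, which is itself close to the exact
    minimizer.\<close>
  have "(norm (X - m))\<^sup>2 <= (norm (X - Y))\<^sup>2"
   using norm_mlt_sce[of eps "Dv phi"] e by (simp add: X_def m_def Y_def norm_pair_square)
  also have "... <= (norm (X - m'))\<^sup>2 + eps * (norm k)\<^sup>2"
   using XYZ norm_mlt_sce[of eps k] e by (simp add: X_def m'_def Z_def norm_pair_square)
  finally have "(norm ((u0, G0) - m))\<^sup>2 <= (norm ((u0, G0) - m'))\<^sup>2 + eps * (norm k)\<^sup>2"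
   using Xq[OF \<open>m \<in> M\<close>] Xq[OF \<open>m' \<in> M\<close>] by linarith
  moreover have "(norm ((u0, G0) - m'))\<^sup>2 <= d\<^sup>2" unfolding norm_minus_commute[of "(u0, G0)"]
   using less_imp_le[OF close] by (intro power_mono) (auto simp: m'_def)
  moreover have "eps * (norm k)\<^sup>2 <= d\<^sup>2" proof -
   have "eps * (norm k)\<^sup>2 <= eps0 * (1 + (norm k)\<^sup>2)" using e by (intro mult_mono) auto
   also have "... = d\<^sup>2" by (simp add: eps0_def add_pos_nonneg add_nonneg_eq_0_iff)
   finally show ?thesis .
  qed
  moreover have "(norm (u0 - toL phi))\<^sup>2 <= (norm ((u0, G0) - m))\<^sup>2" by (simp add: m_def norm_pair_square)
  ultimately have "(norm (u0 - toL phi))\<^sup>2 <= 2 * d\<^sup>2" by linarith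
  also have "... < \<kappa>\<^sup>2" using \<kappa> by (simp add: d_def power_divide)
  finally have "norm (u0 - toL phi) < \<kappa>" using \<kappa> by (intro power2_less_imp_less[of _ \<kappa>]) auto
  then show ?thesis by (simp add: phi_def norm_minus_commute)
 qed
 show "\<forall>\<^sub>F eps in at_right 0. dist (norm (toL (resolvent (visc_approx c eps) 1 f) - u0)) 0 < \<kappa>"
  unfolding eventually_at_right_field by (intro exI[of _ eps0]) (use eps0 bound in auto)
qed

lemma M_projection:
 "\<exists>u G. (u, G) \<in> M & (\<forall>v H. (v, H) \<in> M --> inner (f - u) v = inner G H)"
proof -
 obtain p where p: "p \<in> M" "\<forall>q\<in>M. inner ((f, 0) - p) q = 0"
  using orthogonal_projection_exists[OF M_subspace M_closed] by blast
 obtain u G where uG: "p = (u, G)" by (cases p)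
 have "inner (f - u) v = inner G H" if "(v, H) \<in> M" for v H using p(2)[rule_format, OF that] by (simp add: uG)
 then show ?thesis using p(1) uG by blast
qed

lemma M_projection_unique:
 assumes "(u, G) \<in> M" "!!v H. (v, H) \<in> M ==> inner (f - u) v = inner G H"
  and "(u', G') \<in> M" "!!v H. (v, H) \<in> M ==> inner (f - u') v = inner G' H"
 shows "u = u'"
proof -
 have d: "(u - u', G - G') \<in> M" using subspace_diff[OF M_subspace assms(1,3)] by simp
 have "inner (f - u) (u - u') - inner (f - u') (u - u') = inner G (G - G') - inner G' (G - G')"
  using assms(2)[OF d] assms(4)[OF d] by simp
 then have "- inner (u - u') (u - u') = inner (G - G') (G - G')"
  by (simp add: inner_diff_left inner_diff_right inner_commute algebra_simps)
 then have "inner (u - u') (u - u') = 0" using inner_ge_zero[of "u - u'"] inner_ge_zero[of "G - G'"] by linarith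
 then show ?thesis by simp
qed

subsection \<open>Decoupling at the origin\<close>

definition cut :: "nat => real => complex" where
 "cut n x = cor (min 1 (max 0 (real n * x)))"

definition cut' :: "nat => real => complex" where
 "cut' n x = cor (real n) * indicator {0<..<1 / real n} x"

lemma ac_cut: assumes n: "0 < n" shows "ac_on UNIV (cut n) (cut' n)" proof -
 have "min 1 (max 0 (real n * x)) = real n * max 0 (min (1 / real n) x)" for x
  using n by (simp add: max_mult_distrib_left min_mult_distrib_left)
 then have "cut n x = cor (real n) * ramp 0 (1 / real n) x" for x by (simp add: cut_def ramp_def)
 then have "cut n = (%x. cor (real n) * ramp 0 (1 / real n) x)" by blast
 then show ?thesis unfolding cut'_def[abs_def] using n by (simp add: ac_on_cmult ac_ramp)
qed

definition Q :: "l2 => l2" where "Q = mlt (indicator {0<..})"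

lemma bdd_Q: "bdd_mult (indicator {0<..})" by (rule bdd_multI[of _ 1]) (auto simp: indicator_def)

lemma Q_sym: "inner (Q u) v = inner u (Q v)"
 unfolding Q_def by (rule inner_mlt_real[OF bdd_Q]) (simp add: indicator_def)

lemma Q_linear: "linear Q" unfolding Q_def by (rule mlt_linear[OF bdd_Q])

lemma cut_bounds: "cmod (cut n x) <= 1" by (simp add: cut_def min_def max_def abs_if)

lemma cut_measurable [measurable]: "cut n \<in> borel_measurable borel" "cut' n \<in> borel_measurable borel"
 unfolding cut_def[abs_def] cut'_def[abs_def] by measurable

lemma cut_tendsto: "(%n. cut n x) ----> indicator {0<..} x" proof (cases "0 < x")
 case True
 obtain N where N: "1 / x <= real N" using real_arch_simple by blast
 have "cut n x = 1" if "n \<ge> N" for n proof -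
  have "1 / x <= real n" using N that by linarith
  then show ?thesis using True by (simp add: cut_def field_simps)
 qed
 then show ?thesis using True by (intro tendsto_eventually) (auto simp: eventually_sequentially)
next
 case False
 then have "cut n x = 0" for n by (simp add: cut_def mult_nonneg_nonpos)
 then show ?thesis using False by simp
qed

text \<open>Products with \<open>cut n\<close> stay in \<open>W\<close>, and the delicate term is v
  times \<open>cut' n\<close>. Where it lives n <= 1/x, so with sqrt(c) <= x^\<delta> its weighted
  size is at most B x^(\<delta> - 1), square integrable on (0, 1) because \<delta> > 1/2; at each
  point it vanishes for large n, so it tends to 0 in norm.\<close>

lemma Q_W: assumes ug: "(u, g) \<in> W" shows "(Q u, Q (mlt sc g)) \<in> M" proof -
 obtain v where v: "ac_on UNIV v (fn g)" "AE x in lborel. fn u x = v x" using W_ac[OF ug] by blast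
 have vc: "continuous_on UNIV v" by (rule ac_on_continuous[OF v(1)]) simp
 have vm [measurable]: "v \<in> borel_measurable borel" using vc by (rule borel_measurable_continuous_onI)
 have vL: "v \<in> L2" by (rule L2_dominated[OF vm, of "fn u" 1]) (use v(2) in \<open>auto elim: eventually_mono\<close>)
 have tv: "u = toL v" using v(2) vL by (intro toL_eqI) auto
 have "bounded (v ` {0..1})" by (intro compact_imp_bounded compact_continuous_image continuous_on_subset[OF vc]) auto
 then obtain B where B: "\<forall>y\<in>v ` {0..1}. norm y <= B" unfolding bounded_iff by blast
 have B0: "0 <= B" by (rule order_trans[OF norm_ge_zero[of "v 0"]]) (use B in auto)
 define h where "h n x = sc x * (v x * cut' n x)" for n x
 define k where "k x = cor (indicator {0..1} x * x powr (\<delta> - 1))" for x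
 have hb: "cmod (h n x) <= B * cmod (k x)" for n x proof (cases "x \<in> {0<..<1 / real n} & 0 < n")
  case True
  then have x: "0 < x" "real n <= 1 / x" by (auto simp: field_simps)
  have x1: "x <= 1" using True order.strict_trans2[of x "1 / real n" 1] by (auto simp: less_imp_le)
  have "c x <= (x powr \<delta>)\<^sup>2" using c_le_powr[of x] x by (simp add: powr_power)
  then have "sqrt (c x) <= x powr \<delta>" by (rule real_le_lsqrt[rotated]) simp
  then have "sqrt (c x) * (cmod (v x) * real n) <= x powr \<delta> * (B * (1 / x))" using B x x1 B0 by (intro mult_mono) auto
  moreover have "cmod (h n x) = sqrt (c x) * (cmod (v x) * real n)"
   using True c_nonneg by (simp add: h_def sc_def cut'_def norm_mult)
  moreover have "cmod (k x) = x powr \<delta> / x" using x x1 by (simp only: k_def norm_of_real) (simp add: powr_diff)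
  ultimately show ?thesis by (simp add: mult.commute)
 qed (use B0 in \<open>auto simp: h_def cut'_def indicator_def\<close>)
 have kL: "k \<in> L2" proof (rule L2I_nn)
  have "(\<integral>\<^sup>+x. ennreal ((cmod (k x))\<^sup>2) \<partial>lborel) = (\<integral>\<^sup>+x. ennreal (indicator {0..1} x * x powr (2 * \<delta> - 2)) \<partial>lborel)"
   by (rule nn_integral_cong) (auto simp: k_def indicator_def power2_eq_square simp flip: powr_add)
  also have "... = ennreal (1 powr (2 * \<delta> - 2 + 1) / (2 * \<delta> - 2 + 1))"
   by (intro nn_integral_has_integral_lebesgue has_integral_powr_from_0) (use \<delta> in auto)
  finally show "(\<integral>\<^sup>+x. ennreal ((cmod (k x))\<^sup>2) \<partial>lborel) < \<infinity>" by simp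
 qed (simp add: k_def[abs_def])
 have hm: "h n \<in> borel_measurable borel" for n
  unfolding h_def[abs_def] using bdd_mult_measurable[OF bdd_sc] by measurable
 have h0: "(%n. toL (h n)) ----> 0" proof -
  have "(%n. h n x) ----> 0" for x proof (rule tendsto_eventually)
   obtain N where N: "1 / x <= real N" using real_arch_simple by blast
   have "h n x = 0" if "N <= n" for n proof -
    have "1 / x <= real n" using N that by linarith
    then have "x \<notin> {0<..<1 / real n}"
     by (cases "n = 0") (auto simp: pos_divide_le_eq pos_less_divide_eq mult.commute)
    then show ?thesis by (simp add: h_def cut'_def)
   qed
   then show "\<forall>\<^sub>F n in sequentially. h n x = 0" unfolding eventually_sequentially by blast
  qed
  then have "(%n. toL (h n)) ----> toL (%_. 0)" by (intro toL_L2_tendsto(2)[OF hm _ kL, where C = B] AE_I2 hb) auto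
  then show ?thesis by (simp add: zero_l2_def)
 qed
 have bc: "bdd_mult (cut n)" for n by (rule bdd_multI[of _ 1]) (auto simp: cut_bounds)
 have bc': "bdd_mult (cut' n)" for n by (rule bdd_multI[of _ "real n"]) (auto simp: cut'_def indicator_def)
 define z where "z n = (toL (%x. v x * cut n x), mlt sc (toL (%x. fn g x * cut n x + v x * cut' n x)))" for n
 have L1: "(%x. v x * cut n x) \<in> L2" "(%x. fn g x * cut n x) \<in> L2" "(%x. v x * cut' n x) \<in> L2" for n
  using bdd_mult_L2[OF bc vL, of n] bdd_mult_L2[OF bc, of "fn g" n] bdd_mult_L2[OF bc' vL, of n]
  by (simp_all add: mult.commute)
 have zM: "z n \<in> M" if "0 < n" for n unfolding z_def by (intro gr_M W_I_ac ac_on_mult v(1) ac_cut that L2_add L1)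
 have lim1: "(%n. toL (%x. v x * cut n x)) ----> Q u" proof -
  have "(%n. toL (%x. v x * cut n x)) ----> toL (%x. v x * indicator {0<..} x)"
   by (rule toL_L2_tendsto(2)[OF _ _ vL, of _ _ 1])
    (auto simp: norm_mult mult_left_le cut_bounds intro!: tendsto_mult cut_tendsto)
  moreover have "toL (%x. v x * indicator {0<..} x) = Q u"
   unfolding Q_def tv toL_mlt_bdd[OF bdd_Q vL, symmetric] by (simp add: mult.commute)
  ultimately show ?thesis by simp
 qed
 have lim2: "(%n. mlt sc (toL (%x. fn g x * cut n x + v x * cut' n x))) ----> Q (mlt sc g)" proof -
  have e: "mlt sc (toL (%x. fn g x * cut n x + v x * cut' n x)) = mlt sc (toL (%x. fn g x * cut n x)) + toL (h n)" for n
   unfolding toL_add[OF L1(2,3)] mlt_add[OF bdd_sc] h_def[abs_def] toL_mlt_bdd[OF bdd_sc L1(3)] ..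
  have "(%n. toL (%x. fn g x * cut n x)) ----> toL (%x. fn g x * indicator {0<..} x)"
   by (rule toL_L2_tendsto(2)[of _ _ "fn g" 1])
    (auto simp: norm_mult mult_left_le cut_bounds intro!: tendsto_mult cut_tendsto)
  moreover have "toL (%x. fn g x * indicator {0<..} x) = Q g" unfolding Q_def mlt_def by (simp add: mult.commute)
  ultimately have "(%n. mlt sc (toL (%x. fn g x * cut n x)) + toL (h n)) ----> mlt sc (Q g) + 0"
   by (intro tendsto_add mlt_tendsto bdd_sc h0) simp
  moreover have "mlt sc (Q g) = Q (mlt sc g)"
   unfolding Q_def mlt_mlt[OF bdd_sc bdd_Q] mlt_mlt[OF bdd_Q bdd_sc] by (simp add: mult.commute)
  ultimately show ?thesis unfolding e by simp
 qed
 have "(%n. z (Suc n)) ----> (Q u, Q (mlt sc g))"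
  using tendsto_Pair[OF LIMSEQ_Suc[OF lim1] LIMSEQ_Suc[OF lim2]] unfolding z_def .
 then show ?thesis using closed_sequentially[OF M_closed, of "%n. z (Suc n)"] zM by blast
qed

lemma Q_M: assumes "(u, G) \<in> M" shows "(Q u, Q G) \<in> M" proof -
 have "(u, G) \<in> closure (gr sc)" using assms by (simp add: M_def)
 then obtain z where z: "!!n. z n \<in> gr sc" "z ----> (u, G)" unfolding closure_sequential by blast
 have "(Q (fst (z n)), Q (snd (z n))) \<in> M" for n using z(1)[of n] Q_W by (auto simp: gr_def)
 moreover have "(%n. (Q (fst (z n)), Q (snd (z n)))) ----> (Q u, Q G)"
  unfolding Q_def using tendsto_fst[OF z(2)] tendsto_snd[OF z(2)] by (intro tendsto_Pair mlt_tendsto bdd_Q) auto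
 ultimately show ?thesis by (rule closed_sequentially[OF M_closed])
qed

end

section \<open>The viscosity operator\<close>

lemma (in spectral_family) sop_diff:
 assumes f: "f \<in> borel_measurable borel" and "(u, g) \<in> sop f" "(u', g') \<in> sop f"
 shows "(u - u', g - g') \<in> sop f" using assms(2,3) unfolding sop_iff[OF f]
 by (simp add: P_diff[OF level_sets[OF f]] linear_diff[OF T_linear[OF bounded_borel_trunc[OF f]]])

text \<open>Set to 0 at negative arguments, like \<open>r1\<close>, in order to be bounded on the
  whole line; since the spectrum is nonnegative, \<open>T_cong\<close> makes this choice
  harmless.\<close>

definition et :: "real => real => real" where "et t s = (if 0 <= s then exp (- t * s) else 0)"

definition r1 :: "real => real" where "r1 s = (if 0 <= s then 1 / (1 + s) else 0)"

lemma r1_bounds: "0 <= r1 s" "r1 s <= 1" by (auto simp: r1_def)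

lemma bounded_borel_r1: "bounded_borel r1"
 by (rule bounded_borelI[of _ 1]) (use r1_bounds in \<open>auto simp: r1_def[abs_def]\<close>)

lemma bounded_borel_et: "0 <= t ==> bounded_borel (et t)" by (rule bounded_borelI[of _ 1]) (auto simp: et_def[abs_def])

text \<open>Fixes one spectral resolution of the viscosity operator, namely the one through which
  the semigroup or the square root is given.\<close>

locale viscosity = coefficient \<delta> + l2_pvm E for \<delta> E +
 assumes visc: "is_viscosity_operator (c_coeff \<delta>) (spectral_op E (%s. s))"
begin

section \<open>The resolvent at 1 as an orthogonal projection\<close>

abbreviation H :: "(l2 \<times> l2) set" where "H \<equiv> sop (%s. s)"

lemma id_borel: "(%s::real. s) \<in> borel_measurable borel" by measurable

lemma H_positive: assumes "(u, g) \<in> H" shows "0 <= inner g u" proof -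
 have "(fn u, fn g) \<in> spectral_op E (%s. s)" using assms by (simp add: spectral_op_iff)
 then have "0 <= Re (l2_inner (fn g) (fn u))"
  using visc unfolding is_viscosity_operator_def positive_self_adjoint_def by fast
 then show ?thesis by (simp add: inner_l2_def cip_def)
qed

lemma neg_zero: "P {..<0} u = 0" by (rule P_negative_zero[OF H_positive])

lemmas T_cong = T_cong_nonneg[OF neg_zero]

definition R :: "l2 => l2" where "R = T r1"

lemma R_in_H: "(R f, f - R f) \<in> H" proof -
 have b: "bounded_borel (%s. s * r1 s)" proof (rule bounded_borelI[of _ 1])
  show "\<bar>s * r1 s\<bar> <= 1" for s by (cases "0 <= s") (simp_all add: r1_def abs_of_nonneg)
 qed (simp add: r1_def[abs_def])
 have "T (%s. s * r1 s + r1 s) f = T (%_. 1) f" proof (rule T_cong)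
  show "s * r1 s + r1 s = 1" if "0 <= s" for s
   using that by (simp add: r1_def add_divide_distrib[symmetric] add.commute)
 qed (simp_all add: bounded_borel_add b bounded_borel_r1 bounded_borel_const)
 then have "T (%s. s * r1 s) f = f - R f" by (simp add: T_add b bounded_borel_r1 R_def algebra_simps)
 then show ?thesis using T_in_sop[OF id_borel bounded_borel_r1 b, of f] by (simp add: R_def)
qed

text \<open>The difference d of two solutions satisfies H d = -d, and positivity then gives -|d|^2
  >= 0.\<close>

lemma R_unique: assumes "(u, f - u) \<in> H" shows "u = R f" proof -
 have "(u - R f, (f - u) - (f - R f)) \<in> H" by (rule sop_diff[OF id_borel assms R_in_H])
 then have "0 <= inner ((f - u) - (f - R f)) (u - R f)" by (rule H_positive)
 also have "... = - inner (u - R f) (u - R f)" by (simp add: inner_diff_left inner_diff_right algebra_simps)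
 finally have "inner (u - R f) (u - R f) = 0" using inner_ge_zero[of "u - R f"] by linarith
 then show ?thesis by simp
qed

lemma resolvent_H:
 assumes f: "f \<in> L2"
 shows "resolvent (spectral_op E (%s. s)) 1 f \<in> L2" and "toL (resolvent (spectral_op E (%s. s)) 1 f) = R (toL f)"
proof -
 define phi where "phi = resolvent (spectral_op E (%s. s)) 1 f"
 have L: "(%x. f x - cor 1 * fn (R (toL f)) x) \<in> L2" using f by (simp add: L2_diff)
 have "(fn (R (toL f)), %x. f x - cor 1 * fn (R (toL f)) x) \<in> spectral_op E (%s. s)"
  using R_in_H[of "toL f"] f L toL_resolvent_rhs[OF f, of "fn (R (toL f))"] by (simp add: spectral_op_iff)
 then have "(phi, %x. f x - cor 1 * phi x) \<in> spectral_op E (%s. s)" unfolding phi_def resolvent_def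
  by (rule someI[of "%phi. (phi, %x. f x - cor 1 * phi x) \<in> spectral_op E (%s. s)"])
 then have phi: "phi \<in> L2" "(toL phi, toL (%x. f x - cor 1 * phi x)) \<in> H" by (simp_all add: spectral_op_iff)
 then have "(toL phi, toL f - toL phi) \<in> H" using toL_resolvent_rhs[OF f phi(1)] by simp
 then have "toL phi = R (toL f)" by (rule R_unique)
 then show "resolvent (spectral_op E (%s. s)) 1 f \<in> L2"
  "toL (resolvent (spectral_op E (%s. s)) 1 f) = R (toL f)" using phi(1) by (simp_all add: phi_def)
qed

text \<open>The approximating resolvents converge to the projection by the variational argument and
  to \<open>R f\<close> by the definition of the viscosity operator; uniqueness of limits identifies
  the two.\<close>

lemma R_projection:
 "\<exists>G. (R f, G) \<in> M & (\<forall>v K. (v, K) \<in> M --> inner (f - R f) v = inner G K)"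
proof -
 obtain u G where uG: "(u, G) \<in> M" "!!v K. (v, K) \<in> M ==> inner (f - u) v = inner G K" using M_projection[of f] by blast
 let ?r = "%eps. resolvent (visc_approx c eps) 1 (fn f)"
 have t1: "((%eps. norm (toL (?r eps) - u)) \<longlongrightarrow> 0) (at_right 0)" using uG by (intro visc_resolvent_tendsto) auto
 have "((%eps. l2_norm (%x. ?r eps x - resolvent (spectral_op E (%s. s)) 1 (fn f) x)) \<longlongrightarrow> 0) (at_right 0)"
  using visc fn_L2[of f] unfolding is_viscosity_operator_def by fastforce
 then have t2: "((%eps. norm (toL (?r eps) - R f)) \<longlongrightarrow> 0) (at_right 0)" proof (rule Lim_transform_eventually)
  show "\<forall>\<^sub>F eps in at_right 0. l2_norm (%x. ?r eps x - resolvent (spectral_op E (%s. s)) 1 (fn f) x) = norm (toL (?r eps) - R f)"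
   unfolding eventually_at_right_field
  proof (intro exI[of _ 1] conjI allI impI)
   fix eps :: real assume "0 < eps"
   then have rL: "?r eps \<in> L2" using W12_L2[OF resolvent_visc(1)[OF fn_L2[of f]]] by simp
   have "l2_norm (%x. ?r eps x - resolvent (spectral_op E (%s. s)) 1 (fn f) x)
     = norm (toL (%x. ?r eps x - resolvent (spectral_op E (%s. s)) 1 (fn f) x))"
    using rL resolvent_H(1)[of "fn f"] by (intro norm_toL[symmetric] L2_diff) auto
   then show "l2_norm (%x. ?r eps x - resolvent (spectral_op E (%s. s)) 1 (fn f) x) = norm (toL (?r eps) - R f)"
    using rL resolvent_H[of "fn f"] by (simp add: toL_diff)
  qed simp
 qed
 have "norm (u - R f) <= 0" proof (rule tendsto_le[OF _ _ tendsto_const])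
  show "((%eps. norm (toL (?r eps) - u) + norm (toL (?r eps) - R f)) \<longlongrightarrow> 0) (at_right 0)" using tendsto_add[OF t1 t2] by simp
  have "norm (u - R f) <= norm (toL (?r eps) - u) + norm (toL (?r eps) - R f)" for eps
   using norm_triangle_ineq4[of "toL (?r eps) - R f" "toL (?r eps) - u"] by simp
  then show "\<forall>\<^sub>F eps in at_right 0. norm (u - R f) <= norm (toL (?r eps) - u) + norm (toL (?r eps) - R f)" by simp
 qed simp
 then have "u = R f" by simp
 then show ?thesis using uG by blast
qed

text \<open>The weak form of H u = w: u lies in the closed form domain, and \<open>G\<close> plays
  the role of sqrt(c) u'.\<close>

definition hm :: "l2 => l2 => l2 => bool" where
 "hm u w G \<longleftrightarrow> (u, G) \<in> M & (\<forall>v K. (v, K) \<in> M --> inner w v = inner G K)"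

lemma H_hm: assumes "(u, w) \<in> H" shows "\<exists>G. hm u w G" proof -
 have "u = R (u + w)" by (rule R_unique) (use assms in simp)
 then show ?thesis using R_projection[of "u + w"] by (auto simp: hm_def)
qed

lemma hm_energy: "hm u w G ==> (norm G)\<^sup>2 = inner w u" by (auto simp: hm_def power2_norm_eq_inner)

lemma hm_norm_le: assumes "hm u w G" shows "norm G <= norm u + norm w" proof (rule power2_le_imp_le)
 have "(norm G)\<^sup>2 <= norm w * norm u" unfolding hm_energy[OF assms] by (rule norm_cauchy_schwarz)
 also have "... <= (norm u + norm w)\<^sup>2" by (simp add: power2_sum)
 finally show "(norm G)\<^sup>2 <= (norm u + norm w)\<^sup>2" .
qed simp

text \<open>\<open>Q\<close> is symmetric and preserves \<open>M\<close>, so \<open>Q\<close> of the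
  projection of f satisfies the equations that characterize the projection of
  \<open>Q f\<close>.\<close>

lemma R_Q: "R (Q f) = Q (R f)" proof -
 obtain G where G: "(R f, G) \<in> M" "!!v K. (v, K) \<in> M ==> inner (f - R f) v = inner G K" using R_projection[of f] by blast
 obtain G' where G': "(R (Q f), G') \<in> M" "!!v K. (v, K) \<in> M ==> inner (Q f - R (Q f)) v = inner G' K"
  using R_projection[of "Q f"] by blast
 show ?thesis proof (rule M_projection_unique[OF G' Q_M[OF G(1)]])
  fix v K assume "(v, K) \<in> M"
  then have "inner (f - R f) (Q v) = inner G (Q K)" by (intro G(2) Q_M)
  then show "inner (Q f - Q (R f)) v = inner (Q G) K" by (simp add: Q_sym linear_diff[OF Q_linear, symmetric])
 qed
qed

definition comm_Q :: "(real => real) => bool" where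
 "comm_Q f \<longleftrightarrow> bounded_borel f & (\<forall>u. T f (Q u) = Q (T f u))"

lemma comm_Q_const: "comm_Q (%_. a)" using T_cmult[OF bounded_borel_const, of a 1]
 by (auto simp: comm_Q_def linear_scale[OF Q_linear])

lemma comm_Q_add: "comm_Q f ==> comm_Q g ==> comm_Q (%s. f s + g s)"
 by (auto simp: comm_Q_def T_add linear_add[OF Q_linear])

lemma comm_Q_mult: assumes "comm_Q f" "comm_Q g" shows "comm_Q (%s. f s * g s)"
 using assms T_mult[of f g] by (auto simp: comm_Q_def) (metis)

lemma comm_Q_power: "comm_Q f ==> comm_Q (%s. f s ^ n)" proof (induction n)
 case (Suc n)
 then show ?case using comm_Q_mult[of f "%s. f s ^ n"] by simp
qed (simp add: comm_Q_const)

lemma comm_Q_sum: "(!!k. comm_Q (f k)) ==> comm_Q (%s. \<Sum>k\<le>(n::nat). f k s)" proof (induction n)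
 case (Suc n)
 then show ?case using comm_Q_add[of "%s. \<Sum>k\<le>n. f k s" "f (Suc n)"] by simp
qed simp

lemma comm_Q_r1: "comm_Q r1" using R_Q by (simp add: comm_Q_def bounded_borel_r1 R_def)

lemma norm_Q_le: "norm (Q u) <= norm u"
 unfolding Q_def using norm_mlt_le[of "indicator {0<..}" 1 u] by (simp add: indicator_def)

text \<open>The functions of \<open>H\<close> that commute with the restriction to the half-line form an algebra,
 and \<open>exp (- t s)\<close> is a continuous function of \<open>1 / (1 + s)\<close>.\<close>

theorem T_et_Q: assumes t: "0 < t" shows "T (et t) (Q u) = Q (T (et t) u)" proof -
 \<comment> \<open>Solving y = 1 / (1 + s) for s turns exp(-t s) into a function of y; the value 0
   for y <= 0 is the limit at 0 from the right, because t > 0.\<close>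
 define h where "h y = (if y <= 0 then 0 else exp (- t * (1 / y - 1)))" for y :: real
 have eth: "et t s = h (r1 s)" for s by (auto simp: et_def h_def r1_def)
 have "continuous_on {0..1} h" proof (rule continuous_at_imp_continuous_on, rule ballI)
  fix y :: real assume "y \<in> {0..1}"
  show "isCont h y" proof (cases "y = 0")
   case False
   with \<open>y \<in> {0..1}\<close> have y: "y > 0" by simp
   have "isCont (%y. exp (- t * (1 / y - 1))) y" using y by (intro continuous_intros) auto
   then show ?thesis by (subst isCont_cong[where g = "%y. exp (- t * (1 / y - 1))"])
     (use eventually_nhds_in_open[of "{0<..}" y] y in \<open>auto simp: h_def elim: eventually_mono\<close>)
  next
   case True
   have "(h \<longlongrightarrow> 0) (at_right 0)" proof -
    have "filterlim (%z. - t * (z - 1)) at_bot at_top" proof -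
     have "filterlim (%z::real. z - 1) at_top at_top"
      using filterlim_tendsto_add_at_top[OF tendsto_const filterlim_ident, of "-1"] by simp
     then show ?thesis using t by (intro filterlim_tendsto_neg_mult_at_bot[OF tendsto_const]) auto
    qed
    then have "((%y. exp (- t * (inverse y - 1))) \<longlongrightarrow> 0) (at_right (0::real))"
     by (intro filterlim_compose[OF exp_at_bot] filterlim_compose[OF _ filterlim_inverse_at_top_right])
    then show ?thesis by (rule Lim_transform_eventually) (auto simp: eventually_at_filter h_def inverse_eq_divide)
   qed
   moreover have "(h \<longlongrightarrow> 0) (at_left 0)"
    by (rule Lim_transform_eventually[OF tendsto_const]) (auto simp: eventually_at_filter h_def)
   ultimately have "(h \<longlongrightarrow> 0) (at 0)" by (rule filterlim_split_at_real[rotated])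
   then show ?thesis using True by (simp add: isCont_def h_def)
  qed
 qed
 then have approx: "\<exists>p. comm_Q p & (\<forall>s. \<bar>et t s - p s\<bar> <= e)" if e: "e > 0" for e proof -
  obtain N where N: "!!n x. N <= n ==> x \<in> {0..1} ==> \<bar>h x - (\<Sum>k\<le>n. h (k/n) * Bernstein n k x)\<bar> < e"
   using Bernstein_Weierstrass[OF \<open>continuous_on {0..1} h\<close> e] by metis
  \<comment> \<open>A Bernstein polynomial in \<open>r1\<close>: uniformly close to
    \<open>et t\<close>, and commuting with \<open>Q\<close> because \<open>r1\<close> does.\<close>
  define p where "p s = (\<Sum>k\<le>N. h (k/N) * Bernstein N k (r1 s))" for s
  have "comm_Q (%s. 1 + (- 1) * r1 s)" by (intro comm_Q_add comm_Q_mult comm_Q_const comm_Q_r1)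
  then have c1: "comm_Q (%s. 1 - r1 s)" by simp
  have "comm_Q p" unfolding p_def[abs_def] Bernstein_def
   by (intro comm_Q_sum comm_Q_mult comm_Q_const comm_Q_power comm_Q_r1 c1)
  moreover have "\<bar>et t s - p s\<bar> <= e" for s
   unfolding eth p_def using N[of N "r1 s"] r1_bounds[of s] by (simp add: less_imp_le)
  ultimately show ?thesis by blast
 qed
 have "norm (T (et t) (Q u) - Q (T (et t) u)) <= e * (2 * norm u)" if e: "e > 0" for e proof -
  obtain p where p: "comm_Q p" "!!s. \<bar>et t s - p s\<bar> <= e" using approx[OF e] by blast
  have bp: "bounded_borel p" using p(1) by (simp add: comm_Q_def)
  note be = bounded_borel_et[OF less_imp_le[OF t]]
  have d: "norm (T (et t) v - T p v) <= e * norm v" for v proof -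
   have bm: "bounded_borel (%s. (- 1) * p s)" by (rule bounded_borel_mult[OF bounded_borel_const bp])
   have "T (%s. et t s + (- 1) * p s) v = T (et t) v - T p v" unfolding T_add[OF be bm] T_cmult[OF bp] by simp
   moreover have "norm (T (%s. et t s + (- 1) * p s) v) <= e * norm v"
    by (rule norm_T_le[OF bounded_borel_measurable[OF bounded_borel_add[OF be bm]]]) (use p(2) in simp)
   ultimately show ?thesis by simp
  qed
  have "T (et t) (Q u) - Q (T (et t) u) = (T (et t) (Q u) - T p (Q u)) - Q (T (et t) u - T p u)"
   using p(1) by (simp add: comm_Q_def linear_diff[OF Q_linear])
  also have "norm ... <= e * norm (Q u) + e * norm u"
   by (rule order_trans[OF norm_triangle_ineq4 add_mono[OF d order_trans[OF norm_Q_le d]]])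
  also have "... <= e * (2 * norm u)" using mult_left_mono[OF norm_Q_le[of u], of e] e by simp
  finally show ?thesis .
 qed
 then have "norm (T (et t) (Q u) - Q (T (et t) u)) <= 0" proof -
  assume *: "!!e. 0 < e ==> norm (T (et t) (Q u) - Q (T (et t) u)) <= e * (2 * norm u)"
  show ?thesis proof (rule field_le_epsilon)
   fix e :: real assume "e > 0"
   have "e / (1 + 2 * norm u) * (2 * norm u) <= e" using \<open>e > 0\<close> by (simp add: field_simps add_pos_nonneg)
   then show "norm (T (et t) (Q u) - Q (T (et t) u)) <= 0 + e"
    using *[of "e / (1 + 2 * norm u)"] \<open>e > 0\<close> by (simp add: add_pos_nonneg)
  qed
 qed
 then show ?thesis by simp
qed

end

subsection \<open>Reflection\<close>

lemma L2_reflect: assumes "f \<in> L2" shows "(%x. f (- x)) \<in> L2" proof (rule L2I)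
 show "integrable lborel (%x. (cmod (f (- x)))\<^sup>2)"
  using lborel_integrable_real_affine[OF L2_integrable_square[OF assms], of "-1" 0] by simp
qed (use L2_measurable[OF assms] in measurable)

text \<open>Reflection x -> -x. As c is even, it carries statements on the right half-line to the
  left one.\<close>

definition Rf :: "l2 => l2" where "Rf u = toL (%x. fn u (- x))"

lemma fn_Rf: "AE x in lborel. fn (Rf u) x = fn u (- x)" unfolding Rf_def by (intro fn_toL L2_reflect) simp

lemma cip_reflect:
 assumes "f \<in> L2" "g \<in> L2" shows "cip (toL (%x. f (- x))) (toL g) = cip (toL f) (toL (%x. g (- x)))"
 using lborel_integral_real_affine[of "-1" "%x. f x * cnj (g (- x))" 0] assms
 by (simp add: cip_toL L2_reflect l2_inner_def)

lemma cip_Rf: "cip (Rf u) v = cip u (Rf v)" using cip_reflect[of "fn u" "fn v"] by (simp add: Rf_def)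

lemma inner_Rf: "inner (Rf u) v = inner u (Rf v)" by (simp add: inner_l2_def cip_Rf)

lemma Rf_toL: assumes "f \<in> L2" shows "Rf (toL f) = toL (%x. f (- x))" proof (rule inner_eq_imp_eq)
 fix v
 show "inner (Rf (toL f)) v = inner (toL (%x. f (- x))) v"
  unfolding inner_Rf using cip_reflect[OF assms, of "fn v"] by (simp add: inner_l2_def Rf_def)
qed

lemma Rf_Rf [simp]: "Rf (Rf u) = u" proof -
 have "Rf (toL (%x. fn u (- x))) = toL (%x. fn u (- (- x)))" by (intro Rf_toL L2_reflect) simp
 then show ?thesis by (simp add: Rf_def)
qed

lemma Rf_linear: "linear Rf" using symmetric_operator_linear[of Rf Rf] inner_Rf by blast

lemma norm_Rf [simp]: "norm (Rf u) = norm u" using inner_Rf[of u "Rf u"] by (simp add: norm_eq_sqrt_inner)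

lemma W_Rf: assumes ug: "(u, g) \<in> W" shows "(Rf u, - Rf g) \<in> W" proof -
 obtain v where v: "ac_on UNIV v (fn g)" "AE x in lborel. fn u x = v x" using W_ac[OF ug] by blast
 have vm: "v \<in> borel_measurable borel" using ac_on_continuous[OF v(1)] by (intro borel_measurable_continuous_onI) simp
 have vL: "v \<in> L2" by (rule L2_dominated[OF vm, of "fn u" 1]) (use v(2) in \<open>auto elim: eventually_mono\<close>)
 have tv: "u = toL v" using v(2) vL by (intro toL_eqI) auto
 have "ac_on UNIV (%x. v (- x)) (%x. - fn g (- x))" unfolding ac_on_def proof (intro allI impI conjI)
  fix a b :: real assume ab: "a <= b"
  show "set_integrable lborel {a..b} (%x. - fn g (- x))" by (intro L2_set_integrable L2_uminus L2_reflect fn_L2)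
  have "v (- a) - v (- b) = (LINT x:{-b..-a}|lborel. fn g x)" using ac_onD(2)[OF v(1), of "-b" "-a"] ab by simp
  also have "... = (LINT x:{a..b}|lborel. fn g (- x))" proof -
   have "(LINT x:{-b..-a}|lborel. fn g x) = (LINT x|lborel. indicator {-b..-a} (0 + - 1 * x) *\<^sub>R fn g (0 + - 1 * x))"
    unfolding set_lebesgue_integral_def
    using lborel_integral_real_affine[of "-1" "%x. indicator {-b..-a} x *\<^sub>R fn g x" 0] by simp
   also have "... = (LINT x:{a..b}|lborel. fn g (- x))" unfolding set_lebesgue_integral_def
    by (rule Bochner_Integration.integral_cong) (auto simp: indicator_def)
   finally show ?thesis .
  qed
  finally show "v (- b) - v (- a) = (LINT x:{a..b}|lborel. - fn g (- x))"
   by (simp add: set_lebesgue_integral_def algebra_simps)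
 qed
 then have "(toL (%x. v (- x)), toL (%x. - fn g (- x))) \<in> W" by (intro W_I_ac L2_reflect vL L2_uminus) auto
 moreover have "toL (%x. - fn g (- x)) = - Rf g" using toL_uminus[OF L2_reflect[OF fn_L2[of g]]] by (simp add: Rf_def)
 ultimately show ?thesis using Rf_toL[OF vL] by (simp add: tv)
qed

context coefficient
begin

lemma M_Rf: assumes "(u, G) \<in> M" shows "(Rf u, - Rf G) \<in> M" proof -
 have sc: "mlt sc (Rf g) = Rf (mlt sc g)" for g proof -
  have L: "(%x. sc x * fn g x) \<in> L2" by (intro bdd_mult_L2 bdd_sc) simp
  have "mlt sc (Rf g) = toL (%x. sc x * fn g (- x))"
   unfolding Rf_def by (rule toL_mlt_bdd[symmetric]) (intro bdd_sc, intro L2_reflect, simp)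
  also have "... = toL (%x. sc (- x) * fn g (- x))" by (simp add: sc_def)
  also have "... = Rf (mlt sc g)" unfolding mlt_def by (rule Rf_toL[OF L, symmetric])
  finally show ?thesis .
 qed
 have bl: "bounded_linear Rf"
  by (rule bounded_linear_intro[where K = 1]) (auto simp: linear_add[OF Rf_linear] linear_scale[OF Rf_linear])
 have "(u, G) \<in> closure (gr sc)" using assms by (simp add: M_def)
 then obtain z where z: "!!n. z n \<in> gr sc" "z ----> (u, G)" unfolding closure_sequential by blast
 have "(Rf (fst (z n)), - Rf (snd (z n))) \<in> M" for n proof -
  obtain v g where vg: "(v, g) \<in> W" "z n = (v, mlt sc g)" using z(1)[of n] by (auto simp: gr_def)
  have "(Rf v, mlt sc (- Rf g)) \<in> M" by (intro gr_M W_Rf vg)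
  then show ?thesis by (simp add: vg(2) sc linear_neg[OF mlt_linear[OF bdd_sc]])
 qed
 moreover have "(%n. (Rf (fst (z n)), - Rf (snd (z n)))) ----> (Rf u, - Rf G)"
  using tendsto_fst[OF z(2)] tendsto_snd[OF z(2)]
  by (intro tendsto_Pair tendsto_minus bounded_linear.tendsto[OF bl]) auto
 ultimately show ?thesis by (rule closed_sequentially[OF M_closed])
qed

subsection \<open>Representatives on the half-line\<close>

lemma inv_sc_continuous: "0 < a ==> continuous_on {a..b} (%x. 1 / sc x)" proof -
 assume a: "0 < a"
 have "sc x \<noteq> 0" if "x \<in> {a..b}" for x using c_pos[of x] that a by (auto simp: sc_def)
 then show ?thesis unfolding sc_def[abs_def] by (intro continuous_intros c_continuous) (auto simp: sc_def)
qed

text \<open>Its pairing with \<open>G\<close> is the integral of G / sqrt(c) over [a, b]. For a > 0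
  it is square integrable, which makes that integral continuous in \<open>G\<close>.\<close>

definition kk :: "real => real => real => complex" where
 "kk a b x = indicator {a..b} x / sc x"

lemma sc_measurable [measurable]: "sc \<in> borel_measurable borel" by (rule bdd_mult_measurable[OF bdd_sc])

lemma kk_L2: assumes "0 < a" shows "kk a b \<in> L2" proof -
 have "bounded ((%x. 1 / sc x) ` {a..b})"
  by (intro compact_imp_bounded compact_continuous_image inv_sc_continuous assms) auto
 then obtain C where C: "\<forall>y\<in>(%x. 1 / sc x) ` {a..b}. norm y <= C" unfolding bounded_iff by blast
 show ?thesis proof (rule L2_dominated[where f = "indicator {a..b}" and C = C])
  show "kk a b \<in> borel_measurable borel" unfolding kk_def[abs_def] by measurable
  show "(indicator {a..b} :: real => complex) \<in> L2" by (rule indicator_L2) (auto simp: emeasure_lborel_Icc_eq)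
  show "AE x in lborel. cmod (kk a b x) <= C * cmod (indicator {a..b} x)"
   using C by (intro AE_I2) (auto simp: kk_def indicator_def)
 qed
qed

lemma quot_integral:
 assumes "0 < a"
 shows "set_integrable lborel {a..b} (%x. fn G x / sc x)"
  and "(LINT x:{a..b}|lborel. fn G x / sc x) = cip G (toL (kk a b))"
proof -
 have e: "indicator {a..b} x *\<^sub>R (fn G x / sc x) = fn G x * cnj (kk a b x)" for x
  by (auto simp: kk_def sc_def indicator_def)
 show "set_integrable lborel {a..b} (%x. fn G x / sc x)"
  unfolding set_integrable_def e by (intro l2_inner_integrable kk_L2 assms) simp
 show "(LINT x:{a..b}|lborel. fn G x / sc x) = cip G (toL (kk a b))"
  unfolding set_lebesgue_integral_def e cip_toL_right[OF kk_L2[OF assms]] ..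
qed

lemma cip_tendsto: "u ----> v ==> (%n. cip (u n) w) ----> cip v w"
 unfolding cip_eq_inner by (intro tendsto_Complex tendsto_inner tendsto_const)

text \<open>A base point p > 0 replaces 0, up to which the density G / sqrt(c) may fail to be
  integrable.\<close>

definition prim_at :: "real => (real => complex) => real => complex" where
 "prim_at p g x = (if p <= x then (LINT t:{p..x}|lborel. g t) else - (LINT t:{x..p}|lborel. g t))"

lemma prim_at_diff:
 assumes g: "!!a b. 0 < a ==> set_integrable lborel {a..b} g" and "0 < p" "0 < a" "a <= b"
 shows "prim_at p g b - prim_at p g a = (LINT x:{a..b}|lborel. g x)"
proof -
 consider "p <= a" | "a < p" "p <= b" | "b < p" by linarith
 then show ?thesis proof cases
  case 1
  then show ?thesis using set_integral_split[OF g, of p a b] assms by (simp add: prim_at_def)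
 next
  case 2
  then show ?thesis using set_integral_split[OF g, of a p b] assms by (simp add: prim_at_def)
 next
  case 3
  then show ?thesis using set_integral_split[OF g, of a b p] assms by (simp add: prim_at_def)
 qed
qed

lemma AE_pos_witness:
 assumes "AE x in lborel. P x" and "(a::real) < b"
 shows "\<exists>x. a < x & x < b & P x"
proof (rule ccontr)
 assume "\<not> ?thesis"
 then have "AE x in lborel. x \<notin> {a<..<b}" using assms(1) by (auto elim: eventually_mono)
 then have "emeasure lborel {a<..<b} = 0"
  using AE_iff_measurable[of "{a<..<b}" lborel "%x. x \<notin> {a<..<b}"] by (simp del: greaterThanLessThan_iff)
 then show False using assms(2) by simp
qed

text \<open>Along an approximating sequence from \<open>W\<close>, increments over [a, b] are
  pairings with \<open>kk a b\<close> and therefore converge; a single point of convergence fixes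
  the additive constant. So the singularity of the closure is confined to 0.\<close>

lemma M_half_line:
 assumes "(u, G) \<in> M"
 shows "\<exists>U. ac_on {0<..} U (%x. fn G x / sc x) & (AE x in lborel. 0 < x --> fn u x = U x)"
proof -
 have "(u, G) \<in> closure (gr sc)" using assms by (simp add: M_def)
 then obtain z where z: "!!n. z n \<in> gr sc" "z ----> (u, G)" unfolding closure_sequential by blast
 have "\<exists>v g. (v, g) \<in> W & z n = (v, mlt sc g)" for n using z(1)[of n] by (auto simp: gr_def)
 then obtain v g where vg: "!!n. (v n, g n) \<in> W" "!!n. z n = (v n, mlt sc (g n))" by metis
 have vu: "v ----> u" and gG: "(%n. mlt sc (g n)) ----> G"
  using tendsto_fst[OF z(2)] tendsto_snd[OF z(2)] by (simp_all add: vg(2))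
 obtain r where r: "strict_mono r" "AE x in lborel. (%n. fn (v (r n)) x) ----> fn u x"
  using l2_tendsto_AE_subseq[OF vu] by blast
 have "\<exists>w. ac_on UNIV w (fn (g n)) & (AE x in lborel. fn (v n) x = w x)" for n by (rule W_ac[OF vg(1)])
 then obtain w where w: "!!n. ac_on UNIV (w n) (fn (g n))" "!!n. AE x in lborel. fn (v n) x = w n x" by metis
 have "AE x in lborel. \<forall>n. fn (v n) x = w n x" unfolding AE_all_countable using w(2) by blast
 with r(2) have ae: "AE x in lborel. (%n. w (r n) x) ----> fn u x" by eventually_elim simp
 obtain x0 where x0: "0 < x0" "(%n. w (r n) x0) ----> fn u x0" using AE_pos_witness[OF ae, of 0 1] by auto
 define k where "k x = fn G x / sc x" for x
 define U where "U x = fn u x0 + prim_at x0 k x" for x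
 have ki: "set_integrable lborel {a..b} k" if "0 < a" for a b
  unfolding k_def[abs_def] by (rule quot_integral(1)[OF that])
 have gi: "(LINT x:{a..b}|lborel. fn (g n) x) = cip (mlt sc (g n)) (toL (kk a b))" if "0 < a" for a b n proof -
  have "(LINT x:{a..b}|lborel. fn (g n) x) = (LINT x:{a..b}|lborel. fn (mlt sc (g n)) x / sc x)"
   unfolding set_lebesgue_integral_def
  proof (rule integral_cong_AE)
   show "AE x in lborel. indicator {a..b} x *\<^sub>R fn (g n) x = indicator {a..b} x *\<^sub>R (fn (mlt sc (g n)) x / sc x)"
    using fn_mlt_bdd[OF bdd_sc, of "g n"]
   proof eventually_elim
    case (elim x)
    have "x \<in> {a..b} ==> sc x \<noteq> 0" using c_pos[of x] that by (auto simp: sc_def)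
    then show ?case using elim by (auto simp: indicator_def)
   qed
  qed measurable
  then show ?thesis by (simp add: quot_integral(2)[OF that])
 qed
 have conv: "(%n. LINT x:{a..b}|lborel. fn (g (r n)) x) ----> (LINT x:{a..b}|lborel. k x)" if "0 < a" for a b proof -
  have "(%n. mlt sc (g (r n))) ----> G" using LIMSEQ_subseq_LIMSEQ[OF gG r(1)] by (simp add: o_def)
  then show ?thesis unfolding gi[OF that] k_def quot_integral(2)[OF that] by (rule cip_tendsto)
 qed
 have "AE x in lborel. 0 < x --> fn u x = U x" using ae proof (eventually_elim, intro impI)
  fix x assume lim: "(%n. w (r n) x) ----> fn u x" and x: "0 < x"
  have l1: "(%n. w (r n) x - w (r n) x0) ----> fn u x - fn u x0" by (intro tendsto_intros lim x0)
  have l2: "(%n. w (r n) x - w (r n) x0) ----> prim_at x0 k x" proof (cases "x0 <= x")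
   case True
   then show ?thesis using conv[OF x0(1), of x] ac_onD(2)[OF w(1), of x0 x] by (simp add: prim_at_def)
  next
   case False
   have "(%n. - (LINT t:{x..x0}|lborel. fn (g (r n)) t)) ----> - (LINT t:{x..x0}|lborel. k t)"
    by (intro tendsto_minus conv x)
   moreover have "w (r n) x - w (r n) x0 = - (LINT t:{x..x0}|lborel. fn (g (r n)) t)" for n
    using ac_onD(2)[OF w(1), of x x0 "r n"] False by (simp add: algebra_simps)
   ultimately show ?thesis using False by (simp add: prim_at_def)
  qed
  show "fn u x = U x" using LIMSEQ_unique[OF l1 l2] by (simp add: U_def algebra_simps)
 qed
 moreover have "ac_on {0<..} U k" unfolding ac_on_def proof (intro allI impI)
  fix a b :: real assume ab: "a <= b" "{a..b} \<subseteq> {0<..}"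
  then have "0 < a" by auto
  then show "set_integrable lborel {a..b} k & U b - U a = (LINT x:{a..b}|lborel. k x)"
   using ki prim_at_diff[OF ki x0(1) \<open>0 < a\<close> ab(1)] by (simp add: U_def)
 qed
 ultimately show ?thesis unfolding k_def[abs_def] by blast
qed

end

context viscosity
begin

lemma hm_Rf: assumes "hm u w G" shows "hm (Rf u) (Rf w) (- Rf G)" proof -
 have "inner (Rf w) v = inner (- Rf G) K" if "(v, K) \<in> M" for v K proof -
  have "inner w (Rf v) = inner G (- Rf K)" using assms M_Rf[OF that] by (auto simp: hm_def)
  then show ?thesis by (simp add: inner_Rf)
 qed
 then show ?thesis using assms M_Rf by (auto simp: hm_def)
qed

text \<open>The flux c u' is sqrt(c) G. The test pairs are trapezoids cut off by \<open>Q\<close>,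
  admissible although they do not vanish at 0+; hence no boundary term appears at 0, and the flux is
  minus the integral of w from 0.\<close>

lemma hm_flux:
 assumes hm: "hm u w G"
 shows "AE x in lborel. 0 < x --> sc x * fn G x = - primitive (fn w) x"
proof -
 define F where "F = primitive (fn w)"
 have acF: "ac_on UNIV F (fn w)" unfolding F_def by (intro ac_on_primitive L2_set_integrable) simp
 have Fc: "continuous_on UNIV F" by (rule ac_on_continuous[OF acF]) simp
 have F0: "F 0 = 0" proof -
  have "AE x in lborel. indicator {0..0} x *\<^sub>R fn w x = 0" using AE_lborel_singleton[of 0] by eventually_elim auto
  then show ?thesis unfolding F_def primitive_def set_lebesgue_integral_def by (simp add: integral_eq_zero_AE)
 qed
 have Fi: "set_integrable lborel {a..b} F" for a b
  by (intro borel_integrable_atLeastAtMost') (rule continuous_on_subset[OF Fc], simp)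
 have scG: "(%x. sc x * fn G x) \<in> L2" by (intro bdd_mult_L2 bdd_sc) simp
 have sGi: "set_integrable lborel {a..b} (%x. sc x * fn G x)" for a b by (rule L2_set_integrable[OF scG])
 \<comment> \<open>On the positive axis the derivative of the trapezoid is -1 on (a, b) and 0
   elsewhere, so the weak equation compares the integrals over (a, b) of the flux and of the
   primitive of \<open>w\<close>.\<close>
 have main: "(LINT x:{a..b}|lborel. sc x * fn G x + F x) = 0" if ab: "0 < a" "a < b" for a b proof -
  have W: "(cs d (toL (trap a b)), cs d (toL (trap' a b))) \<in> W" for d by (intro W_cs W_I_ac ac_trap ab trap_L2)
  have Qcs: "Q (cs d x) = cs d (Q x)" for d x unfolding Q_def by (rule mlt_cs[OF bdd_Q])
  have "inner w (cs d (Q (toL (trap a b)))) = inner G (cs d (Q (mlt sc (toL (trap' a b)))))" for d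
   using Q_W[OF W[of d]] hm by (simp add: hm_def Qcs mlt_cs[OF bdd_sc])
  from this[of 1] this[of \<i>]
  have eq: "cip w (Q (toL (trap a b))) = cip G (Q (mlt sc (toL (trap' a b))))" by (simp add: cip_eq_inner)
  have "cip w (Q (toL (trap a b))) = (LINT x|lborel. fn w x * cnj (indicator {0<..} x * trap a b x))"
   unfolding Q_def toL_mlt_bdd[OF bdd_Q trap_L2(1), symmetric]
   by (rule cip_toL_right) (rule bdd_mult_L2[OF bdd_Q trap_L2(1)])
  also have "... = (LINT x:{0..b}|lborel. fn w x * trap a b x)" unfolding set_lebesgue_integral_def
  proof (rule integral_cong_AE)
   show "AE x in lborel. fn w x * cnj (indicator {0<..} x * trap a b x) = indicator {0..b} x *\<^sub>R (fn w x * trap a b x)"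
    using AE_lborel_singleton[of 0] by eventually_elim (auto simp: indicator_def trap_def)
   show "(%x. fn w x * cnj (indicator {0<..} x * trap a b x)) \<in> borel_measurable lborel"
    "(%x. indicator {0..b} x *\<^sub>R (fn w x * trap a b x)) \<in> borel_measurable lborel"
    using L2_measurable[OF trap_L2(1), of a b] by measurable
  qed
  also have "... = (LINT x:{a..b}|lborel. F x)" proof -
   have ac: "ac_on UNIV (%x. F x * trap a b x) (%x. fn w x * trap a b x + F x * trap' a b x)"
    by (intro ac_on_mult acF ac_trap ab)
   have tc: "continuous_on UNIV (trap a b)" by (rule ac_on_continuous[OF ac_trap[OF ab]]) simp
   have i1: "set_integrable lborel {0..b} (%x. fn w x * trap a b x)"
    by (intro set_integrable_mult_continuous L2_set_integrable tc) simp
   have i2: "set_integrable lborel {0..b} (%x. F x * trap' a b x)"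
    using set_integral_diff(1)[OF ac_onD(1)[OF ac, of 0 b] i1] ab by simp
   have "(LINT x:{0..b}|lborel. fn w x * trap a b x + F x * trap' a b x) = 0"
    using ac_onD(2)[OF ac, of 0 b] ab by (simp add: F0 trap_def)
   then have "(LINT x:{0..b}|lborel. fn w x * trap a b x) = - (LINT x:{0..b}|lborel. F x * trap' a b x)"
    unfolding set_integral_add(2)[OF i1 i2] by (simp add: eq_neg_iff_add_eq_0)
   also have "... = (LINT x:{0..b}|lborel. - (F x * trap' a b x))" by (simp add: set_lebesgue_integral_def)
   also have "... = (LINT x:{a..b}|lborel. F x)" unfolding set_lebesgue_integral_def proof (rule integral_cong_AE)
    show "AE x in lborel. indicator {0..b} x *\<^sub>R - (F x * trap' a b x) = indicator {a..b} x *\<^sub>R F x"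
     using AE_lborel_singleton[of a] AE_lborel_singleton[of b]
     by eventually_elim (use ab in \<open>auto simp: indicator_def trap'_def\<close>)
    show "(%x. indicator {0..b} x *\<^sub>R - (F x * trap' a b x)) \<in> borel_measurable lborel"
     "(%x. indicator {a..b} x *\<^sub>R F x) \<in> borel_measurable lborel"
     using L2_measurable[OF trap_L2(2), of a b] borel_measurable_continuous_onI[OF Fc] by measurable
   qed
   finally show ?thesis .
  qed
  finally have 1: "cip w (Q (toL (trap a b))) = (LINT x:{a..b}|lborel. F x)" .
  have "cip G (Q (mlt sc (toL (trap' a b)))) = (LINT x|lborel. fn G x * cnj (indicator {0<..} x * (sc x * trap' a b x)))"
   unfolding Q_def toL_mlt_bdd[OF bdd_sc trap_L2(2), symmetric]
    toL_mlt_bdd[OF bdd_Q bdd_mult_L2[OF bdd_sc trap_L2(2)], symmetric]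
   by (rule cip_toL_right) (intro bdd_mult_L2 bdd_Q bdd_sc trap_L2)
  also have "... = (LINT x:{a..b}|lborel. - (sc x * fn G x))" unfolding set_lebesgue_integral_def
  proof (rule integral_cong_AE)
   show "AE x in lborel. fn G x * cnj (indicator {0<..} x * (sc x * trap' a b x)) = indicator {a..b} x *\<^sub>R - (sc x * fn G x)"
    using AE_lborel_singleton[of a] AE_lborel_singleton[of b]
    by eventually_elim (use ab in \<open>auto simp: indicator_def trap'_def sc_def\<close>)
   show "(%x. fn G x * cnj (indicator {0<..} x * (sc x * trap' a b x))) \<in> borel_measurable lborel"
    "(%x. indicator {a..b} x *\<^sub>R - (sc x * fn G x)) \<in> borel_measurable lborel"
    using L2_measurable[OF trap_L2(2), of a b] by measurable
  qed
  finally have 2: "cip G (Q (mlt sc (toL (trap' a b)))) = (LINT x:{a..b}|lborel. - (sc x * fn G x))" .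
  have "(LINT x:{a..b}|lborel. F x) = - (LINT x:{a..b}|lborel. sc x * fn G x)"
   using eq 1 2 by (simp add: set_lebesgue_integral_def)
  then show ?thesis unfolding set_integral_add(2)[OF sGi Fi] by simp
 qed
 have "AE x in lborel. 0 < x --> sc x * fn G x + F x = 0" proof (rule AE_zero_of_interval_integrals_pos)
  show "set_integrable lborel {a..b} (%x. sc x * fn G x + F x)" for a b by (intro set_integral_add sGi Fi)
  show "(LINT x:{a..b}|lborel. sc x * fn G x + F x) = 0" if "0 < a" "a <= b" for a b proof (cases "a = b")
   case True
   have "AE x in lborel. indicator {a..b} x *\<^sub>R (sc x * fn G x + F x) = 0"
    using AE_lborel_singleton[of a] by eventually_elim (auto simp: True)
   then show ?thesis unfolding set_lebesgue_integral_def by (rule integral_eq_zero_AE)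
  qed (use main that in auto)
 qed
 then show ?thesis by eventually_elim (auto simp: F_def add_eq_0_iff)
qed

text \<open>One representative with two densities that agree almost everywhere: G / sqrt(c) carries
  the energy bound, the quotient of the primitive of w by c carries pointwise bounds.\<close>

theorem hm_half_line:
 assumes hm: "hm u w G"
 shows "\<exists>U. ac_on {0<..} U (%x. fn G x / sc x)
  & ac_on {0<..} U (%x. - primitive (fn w) x / cor (c x))
  & (AE x in lborel. 0 < x --> fn u x = U x)"
proof -
 have m: "(u, G) \<in> M" using hm unfolding hm_def by (rule conjunct1)
 obtain U where U: "ac_on {0<..} U (%x. fn G x / sc x)" "AE x in lborel. 0 < x --> fn u x = U x"
  using M_half_line[OF m] by (elim exE conjE)
 define F where "F x = - primitive (fn w) x / cor (c x)" for x
 have Pm: "primitive (fn w) \<in> borel_measurable borel"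
  by (intro borel_measurable_continuous_onI ac_on_continuous[OF ac_on_primitive] L2_set_integrable) auto
 have ae: "AE x in lborel. 0 < x --> fn G x / sc x = F x" using hm_flux[OF hm] proof (eventually_elim, intro impI)
  fix x assume *: "0 < x --> sc x * fn G x = - primitive (fn w) x" and x: "0 < x"
  have cc: "cor (c x) = sc x * sc x" using c_nonneg[of x] by (simp add: sc_def flip: of_real_mult)
  have nz: "sc x \<noteq> 0" using c_pos[of x] x by (simp add: sc_def)
  have "F x = sc x * fn G x / (sc x * sc x)" unfolding F_def cc using * x by simp
  also have "... = fn G x / sc x" by (rule mult_divide_mult_cancel_left[OF nz])
  finally show "fn G x / sc x = F x" ..
 qed
 have "ac_on {0<..} U F" unfolding ac_on_def proof (intro allI impI)
  fix a b :: real assume ab: "a <= b" "{a..b} \<subseteq> {0<..}"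
  have e: "AE x in lborel. indicator {a..b} x *\<^sub>R (fn G x / sc x) = indicator {a..b} x *\<^sub>R F x"
   using ae by eventually_elim (use ab in \<open>auto simp: indicator_def\<close>)
  have m: "(%x. indicator {a..b} x *\<^sub>R (fn G x / sc x)) \<in> borel_measurable lborel"
   "(%x. indicator {a..b} x *\<^sub>R F x) \<in> borel_measurable lborel" unfolding F_def using Pm by measurable
  have "set_integrable lborel {a..b} F" unfolding set_integrable_def
   using integrable_cong_AE_imp[OF ac_onD(1)[OF U(1) ab, unfolded set_integrable_def] m(2)] e
   by (auto elim: eventually_mono)
  moreover have "U b - U a = (LINT x:{a..b}|lborel. F x)"
   unfolding ac_onD(2)[OF U(1) ab] set_lebesgue_integral_def by (rule integral_cong_AE[OF m e])
  ultimately show "set_integrable lborel {a..b} F & U b - U a = (LINT x:{a..b}|lborel. F x)" by blast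
 qed
 then show ?thesis using U unfolding F_def[abs_def] by blast
qed

end

subsection \<open>Pointwise bounds on the half-line\<close>

lemma AE_reflect: assumes "AE x in lborel. P (x::real)" shows "AE x in lborel. P (- x)"
proof (rule AE_distrD[where M' = borel and f = uminus and P = P])
 show "AE x in distr lborel borel uminus. P x" using assms unfolding lborel_distr_uminus .
qed simp

lemma has_real_derivative_powr_divide:
 assumes "0 < y" "p \<noteq> 0" shows "((%y. D / p * y powr p) has_real_derivative D * y powr (p - 1)) (at y)"
proof -
 have "D / p * (p * y powr (p - 1)) = D * y powr (p - 1)" using assms by simp
 then show ?thesis using DERIV_cmult[OF has_real_derivative_powr[OF assms(1), of p], of "D / p"] by metis
qed

lemma ac_on_compare:
 assumes ac: "ac_on S U g" and ab: "a <= b" "{a..b} \<subseteq> S"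
  and h: "!!y. a <= y ==> y <= b ==> (h has_real_derivative h' y) (at y)" and h': "continuous_on {a..b} h'"
  and ae: "AE y in lborel. a <= y & y <= b --> cmod (g y) <= h' y"
 shows "cmod (U b - U a) <= h b - h a"
proof -
 have "cmod (U b - U a) = cmod (LINT y:{a..b}|lborel. g y)" by (simp add: ac_onD(2)[OF ac ab])
 also have "... <= (LINT y:{a..b}|lborel. cmod (g y))" by (rule set_integral_norm_bound[OF ac_onD(1)[OF ac ab]])
 also have "... <= (LINT y:{a..b}|lborel. h' y)" proof (rule set_integral_mono_AE)
  show "set_integrable lborel {a..b} (%y. cmod (g y))" by (rule set_integrable_norm[OF ac_onD(1)[OF ac ab]])
  show "set_integrable lborel {a..b} h'" by (rule borel_integrable_atLeastAtMost'[OF h'])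
  show "AE y\<in>{a..b} in lborel. cmod (g y) <= h' y" using ae by eventually_elim simp
 qed
 also have "... = h b - h a" unfolding set_lebesgue_integral_def by (rule integral_FTC_atLeastAtMost)
   (use ab h h' in \<open>auto simp flip: has_real_derivative_iff_has_vector_derivative
    intro: has_field_derivative_at_within\<close>)
 finally show ?thesis .
qed

context coefficient
begin

section \<open>Quantitative bounds for 1 / c and for increments away from 0\<close>

lemma inv_c_le: assumes "0 < a" "a <= x" shows "1 / c x <= 2 * max 1 (a powr (- (2 * \<delta>)))" proof (cases "x <= 1")
 case True
 have "a powr (2 * \<delta>) <= x powr (2 * \<delta>)" using assms \<delta> by (intro powr_mono2) auto
 then have "a powr (2 * \<delta>) / 2 <= c x" using c_lower_near[of x] True assms by simp
 then have "1 / c x <= 1 / (a powr (2 * \<delta>) / 2)" using assms c_pos[of x] by (intro divide_left_mono mult_pos_pos) auto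
 also have "... = 2 * a powr (- (2 * \<delta>))" by (simp add: powr_minus_divide)
 also have "... <= 2 * max 1 (a powr (- (2 * \<delta>)))" by simp
 finally show ?thesis .
next
 case False
 then have "1 / 2 <= c x" by (intro c_lower_far) simp
 then have "1 / c x <= 1 / (1 / 2)" by (intro divide_left_mono) auto
 also have "... <= 2 * max 1 (a powr (- (2 * \<delta>)))" by simp
 finally show ?thesis .
qed

lemma inv_c_near: assumes "0 < x" "x <= 1" shows "1 / c x <= 2 * x powr (- (2 * \<delta>))" proof -
 have "1 <= x powr (- (2 * \<delta>))" using powr_mono_both'[of "- (2 * \<delta>)" 0 x 1] powr_le1[of "2 * \<delta>" x] assms \<delta>
  by (simp add: powr_minus_divide)
 then show ?thesis using inv_c_le[of x x] assms by (simp add: max_def)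
qed

lemma norm_kk:
 assumes "0 < a" "a <= b"
 shows "(norm (toL (kk a b)))\<^sup>2 <= 2 * (b - a) * max 1 (a powr (- (2 * \<delta>)))"
proof -
 let ?B = "2 * max 1 (a powr (- (2 * \<delta>)))"
 have "(norm (toL (kk a b)))\<^sup>2 = (LINT x|lborel. (cmod (kk a b x))\<^sup>2)" by (rule norm_toL_square[OF kk_L2[OF assms(1)]])
 also have "... <= (LINT x|lborel. indicator {a..b} x * ?B)" proof (rule integral_mono)
  show "integrable lborel (%x. (cmod (kk a b x))\<^sup>2)" by (rule L2_integrable_square[OF kk_L2[OF assms(1)]])
  show "integrable lborel (%x. indicator {a..b} x * ?B :: real)"
   by (intro integrable_mult_left integrable_indicator_Icc)
  show "(cmod (kk a b x))\<^sup>2 <= indicator {a..b} x * ?B" for x proof (cases "x \<in> {a..b}")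
   case True
   have "(cmod (kk a b x))\<^sup>2 = 1 / c x"
    using True c_nonneg[of x] by (simp add: kk_def sc_def norm_divide power_divide)
   then show ?thesis using inv_c_le[of a x] assms True by simp
  qed (simp add: kk_def)
 qed
 also have "... = 2 * (b - a) * max 1 (a powr (- (2 * \<delta>)))" using assms by simp
 finally show ?thesis .
qed

text \<open>Cauchy-Schwarz for the pairing of \<open>G\<close> with \<open>kk a b\<close>, whose
  norm is controlled by 1 / c on [a, b].\<close>

lemma half_line_diff:
 assumes ac: "ac_on {0<..} U (%x. fn G x / sc x)" and ab: "0 < a" "a <= b"
 shows "cmod (U b - U a) <= norm G * sqrt (2 * (b - a) * max 1 (a powr (- (2 * \<delta>))))"
proof -
 have "U b - U a = cip G (toL (kk a b))"
  using ac_onD(2)[OF ac ab(2)] ab quot_integral(2)[OF ab(1), of b G] by (simp add: subset_eq)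
 then have "cmod (U b - U a) <= norm G * norm (toL (kk a b))" using norm_cip_le by simp
 also have "... <= norm G * sqrt (2 * (b - a) * max 1 (a powr (- (2 * \<delta>))))"
  by (intro mult_left_mono real_le_rsqrt norm_kk ab) simp
 finally show ?thesis .
qed

text \<open>U varies by at most twice the norm of \<open>G\<close> on [x, x + 1]. If the bound
  failed at x, then |U| would exceed the norm of u on this whole interval of length 1, contradicting
  the value of that norm.\<close>

lemma half_line_far:
 assumes U: "ac_on {0<..} U (%x. fn G x / sc x)" and ae: "AE x in lborel. 0 < x --> fn u x = U x" and x: "1 <= x"
 shows "cmod (U x) <= norm u + 2 * norm G"
proof (rule ccontr)
 assume "\<not> ?thesis"
 then have m: "norm u < cmod (U x) - 2 * norm G" by simp
 define m where "m = cmod (U x) - 2 * norm G"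
 have m0: "0 <= m" using m norm_ge_zero[of u] unfolding m_def by linarith
 have mU: "m <= cmod (U y)" if "x <= y" "y <= x + 1" for y proof -
  have "x powr (- (2 * \<delta>)) <= 1" using ge_one_powr_ge_zero[of x "2 * \<delta>"] x \<delta> by (simp add: powr_minus_divide)
  then have "sqrt (2 * (y - x) * max 1 (x powr (- (2 * \<delta>)))) <= 2"
   using that by (intro real_le_lsqrt) (auto simp: max_def)
  then have "norm G * sqrt (2 * (y - x) * max 1 (x powr (- (2 * \<delta>)))) <= norm G * 2" by (rule mult_left_mono) simp
  with half_line_diff[OF U, of x y] that x have "cmod (U y - U x) <= 2 * norm G" by simp
  then show ?thesis using norm_triangle_ineq4[of "U y" "U y - U x"] by (simp add: m_def)
 qed
 have "AE y in lborel. indicator {x..x + 1} y * m\<^sup>2 <= (cmod (fn u y))\<^sup>2" using ae proof eventually_elim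
  case (elim y)
  show ?case proof (cases "y \<in> {x..x + 1}")
   case True
   then have "m\<^sup>2 <= (cmod (U y))\<^sup>2" using mU m0 by (intro power_mono) auto
   then show ?thesis using True elim x by simp
  qed simp
 qed
 then have "(LINT y|lborel. indicator {x..x + 1} y * m\<^sup>2) <= (LINT y|lborel. (cmod (fn u y))\<^sup>2)"
  by (intro integral_mono_AE integrable_mult_left integrable_indicator_Icc L2_integrable_square fn_L2)
 then have "m\<^sup>2 <= (norm u)\<^sup>2" by (simp add: norm_l2_square)
 then have "m <= norm u" by (rule power2_le_imp_le) simp
 then show False using m by (simp add: m_def)
qed

lemma primitive_at_0: "primitive (fn w) 0 = 0" proof -
 have "AE x in lborel. indicator {0..0} x *\<^sub>R fn w x = 0" using AE_lborel_singleton[of 0] by eventually_elim auto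
 then show ?thesis unfolding primitive_def set_lebesgue_integral_def by (simp add: integral_eq_zero_AE)
qed

lemma ac_primitive_fn: "ac_on UNIV (primitive (fn w)) (fn w)" by (intro ac_on_primitive L2_set_integrable) simp

text \<open>Comparison with the primitive of the power on [e, y]; continuity of the primitive at 0
  allows e to tend to 0.\<close>

lemma primitive_power_bound:
 assumes w: "AE y in lborel. 0 < y & y <= 1 --> cmod (fn w y) <= A * y powr \<beta>"
  and \<beta>: "-1 < \<beta>" and A: "0 <= A" and y: "0 < y" "y <= 1"
 shows "cmod (primitive (fn w) y) <= A / (1 + \<beta>) * y powr (1 + \<beta>)"
proof -
 let ?F = "primitive (fn w)"
 let ?h = "%z. A / (1 + \<beta>) * z powr (1 + \<beta>)"
 have le: "cmod (?F y - ?F e) <= ?h y" if e: "0 < e" "e < y" for e proof -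
  have "cmod (?F y - ?F e) <= ?h y - ?h e" proof (rule ac_on_compare[OF ac_primitive_fn])
   show "(?h has_real_derivative A * z powr \<beta>) (at z)" if "e <= z" "z <= y" for z
    using has_real_derivative_powr_divide[of z "1 + \<beta>" A] that e \<beta> by simp
   show "continuous_on {e..y} (%z. A * z powr \<beta>)" using e by (intro continuous_intros) auto
   show "AE z in lborel. e <= z & z <= y --> cmod (fn w z) <= A * z powr \<beta>" using w by eventually_elim (use e y in auto)
  qed (use e in auto)
  moreover have "0 <= ?h e" using A \<beta> by simp
  ultimately show ?thesis by linarith
 qed
 have "continuous_on UNIV ?F" by (rule ac_on_continuous[OF ac_primitive_fn]) simp
 then have "isCont ?F 0" by (simp add: continuous_on_eq_continuous_at)
 then have "(?F \<longlongrightarrow> 0) (at_right 0)" using filterlim_at_split isContD primitive_at_0 by metis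
 then have lim: "((%e. cmod (?F y - ?F e)) \<longlongrightarrow> cmod (?F y - 0)) (at_right 0)" by (intro tendsto_intros)
 have "cmod (?F y - 0) <= ?h y" by (rule tendsto_upperbound[OF lim])
   (use le y in \<open>auto simp: eventually_at_right_field intro: exI[of _ y]\<close>)
 then show ?thesis by simp
qed

end

context viscosity
begin

definition hrep :: "l2 => l2 => l2 => (real => complex) => bool" where
 "hrep u w G U \<longleftrightarrow> ac_on {0<..} U (%x. fn G x / sc x)
  & ac_on {0<..} U (%x. - primitive (fn w) x / cor (c x))
  & (AE x in lborel. 0 < x --> fn u x = U x)"

lemma hrep_exists: "hm u w G ==> \<exists>U. hrep u w G U" unfolding hrep_def by (rule hm_half_line)

lemma hrep_AE: "hrep u w G U ==> AE x in lborel. 0 < x --> fn u x = U x" by (simp add: hrep_def)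

lemma hrep_diff:
 assumes U: "hrep u w G U" and ab: "0 < a" "a <= b"
 shows "cmod (U b - U a) <= norm G * sqrt (2 * (b - a) * max 1 (a powr (- (2 * \<delta>))))"
 using half_line_diff[OF _ ab] U by (simp add: hrep_def)

lemma hrep_far: "hrep u w G U ==> 1 <= x ==> cmod (U x) <= norm u + 2 * norm G" using half_line_far by (simp add: hrep_def)

text \<open>Cauchy-Schwarz from x to 1, where \<open>kk x 1\<close> has norm of order x^(-\<delta>).
  This crude singularity is the starting point of the improvement.\<close>

lemma hrep_near:
 assumes U: "hrep u w G U" and x: "0 < x" "x <= 1"
 shows "cmod (U x) <= (norm u + 4 * norm G) * x powr (- \<delta>)"
proof -
 have x1: "1 <= x powr (- \<delta>)" using powr_le1[of \<delta> x] x \<delta> by (simp add: powr_minus_divide)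
 have "(x powr (- \<delta>))\<^sup>2 = x powr (- (2 * \<delta>))" using x by (simp add: powr_power)
 moreover have "1 <= (x powr (- \<delta>))\<^sup>2" using x1 by (simp add: one_le_power)
 ultimately have m: "max 1 (x powr (- (2 * \<delta>))) = (x powr (- \<delta>))\<^sup>2" by simp
 have "2 * (1 - x) * (x powr (- \<delta>))\<^sup>2 <= 4 * (x powr (- \<delta>))\<^sup>2" using x by (intro mult_right_mono) auto
 then have "sqrt (2 * (1 - x) * max 1 (x powr (- (2 * \<delta>)))) <= 2 * x powr (- \<delta>)"
  unfolding m by (intro real_le_lsqrt) (auto simp: power_mult_distrib)
 then have "norm G * sqrt (2 * (1 - x) * max 1 (x powr (- (2 * \<delta>)))) <= norm G * (2 * x powr (- \<delta>))"
  by (rule mult_left_mono) simp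
 with hrep_diff[OF U x] have "cmod (U 1 - U x) <= norm G * (2 * x powr (- \<delta>))" by simp
 moreover have "cmod (U x) <= cmod (U 1) + cmod (U 1 - U x)" using norm_triangle_ineq4[of "U 1" "U 1 - U x"] by simp
 moreover have "cmod (U 1) <= norm u + 2 * norm G" by (rule hrep_far[OF U]) simp
 ultimately have "cmod (U x) <= (norm u + 2 * norm G) * 1 + norm G * (2 * x powr (- \<delta>))" by simp
 also have "... <= (norm u + 2 * norm G) * x powr (- \<delta>) + norm G * (2 * x powr (- \<delta>))"
  by (intro add_right_mono mult_left_mono x1) simp
 finally show ?thesis by (simp add: algebra_simps)
qed

text \<open>Integrating w raises the exponent by 1 and dividing by c lowers it by 2 \<delta>; the
  result is written as (\<beta> + 2 (1 - \<delta>)) - 1, ready for one more integration.\<close>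

lemma flux_bound:
 assumes w: "AE y in lborel. 0 < y & y <= 1 --> cmod (fn w y) <= A * y powr \<beta>"
  and \<beta>: "-1 < \<beta>" and A: "0 <= A" and y: "0 < y" "y <= 1"
 shows "cmod (- primitive (fn w) y / cor (c y)) <= 2 * A / (1 + \<beta>) * y powr (\<beta> + 2 * (1 - \<delta>) - 1)"
proof -
 have "cmod (- primitive (fn w) y / cor (c y)) = cmod (primitive (fn w) y) * (1 / c y)"
  using c_nonneg[of y] by (simp add: norm_divide)
 also have "... <= (A / (1 + \<beta>) * y powr (1 + \<beta>)) * (2 * y powr (- (2 * \<delta>)))"
  by (intro mult_mono primitive_power_bound[OF w] inv_c_near \<beta> A y) (use A \<beta> c_nonneg in auto)
 also have "... = 2 * A / (1 + \<beta>) * (y powr (1 + \<beta>) * y powr (- (2 * \<delta>)))" by simp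
 also have "y powr (1 + \<beta>) * y powr (- (2 * \<delta>)) = y powr (\<beta> + 2 * (1 - \<delta>) - 1)"
  unfolding powr_add[symmetric] by (simp add: algebra_simps)
 finally show ?thesis .
qed

text \<open>Of the gain 2 (1 - \<delta>), half goes into y^(\<beta> + 1 - \<delta>), bounded by the
  same power at x or by 1, and half leaves y^(-\<delta>), integrable at 0; so a step gains 1 -
  \<delta>. The cap at 0 reflects that U 1 need not vanish. One factor 1 / (1 - \<delta>) bounds 1 /
  (1 + \<beta>), the other comes from the last integration.\<close>

lemma hrep_step:
 assumes U: "hrep u w G U" and w: "AE y in lborel. 0 < y & y <= 1 --> cmod (fn w y) <= A * y powr \<beta>"
  and \<beta>: "-\<delta> <= \<beta>" and A: "0 <= A" and x: "0 < x" "x <= 1"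
 shows "cmod (U x) <= (norm u + 2 * norm G + 2 * A / (1 - \<delta>)\<^sup>2) * x powr (min 0 (\<beta> + (1 - \<delta>)))"
proof -
 let ?g = "1 - \<delta>" and ?q = "x powr (min 0 (\<beta> + (1 - \<delta>)))"
 let ?D = "2 * A / ?g * ?q"
 have g: "0 < ?g" "?g <= 1 + \<beta>" using \<delta> \<beta> by auto
 have D: "0 <= ?D" using A g by simp
 have ac: "ac_on {0<..} U (%x. - primitive (fn w) x / cor (c x))" using U by (simp add: hrep_def)
 have "cmod (U 1 - U x) <= ?D / ?g * 1 powr ?g - ?D / ?g * x powr ?g" proof (rule ac_on_compare[OF ac])
  show "((%y. ?D / ?g * y powr ?g) has_real_derivative ?D * y powr (?g - 1)) (at y)" if "x <= y" "y <= 1" for y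
   by (rule has_real_derivative_powr_divide) (use that x g in auto)
  show "continuous_on {x..1} (%y. ?D * y powr (?g - 1))" using x by (intro continuous_intros) auto
  have "cmod (- primitive (fn w) y / cor (c y)) <= ?D * y powr (?g - 1)" if y: "x <= y" "y <= 1" for y
  proof -
   have "y powr (\<beta> + ?g) <= ?q" proof (cases "\<beta> + ?g \<ge> 0")
    case True
    then show ?thesis using powr_le1[of "\<beta> + ?g" y] x y by (simp add: min_def)
   next
    case False
    then show ?thesis using powr_mono2'[of "\<beta> + ?g" x y] x y by (simp add: min_def)
   qed
   then have "y powr (\<beta> + ?g) * y powr (?g - 1) <= ?q * y powr (?g - 1)" by (rule mult_right_mono) simp
   moreover have "y powr (\<beta> + ?g) * y powr (?g - 1) = y powr (\<beta> + 2 * ?g - 1)"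
    unfolding powr_add[symmetric] by (simp add: algebra_simps)
   ultimately have "2 * A / (1 + \<beta>) * y powr (\<beta> + 2 * ?g - 1) <= 2 * A / ?g * (?q * y powr (?g - 1))"
    using A g by (intro mult_mono divide_left_mono) auto
   moreover have "cmod (- primitive (fn w) y / cor (c y)) <= 2 * A / (1 + \<beta>) * y powr (\<beta> + 2 * ?g - 1)"
    by (rule flux_bound[OF w]) (use \<beta> \<delta> A x y in auto)
   ultimately show ?thesis by (simp add: mult.assoc)
  qed
  then show "AE y in lborel. x <= y & y <= 1 --> cmod (- primitive (fn w) y / cor (c y)) <= ?D * y powr (?g - 1)"
   by auto
 qed (use x in auto)
 moreover have "0 <= ?D / ?g * x powr ?g" using D g by (intro mult_nonneg_nonneg divide_nonneg_pos) (use A in auto)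
 ultimately have d: "cmod (U 1 - U x) <= ?D / ?g" by simp
 have q: "1 <= ?q" using powr_le1[of "- min 0 (\<beta> + ?g)" x] x by (simp add: powr_minus_divide)
 have "cmod (U x) <= cmod (U 1) + cmod (U 1 - U x)" using norm_triangle_ineq4[of "U 1" "U 1 - U x"] by simp
 also have "... <= (norm u + 2 * norm G) * 1 + ?D / ?g" using d hrep_far[OF U, of 1] by simp
 also have "... <= (norm u + 2 * norm G) * ?q + ?D / ?g" by (intro add_right_mono mult_left_mono q) simp
 also have "... = (norm u + 2 * norm G + 2 * A / ?g\<^sup>2) * ?q" by (simp add: power2_eq_square distrib_right)
 finally show ?thesis .
qed

text \<open>Each entry is the image of the previous one under H in the weak sense, so regularity
  passes from every entry to the one before it.\<close>

definition chain :: "(nat => l2) => bool" where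
 "chain u \<longleftrightarrow> (\<forall>j. \<exists>G. hm (u j) (u (Suc j)) G)"

lemma chain_Suc: "chain u ==> chain (%j. u (Suc j))" by (simp add: chain_def)

lemma chain_Rf: assumes "chain u" shows "chain (%j. Rf (u j))" unfolding chain_def proof
 fix j
 obtain G where "hm (u j) (u (Suc j)) G" using assms by (auto simp: chain_def)
 then show "\<exists>G. hm (Rf (u j)) (Rf (u (Suc j))) G" using hm_Rf by blast
qed

lemma chain_two_norms: "norm (u 0) + norm (u (Suc 0)) <= (\<Sum>j\<le>Suc k. norm (u j :: l2))" proof -
 have "(\<Sum>j\<le>Suc 0. norm (u j)) <= (\<Sum>j\<le>Suc k. norm (u j))" by (intro sum_mono2) auto
 then show ?thesis by simp
qed

text \<open>Each application of the resolvent improves the power of the singularity at \<open>0\<close> by \<open>1 - \<delta>\<close>.\<close>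

lemma chain_bound_near:
 "\<exists>C\<ge>0. \<forall>u. chain u --> (AE x in lborel. 0 < x & x <= 1 -->
   cmod (fn (u 0) x) <= C * (\<Sum>j\<le>Suc k. norm (u j)) * x powr (min 0 (real k * (1 - \<delta>) - \<delta>)))"
proof (induction k)
 case 0
 have "AE x in lborel. 0 < x & x <= 1 --> cmod (fn (u 0) x) <= 5 * (\<Sum>j\<le>Suc 0. norm (u j)) * x powr (min 0 (real 0 * (1 - \<delta>) - \<delta>))"
  if u: "chain u" for u
 proof -
  obtain G where G: "hm (u 0) (u (Suc 0)) G" using u by (auto simp: chain_def)
  obtain U where U: "hrep (u 0) (u (Suc 0)) G U" using hrep_exists[OF G] by blast
  have "cmod (U x) <= 5 * (\<Sum>j\<le>Suc 0. norm (u j)) * x powr (min 0 (real 0 * (1 - \<delta>) - \<delta>))" if "0 < x" "x <= 1" for x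
  proof -
   have "cmod (U x) <= (norm (u 0) + 4 * norm G) * x powr (- \<delta>)" by (rule hrep_near[OF U that])
   also have "... <= 5 * (\<Sum>j\<le>Suc 0. norm (u j)) * x powr (- \<delta>)" proof (rule mult_right_mono)
    have "(\<Sum>j\<le>Suc 0. norm (u j)) = norm (u 0) + norm (u (Suc 0))" by simp
    then show "norm (u 0) + 4 * norm G <= 5 * (\<Sum>j\<le>Suc 0. norm (u j))"
     using hm_norm_le[OF G] norm_ge_zero[of "u (Suc 0)"] by linarith
   qed simp
   finally show ?thesis using \<delta> by (simp add: min_def)
  qed
  then show ?thesis using hrep_AE[OF U] by (auto elim: eventually_mono)
 qed
 then show ?case by (intro exI[of _ 5]) auto
next
 case (Suc k)
 obtain C where C: "0 <= C" and IH: "!!u. chain u ==> AE x in lborel. 0 < x & x <= 1 -->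
   cmod (fn (u 0) x) <= C * (\<Sum>j\<le>Suc k. norm (u j)) * x powr (min 0 (real k * (1 - \<delta>) - \<delta>))" using Suc by blast
 \<comment> \<open>The 3 absorbs the norms of \<open>u 0\<close> and \<open>G\<close> through
   \<open>hm_norm_le\<close>; the other summand is the constant produced by
   \<open>hrep_step\<close>.\<close>
 define C' where "C' = 3 + 2 * C / (1 - \<delta>)\<^sup>2"
 have C': "0 <= C'" using C by (simp add: C'_def)
 have "AE x in lborel. 0 < x & x <= 1 -->
   cmod (fn (u 0) x) <= C' * (\<Sum>j\<le>Suc (Suc k). norm (u j)) * x powr (min 0 (real (Suc k) * (1 - \<delta>) - \<delta>))"
  if u: "chain u" for u
 proof -
  let ?N = "\<Sum>j\<le>Suc (Suc k). norm (u j)" and ?N' = "\<Sum>j\<le>Suc k. norm (u (Suc j))"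
  obtain G where G: "hm (u 0) (u (Suc 0)) G" using u by (auto simp: chain_def)
  obtain U where U: "hrep (u 0) (u (Suc 0)) G U" using hrep_exists[OF G] by blast
  have N: "?N = norm (u 0) + ?N'" by (rule sum.atMost_Suc_shift)
  have N': "0 <= ?N'" "?N' <= ?N" unfolding N by (simp_all only: le_add_same_cancel2 norm_ge_zero sum_nonneg)
  have m: "min 0 (min 0 (real k * (1 - \<delta>) - \<delta>) + (1 - \<delta>)) = min 0 (real (Suc k) * (1 - \<delta>) - \<delta>)"
   using \<delta> by (auto simp: min_def algebra_simps)
  have "cmod (U x) <= C' * ?N * x powr (min 0 (real (Suc k) * (1 - \<delta>) - \<delta>))" if x: "0 < x" "x <= 1" for x proof -
   have "cmod (U x) <= (norm (u 0) + 2 * norm G + 2 * (C * ?N') / (1 - \<delta>)\<^sup>2) *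
     x powr (min 0 (min 0 (real k * (1 - \<delta>) - \<delta>) + (1 - \<delta>)))"
    by (rule hrep_step[OF U IH[OF chain_Suc[OF u]]]) (use \<delta> C N' x in auto)
   also have "... <= C' * ?N * x powr (min 0 (min 0 (real k * (1 - \<delta>) - \<delta>) + (1 - \<delta>)))" proof (rule mult_right_mono)
    have "norm (u 0) + 2 * norm G <= 3 * ?N"
     using hm_norm_le[OF G] chain_two_norms[of u "Suc k"] norm_ge_zero[of "u 0"] norm_ge_zero[of "u (Suc 0)"] by linarith
    moreover have "2 * (C * ?N') / (1 - \<delta>)\<^sup>2 <= 2 * (C * ?N) / (1 - \<delta>)\<^sup>2"
     using C N' by (intro divide_right_mono mult_left_mono) auto
    ultimately show "norm (u 0) + 2 * norm G + 2 * (C * ?N') / (1 - \<delta>)\<^sup>2 <= C' * ?N"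
     by (simp add: C'_def distrib_right)
   qed simp
   finally show ?thesis unfolding m .
  qed
  then show ?thesis using hrep_AE[OF U] by (auto elim: eventually_mono)
 qed
 then show ?case using C' by blast
qed

lemma chain_bound_half_line:
 "\<exists>C\<ge>0. \<exists>n. \<forall>u. chain u --> (AE x in lborel. 0 < x --> cmod (fn (u 0) x) <= C * (\<Sum>j\<le>n. norm (u j)))"
proof -
 \<comment> \<open>Enough steps of gain 1 - \<delta> to remove the initial singularity
   x^(-\<delta>).\<close>
 obtain k :: nat where "\<delta> / (1 - \<delta>) <= real k" using real_arch_simple by blast
 then have k: "0 <= real k * (1 - \<delta>) - \<delta>" using \<delta> by (simp add: field_simps)
 obtain C where C: "0 <= C" and b: "!!u. chain u ==> AE x in lborel. 0 < x & x <= 1 -->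
   cmod (fn (u 0) x) <= C * (\<Sum>j\<le>Suc k. norm (u j)) * x powr (min 0 (real k * (1 - \<delta>) - \<delta>))"
  using chain_bound_near[of k] by blast
 have "AE x in lborel. 0 < x --> cmod (fn (u 0) x) <= (C + 5) * (\<Sum>j\<le>Suc k. norm (u j))" if u: "chain u" for u proof -
  let ?N = "\<Sum>j\<le>Suc k. norm (u j)"
  obtain G where G: "hm (u 0) (u (Suc 0)) G" using u by (auto simp: chain_def)
  obtain U where U: "hrep (u 0) (u (Suc 0)) G U" using hrep_exists[OF G] by blast
  have N: "0 <= ?N" by (intro sum_nonneg) simp
  show ?thesis using b[OF u] hrep_AE[OF U] proof (eventually_elim, intro impI)
   fix x assume 1: "0 < x & x <= 1 --> cmod (fn (u 0) x) <= C * ?N * x powr (min 0 (real k * (1 - \<delta>) - \<delta>))"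
    and 2: "0 < x --> fn (u 0) x = U x" and x: "0 < x"
   show "cmod (fn (u 0) x) <= (C + 5) * ?N" proof (cases "x <= 1")
    case True
    then show ?thesis using 1 x k N by (simp add: min_def distrib_right)
   next
    case False
    have "cmod (U x) <= norm (u 0) + 2 * norm G" by (rule hrep_far[OF U]) (use False in simp)
    also have "... <= 5 * ?N"
     using hm_norm_le[OF G] chain_two_norms[of u k] norm_ge_zero[of "u 0"] norm_ge_zero[of "u (Suc 0)"] by linarith
    finally show ?thesis using 2 x mult_nonneg_nonneg[OF C N] by (simp add: distrib_right)
   qed
  qed
 qed
 then show ?thesis using C by (intro exI[of _ "C + 5"] conjI exI[of _ "Suc k"]) auto
qed

end

subsection \<open>The kernel of the semigroup\<close>

context l2_pvm
begin

lemma T_cs_i: assumes f: "bounded_borel f" shows "T f (cs \<i> u) = cs \<i> (T f u)" proof (rule inner_eq_imp_eq)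
 fix v
 have cc: "cs \<i> (cs (- \<i>) v) = v" by simp
 have d: "cs \<i> (u - w) = cs \<i> u - cs \<i> w" for w using cs_add_right[of \<i> "u - w" w] by (simp add: algebra_simps)
 have "inner (T f (cs \<i> u)) (cs \<i> (cs (- \<i>) v)) = inner (T f u) (cs (- \<i>) v)"
  by (simp only: inner_T[OF f] form_def cs_add_right[symmetric] d[symmetric] mu_cs[of \<i>] norm_ii)
 then show "inner (T f (cs \<i> u)) v = inner (cs \<i> (T f u)) v" unfolding cc by (simp add: inner_cs)
qed

lemma cip_T: assumes f: "bounded_borel f" shows "cip (T f u) v = cip u (T f v)"
 by (simp add: cip_eq_inner T_sym[OF f] T_cs_i[OF f])

lemma norm_T_bounded: assumes "bounded_borel f" shows "\<exists>B\<ge>0. \<forall>u. norm (T f u) <= B * norm u" proof -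
 obtain C where "C > 0" "!!x. \<bar>f x\<bar> <= C" using bounded_borel_bound[OF assms] by metis
 then show ?thesis using norm_T_le[OF bounded_borel_measurable[OF assms]] by (intro exI[of _ C]) auto
qed

end

text \<open>Reduced to the case of equality: the maximum of |f| and b is continuous and equals b
  almost everywhere.\<close>

lemma continuous_AE_le:
 fixes f :: "real => complex"
 assumes S: "open S" and f: "continuous_on S f" and ae: "AE x in lborel. x \<in> S --> cmod (f x) <= b" and x: "x \<in> S"
 shows "cmod (f x) <= b"
proof -
 have "cor (max (cmod (f x)) b) = cor b" proof (rule continuous_AE_eq[OF S _ _ _ x])
  show "continuous_on S (%x. cor (max (cmod (f x)) b))" by (intro continuous_intros f)
  show "AE x in lborel. x \<in> S --> cor (max (cmod (f x)) b) = cor b"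
   using ae by eventually_elim auto
 qed (intro continuous_intros)
 then show ?thesis by simp
qed

lemma power_le_fact_exp: assumes "0 <= (x::real)" shows "x ^ j <= fact j * exp x" proof -
 have "(\<Sum>n\<in>{j}. x ^ n /\<^sub>R fact n) <= (\<Sum>n. x ^ n /\<^sub>R fact n)"
  by (rule sum_le_suminf[OF summable_exp_generic]) (use assms in auto)
 then show ?thesis by (simp add: exp_def field_simps)
qed

lemma bounded_borel_power_et: assumes t: "0 < t" shows "bounded_borel (%s. s ^ j * et t s)" proof (rule bounded_borelI)
 show "\<bar>s ^ j * et t s\<bar> <= fact j / t ^ j" for s proof (cases "0 <= s")
  case True
  have "(t * s) ^ j <= fact j * exp (t * s)" by (rule power_le_fact_exp) (use t True in simp)
  then show ?thesis using t True by (simp add: et_def exp_minus power_mult_distrib field_simps abs_mult)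
 qed (use t in \<open>simp add: et_def\<close>)
 show "(%s. s ^ j * et t s) \<in> borel_measurable borel" unfolding et_def[abs_def] by measurable
qed

context viscosity
begin

lemma chain_T:
 assumes g: "!!j. bounded_borel (%s. s ^ j * g s)"
 shows "chain (%j. T (%s. s ^ j * g s) phi)" unfolding chain_def
proof
 fix j
 have "bounded_borel (%s. s * (s ^ j * g s))" using g[of "Suc j"] by (simp add: mult.assoc)
 from T_in_sop[OF id_borel g this, of phi]
 have "(T (%s. s ^ j * g s) phi, T (%s. s ^ Suc j * g s) phi) \<in> H" by (simp add: mult.assoc)
 then show "\<exists>G. hm (T (%s. s ^ j * g s) phi) (T (%s. s ^ Suc j * g s) phi) G" by (rule H_hm)
qed

text \<open>All functions s^j exp(-t s) are bounded on the spectrum, so every value of the semigroup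
  starts an infinite chain whose norms are controlled by that of \<open>phi\<close>.\<close>

lemma semigroup_bounds:
 assumes t: "0 < t"
 shows "\<exists>C\<ge>0. \<forall>phi. (AE x in lborel. 0 < x --> cmod (fn (T (et t) phi) x) <= C * norm phi) &
  (AE x in lborel. 0 < x --> cmod (fn (Rf (T (et t) phi)) x) <= C * norm phi)"
proof -
 obtain C n where C: "0 <= C" and b: "!!u. chain u ==> AE x in lborel. 0 < x --> cmod (fn (u 0) x) <= C * (\<Sum>j\<le>n. norm (u j))"
  using chain_bound_half_line by blast
 let ?u = "%phi j. T (%s. s ^ j * et t s) phi"
 have "\<forall>j. \<exists>B\<ge>0. \<forall>phi. norm (?u phi j) <= B * norm phi" using norm_T_bounded[OF bounded_borel_power_et[OF t]] by blast
 then obtain B where B: "!!j. 0 <= B j" "!!j phi. norm (?u phi j) <= B j * norm phi" by metis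
 have s: "C * (\<Sum>j\<le>n. norm (?u phi j)) <= C * (\<Sum>j\<le>n. B j) * norm phi" for phi
  unfolding mult.assoc by (intro mult_left_mono C) (simp add: sum_distrib_right sum_mono B)
 have c: "chain (?u phi)" for phi by (rule chain_T[OF bounded_borel_power_et[OF t]])
 have u0: "?u phi 0 = T (et t) phi" for phi by simp
 have "(AE x in lborel. 0 < x --> cmod (fn (T (et t) phi) x) <= C * (\<Sum>j\<le>n. B j) * norm phi) &
  (AE x in lborel. 0 < x --> cmod (fn (Rf (T (et t) phi)) x) <= C * (\<Sum>j\<le>n. B j) * norm phi)" for phi
 proof
  show "AE x in lborel. 0 < x --> cmod (fn (T (et t) phi) x) <= C * (\<Sum>j\<le>n. B j) * norm phi"
   using b[OF c[of phi]] unfolding u0 by eventually_elim (use s[of phi] in auto)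
  show "AE x in lborel. 0 < x --> cmod (fn (Rf (T (et t) phi)) x) <= C * (\<Sum>j\<le>n. B j) * norm phi"
   using b[OF chain_Rf[OF c[of phi]]] unfolding u0 norm_Rf by eventually_elim (use s[of phi] in auto)
 qed
 then show ?thesis using C B(1) by (intro exI[of _ "C * (\<Sum>j\<le>n. B j)"]) (auto intro!: mult_nonneg_nonneg sum_nonneg)
qed

lemma semigroup_hm:
 assumes t: "0 < t"
 shows "\<exists>D\<ge>0. \<forall>phi. \<exists>w G. hm (T (et t) phi) w G & norm G <= D * norm phi"
proof -
 obtain A where A: "0 <= A" "!!phi. norm (T (%s. s ^ 0 * et t s) phi) <= A * norm phi"
  using norm_T_bounded[OF bounded_borel_power_et[OF t, of 0]] by blast
 obtain B where B: "0 <= B" "!!phi. norm (T (%s. s ^ Suc 0 * et t s) phi) <= B * norm phi"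
  using norm_T_bounded[OF bounded_borel_power_et[OF t, of "Suc 0"]] by blast
 have "\<exists>w G. hm (T (et t) phi) w G & norm G <= (A + B) * norm phi" for phi proof -
  obtain G where G: "hm (T (%s. s ^ 0 * et t s) phi) (T (%s. s ^ Suc 0 * et t s) phi) G"
   using chain_T[OF bounded_borel_power_et[OF t], of phi] unfolding chain_def by blast
  have "norm G <= (A + B) * norm phi" using hm_norm_le[OF G] A(2)[of phi] B(2)[of phi] by (simp only: distrib_right)
  then show ?thesis using G by auto
 qed
 then show ?thesis using A B by (intro exI[of _ "A + B"]) auto
qed

text \<open>Evaluation of the continuous representative at x is a bounded functional and so is given
  by a vector \<open>k x\<close>. The bound on increments makes \<open>k\<close> continuous in norm,
  from which the measurability of the kernel in both variables is obtained.\<close>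

lemma half_line_kernel:
 assumes lin: "linear A" and Ai: "!!phi. A (cs \<i> phi) = cs \<i> (A phi)" and C: "0 <= C" and D: "0 <= D"
  and hm: "!!phi. \<exists>w G. hm (A phi) w G & norm G <= D * norm phi"
  and bd: "!!phi. AE x in lborel. 0 < x --> cmod (fn (A phi) x) <= C * norm phi"
 shows "\<exists>k. continuous_on {0<..} k & (\<forall>x>0. norm (k x) <= C) & (\<forall>phi. AE x in lborel. 0 < x --> fn (A phi) x = cip phi (k x))"
proof -
 have "\<forall>phi. \<exists>w G U. hrep (A phi) w G U & norm G <= D * norm phi" using hm hrep_exists by blast
 then obtain w G U where U: "!!phi. hrep (A phi) (w phi) (G phi) (U phi)" and G: "!!phi. norm (G phi) <= D * norm phi" by metis
 have Uc: "continuous_on {0<..} (U phi)" for phi using U[of phi] by (auto simp: hrep_def intro: ac_on_continuous)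
 \<comment> \<open>Identities between classes hold only almost everywhere; continuity makes them
   hold at every x > 0, as linearity of the evaluation requires.\<close>
 have uniq: "U phi x = V x" if "continuous_on {0<..} V" "AE x in lborel. 0 < x --> fn (A phi) x = V x" "0 < x" for phi V x
 proof (rule continuous_AE_eq[OF open_greaterThan Uc that(1)])
  show "AE x in lborel. x \<in> {0<..} --> U phi x = V x" using that(2) hrep_AE[OF U[of phi]] by eventually_elim auto
 qed (use that in simp)
 have Ub: "cmod (U phi x) <= C * norm phi" if "0 < x" for phi x proof (rule continuous_AE_le[OF open_greaterThan Uc])
  show "AE x in lborel. x \<in> {0<..} --> cmod (U phi x) <= C * norm phi"
   using bd[of phi] hrep_AE[OF U[of phi]] by eventually_elim auto
 qed (use that in simp)
 have Uadd: "U (phi + psi) x = U phi x + U psi x" if "0 < x" for phi psi x proof (rule uniq[OF _ _ that])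
  show "continuous_on {0<..} (%x. U phi x + U psi x)" by (intro continuous_intros Uc)
  show "AE x in lborel. 0 < x --> fn (A (phi + psi)) x = U phi x + U psi x" unfolding linear_add[OF lin]
   using fn_add[of "A phi" "A psi"] hrep_AE[OF U[of phi]] hrep_AE[OF U[of psi]] by eventually_elim simp
 qed
 have Uscale: "U (r *\<^sub>R phi) x = cor r * U phi x" if "0 < x" for r phi x proof (rule uniq[OF _ _ that])
  show "continuous_on {0<..} (%x. cor r * U phi x)" by (intro continuous_intros Uc)
  show "AE x in lborel. 0 < x --> fn (A (r *\<^sub>R phi)) x = cor r * U phi x" unfolding linear_scale[OF lin]
   using fn_scaleR[of r "A phi"] hrep_AE[OF U[of phi]] by eventually_elim simp
 qed
 have Ui: "U (cs \<i> phi) x = \<i> * U phi x" if "0 < x" for phi x proof (rule uniq[OF _ _ that])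
  show "continuous_on {0<..} (%x. \<i> * U phi x)" by (intro continuous_intros Uc)
  show "AE x in lborel. 0 < x --> fn (A (cs \<i> phi)) x = \<i> * U phi x"
   unfolding Ai using fn_cs[of \<i> "A phi"] hrep_AE[OF U[of phi]] by eventually_elim simp
 qed
 have "\<exists>k. \<forall>phi. Re (U phi x) = inner phi k" if x: "0 < x" for x proof -
  have "bounded_linear (%phi. Re (U phi x))" proof (rule bounded_linear_intro[where K = C])
   show "norm (Re (U phi x)) <= norm phi * C" for phi
    using Ub[OF x, of phi] abs_Re_le_cmod[of "U phi x"] by (simp add: mult.commute)
  qed (simp_all add: Uadd Uscale x)
  then show ?thesis using Riesz_representation by blast
 qed
 then obtain k where k: "!!x phi. 0 < x ==> Re (U phi x) = inner phi (k x)" by metis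
 have Uk: "U phi x = cip phi (k x)" if x: "0 < x" for phi x proof -
  have "Im (U phi x) = - inner (cs \<i> phi) (k x)" using k[OF x, of "cs \<i> phi"] by (simp add: Ui[OF x])
  also have "... = inner phi (cs \<i> (k x))" proof -
   have "cs (- \<i>) (k x) = - cs \<i> (k x)" using cs_cs[of "-1" \<i> "k x"] scaleR_eq_cs[of "-1" "cs \<i> (k x)"] by simp
   then show ?thesis by (simp add: inner_cs)
  qed
  finally show ?thesis using k[OF x] by (simp add: cip_eq_inner complex_eq_iff)
 qed
 have bound: "norm v <= b" if "!!phi. cmod (cip phi v) <= b * norm phi" "0 <= b" for v :: l2 and b proof (cases "v = 0")
  case False
  have "norm v * norm v = Re (cip v v)" by (simp add: inner_l2_def[symmetric] power2_norm_eq_inner[symmetric] power2_eq_square)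
  also have "... <= b * norm v" using that(1)[of v] complex_Re_le_cmod[of "cip v v"] by linarith
  finally show ?thesis using False by simp
 qed (use that in simp)
 have kb: "norm (k x) <= C" if "0 < x" for x using bound[OF _ C] Ub[OF that] by (simp add: Uk[OF that])
 have kd: "norm (k y - k x) <= D * sqrt (2 * (y - x) * max 1 (a powr (- (2 * \<delta>))))"
  if a: "0 < a" "a <= x" "x <= y" for a x y
 proof (rule bound)
  fix phi
  have "cip phi (k y - k x) = cip phi (k y) - cip phi (k x)" using cip_add_right[of phi "k y - k x" "k x"] by simp
  then have "cip phi (k y - k x) = U phi y - U phi x" using a by (simp add: Uk)
  also have "cmod ... <= norm (G phi) * sqrt (2 * (y - x) * max 1 (x powr (- (2 * \<delta>))))"
   by (rule hrep_diff[OF U]) (use a in auto)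
  also have "... <= (D * norm phi) * sqrt (2 * (y - x) * max 1 (a powr (- (2 * \<delta>))))"
  proof (intro mult_mono G real_sqrt_le_mono mult_left_mono)
   show "max 1 (x powr (- (2 * \<delta>))) <= max 1 (a powr (- (2 * \<delta>)))"
    using powr_mono2'[of "- (2 * \<delta>)" a x] a \<delta> by (auto simp: max_def)
  qed (use a D in auto)
  finally show "cmod (cip phi (k y - k x)) <= D * sqrt (2 * (y - x) * max 1 (a powr (- (2 * \<delta>)))) * norm phi"
   by (simp add: mult_ac)
 qed (use a D in simp)
 have "continuous_on {0<..} k" proof (rule continuous_at_imp_continuous_on, rule ballI)
  fix x0 :: real assume "x0 \<in> {0<..}"
  then have x0: "0 < x0" by simp
  let ?g = "%y. D * sqrt (2 * \<bar>y - x0\<bar> * max 1 ((x0 / 2) powr (- (2 * \<delta>))))"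
  have "((%y. k y - k x0) \<longlongrightarrow> 0) (at x0)" proof (rule Lim_null_comparison)
   have "norm (k y - k x0) <= ?g y" if "x0 / 2 < y" for y
    using kd[of "x0 / 2" x0 y] kd[of "x0 / 2" y x0] that x0 norm_minus_commute[of "k y" "k x0"]
    by (cases "x0 <= y") auto
   then show "\<forall>\<^sub>F y in at x0. norm (k y - k x0) <= ?g y"
    using x0 by (intro eventually_at_in_open'[of "{x0/2<..}", THEN eventually_mono]) auto
   have "(?g \<longlongrightarrow> D * sqrt (2 * \<bar>x0 - x0\<bar> * max 1 ((x0 / 2) powr (- (2 * \<delta>))))) (at x0)" by (intro tendsto_intros)
   then show "(?g \<longlongrightarrow> 0) (at x0)" by simp
  qed
  then show "isCont k x0" unfolding isCont_def by (rule LIM_zero_cancel)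
 qed
 moreover have "AE x in lborel. 0 < x --> fn (A phi) x = cip phi (k x)" for phi
  using hrep_AE[OF U[of phi]] by eventually_elim (simp add: Uk)
 ultimately show ?thesis using kb by blast
qed

lemma Rf_cs: "Rf (cs \<i> u) = cs \<i> (Rf u)" proof (rule inner_eq_imp_eq)
 fix v show "inner (Rf (cs \<i> u)) v = inner (cs \<i> (Rf u)) v" by (simp add: inner_l2_def cip_Rf cip_cs_left)
qed

text \<open>The left half-line is the reflected operator on the right one; at 0 the vector
  \<open>k 0\<close> remains arbitrary.\<close>

lemma semigroup_vectors:
 assumes t: "0 < t"
 shows "\<exists>k C. continuous_on (-{0}) k & (\<forall>x. x \<noteq> 0 --> norm (k x) <= C) &
  (\<forall>phi. AE x in lborel. fn (T (et t) phi) x = cip phi (k x))"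
proof -
 have be: "bounded_borel (et t)" by (rule bounded_borel_et) (use t in simp)
 obtain C where C: "0 <= C" "!!phi. AE x in lborel. 0 < x --> cmod (fn (T (et t) phi) x) <= C * norm phi"
  "!!phi. AE x in lborel. 0 < x --> cmod (fn (Rf (T (et t) phi)) x) <= C * norm phi" using semigroup_bounds[OF t] by blast
 obtain D where D: "0 <= D" "!!phi. \<exists>w G. hm (T (et t) phi) w G & norm G <= D * norm phi" using semigroup_hm[OF t] by blast
 have D': "\<exists>w G. hm (Rf (T (et t) phi)) w G & norm G <= D * norm phi" for phi proof -
  obtain w G where G: "hm (T (et t) phi) w G" "norm G <= D * norm phi" using D(2) by blast
  then show ?thesis using hm_Rf[OF G(1)] by (intro exI[of _ "Rf w"] exI[of _ "- Rf G"]) simp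
 qed
 obtain k1 where k1: "continuous_on {0<..} k1" "!!x. 0 < x ==> norm (k1 x) <= C"
  "!!phi. AE x in lborel. 0 < x --> fn (T (et t) phi) x = cip phi (k1 x)"
  using half_line_kernel[OF T_linear[OF be] T_cs_i[OF be] C(1) D(1,2) C(2)] by blast
 have lin2: "linear (%phi. Rf (T (et t) phi))" using linear_compose[OF T_linear[OF be] Rf_linear] by (simp add: o_def)
 obtain k2 where k2: "continuous_on {0<..} k2" "!!x. 0 < x ==> norm (k2 x) <= C"
  "!!phi. AE x in lborel. 0 < x --> fn (Rf (T (et t) phi)) x = cip phi (k2 x)"
  using half_line_kernel[OF lin2 _ C(1) D(1) D' C(3)] by (auto simp: T_cs_i[OF be] Rf_cs)
 define k where "k x = (if 0 < x then k1 x else k2 (- x))" for x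
 have "continuous_on ({0<..} \<union> {..<0}) k" proof (rule continuous_on_open_Un)
  show "continuous_on {0<..} k" by (rule continuous_on_eq[OF k1(1)]) (simp add: k_def)
  have "continuous_on {..<0} (k2 \<circ> uminus)"
   by (rule continuous_on_compose) (auto intro!: continuous_intros continuous_on_subset[OF k2(1)])
  then show "continuous_on {..<0} k" by (rule continuous_on_eq) (simp add: k_def)
 qed auto
 moreover have "{0<..} \<union> {..<0} = -{0::real}" by auto
 ultimately have "continuous_on (-{0}) k" by simp
 moreover have "norm (k x) <= C" if "x \<noteq> 0" for x using k1(2)[of x] k2(2)[of "- x"] that by (auto simp: k_def)
 moreover have "AE x in lborel. fn (T (et t) phi) x = cip phi (k x)" for phi
  using k1(3)[of phi] AE_reflect[OF k2(3)[of phi]] AE_reflect[OF fn_Rf[of "T (et t) phi"]] AE_lborel_singleton[of 0]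
  by eventually_elim (auto simp: k_def)
 ultimately show ?thesis by blast
qed

text \<open>For t > 0 the exponential is unbounded on the negative axis, so it is compared with its
  truncation at level 1, which leaves it unchanged on the nonnegative axis.\<close>

lemma exp_operator:
 assumes t: "0 <= t" and g: "(phi, g) \<in> spectral_op E (%s. exp (- t * s))"
 shows "g \<in> L2" "toL g = T (et t) (toL phi)"
proof -
 have m: "(%s. exp (- t * s)) \<in> borel_measurable borel" by measurable
 show "g \<in> L2" using g by (simp add: spectral_op_iff)
 have eq: "P {x. \<bar>exp (- t * x)\<bar> <= real (Suc 0)} (toL g) = T (trunc (%s. exp (- t * s)) (Suc 0)) (toL phi)"
  using g unfolding spectral_op_iff sop_iff[OF m] by blast
 have "P {x. \<bar>exp (- t * x)\<bar> <= real (Suc 0)} (toL g) = T (%_. 1) (toL g)"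
  unfolding T_indicator[OF level_sets[OF m], symmetric]
  by (rule T_cong) (use t level_sets[OF m, of "Suc 0"] in \<open>auto simp: indicator_def\<close>)
 moreover have "T (trunc (%s. exp (- t * s)) (Suc 0)) (toL phi) = T (et t) (toL phi)"
  by (rule T_cong) (use t in \<open>auto simp: trunc_def et_def bounded_borel_et bounded_borel_trunc[OF m]\<close>)
 ultimately show "toL g = T (et t) (toL phi)" using eq by simp
qed

lemma et_add: "et s x * et t x = et (s + t) x" by (simp add: et_def exp_add[symmetric] algebra_simps)

lemma T_et_add: "0 <= s ==> 0 <= t ==> T (et s) (T (et t) u) = T (et (s + t)) u" by (simp add: T_mult bounded_borel_et et_add)

text \<open>Splitting the semigroup at t/2 and using symmetry gives K(x, y) = <k y, k x>, which is
  bounded by the square of the bound on the vectors.\<close>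

theorem kernel_exists:
 assumes t: "0 < t" and S: "!!phi. phi \<in> L2 ==> (phi, S phi) \<in> spectral_op E (%s. exp (- t * s))"
 shows "\<exists>K. is_kernel S K & bounded_kernel K"
proof -
 have t2: "0 < t / 2" using t by simp
 obtain k C where k: "continuous_on (-{0}) k" "!!x. x \<noteq> 0 ==> norm (k x) <= C"
  "!!phi. AE x in lborel. fn (T (et (t / 2)) phi) x = cip phi (k x)" using semigroup_vectors[OF t2] by blast
 have C: "0 <= C" using k(2)[of 1] norm_ge_zero[of "k 1"] by linarith
 \<comment> \<open>Set to 0 on the two axes, where \<open>k\<close> need not be continuous; this
   makes \<open>K\<close> Borel.\<close>
 define K where "K z = indicator ((-{0}) \<times> (-{0})) z *\<^sub>R cip (k (snd z)) (k (fst z))" for z :: "real \<times> real"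
 have c1: "continuous_on ((-{0}) \<times> (-{0})) (%z. k (fst z))" "continuous_on ((-{0}) \<times> (-{0})) (%z. k (snd z))"
  by (rule continuous_on_compose2[OF k(1)]; auto intro!: continuous_intros)+
 have bl: "bounded_linear (cs \<i>)" by (rule bounded_linear_intro[where K = 1])
   (auto simp: cs_add_right norm_cs scaleR_eq_cs mult.commute)
 have "continuous_on ((-{0}) \<times> (-{0})) (%z. cip (k (snd z)) (k (fst z)))" unfolding cip_eq_inner
  by (intro continuous_on_Complex continuous_on_inner c1 bounded_linear.continuous_on[OF bl])
 then have Km: "K \<in> borel_measurable borel"
  unfolding K_def[abs_def] by (intro borel_measurable_continuous_on_indicator) (auto intro: borel_open open_Times)
 have Kb: "cmod (K z) <= C * C" for z proof (cases "z \<in> (-{0}) \<times> (-{0})")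
  case True
  then have "norm (k (snd z)) * norm (k (fst z)) <= C * C" by (intro mult_mono k C) auto
  then show ?thesis using norm_cip_le[of "k (snd z)" "k (fst z)"] True by (simp add: K_def)
 qed (use C in \<open>simp add: K_def\<close>)
 have "AE x in lborel. integrable lborel (%y. K (x, y) * phi y) & S phi x = (LINT y|lborel. K (x, y) * phi y)"
  if phi: "phi \<in> L2" for phi
 proof -
  define v where "v = toL phi"
  define e where "e = et (t / 2)"
  have be: "bounded_borel e" unfolding e_def by (rule bounded_borel_et) (use t in simp)
  have SL: "S phi \<in> L2" "toL (S phi) = T e (T e v)"
   using exp_operator[OF _ S[OF phi]] t T_et_add[of "t/2" "t/2" v] by (simp_all add: v_def e_def)
  have "AE x in lborel. S phi x = fn (T e (T e v)) x" using fn_toL[OF SL(1)] unfolding SL(2) by eventually_elim simp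
  then show ?thesis using k(3)[of "T e v"] AE_lborel_singleton[of 0] proof eventually_elim
   case (elim x)
   have ae: "AE y in lborel. K (x, y) * phi y = fn v y * cnj (fn (T e (k x)) y)"
    using k(3)[of "k x"] fn_toL[OF phi] AE_lborel_singleton[of 0]
   proof eventually_elim
    case (elim y)
    then show ?case using \<open>x \<noteq> 0\<close> cip_cnj[of "k y" "k x"] by (simp add: K_def v_def e_def)
   qed
   have m: "(%y. K (x, y) * phi y) \<in> borel_measurable lborel" proof (rule borel_measurable_times)
    have "Pair x \<in> borel_measurable (borel :: real measure)" by (intro borel_measurable_continuous_onI continuous_intros)
    from measurable_compose[OF this Km] show "(%y. K (x, y)) \<in> borel_measurable lborel" by simp
   qed (use L2_measurable[OF phi] in simp)
   have i: "integrable lborel (%y. fn v y * cnj (fn (T e (k x)) y))" by (intro l2_inner_integrable) auto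
   have "S phi x = cip (T e v) (k x)" using elim by (simp add: e_def)
   also have "... = cip v (T e (k x))" by (rule cip_T[OF be])
   also have "... = (LINT y|lborel. K (x, y) * phi y)"
    unfolding cip_eq by (rule integral_cong_AE) (use ae m i in \<open>auto elim: eventually_mono\<close>)
   finally have "S phi x = (LINT y|lborel. K (x, y) * phi y)" .
   moreover have "AE y in lborel. fn v y * cnj (fn (T e (k x)) y) = K (x, y) * phi y" using ae by eventually_elim simp
   then have "integrable lborel (%y. K (x, y) * phi y)" by (rule integrable_cong_AE_imp[OF i m])
   ultimately show ?case by blast
  qed
 qed
 then have "is_kernel S K" using Km by (simp add: is_kernel_def)
 moreover have "bounded_kernel K" using Kb unfolding bounded_kernel_def by blast
 ultimately show ?thesis by blast
qed

end

subsection \<open>Failure of positivity and of continuity\<close>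

lemma norm_indicator_Ioo: assumes "a <= b" shows "(norm (toL (indicator {a<..<b})))\<^sup>2 = b - a" proof -
 have "(norm (toL (indicator {a<..<b})))\<^sup>2 = (LINT x|lborel. (cmod (indicator {a<..<b} x))\<^sup>2)"
  by (rule norm_toL_square[OF indicator_Ioo_L2])
 also have "... = (LINT x|lborel. indicator {a<..<b} x)"
  by (rule Bochner_Integration.integral_cong) (auto simp: indicator_def)
 finally show ?thesis using assms by simp
qed

lemma AE_sections:
 assumes "AE z in lborel. P (z :: real \<times> real)"
 shows "AE x in lborel. AE y in lborel. P (x, y)"
proof -
 have "AE z in lborel \<Otimes>\<^sub>M lborel. P z" unfolding lborel_prod by (rule assms)
 then show ?thesis by (rule lborel_pair.AE_pair)
qed

context viscosity
begin

lemma Q_toL: assumes "f \<in> L2" "!!x. x <= 0 ==> f x = 0" shows "Q (toL f) = toL f" proof -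
 have "(%x. indicator {0<..} x * f x) = f" using assms(2) by (auto simp: indicator_def fun_eq_iff)
 then show ?thesis using toL_mlt_bdd[OF bdd_Q assms(1)] by (simp add: Q_def)
qed

text \<open>Data supported on the right are fixed by \<open>Q\<close>, and \<open>Q\<close> commutes
  with the semigroup.\<close>

lemma semigroup_zero_left:
 assumes t: "0 < t" and S: "!!phi. phi \<in> L2 ==> (phi, S phi) \<in> spectral_op E (%s. exp (- t * s))"
  and phi: "phi \<in> L2" "!!x. x <= 0 ==> phi x = 0"
 shows "AE x in lborel. x <= 0 --> S phi x = 0"
proof -
 have L: "S phi \<in> L2" "toL (S phi) = Q (T (et t) (toL phi))" using exp_operator[OF less_imp_le[OF t] S[OF phi(1)]]
  by (simp_all only: T_et_Q[OF t, symmetric] Q_toL[OF phi])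
 show ?thesis using fn_toL[OF L(1)] fn_mlt_bdd[OF bdd_Q, of "T (et t) (toL phi)"] unfolding L(2) Q_def
  by eventually_elim (auto simp: indicator_def)
qed

theorem not_positivity_improving:
 assumes t: "0 < t" and S: "!!phi. phi \<in> L2 ==> (phi, S phi) \<in> spectral_op E (%s. exp (- t * s))"
 shows "\<not> positivity_improving S"
proof
 assume pi: "positivity_improving S"
 let ?phi = "indicator {0<..<1} :: real => complex"
 have "\<not> ae_eq ?phi (%x. 0)" proof
  assume "ae_eq ?phi (%x. 0)"
  then have "AE x in lborel. ?phi x = 0" by (simp add: ae_eq_def)
  from AE_pos_witness[OF this, of 0 1] obtain x :: real where "0 < x" "x < 1" "?phi x = 0" by auto
  then show False by simp
 qed
 moreover have "AE x in lborel. 0 <= ?phi x" by (rule AE_I2) (simp add: indicator_def less_eq_complex_def)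
 ultimately have "AE x in lborel. 0 < S ?phi x"
  using pi indicator_Ioo_L2[of 0 1] unfolding positivity_improving_def by blast
 moreover have "AE x in lborel. x <= 0 --> S ?phi x = 0" by (rule semigroup_zero_left[OF t S indicator_Ioo_L2]) auto
 ultimately have "AE x::real in lborel. \<not> x <= 0" by eventually_elim auto
 from AE_pos_witness[OF this, of "-1" 0] show False by auto
qed

lemma kernel_zero_left:
 fixes K :: "real \<times> real => complex"
 assumes t: "0 < t" and S: "!!phi. phi \<in> L2 ==> (phi, S phi) \<in> spectral_op E (%s. exp (- t * s))" and K: "is_kernel S K"
 shows "AE x in lborel. x <= 0 --> integrable lborel (%y. K (x, y) * indicator {0<..<r} y) &
  (LINT y|lborel. K (x, y) * indicator {0<..<r} y) = 0"
proof -
 let ?phi = "indicator {0<..<r} :: real => complex"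
 have "AE x in lborel. integrable lborel (%y. K (x, y) * ?phi y) & S ?phi x = (LINT y|lborel. K (x, y) * ?phi y)"
  using K indicator_Ioo_L2[of 0 r] by (simp add: is_kernel_def)
 moreover have "AE x in lborel. x <= 0 --> S ?phi x = 0" by (rule semigroup_zero_left[OF t S indicator_Ioo_L2]) auto
 ultimately show ?thesis by eventually_elim auto
qed

theorem not_strictly_positive_kernel:
 fixes K :: "real \<times> real => complex"
 assumes t: "0 < t" and S: "!!phi. phi \<in> L2 ==> (phi, S phi) \<in> spectral_op E (%s. exp (- t * s))" and K: "is_kernel S K"
 shows "\<not> strictly_positive_kernel K"
proof
 assume "strictly_positive_kernel K"
 then have "AE x in lborel. AE y in lborel. 0 < K (x, y)" unfolding strictly_positive_kernel_def by (rule AE_sections)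
 moreover have "AE x in lborel. x <= 0 --> integrable lborel (%y. K (x, y) * indicator {0<..<1} y) &
   (LINT y|lborel. K (x, y) * indicator {0<..<1} y) = 0" by (rule kernel_zero_left[OF t S K])
 ultimately have "AE x in lborel. x <= 0 --> (AE y in lborel. 0 < K (x, y)) &
   integrable lborel (%y. K (x, y) * indicator {0<..<1} y) & (LINT y|lborel. K (x, y) * indicator {0<..<1} y) = 0"
  by eventually_elim auto
 from AE_pos_witness[OF this, of "-1" 0] obtain x where x: "AE y in lborel. 0 < K (x, y)"
  "integrable lborel (%y. K (x, y) * indicator {0<..<1} y)" "(LINT y|lborel. K (x, y) * indicator {0<..<1} y) = 0" by auto
 have "(LINT y|lborel. Re (K (x, y) * indicator {0<..<1} y)) = 0" using x(3) by (simp only: integral_Re[OF x(2)] zero_complex.simps)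
 moreover have "AE y in lborel. 0 <= Re (K (x, y) * indicator {0<..<1} y)"
  using x(1) by eventually_elim (auto simp: less_complex_def indicator_def)
 ultimately have "AE y in lborel. Re (K (x, y) * indicator {0<..<1} y) = 0"
  using integral_nonneg_eq_0_iff_AE[of lborel "%y. Re (K (x, y) * indicator {0<..<1} y)"] integrable_Re[OF x(2)] by blast
 with x(1) have "AE y::real in lborel. \<not> (0 < y & y < 1)"
  by eventually_elim (auto simp: less_complex_def indicator_def)
 from AE_pos_witness[OF this, of 0 1] show False by auto
qed

section \<open>Averages over (0, r) and boundary values at 0\<close>

lemma indicator_average_le:
 fixes f :: "real => complex"
 assumes f: "integrable lborel (%y. f y * indicator {0<..<r} y)"
  and b: "AE y in lborel. 0 < y & y < r --> cmod (f y - z) <= b" and r: "0 < r"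
 shows "cmod ((LINT y|lborel. f y * indicator {0<..<r} y) - of_real r * z) <= b * r"
proof -
 have ii: "integrable lborel (indicator {0<..<r} :: real => real)" using r by (simp add: integrable_indicator_iff)
 then have i: "integrable lborel (%y. z * indicator {0<..<r} y)"
  using integrable_mult_right[of z, OF integrable_of_real[OF ii, where 'a = complex]] by (simp add: of_real_indicator)
 have "(LINT y|lborel. (indicator {0<..<r} y :: complex)) = (LINT y|lborel. cor (indicator {0<..<r} y))"
  by (simp add: of_real_indicator)
 also have "... = of_real r" unfolding integral_complex_of_real using r by simp
 finally have "(LINT y|lborel. z * indicator {0<..<r} y) = of_real r * z" by simp
 then have z: "of_real r * z = (LINT y|lborel. z * indicator {0<..<r} y)" ..
 have "cmod ((LINT y|lborel. f y * indicator {0<..<r} y) - of_real r * z)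
   = cmod (LINT y|lborel. f y * indicator {0<..<r} y - z * indicator {0<..<r} y)" unfolding z using f i by simp
 also have "... <= (LINT y|lborel. cmod (f y * indicator {0<..<r} y - z * indicator {0<..<r} y))"
  by (rule integral_norm_bound)
 also have "... <= (LINT y|lborel. b * indicator {0<..<r} y)" proof (rule integral_mono_AE)
  show "integrable lborel (%y. cmod (f y * indicator {0<..<r} y - z * indicator {0<..<r} y))"
   by (intro integrable_norm Bochner_Integration.integrable_diff f i)
  show "integrable lborel (%y. b * indicator {0<..<r} y)" by (intro integrable_mult_right ii)
  show "AE y in lborel. cmod (f y * indicator {0<..<r} y - z * indicator {0<..<r} y) <= b * indicator {0<..<r} y"
   using b by eventually_elim (auto simp: indicator_def)
 qed
 also have "... = b * r" using r by simp
 finally show ?thesis .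
qed

text \<open>If the kernel were continuous, its value at the origin would vanish, since it vanishes for
 \<open>x < 0 < y\<close>.\<close>

lemma continuous_kernel_small:
 fixes K :: "real \<times> real => complex"
 assumes t: "0 < t" and S: "!!phi. phi \<in> L2 ==> (phi, S phi) \<in> spectral_op E (%s. exp (- t * s))"
  and K: "is_kernel S K" and cont: "continuous_kernel K" and e: "0 < e"
 shows "\<exists>r0>0. \<forall>r. 0 < r & r < r0 --> norm (T (et (t / 2)) (toL (indicator {0<..<r}))) <= e * r"
proof -
 obtain G where G: "continuous_on UNIV G" "AE z in lborel. K z = G z"
  using cont unfolding continuous_kernel_def by blast
 have near: "\<exists>r0>0. \<forall>x y. \<bar>x\<bar> < r0 & \<bar>y\<bar> < r0 --> cmod (G (x, y) - G (0, 0)) <= d" if d: "0 < d" for d proof -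
  have "isCont G (0, 0)" using G(1) by (simp add: continuous_on_eq_continuous_at)
  then obtain s where s: "0 < s" "!!z. norm (z - (0, 0)) < s ==> norm (G z - G (0, 0)) < d"
   using d unfolding continuous_at_eps_delta dist_norm by metis
  show ?thesis proof (intro exI[of _ "s / 2"] conjI allI impI)
   fix x y :: real assume "\<bar>x\<bar> < s / 2 & \<bar>y\<bar> < s / 2"
   then have "norm ((x, y) - (0, 0)) < s" using norm_Pair_le[of x y] by (simp add: zero_prod_def[symmetric])
   then show "cmod (G (x, y) - G (0, 0)) <= d" using s(2) less_imp_le by blast
  qed (use s in simp)
 qed
 have KG: "AE x in lborel. AE y in lborel. K (x, y) = G (x, y)" by (rule AE_sections[OF G(2)])
 \<comment> \<open>For x < 0 the average of K(x, y) over y in (0, r) is 0, yet continuity would keep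
   it within half of |G (0, 0)| from G (0, 0).\<close>
 have G0: "G (0, 0) = 0" proof (rule ccontr)
  assume n: "G (0, 0) \<noteq> 0"
  define d where "d = cmod (G (0, 0)) / 2"
  have d: "0 < d" using n by (simp add: d_def)
  obtain r where r: "0 < r" "!!x y. \<bar>x\<bar> < r & \<bar>y\<bar> < r ==> cmod (G (x, y) - G (0, 0)) <= d" using near[OF d] by blast
  have "AE x in lborel. x <= 0 --> integrable lborel (%y. K (x, y) * indicator {0<..<r} y) &
    (LINT y|lborel. K (x, y) * indicator {0<..<r} y) = 0" by (rule kernel_zero_left[OF t S K])
  with KG have "AE x in lborel. x <= 0 --> (AE y in lborel. K (x, y) = G (x, y)) &
    integrable lborel (%y. K (x, y) * indicator {0<..<r} y) & (LINT y|lborel. K (x, y) * indicator {0<..<r} y) = 0"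
   by eventually_elim auto
  from AE_pos_witness[OF this, of "-r" 0] r(1) obtain x where x: "-r < x" "x < 0" "AE y in lborel. K (x, y) = G (x, y)"
   "integrable lborel (%y. K (x, y) * indicator {0<..<r} y)" "(LINT y|lborel. K (x, y) * indicator {0<..<r} y) = 0" by auto
  have "cmod ((LINT y|lborel. K (x, y) * indicator {0<..<r} y) - of_real r * G (0, 0)) <= d * r"
  proof (rule indicator_average_le[OF x(4) _ r(1)])
   show "AE y in lborel. 0 < y & y < r --> cmod (K (x, y) - G (0, 0)) <= d"
    using x(3) by eventually_elim (use x r in auto)
  qed
  then have "r * cmod (G (0, 0)) <= r * d" using r(1) by (simp add: x(5) norm_mult mult.commute)
  then have "cmod (G (0, 0)) <= d" using r(1) by simp
  then show False using d by (simp add: d_def)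
 qed
 \<comment> \<open>The kernel bound is taken as e^2 because a square root follows.\<close>
 have "0 < e\<^sup>2" using e by simp
 from near[OF this] obtain r0 where r0: "0 < r0" "!!x y. \<bar>x\<bar> < r0 & \<bar>y\<bar> < r0 ==> cmod (G (x, y)) <= e\<^sup>2"
  unfolding G0 diff_zero by blast
 have "norm (T (et (t / 2)) (toL (indicator {0<..<r}))) <= e * r" if r: "0 < r" "r < r0" for r proof -
  let ?phi = "indicator {0<..<r} :: real => complex" and ?v = "toL (indicator {0<..<r})"
  have L: "S ?phi \<in> L2" "toL (S ?phi) = T (et t) ?v" using exp_operator[OF _ S[OF indicator_Ioo_L2]] t by simp_all
  have ae: "AE x in lborel. integrable lborel (%y. K (x, y) * ?phi y) & S ?phi x = (LINT y|lborel. K (x, y) * ?phi y)"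
   using K indicator_Ioo_L2[of 0 r] by (simp add: is_kernel_def)
  have Sb: "AE x in lborel. 0 < x & x < r --> cmod (S ?phi x - 0) <= e\<^sup>2 * r" using ae KG
  proof (eventually_elim, intro impI)
   fix x assume 1: "integrable lborel (%y. K (x, y) * ?phi y) & S ?phi x = (LINT y|lborel. K (x, y) * ?phi y)"
    and 2: "AE y in lborel. K (x, y) = G (x, y)" and x: "0 < x & x < r"
   have "cmod ((LINT y|lborel. K (x, y) * indicator {0<..<r} y) - of_real r * 0) <= e\<^sup>2 * r"
   proof (rule indicator_average_le[OF _ _ r(1)])
    show "AE y in lborel. 0 < y & y < r --> cmod (K (x, y) - 0) <= e\<^sup>2" using 2 by eventually_elim (use x r r0 in auto)
   qed (use 1 in simp)
   then show "cmod (S ?phi x - 0) <= e\<^sup>2 * r" using 1 by simp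
  qed
  \<comment> \<open>The squared norm at time t/2 is the quadratic form of the semigroup at time t,
    hence at most the kernel bound e^2 times r^2.\<close>
  have "(norm (T (et (t / 2)) ?v))\<^sup>2 = Re (cip (T (et t) ?v) ?v)"
   using T_sym[OF bounded_borel_et[of "t/2"], of "T (et (t / 2)) ?v" ?v] T_et_add[of "t/2" "t/2" ?v] t
   by (simp add: power2_norm_eq_inner inner_l2_def[symmetric])
  also have "... <= cmod (cip (T (et t) ?v) ?v)" by (rule complex_Re_le_cmod)
  also have "cip (T (et t) ?v) ?v = (LINT x|lborel. S ?phi x * ?phi x)"
   unfolding L(2)[symmetric] cip_toL[OF L(1) indicator_Ioo_L2] l2_inner_def
   by (rule Bochner_Integration.integral_cong) (auto simp: indicator_def)
  also have "cmod ... <= e\<^sup>2 * r * r"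
   using indicator_average_le[OF L2_mult_integrable[OF L(1) indicator_Ioo_L2] Sb r(1)] by simp
  also have "... = (e * r)\<^sup>2" by (simp add: power2_eq_square)
  finally show ?thesis by (rule power2_le_imp_le) (use e r in simp)
 qed
 then show ?thesis using r0(1) by blast
qed

text \<open>By duality the integral of u over (0, r) pairs \<open>psi\<close> with the semigroup
  applied to the indicator of (0, r), so it is o(r) and U tends to 0 at 0. Integrating the flux
  bound from 0 then gives the full gain 2 (1 - \<delta>), whereas in \<open>hrep_step\<close> an
  unknown boundary value caps the exponent.\<close>

lemma boundary_power_bound:
 assumes t: "0 < t"
  and small: "!!e. 0 < e ==> \<exists>r0>0. \<forall>r. 0 < r & r < r0 --> norm (T (et t) (toL (indicator {0<..<r}))) <= e * r"
  and U: "hrep (T (et t) psi) w G U" and w: "AE y in lborel. 0 < y & y <= 1 --> cmod (fn w y) <= A * y powr \<beta>"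
  and \<beta>: "0 <= \<beta>" and A: "0 <= A" and x: "0 < x" "x <= 1"
 shows "cmod (U x) <= 2 * A / (1 + \<beta>) / (\<beta> + 2 * (1 - \<delta>)) * x powr (\<beta> + 2 * (1 - \<delta>))"
proof -
 let ?p = "\<beta> + 2 * (1 - \<delta>)" and ?D = "2 * A / (1 + \<beta>)"
 let ?u = "T (et t) psi"
 have p: "0 < ?p" using \<beta> \<delta> by simp
 have D: "0 <= ?D" using A \<beta> by simp
 have be: "bounded_borel (et t)" by (rule bounded_borel_et) (use t in simp)
 have ac: "ac_on {0<..} U (%x. - primitive (fn w) x / cor (c x))" using U by (simp add: hrep_def)
 have diff: "cmod (U y - U x) <= ?D / ?p * x powr ?p" if y: "0 < y" "y <= x" for y proof -
  have "cmod (U x - U y) <= ?D / ?p * x powr ?p - ?D / ?p * y powr ?p" proof (rule ac_on_compare[OF ac])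
   show "((%z. ?D / ?p * z powr ?p) has_real_derivative ?D * z powr (?p - 1)) (at z)" if "y <= z" for z
    by (rule has_real_derivative_powr_divide) (use that y p in auto)
   show "continuous_on {y..x} (%z. ?D * z powr (?p - 1))" using y by (intro continuous_intros) auto
   have "cmod (- primitive (fn w) z / cor (c z)) <= ?D * z powr (?p - 1)" if "y <= z" "z <= x" for z
    by (rule flux_bound[OF w]) (use \<beta> A x y that in auto)
   then show "AE z in lborel. y <= z & z <= x --> cmod (- primitive (fn w) z / cor (c z)) <= ?D * z powr (?p - 1)"
    by auto
  qed (use y in auto)
  moreover have "0 <= ?D / ?p * y powr ?p" by (rule mult_nonneg_nonneg[OF divide_nonneg_pos[OF D p]]) simp
  ultimately show ?thesis by (simp add: norm_minus_commute)
 qed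
 have "cmod (U x) <= ?D / ?p * x powr ?p + norm psi * e" if e: "0 < e" for e proof -
  obtain r0 where r0: "0 < r0" "!!r. 0 < r & r < r0 ==> norm (T (et t) (toL (indicator {0<..<r}))) <= e * r"
   using small[OF e] by blast
  define r where "r = min x (r0 / 2)"
  have r: "0 < r" "r <= x" "r < r0" using x r0 by (auto simp: r_def)
  have i: "integrable lborel (%y. fn ?u y * indicator {0<..<r} y)" by (intro L2_mult_integrable indicator_Ioo_L2) simp
  have cu: "(LINT y|lborel. fn ?u y * indicator {0<..<r} y) = cip psi (T (et t) (toL (indicator {0<..<r})))"
   unfolding cip_T[OF be, symmetric] cip_toL_right[OF indicator_Ioo_L2]
   by (rule Bochner_Integration.integral_cong) (auto simp: indicator_def)
  have "cmod (LINT y|lborel. fn ?u y * indicator {0<..<r} y) <= norm psi * (e * r)"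
   unfolding cu by (rule order_trans[OF norm_cip_le mult_left_mono[OF r0(2)]]) (use r in auto)
  moreover have "cmod ((LINT y|lborel. fn ?u y * indicator {0<..<r} y) - of_real r * U x) <= ?D / ?p * x powr ?p * r"
  proof (rule indicator_average_le[OF i _ r(1)])
   show "AE y in lborel. 0 < y & y < r --> cmod (fn ?u y - U x) <= ?D / ?p * x powr ?p"
    using hrep_AE[OF U] by eventually_elim (use diff r in auto)
  qed
  moreover have "cmod (of_real r * U x) <= cmod (LINT y|lborel. fn ?u y * indicator {0<..<r} y)
    + cmod ((LINT y|lborel. fn ?u y * indicator {0<..<r} y) - of_real r * U x)"
   using norm_triangle_ineq4[of "LINT y|lborel. fn ?u y * indicator {0<..<r} y"
     "(LINT y|lborel. fn ?u y * indicator {0<..<r} y) - of_real r * U x"] by simp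
  ultimately have "r * cmod (U x) <= norm psi * (e * r) + ?D / ?p * x powr ?p * r" using r by (simp add: norm_mult)
  then have "r * cmod (U x) <= r * (?D / ?p * x powr ?p + norm psi * e)"
   by (simp only: distrib_left mult.commute mult.left_commute add.commute)
  then show ?thesis using r(1) by simp
 qed
 note eps = this
 show ?thesis proof (rule field_le_epsilon)
  fix e :: real assume e: "0 < e"
  have n: "0 < norm psi + 1" using norm_ge_zero[of psi] by linarith
  have "norm psi * (e / (norm psi + 1)) <= e" using e n by (simp add: pos_divide_le_eq distrib_left mult.commute)
  moreover have "0 < e / (norm psi + 1)" using e n by simp
  ultimately show "cmod (U x) <= ?D / ?p * x powr ?p + e" using eps[of "e / (norm psi + 1)"] by linarith
 qed
qed

text \<open>Functions with bounded spectral support whose boundary value at \<open>0\<close> vanishes, together with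
 those of all their images under powers of \<open>H\<close>, satisfy a Volterra estimate and hence vanish
 near \<open>0\<close>.\<close>

lemma boundary_values_not_small:
 assumes t: "0 < t"
  and small: "!!e. 0 < e ==> \<exists>r0>0. \<forall>r. 0 < r & r < r0 --> norm (T (et t) (toL (indicator {0<..<r}))) <= e * r"
 shows False
proof -
 have be: "bounded_borel (et t)" by (rule bounded_borel_et) (use t in simp)
 have zero: "AE y in lborel. 0 < y & y <= 1 --> fn (T (indicator {0..N}) psi) y = 0" if N: "0 <= N" for N :: real and psi
 proof -
  let ?g = "1 - \<delta>"
  have g: "0 < ?g" using \<delta> by simp
  define u where "u i = T (%s. s ^ i * indicator {0..N} s) psi" for i
  \<comment> \<open>The spectral cut-off at \<open>N\<close> makes exp(t s) a bounded factor; it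
    exhibits each \<open>u i\<close> as a value of the semigroup at time t, so its boundary value
    vanishes.\<close>
  define h where "h i s = s ^ i * indicator {0..N} s * exp (t * s)" for i s
  have bh: "\<bar>h i s\<bar> <= N ^ i * exp (t * N)" for i s
   using t N by (auto simp: h_def indicator_def abs_mult intro!: mult_mono power_mono)
  have hb: "bounded_borel (h i)" for i by (rule bounded_borelI[OF _ bh]) (simp add: h_def[abs_def])
  have gb: "bounded_borel (%s. s ^ i * indicator {0..N} s)" for i
   by (rule bounded_borelI[of _ "N ^ i"]) (use N in \<open>auto simp: indicator_def abs_mult intro!: power_mono\<close>)
  have uh: "u i = T (et t) (T (h i) psi)" for i unfolding u_def T_mult[OF be hb]
   by (rule arg_cong[of _ _ "%f. T f psi"]) (auto simp: fun_eq_iff et_def h_def indicator_def exp_minus)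
  have ch: "chain u" unfolding u_def by (rule chain_T[OF gb])
  obtain C where C: "0 <= C" "!!phi. AE x in lborel. 0 < x --> cmod (fn (T (et t) phi) x) <= C * norm phi"
   using semigroup_bounds[OF t] by blast
  define B where "B = C * exp (t * N) * norm psi"
  have B: "0 <= B" using C by (simp add: B_def)
  \<comment> \<open>The induction runs for all i at once, since the bound for \<open>u i\<close>
    uses the one for \<open>u (Suc i)\<close>. A step contributes N from \<open>u (Suc i)\<close>, 2
    from 1 / c and 1 / (2 (1 - \<delta>) (j + 1)) from the integration, which builds up the
    factorial.\<close>
  have "AE y in lborel. 0 < y & y <= 1 -->
    cmod (fn (u i) y) <= B * N ^ i * (N / ?g) ^ j / fact j * y powr (2 * ?g * real j)" for i j
  proof (induction j arbitrary: i)
   case 0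
   have "C * norm (T (h i) psi) <= B * N ^ i"
    using mult_left_mono[OF norm_T_le[OF bounded_borel_measurable[OF hb] bh, of i psi] C(1)]
    by (simp add: B_def mult_ac)
   then show ?case using C(2)[of "T (h i) psi"] unfolding uh by (auto elim!: eventually_mono)
  next
   case (Suc j)
   obtain G where G: "hm (u i) (u (Suc i)) G" using ch by (auto simp: chain_def)
   obtain U where U: "hrep (u i) (u (Suc i)) G U" using hrep_exists[OF G] by blast
   let ?A = "B * N ^ Suc i * (N / ?g) ^ j / fact j" and ?b = "2 * ?g * real j"
   have A: "0 <= ?A" using B N g by simp
   have b: "0 <= ?b" using g by simp
   have "cmod (U y) <= B * N ^ i * (N / ?g) ^ Suc j / fact (Suc j) * y powr (2 * ?g * real (Suc j))"
    if y: "0 < y" "y <= 1" for y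
   proof -
    have e: "?b + 2 * ?g = 2 * ?g * real (Suc j)" by (simp add: algebra_simps)
    have "cmod (U y) <= 2 * ?A / (1 + ?b) / (?b + 2 * ?g) * y powr (?b + 2 * ?g)"
     by (rule boundary_power_bound[OF t small U[unfolded uh[of i]] Suc.IH[of "Suc i"] b A y])
    also have "... <= 2 * ?A / 1 / (?b + 2 * ?g) * y powr (?b + 2 * ?g)"
    proof (rule mult_right_mono[OF divide_right_mono[OF frac_le]])
     show "0 <= 2 * ?A" by (rule mult_nonneg_nonneg[OF _ A]) simp
     show "2 * ?A <= 2 * ?A" by (rule order_refl)
     show "(1::real) <= 1 + ?b" using b by simp
     show "0 <= ?b + 2 * ?g" by (rule add_nonneg_nonneg[OF b]) (use g in simp)
    qed simp_all
    also have "2 * ?A / 1 / (?b + 2 * ?g) = B * N ^ i * (N / ?g) ^ Suc j / fact (Suc j)" proof -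
     have "2 * (b * (N * n) * q / f) / 1 / (2 * d * m) = b * n * (N / d * q) / (m * f)"
      if "d \<noteq> 0" "m \<noteq> 0" "f \<noteq> 0" for b n q f d m :: real using that by (simp add: field_simps)
     from this[of ?g "real (Suc j)" "fact j" B "N ^ i" "(N / ?g) ^ j"] g
     show ?thesis unfolding e by (simp only: power_Suc fact_Suc of_nat_fact) simp
    qed
    finally show ?thesis unfolding e .
   qed
   then show ?case using hrep_AE[OF U] by (auto elim!: eventually_mono)
  qed
  from this[of 0]
  have "AE y in lborel. \<forall>j. 0 < y & y <= 1 --> cmod (fn (u 0) y) <= B * ((N / ?g) ^ j / fact j) * y powr (2 * ?g * real j)"
   unfolding AE_all_countable by simp
  then show ?thesis proof (eventually_elim, intro impI)
   fix y assume *: "\<forall>j. 0 < y & y <= 1 --> cmod (fn (u 0) y) <= B * ((N / ?g) ^ j / fact j) * y powr (2 * ?g * real j)"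
    and y: "0 < y & y <= 1"
   have "cmod (fn (u 0) y) <= B * ((N / ?g) ^ j / fact j)" for j proof -
    have "cmod (fn (u 0) y) <= B * ((N / ?g) ^ j / fact j) * y powr (2 * ?g * real j)" using * y by blast
    also have "... <= B * ((N / ?g) ^ j / fact j) * 1"
     using y B N g by (intro mult_left_mono powr_le1 mult_nonneg_nonneg divide_nonneg_pos) auto
    finally show ?thesis by simp
   qed
   moreover have "(%j. B * ((N / ?g) ^ j / fact j)) ----> B * 0" using summable_LIMSEQ_zero[OF summable_exp[of "N / ?g"]]
    by (intro tendsto_mult tendsto_const) (simp add: divide_inverse mult.commute)
   ultimately have "cmod (fn (u 0) y) <= B * 0" by (intro LIMSEQ_le_const) auto
   then show "fn (T (indicator {0..N}) psi) y = 0" by (simp add: u_def)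
  qed
 qed
 \<comment> \<open>A vector supported in (0, 1) is orthogonal to its own spectral truncations, which
   vanish there and yet converge to it; so its norm would be 0.\<close>
 define psi where "psi = toL (indicator {0<..<1})"
 have orth: "inner (P {..real n} psi) psi = 0" for n proof -
  have "P {..real n} psi = T (indicator {0..real n}) psi" unfolding T_indicator[of "{..real n}", symmetric, simplified]
   by (rule T_cong) (auto simp: indicator_def)
  moreover have "cip (T (indicator {0..real n}) psi) psi = 0" proof -
   have "cip (T (indicator {0..real n}) psi) psi = (LINT x|lborel. fn (T (indicator {0..real n}) psi) x * cnj (indicator {0<..<1} x))"
    unfolding psi_def by (rule cip_toL_right[OF indicator_Ioo_L2])
   also have "... = 0" proof (rule integral_eq_zero_AE)
    show "AE x in lborel. fn (T (indicator {0..real n}) psi) x * cnj (indicator {0<..<1} x) = 0"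
     using zero[of "real n" psi] by (auto elim!: eventually_mono simp: indicator_def)
   qed
   finally show ?thesis .
  qed
  ultimately show ?thesis by (simp add: inner_l2_def)
 qed
 have "(%n. P {..real n} psi) ----> psi" proof (rule P_incseq_tendsto)
  show "(\<Union>n. {..real n}) = UNIV" using real_arch_simple by auto
 qed (auto simp: incseq_def)
 then have "(%n. inner (P {..real n} psi) psi) ----> inner psi psi" by (intro tendsto_inner tendsto_const)
 then have "inner psi psi = 0" unfolding orth by (simp add: LIMSEQ_const_iff)
 then show False using norm_indicator_Ioo[of 0 1] by (simp add: psi_def power2_norm_eq_inner)
qed

theorem not_continuous_kernel:
 fixes K :: "real \<times> real => complex"
 assumes t: "0 < t" and S: "!!phi. phi \<in> L2 ==> (phi, S phi) \<in> spectral_op E (%s. exp (- t * s))" and K: "is_kernel S K"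
 shows "\<not> continuous_kernel K"
proof
 assume "continuous_kernel K"
 from continuous_kernel_small[OF t S K this] show False
  by (rule boundary_values_not_small[of "t / 2", rotated]) (use t in auto)
qed

end

section \<open>Subellipticity\<close>

subsection \<open>A Schur test\<close>

lemma nn_integral_even_le:
 fixes h f :: "real => real"
 assumes [measurable]: "h \<in> borel_measurable borel" and h: "!!x. 0 <= h x" and L: "0 <= L" "(\<integral>\<^sup>+x. ennreal (h x) \<partial>lborel) <= ennreal L"
  and f: "!!x. x \<noteq> 0 ==> f x <= h \<bar>x\<bar>"
 shows "(\<integral>\<^sup>+x. ennreal (f x) \<partial>lborel) <= ennreal (2 * L)"
proof -
 have "(\<integral>\<^sup>+x. ennreal (f x) \<partial>lborel) <= (\<integral>\<^sup>+x. ennreal (h x) + ennreal (h (- x)) \<partial>lborel)"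
 proof (rule nn_integral_mono_AE)
  show "AE x in lborel. ennreal (f x) <= ennreal (h x) + ennreal (h (- x))" using AE_lborel_singleton[of 0]
  proof eventually_elim
   case (elim x)
   have "f x <= h x + h (- x)" using f[OF elim] h[of x] h[of "- x"] by (cases "0 <= x") auto
   then show ?case using h by (simp flip: ennreal_plus add: ennreal_leI)
  qed
 qed
 also have "... = (\<integral>\<^sup>+x. ennreal (h x) \<partial>lborel) + (\<integral>\<^sup>+x. ennreal (h (- x)) \<partial>lborel)" by (rule nn_integral_add) measurable
 also have "(\<integral>\<^sup>+x. ennreal (h (- x)) \<partial>lborel) = (\<integral>\<^sup>+x. ennreal (h x) \<partial>lborel)"
  using nn_integral_real_affine[of "%x. ennreal (h x)" "-1" 0] by simp
 also have "(\<integral>\<^sup>+x. ennreal (h x) \<partial>lborel) + (\<integral>\<^sup>+x. ennreal (h x) \<partial>lborel) <= ennreal (2 * L)"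
  using add_mono[OF L(2) L(2)] L(1) by (simp flip: ennreal_plus)
 finally show ?thesis .
qed

context coefficient
begin

text \<open>Majorant of |s|^(-\<delta>) |exp(i s) - 1|. At s = y xi the power splits into
  |y|^(-\<delta>) |xi|^(-\<delta>), which trades the weight of the energy for a weight in the
  Fourier variable.\<close>

definition mm :: "real => real" where "mm s = \<bar>s\<bar> powr (- \<delta>) * min 2 \<bar>s\<bar>"

lemma mm_nonneg: "0 <= mm s" by (simp add: mm_def)

lemma mm_measurable [measurable]: "mm \<in> borel_measurable borel" unfolding mm_def[abs_def] by measurable

text \<open>The Schur constant of the kernel mm(y xi) for the weight |y|^(-1/2). It is finite
  because the integrand has order |s|^(1/2 - \<delta>) at 0 and |s|^(-1/2 - \<delta>) at
  infinity.\<close>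

definition kap :: ennreal where "kap = (\<integral>\<^sup>+s. ennreal (\<bar>s\<bar> powr (- (1/2)) * mm s) \<partial>lborel)"

lemma kap_finite: "kap < \<infinity>" proof -
 define h where "h s = indicator {0..1} s * s powr (1 / 2 - \<delta>) + 2 * (indicator {1..} s * s powr (- (1 / 2) - \<delta>))" for s :: real
 define a where "a = 1 powr (1 / 2 - \<delta> + 1) / (1 / 2 - \<delta> + 1)"
 define b where "b = - (1 powr (- (1 / 2) - \<delta> + 1)) / (- (1 / 2) - \<delta> + 1)"
 have ab: "0 <= a" "0 <= b" using \<delta> by (simp_all add: a_def b_def divide_nonpos_neg)
 have i1: "(\<integral>\<^sup>+s. ennreal (indicator {0..1} s * s powr (1 / 2 - \<delta>)) \<partial>lborel) = ennreal a"
  unfolding a_def by (intro nn_integral_has_integral_lebesgue has_integral_powr_from_0) (use \<delta> in auto)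
 have i2: "(\<integral>\<^sup>+s. ennreal (indicator {1..} s * s powr (- (1 / 2) - \<delta>)) \<partial>lborel) = ennreal b"
  unfolding b_def by (intro nn_integral_has_integral_lebesgue has_integral_powr_to_inf) (use \<delta> in auto)
 have "kap <= ennreal (2 * (a + 2 * b))" unfolding kap_def proof (rule nn_integral_even_le[where h = h])
  show "h \<in> borel_measurable borel" unfolding h_def[abs_def] by measurable
  have "(\<integral>\<^sup>+s. ennreal (h s) \<partial>lborel) = (\<integral>\<^sup>+s. ennreal (indicator {0..1} s * s powr (1 / 2 - \<delta>)) +
    2 * ennreal (indicator {1..} s * s powr (- (1 / 2) - \<delta>)) \<partial>lborel)"
   by (intro nn_integral_cong) (simp add: h_def ennreal_plus ennreal_mult)
  also have "... = ennreal a + 2 * ennreal b" by (subst nn_integral_add) (simp_all add: nn_integral_cmult i1 i2)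
  also have "... = ennreal (a + 2 * b)" using ab by (simp add: ennreal_plus ennreal_mult)
  finally show "(\<integral>\<^sup>+s. ennreal (h s) \<partial>lborel) <= ennreal (a + 2 * b)" by simp
  show "\<bar>s\<bar> powr (- (1/2)) * mm s <= h \<bar>s\<bar>" if s: "s \<noteq> 0" for s proof (cases "\<bar>s\<bar> <= 1")
   case True
   have "\<bar>s\<bar> powr (- (1/2)) * mm s = \<bar>s\<bar> powr (- (1/2)) * \<bar>s\<bar> powr (- \<delta>) * \<bar>s\<bar> powr 1"
    using s True by (simp add: mm_def)
   also have "... = \<bar>s\<bar> powr (1 / 2 - \<delta>)" unfolding powr_add[symmetric] by simp
   finally show ?thesis using True by (simp add: h_def)
  next
   case False
   have "\<bar>s\<bar> powr (- (1/2)) * mm s <= \<bar>s\<bar> powr (- (1/2)) * (\<bar>s\<bar> powr (- \<delta>) * 2)"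
    unfolding mm_def by (intro mult_left_mono) auto
   also have "... = 2 * (\<bar>s\<bar> powr (- (1/2)) * \<bar>s\<bar> powr (- \<delta>))" by simp
   also have "\<bar>s\<bar> powr (- (1/2)) * \<bar>s\<bar> powr (- \<delta>) = \<bar>s\<bar> powr (- (1 / 2) - \<delta>)" unfolding powr_add[symmetric] by simp
   finally show ?thesis using False by (simp add: h_def)
  qed
 qed (use ab in \<open>auto simp: h_def\<close>)
 then show ?thesis by (rule le_less_trans) simp
qed

text \<open>The substitution s = y xi reproduces the weight: a factor |xi|^(1/2) from the power and
  1 / |xi| from the measure leave |xi|^(-1/2).\<close>

lemma kap_scale:
 assumes "xi \<noteq> 0"
 shows "(\<integral>\<^sup>+y. ennreal (\<bar>y\<bar> powr (- (1/2)) * mm (y * xi)) \<partial>lborel) = ennreal (\<bar>xi\<bar> powr (- (1/2))) * kap"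
proof -
 have x: "\<bar>xi\<bar> powr (- (1/2)) * \<bar>xi\<bar> * \<bar>xi\<bar> powr (- (1/2)) = 1" proof -
  have "\<bar>xi\<bar> powr (- (1/2)) * \<bar>xi\<bar> powr 1 * \<bar>xi\<bar> powr (- (1/2)) = 1" unfolding powr_add[symmetric] using assms by simp
  then show ?thesis using assms by simp
 qed
 have "ennreal (\<bar>xi\<bar> powr (- (1/2))) * kap = ennreal (\<bar>xi\<bar> powr (- (1/2))) * (ennreal \<bar>xi\<bar> *
   (\<integral>\<^sup>+y. ennreal (\<bar>xi * y\<bar> powr (- (1/2)) * mm (xi * y)) \<partial>lborel))"
  unfolding kap_def by (subst nn_integral_real_affine[OF _ assms, of _ 0]) simp_all
 also have "(\<integral>\<^sup>+y. ennreal (\<bar>xi * y\<bar> powr (- (1/2)) * mm (xi * y)) \<partial>lborel)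
   = (\<integral>\<^sup>+y. ennreal (\<bar>xi\<bar> powr (- (1/2))) * ennreal (\<bar>y\<bar> powr (- (1/2)) * mm (y * xi)) \<partial>lborel)"
  by (intro nn_integral_cong)
   (simp add: abs_mult powr_mult mult.assoc mult.commute[of _ xi] mm_nonneg ennreal_mult[symmetric])
 also have "... = ennreal (\<bar>xi\<bar> powr (- (1/2))) * (\<integral>\<^sup>+y. ennreal (\<bar>y\<bar> powr (- (1/2)) * mm (y * xi)) \<partial>lborel)"
  by (rule nn_integral_cmult) measurable
 also have "ennreal (\<bar>xi\<bar> powr (- (1/2))) * (ennreal \<bar>xi\<bar> * (ennreal (\<bar>xi\<bar> powr (- (1/2))) * I)) = I" for I proof -
  have "ennreal (\<bar>xi\<bar> powr (- (1/2))) * (ennreal \<bar>xi\<bar> * (ennreal (\<bar>xi\<bar> powr (- (1/2))) * I))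
    = ennreal (\<bar>xi\<bar> powr (- (1/2)) * \<bar>xi\<bar> * \<bar>xi\<bar> powr (- (1/2))) * I" by (simp add: ennreal_mult mult.assoc)
  then show ?thesis unfolding x by simp
 qed
 finally show ?thesis ..
qed

text \<open>Cauchy-Schwarz with 1 split as |y|^(1/4) |y|^(-1/4): the second factor integrates to
  \<open>kap\<close> |xi|^(-1/2); after exchanging the integrals, the same computation in xi gives
  another \<open>kap\<close> and cancels |y|^(1/2).\<close>

theorem schur_bound:
 assumes a: "a \<in> borel_measurable borel" and a0: "!!y. 0 <= a y"
 shows "(\<integral>\<^sup>+xi. (\<integral>\<^sup>+y. ennreal (a y * mm (y * xi)) \<partial>lborel)\<^sup>2 \<partial>lborel) <= kap\<^sup>2 * (\<integral>\<^sup>+y. ennreal ((a y)\<^sup>2) \<partial>lborel)"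
proof -
 note [measurable] = a
 define k where "k xi y = ennreal ((a y)\<^sup>2 * \<bar>y\<bar> powr (1/2) * mm (y * xi))" for xi y
 have km: "(%(xi, y). k xi y) \<in> borel_measurable (lborel \<Otimes>\<^sub>M lborel)" unfolding k_def by measurable
 have CS: "(\<integral>\<^sup>+y. ennreal (a y * mm (y * xi)) \<partial>lborel)\<^sup>2 <= (\<integral>\<^sup>+y. k xi y \<partial>lborel) * (ennreal (\<bar>xi\<bar> powr (- (1/2))) * kap)"
  if xi: "xi \<noteq> 0" for xi
 proof -
  let ?p = "%y. ennreal (a y * \<bar>y\<bar> powr (1/4) * sqrt (mm (y * xi)))"
  let ?q = "%y. ennreal (\<bar>y\<bar> powr (- (1/4)) * sqrt (mm (y * xi)))"
  have e1: "(\<integral>\<^sup>+y. ennreal (a y * mm (y * xi)) \<partial>lborel) = (\<integral>\<^sup>+y. ?p y * ?q y \<partial>lborel)" proof (rule nn_integral_cong_AE)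
   show "AE y in lborel. ennreal (a y * mm (y * xi)) = ?p y * ?q y" using AE_lborel_singleton[of 0]
   proof eventually_elim
    case (elim y)
    have 1: "\<bar>y\<bar> powr (1/4) * \<bar>y\<bar> powr (- (1/4)) = 1" unfolding powr_add[symmetric] using elim by simp
    have 2: "sqrt (mm (y * xi)) * sqrt (mm (y * xi)) = mm (y * xi)" using mm_nonneg by simp
    have "(a y * \<bar>y\<bar> powr (1/4) * sqrt (mm (y * xi))) * (\<bar>y\<bar> powr (- (1/4)) * sqrt (mm (y * xi)))
     = a y * (\<bar>y\<bar> powr (1/4) * \<bar>y\<bar> powr (- (1/4))) * (sqrt (mm (y * xi)) * sqrt (mm (y * xi)))" by (simp only: mult_ac)
    then have "a y * mm (y * xi) = (a y * \<bar>y\<bar> powr (1/4) * sqrt (mm (y * xi))) * (\<bar>y\<bar> powr (- (1/4)) * sqrt (mm (y * xi)))"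
     by (simp only: 1 2 mult_1_right)
    then show ?case using a0[of y] mm_nonneg[of "y * xi"] by (simp only: ennreal_mult mult_nonneg_nonneg powr_ge_zero real_sqrt_ge_zero)
   qed
  qed
  have CS: "(\<integral>\<^sup>+y. ?p y * ?q y \<partial>lborel)\<^sup>2 <= (\<integral>\<^sup>+y. (?p y)\<^sup>2 \<partial>lborel) * (\<integral>\<^sup>+y. (?q y)\<^sup>2 \<partial>lborel)"
   by (rule Cauchy_Schwarz_nn_integral) measurable
  have e2: "(\<integral>\<^sup>+y. (?p y)\<^sup>2 \<partial>lborel) = (\<integral>\<^sup>+y. k xi y \<partial>lborel)" proof (rule nn_integral_cong)
   fix y :: real
   have "(\<bar>y\<bar> powr (1/4))\<^sup>2 = \<bar>y\<bar> powr (1/2)" by (simp add: power2_eq_square flip: powr_add)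
   then show "(?p y)\<^sup>2 = k xi y"
    using a0[of y] mm_nonneg[of "y * xi"] by (simp add: k_def ennreal_power power_mult_distrib)
  qed
  have e3: "(\<integral>\<^sup>+y. (?q y)\<^sup>2 \<partial>lborel) = (\<integral>\<^sup>+y. ennreal (\<bar>y\<bar> powr (- (1/2)) * mm (y * xi)) \<partial>lborel)"
  proof (rule nn_integral_cong)
   fix y :: real
   have "(\<bar>y\<bar> powr (- (1/4)))\<^sup>2 = \<bar>y\<bar> powr (- (1/2))" by (simp add: power2_eq_square flip: powr_add)
   then show "(?q y)\<^sup>2 = ennreal (\<bar>y\<bar> powr (- (1/2)) * mm (y * xi))"
    using mm_nonneg[of "y * xi"] by (simp add: ennreal_power power_mult_distrib)
  qed
  show ?thesis using CS unfolding e1 e2 e3 kap_scale[OF xi] .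
 qed
 have "(\<integral>\<^sup>+xi. (\<integral>\<^sup>+y. ennreal (a y * mm (y * xi)) \<partial>lborel)\<^sup>2 \<partial>lborel)
   <= (\<integral>\<^sup>+xi. (\<integral>\<^sup>+y. k xi y \<partial>lborel) * (ennreal (\<bar>xi\<bar> powr (- (1/2))) * kap) \<partial>lborel)"
  by (rule nn_integral_mono_AE) (use AE_lborel_singleton[of 0] CS in \<open>auto elim: eventually_mono\<close>)
 also have "... = (\<integral>\<^sup>+xi. kap * (\<integral>\<^sup>+y. ennreal (\<bar>xi\<bar> powr (- (1/2))) * k xi y \<partial>lborel) \<partial>lborel)"
 proof (rule nn_integral_cong)
  fix xi
  have "(\<integral>\<^sup>+y. ennreal (\<bar>xi\<bar> powr (- (1/2))) * k xi y \<partial>lborel) = ennreal (\<bar>xi\<bar> powr (- (1/2))) * (\<integral>\<^sup>+y. k xi y \<partial>lborel)"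
   by (rule nn_integral_cmult) (simp add: k_def)
  then show "(\<integral>\<^sup>+y. k xi y \<partial>lborel) * (ennreal (\<bar>xi\<bar> powr (- (1/2))) * kap) = kap * (\<integral>\<^sup>+y. ennreal (\<bar>xi\<bar> powr (- (1/2))) * k xi y \<partial>lborel)"
   by (simp add: mult_ac)
 qed
 also have "... = kap * (\<integral>\<^sup>+xi. (\<integral>\<^sup>+y. ennreal (\<bar>xi\<bar> powr (- (1/2))) * k xi y \<partial>lborel) \<partial>lborel)"
  by (rule nn_integral_cmult) (unfold k_def, measurable)
 also have "(\<integral>\<^sup>+xi. (\<integral>\<^sup>+y. ennreal (\<bar>xi\<bar> powr (- (1/2))) * k xi y \<partial>lborel) \<partial>lborel)
   = (\<integral>\<^sup>+y. (\<integral>\<^sup>+xi. ennreal (\<bar>xi\<bar> powr (- (1/2))) * k xi y \<partial>lborel) \<partial>lborel)"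
  by (rule lborel_pair.Fubini'[symmetric]) (unfold k_def, measurable)
 also have "... = (\<integral>\<^sup>+y. kap * ennreal ((a y)\<^sup>2) \<partial>lborel)" proof (rule nn_integral_cong_AE)
  show "AE y in lborel. (\<integral>\<^sup>+xi. ennreal (\<bar>xi\<bar> powr (- (1/2))) * k xi y \<partial>lborel) = kap * ennreal ((a y)\<^sup>2)"
   using AE_lborel_singleton[of 0]
  proof eventually_elim
   case (elim y)
   have "(\<integral>\<^sup>+xi. ennreal (\<bar>xi\<bar> powr (- (1/2))) * k xi y \<partial>lborel)
     = (\<integral>\<^sup>+xi. ennreal ((a y)\<^sup>2 * \<bar>y\<bar> powr (1/2)) * ennreal (\<bar>xi\<bar> powr (- (1/2)) * mm (xi * y)) \<partial>lborel)"
    unfolding k_def by (intro nn_integral_cong) (simp add: mm_nonneg mult_ac flip: ennreal_mult)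
   also have "... = ennreal ((a y)\<^sup>2 * \<bar>y\<bar> powr (1/2)) * (ennreal (\<bar>y\<bar> powr (- (1/2))) * kap)"
    unfolding kap_scale[OF elim, symmetric] by (rule nn_integral_cmult) measurable
   also have "... = ennreal ((a y)\<^sup>2 * (\<bar>y\<bar> powr (1/2) * \<bar>y\<bar> powr (- (1/2)))) * kap"
    by (simp add: ennreal_mult mult.assoc)
   also have "\<bar>y\<bar> powr (1/2) * \<bar>y\<bar> powr (- (1/2)) = 1" unfolding powr_add[symmetric] using elim by simp
   finally show ?case by (simp add: mult.commute)
  qed
 qed
 also have "... = kap * (\<integral>\<^sup>+y. ennreal ((a y)\<^sup>2) \<partial>lborel)" by (rule nn_integral_cmult) measurable
 finally show ?thesis by (simp add: power2_eq_square mult.assoc)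
qed

end

subsection \<open>The fractional energy estimate\<close>

lemma ennreal_sum3_square: "((x::ennreal) + y + z)\<^sup>2 <= 3 * (x\<^sup>2 + y\<^sup>2 + z\<^sup>2)" proof (cases x; cases y; cases z)
 fix a b c :: real assume a: "0 <= a" "x = ennreal a" and b: "0 <= b" "y = ennreal b" and c: "0 <= c" "z = ennreal c"
 have "0 <= (a - b)\<^sup>2 + (b - c)\<^sup>2 + (a - c)\<^sup>2" by simp
 then have le: "(a + b + c)\<^sup>2 <= 3 * (a\<^sup>2 + b\<^sup>2 + c\<^sup>2)" by (simp add: power2_eq_square algebra_simps)
 have "(x + y + z)\<^sup>2 = ennreal ((a + b + c)\<^sup>2)" using a b c by (simp add: ennreal_power flip: ennreal_plus)
 moreover have "3 * (x\<^sup>2 + y\<^sup>2 + z\<^sup>2) = ennreal (3 * (a\<^sup>2 + b\<^sup>2 + c\<^sup>2))"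
  using a b c by (simp add: ennreal_power ennreal_mult del: distrib_left_numeral flip: ennreal_plus)
 ultimately show ?thesis using le by (simp only: ennreal_leI)
qed (simp_all add: power2_eq_square ennreal_mult_top ennreal_top_mult)

lemma cis_minus_1_bound: "cmod (cis t - 1) <= min 2 \<bar>t\<bar>" proof -
 have "(cmod (1 - cis t))\<^sup>2 <= \<bar>t\<bar>\<^sup>2" using norm_1_minus_cis[of t] cos_quadratic_bound[of t] by simp
 then have "cmod (1 - cis t) <= \<bar>t\<bar>" by (rule power2_le_imp_le) simp
 moreover have "cmod (cis t - 1) <= 2" using norm_triangle_ineq4[of "cis t" 1] by simp
 ultimately show ?thesis by (simp add: norm_minus_commute)
qed

text \<open>Fatou along a subsequence that converges almost everywhere. It carries weighted Fourier
  bounds to limits that are taken in norm only.\<close>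

lemma nn_integral_l2_lower_semicontinuous:
 fixes h :: "real => real"
 assumes h [measurable]: "h \<in> borel_measurable borel" and v: "v ----> w"
  and le: "!!n. (\<integral>\<^sup>+x. ennreal (h x * (cmod (fn (v n) x))\<^sup>2) \<partial>lborel) <= ennreal (b n)" and b: "b ----> b0"
 shows "(\<integral>\<^sup>+x. ennreal (h x * (cmod (fn w x))\<^sup>2) \<partial>lborel) <= ennreal b0"
proof -
 obtain r where r: "strict_mono r" "AE x in lborel. (%n. fn (v (r n)) x) ----> fn w x"
  using l2_tendsto_AE_subseq[OF v] by blast
 have "(\<integral>\<^sup>+x. ennreal (h x * (cmod (fn w x))\<^sup>2) \<partial>lborel)
   = (\<integral>\<^sup>+x. liminf (%n. ennreal (h x * (cmod (fn (v (r n)) x))\<^sup>2)) \<partial>lborel)"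
 proof (rule nn_integral_cong_AE)
  show "AE x in lborel. ennreal (h x * (cmod (fn w x))\<^sup>2) = liminf (%n. ennreal (h x * (cmod (fn (v (r n)) x))\<^sup>2))"
   using r(2)
  proof eventually_elim
   case (elim x)
   have "(%n. ennreal (h x * (cmod (fn (v (r n)) x))\<^sup>2)) ----> ennreal (h x * (cmod (fn w x))\<^sup>2)"
    by (intro tendsto_ennrealI tendsto_intros elim)
   then show ?case using lim_imp_Liminf[OF sequentially_bot] by metis
  qed
 qed
 also have "... <= liminf (%n. \<integral>\<^sup>+x. ennreal (h x * (cmod (fn (v (r n)) x))\<^sup>2) \<partial>lborel)"
  by (rule nn_integral_liminf) measurable
 also have "... <= liminf (%n. ennreal (b (r n)))" by (rule Liminf_mono) (simp add: le)
 also have "... = ennreal b0" using LIMSEQ_subseq_LIMSEQ[OF b r(1)]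
  by (intro lim_imp_Liminf sequentially_bot tendsto_ennrealI) (simp add: o_def)
 finally show ?thesis .
qed

context coefficient
begin

text \<open>At 1 the continuous representative agrees with the half-line one, which is controlled
  away from the degeneracy.\<close>

lemma M_value_1:
 assumes m: "(u, G) \<in> M" and v: "continuous_on UNIV v" "AE x in lborel. fn u x = v x"
 shows "cmod (v 1) <= norm u + 2 * norm G"
proof -
 obtain U where U: "ac_on {0<..} U (%x. fn G x / sc x)" "AE x in lborel. 0 < x --> fn u x = U x"
  using M_half_line[OF m] by (elim exE conjE)
 have "v 1 = U 1" proof (rule continuous_AE_eq[OF open_greaterThan[of 0]])
  show "continuous_on {0<..} v" by (rule continuous_on_subset[OF v(1)]) simp
  show "continuous_on {0<..} U" by (rule ac_on_continuous[OF U(1)]) simp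
  show "AE x in lborel. x \<in> {0<..} --> v x = U x" using v(2) U(2) by eventually_elim auto
 qed simp
 then show ?thesis using half_line_far[OF U, of 1] by simp
qed

lemma M_value_minus_1:
 assumes m: "(u, G) \<in> M" and v: "continuous_on UNIV v" "AE x in lborel. fn u x = v x"
 shows "cmod (v (- 1)) <= norm u + 2 * norm G"
proof -
 have "cmod (v (- 1)) <= norm (Rf u) + 2 * norm (- Rf G)" proof (rule M_value_1[OF M_Rf[OF m], of "%x. v (- x)"])
  show "continuous_on UNIV (%x. v (- x))" by (rule continuous_on_compose2[OF v(1)]) (auto intro!: continuous_intros)
  show "AE x in lborel. fn (Rf u) x = v (- x)" using fn_Rf[of u] AE_reflect[OF v(2)] by eventually_elim simp
 qed
 then show ?thesis by simp
qed

text \<open>Subtracting the integral of g replaces the exponential by exp(-i xi y) - 1, whose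
  smallness at y = 0 pays for the weight |y|^\<delta> put on g. The subtracted mean contributes the
  second term.\<close>

lemma fourier_near_bound:
 assumes g: "g \<in> L2" "integrable lborel g" "!!y. 1 < \<bar>y\<bar> ==> g y = 0" and I: "cmod (LINT y|lborel. g y) <= B" and xi: "xi \<noteq> 0"
 shows "ennreal (\<bar>xi\<bar> powr (- \<delta>) * cmod (LINT y|lborel. g y * cis (- (xi * y))))
  <= (\<integral>\<^sup>+y. ennreal (\<bar>y\<bar> powr \<delta> * cmod (g y) * mm (y * xi)) \<partial>lborel) + ennreal (\<bar>xi\<bar> powr (- \<delta>) * B)"
proof -
 note [measurable] = L2_measurable[OF g(1)]
 let ?q = "\<bar>xi\<bar> powr (- \<delta>)"
 have ic: "integrable lborel (%y. g y * cis (- (xi * y)))"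
  by (rule Bochner_Integration.integrable_bound[OF g(2)]) (auto simp: norm_mult)
 have id: "integrable lborel (%y. g y * (cis (- (xi * y)) - 1))"
  using Bochner_Integration.integrable_diff[OF ic g(2)] by (simp add: right_diff_distrib)
 have "(LINT y|lborel. g y * cis (- (xi * y))) = (LINT y|lborel. g y * (cis (- (xi * y)) - 1)) + (LINT y|lborel. g y)"
  using ic g(2) by (simp add: right_diff_distrib)
 then have "cmod (LINT y|lborel. g y * cis (- (xi * y))) <= cmod (LINT y|lborel. g y * (cis (- (xi * y)) - 1)) + B"
  using norm_triangle_ineq[of "LINT y|lborel. g y * (cis (- (xi * y)) - 1)" "LINT y|lborel. g y"] I by simp
 then have "?q * cmod (LINT y|lborel. g y * cis (- (xi * y))) <= ?q * (cmod (LINT y|lborel. g y * (cis (- (xi * y)) - 1)) + B)"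
  by (rule mult_left_mono) simp
 moreover have B: "0 <= B" using I norm_ge_zero order_trans by blast
 ultimately have "ennreal (?q * cmod (LINT y|lborel. g y * cis (- (xi * y))))
   <= ennreal (?q * cmod (LINT y|lborel. g y * (cis (- (xi * y)) - 1))) + ennreal (?q * B)"
  by (simp add: distrib_left ennreal_leI flip: ennreal_plus)
 also have "ennreal (?q * cmod (LINT y|lborel. g y * (cis (- (xi * y)) - 1)))
   <= ennreal ?q * (\<integral>\<^sup>+y. ennreal (cmod (g y * (cis (- (xi * y)) - 1))) \<partial>lborel)"
  using integral_norm_bound_ennreal[OF id] by (simp add: ennreal_mult mult_left_mono)
 also have "... = (\<integral>\<^sup>+y. ennreal ?q * ennreal (cmod (g y * (cis (- (xi * y)) - 1))) \<partial>lborel)"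
  by (rule nn_integral_cmult[symmetric]) measurable
 also have "... <= (\<integral>\<^sup>+y. ennreal (\<bar>y\<bar> powr \<delta> * cmod (g y) * mm (y * xi)) \<partial>lborel)" proof (rule nn_integral_mono_AE)
  show "AE y in lborel. ennreal ?q * ennreal (cmod (g y * (cis (- (xi * y)) - 1))) <= ennreal (\<bar>y\<bar> powr \<delta> * cmod (g y) * mm (y * xi))"
   using AE_lborel_singleton[of 0]
  proof eventually_elim
   case (elim y)
   have y: "\<bar>y\<bar> powr \<delta> * \<bar>y\<bar> powr (- \<delta>) = 1" unfolding powr_add[symmetric] using elim by simp
   have "cmod (cis (- (xi * y)) - 1) <= min 2 \<bar>y * xi\<bar>"
    using cis_minus_1_bound[of "- (xi * y)"] by (simp add: mult.commute)
   then have "?q * (cmod (g y) * cmod (cis (- (xi * y)) - 1)) <= ?q * (cmod (g y) * min 2 \<bar>y * xi\<bar>)"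
    by (intro mult_left_mono) auto
   also have "... = (\<bar>y\<bar> powr \<delta> * \<bar>y\<bar> powr (- \<delta>)) * (?q * (cmod (g y) * min 2 \<bar>y * xi\<bar>))" unfolding y by simp
   also have "... = \<bar>y\<bar> powr \<delta> * cmod (g y) * mm (y * xi)" by (simp only: mm_def abs_mult powr_mult mult_ac)
   finally show ?case by (simp add: norm_mult ennreal_leI flip: ennreal_mult)
  qed
 qed
 finally show ?thesis by (simp add: add_right_mono)
qed

lemma sc_norm_square: "(cmod (sc y))\<^sup>2 = c y" using c_nonneg[of y] by (simp add: sc_def)

lemma tail_integral: "\<exists>l\<ge>0. (\<integral>\<^sup>+xi. ennreal (indicator {xi. 1 < \<bar>xi\<bar>} xi * \<bar>xi\<bar> powr (- (2 * \<delta>))) \<partial>lborel) <= ennreal l"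
proof -
 define b where "b = - (1 powr (- (2 * \<delta>) + 1)) / (- (2 * \<delta>) + 1)"
 have b: "0 <= b" using \<delta> by (simp add: b_def divide_nonpos_neg)
 have "(\<integral>\<^sup>+xi. ennreal (indicator {xi. 1 < \<bar>xi\<bar>} xi * \<bar>xi\<bar> powr (- (2 * \<delta>))) \<partial>lborel) <= ennreal (2 * b)"
 proof (rule nn_integral_even_le[where h = "%s. indicator {1..} s * s powr (- (2 * \<delta>))"])
  have "(\<integral>\<^sup>+s. ennreal (indicator {1..} s * s powr (- (2 * \<delta>))) \<partial>lborel) = ennreal b"
   unfolding b_def by (intro nn_integral_has_integral_lebesgue has_integral_powr_to_inf) (use \<delta> in auto)
  then show "(\<integral>\<^sup>+s. ennreal (indicator {1..} s * s powr (- (2 * \<delta>))) \<partial>lborel) <= ennreal b" by simp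
 qed (use b in \<open>auto simp: indicator_def\<close>)
 then show ?thesis using b by (intro exI[of _ "2 * b"]) simp
qed

text \<open>For the transforms, |xi|^(1 - \<delta>) |Fo u| = |xi|^(-\<delta>) |Fo g|, so high
  frequencies are treated through g = u'. The part of g beyond 1 is bounded in norm because c >= 1/2
  there; the part on [-1, 1] is left to the Schur test and to its mean v 1 - v (-1). Low frequencies
  cost only the norm of u.\<close>

lemma W_fourier_bound:
 "\<exists>C\<ge>0. \<forall>u g. (u, g) \<in> W --> (\<integral>\<^sup>+xi. ennreal ((xi\<^sup>2) powr (1 - \<delta>) * (cmod (fn (Fo u) xi))\<^sup>2) \<partial>lborel)
   <= ennreal (C * ((norm (mlt sc g))\<^sup>2 + (norm u)\<^sup>2))"
proof -
 define N where "N = sqrt (2 * cos_const)"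
 have N: "0 < N" using cos_const_pos by (simp add: N_def)
 obtain \<kappa> where \<kappa>: "0 <= \<kappa>" "kap = ennreal \<kappa>" using kap_finite by (cases kap) auto
 obtain l where l: "0 <= l" "(\<integral>\<^sup>+xi. ennreal (indicator {xi. 1 < \<bar>xi\<bar>} xi * \<bar>xi\<bar> powr (- (2 * \<delta>))) \<partial>lborel) <= ennreal l"
  using tail_integral by blast
 \<comment> \<open>The 1 is for low frequencies and the 3 comes from squaring a sum of three terms;
   inside stand the far part, the Schur term and the mean, where 32 is the larger coefficient in the
   bound for B^2.\<close>
 define C where "C = 1 + 3 * (2 + 2 * (\<kappa> / N)\<^sup>2 + 32 * (l / N\<^sup>2))"
 have C: "0 <= C" using l \<kappa> N unfolding C_def by (intro add_nonneg_nonneg mult_nonneg_nonneg) auto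
 have "(\<integral>\<^sup>+xi. ennreal ((xi\<^sup>2) powr (1 - \<delta>) * (cmod (fn (Fo u) xi))\<^sup>2) \<partial>lborel)
   <= ennreal (C * ((norm (mlt sc g))\<^sup>2 + (norm u)\<^sup>2))" if ug: "(u, g) \<in> W" for u g
 proof -
  define G where "G = mlt sc g"
  have GM: "(u, G) \<in> M" unfolding G_def by (rule gr_M[OF ug])
  obtain v where v: "ac_on UNIV v (fn g)" "AE x in lborel. fn u x = v x" using W_ac[OF ug] by blast
  have vc: "continuous_on UNIV v" by (rule ac_on_continuous[OF v(1)]) simp
  define B where "B = cmod (v 1) + cmod (v (- 1))"
  have B0: "0 <= B" by (simp add: B_def)
  have "B <= 2 * (norm u + 2 * norm G)"
   using M_value_1[OF GM vc v(2)] M_value_minus_1[OF GM vc v(2)] by (simp add: B_def)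
  then have "B\<^sup>2 <= (2 * (norm u + 2 * norm G))\<^sup>2" using B0 by (rule power_mono)
  also have "... <= 8 * (norm u)\<^sup>2 + 32 * (norm G)\<^sup>2"
   using zero_le_power2[of "norm u - 2 * norm G"] by (simp add: power2_eq_square algebra_simps)
  finally have B: "B\<^sup>2 <= 8 * (norm u)\<^sup>2 + 32 * (norm G)\<^sup>2" .
  define gn where "gn y = (if \<bar>y\<bar> <= 1 then fn g y else 0)" for y
  define gf where "gf y = (if \<bar>y\<bar> <= 1 then 0 else fn g y)" for y
  have gm [measurable]: "gn \<in> borel_measurable borel" "gf \<in> borel_measurable borel"
   unfolding gn_def[abs_def] gf_def[abs_def] by measurable
  have gL: "gn \<in> L2" "gf \<in> L2"
   by (rule L2_dominated[where f = "fn g" and C = 1]; (simp add: gm)?; (simp add: gn_def gf_def)?)+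
  have gn_eq: "gn y = indicator {-1..1} y *\<^sub>R fn g y" for y by (auto simp: gn_def indicator_def abs_le_iff)
  have gni: "integrable lborel gn"
   using L2_set_integrable[OF fn_L2[of g], of "-1" 1] unfolding set_integrable_def gn_eq[abs_def] .
  have "(LINT y|lborel. gn y) = v 1 - v (- 1)"
   using ac_onD(2)[OF v(1), of "-1" 1] by (simp add: gn_eq set_lebesgue_integral_def)
  then have gI: "cmod (LINT y|lborel. gn y) <= B" using norm_triangle_ineq4[of "v 1" "v (- 1)"] by (simp add: B_def)
  have "toL (%y. gf y + gn y) = g" proof -
   have "(%y. gf y + gn y) = fn g" by (auto simp: gf_def gn_def)
   then show ?thesis by simp
  qed
  then have Fg: "Fo g = Fo (toL gf) + Fo (toL gn)" using toL_add[OF gL(2,1)] linear_add[OF Fo_linear(1)] by metis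
  have wd: "weak_deriv (fn u) (fn g)" using ug by (simp add: W_def)
  define a where "a y = \<bar>y\<bar> powr \<delta> * cmod (gn y)" for y
  have am [measurable]: "a \<in> borel_measurable borel" unfolding a_def[abs_def] by measurable
  define \<Phi> where "\<Phi> xi = (\<integral>\<^sup>+y. ennreal (a y * mm (y * xi)) \<partial>lborel)" for xi
  have \<Phi>m [measurable]: "\<Phi> \<in> borel_measurable borel" unfolding \<Phi>_def[abs_def] by measurable
  let ?tail = "%xi. ennreal (indicator {xi. 1 < \<bar>xi\<bar>} xi * \<bar>xi\<bar> powr (- (2 * \<delta>)))"
  have pw: "AE xi in lborel. ennreal ((xi\<^sup>2) powr (1 - \<delta>) * (cmod (fn (Fo u) xi))\<^sup>2)
    <= ennreal ((cmod (fn (Fo u) xi))\<^sup>2) + 3 * (ennreal ((cmod (fn (Fo (toL gf)) xi))\<^sup>2) +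
     ennreal ((1 / N)\<^sup>2) * (\<Phi> xi)\<^sup>2 + ennreal ((B / N)\<^sup>2) * ?tail xi)"
   using Fo_weak_deriv[OF wd] Fo_integrable[OF gL(1) gni] fn_add[of "Fo (toL gf)" "Fo (toL gn)"]
  proof eventually_elim
   case (elim xi)
   show ?case proof (cases "\<bar>xi\<bar> <= 1")
    case True
    have "(xi\<^sup>2) powr (1 - \<delta>) <= 1" using True \<delta> by (intro powr_le1) (auto simp: abs_square_le_1)
    then have "ennreal ((xi\<^sup>2) powr (1 - \<delta>) * (cmod (fn (Fo u) xi))\<^sup>2) <= ennreal ((cmod (fn (Fo u) xi))\<^sup>2)"
     by (intro ennreal_leI mult_left_le_one_le) auto
    then show ?thesis by (rule order_trans) simp
   next
    case False
    let ?q = "\<bar>xi\<bar> powr (- \<delta>)"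
    have xi: "xi \<noteq> 0" using False by auto
    have q1: "?q <= 1" using ge_one_powr_ge_zero[of "\<bar>xi\<bar>" \<delta>] False \<delta> by (simp add: powr_minus_divide)
    have q2: "?q\<^sup>2 = \<bar>xi\<bar> powr (- (2 * \<delta>))" using xi by (simp add: powr_power)
    have "\<bar>xi\<bar> powr (- (2 * \<delta>)) * xi\<^sup>2 = \<bar>xi\<bar> powr (- (2 * \<delta>)) * \<bar>xi\<bar> powr 2" using xi by simp
    also have "... = \<bar>xi\<bar> powr (2 * (1 - \<delta>))" unfolding powr_add[symmetric] by (simp add: algebra_simps)
    also have "... = (xi\<^sup>2) powr (1 - \<delta>)" using powr_powr[of "\<bar>xi\<bar>" 2 "1 - \<delta>"] xi by simp
    finally have eq: "(xi\<^sup>2) powr (1 - \<delta>) * (cmod (fn (Fo u) xi))\<^sup>2 = (?q * cmod (fn (Fo g) xi))\<^sup>2"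
     using elim(1) by (simp add: norm_mult power_mult_distrib q2)
    have le: "ennreal (?q * cmod (fn (Fo g) xi)) <= ennreal (cmod (fn (Fo (toL gf)) xi)) + ennreal (1 / N) * \<Phi> xi + ennreal (?q * B / N)"
    proof -
     let ?I = "LINT y|lborel. gn y * cis (- (xi * y))"
     have "cmod (fn (Fo g) xi) <= cmod (fn (Fo (toL gf)) xi) + cmod ?I / N"
      using elim(2,3) N norm_triangle_ineq[of "fn (Fo (toL gf)) xi" "?I / cor N"]
      by (simp add: Fg N_def norm_divide)
     then have "?q * cmod (fn (Fo g) xi) <= ?q * (cmod (fn (Fo (toL gf)) xi) + cmod ?I / N)"
      by (rule mult_left_mono) simp
     also have "... <= cmod (fn (Fo (toL gf)) xi) + 1 / N * (?q * cmod ?I)"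
      using mult_right_mono[OF q1, of "cmod (fn (Fo (toL gf)) xi)"] by (simp add: distrib_left)
     finally have "ennreal (?q * cmod (fn (Fo g) xi)) <= ennreal (cmod (fn (Fo (toL gf)) xi)) + ennreal (1 / N) * ennreal (?q * cmod ?I)"
      using N by (simp add: ennreal_leI flip: ennreal_plus ennreal_mult)
     also have "ennreal (1 / N) * ennreal (?q * cmod ?I) <= ennreal (1 / N) * (\<Phi> xi + ennreal (?q * B))"
      unfolding \<Phi>_def a_def by (intro mult_left_mono fourier_near_bound gL gni gI xi) (auto simp: gn_def)
     also have "... = ennreal (1 / N) * \<Phi> xi + ennreal (?q * B / N)"
      using N B0 by (simp add: distrib_left flip: ennreal_mult)
     finally show ?thesis by (simp add: add.assoc add_left_mono)
    qed
    have e1: "(ennreal (1 / N) * \<Phi> xi)\<^sup>2 = ennreal ((1 / N)\<^sup>2) * (\<Phi> xi)\<^sup>2"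
     using N by (simp only: power_mult_distrib ennreal_power zero_le_divide_1_iff less_imp_le)
    have "(?q * B / N)\<^sup>2 = (B / N)\<^sup>2 * ?q\<^sup>2" by (simp add: power_mult_distrib power_divide)
    then have e2: "(ennreal (?q * B / N))\<^sup>2 = ennreal ((B / N)\<^sup>2) * ?tail xi"
     using False N B0 by (simp add: ennreal_power q2 flip: ennreal_mult)
    have e3: "(ennreal (cmod (fn (Fo (toL gf)) xi)))\<^sup>2 = ennreal ((cmod (fn (Fo (toL gf)) xi))\<^sup>2)"
     by (simp add: ennreal_power)
    have "ennreal ((xi\<^sup>2) powr (1 - \<delta>) * (cmod (fn (Fo u) xi))\<^sup>2) = (ennreal (?q * cmod (fn (Fo g) xi)))\<^sup>2"
     unfolding eq by (simp add: ennreal_power)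
    also have "... <= (ennreal (cmod (fn (Fo (toL gf)) xi)) + ennreal (1 / N) * \<Phi> xi + ennreal (?q * B / N))\<^sup>2"
     by (rule power_mono[OF le]) simp
    also have "... <= 3 * (ennreal ((cmod (fn (Fo (toL gf)) xi))\<^sup>2) + ennreal ((1 / N)\<^sup>2) * (\<Phi> xi)\<^sup>2 + ennreal ((B / N)\<^sup>2) * ?tail xi)"
     unfolding e1[symmetric] e2[symmetric] e3[symmetric] by (rule ennreal_sum3_square)
    finally show ?thesis by (rule order_trans) (simp add: add_increasing)
   qed
  qed
  have G2: "AE y in lborel. (cmod (fn G y))\<^sup>2 = c y * (cmod (fn g y))\<^sup>2"
   using fn_mlt_bdd[OF bdd_sc, of g] unfolding G_def by eventually_elim (simp add: norm_mult power_mult_distrib sc_norm_square)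
  have "ennreal ((norm (toL gf))\<^sup>2) = (\<integral>\<^sup>+y. ennreal ((cmod (gf y))\<^sup>2) \<partial>lborel)"
   by (rule nn_integral_norm_toL[OF gL(2), symmetric])
  also have "... <= (\<integral>\<^sup>+y. ennreal 2 * ennreal ((cmod (fn G y))\<^sup>2) \<partial>lborel)" proof (rule nn_integral_mono_AE)
   show "AE y in lborel. ennreal ((cmod (gf y))\<^sup>2) <= ennreal 2 * ennreal ((cmod (fn G y))\<^sup>2)" using G2
   proof eventually_elim
    case (elim y)
    have "(cmod (gf y))\<^sup>2 <= 2 * (cmod (fn G y))\<^sup>2" proof (cases "\<bar>y\<bar> <= 1")
     case False
     then have "1 / 2 * (cmod (fn g y))\<^sup>2 <= c y * (cmod (fn g y))\<^sup>2" by (intro mult_right_mono c_lower_far) auto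
     then show ?thesis using False elim by (simp add: gf_def)
    qed (simp add: gf_def)
    then show ?case by (metis ennreal_leI ennreal_mult zero_le_numeral zero_le_power2)
   qed
  qed
  also have "... = ennreal 2 * ennreal ((norm G)\<^sup>2)"
   by (subst nn_integral_cmult) (simp_all only: nn_integral_norm_l2, measurable)
  finally have I1: "ennreal ((norm (toL gf))\<^sup>2) <= ennreal (2 * (norm G)\<^sup>2)" by (simp add: ennreal_mult)
  have "(\<integral>\<^sup>+y. ennreal ((a y)\<^sup>2) \<partial>lborel) <= (\<integral>\<^sup>+y. ennreal 2 * ennreal ((cmod (fn G y))\<^sup>2) \<partial>lborel)"
  proof (rule nn_integral_mono_AE)
   show "AE y in lborel. ennreal ((a y)\<^sup>2) <= ennreal 2 * ennreal ((cmod (fn G y))\<^sup>2)" using G2 proof eventually_elim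
    case (elim y)
    have "(a y)\<^sup>2 <= 2 * (cmod (fn G y))\<^sup>2" proof (cases "\<bar>y\<bar> <= 1")
     case True
     have "(\<bar>y\<bar> powr \<delta>)\<^sup>2 = \<bar>y\<bar> powr (2 * \<delta>)" by (simp add: power2_eq_square flip: powr_add)
     moreover have "\<bar>y\<bar> powr (2 * \<delta>) * (cmod (fn g y))\<^sup>2 <= 2 * c y * (cmod (fn g y))\<^sup>2"
      using c_lower_near[OF True] by (intro mult_right_mono) auto
     ultimately show ?thesis using True elim by (simp add: a_def gn_def power_mult_distrib)
    qed (simp add: a_def gn_def)
    then show ?case by (metis ennreal_leI ennreal_mult zero_le_numeral zero_le_power2)
   qed
  qed
  also have "... = ennreal 2 * ennreal ((norm G)\<^sup>2)"
   by (subst nn_integral_cmult) (simp_all only: nn_integral_norm_l2, measurable)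
  finally have I2: "(\<integral>\<^sup>+y. ennreal ((a y)\<^sup>2) \<partial>lborel) <= ennreal (2 * (norm G)\<^sup>2)" by (simp add: ennreal_mult)
  have "(\<integral>\<^sup>+xi. (\<Phi> xi)\<^sup>2 \<partial>lborel) <= kap\<^sup>2 * (\<integral>\<^sup>+y. ennreal ((a y)\<^sup>2) \<partial>lborel)"
   unfolding \<Phi>_def by (rule schur_bound) (auto simp: a_def)
  also have "... <= kap\<^sup>2 * ennreal (2 * (norm G)\<^sup>2)" by (rule mult_left_mono[OF I2]) simp
  finally have I3: "(\<integral>\<^sup>+xi. (\<Phi> xi)\<^sup>2 \<partial>lborel) <= ennreal (\<kappa>\<^sup>2 * (2 * (norm G)\<^sup>2))"
   using \<kappa> by (simp add: ennreal_power flip: ennreal_mult)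
  have "(\<integral>\<^sup>+xi. ennreal ((xi\<^sup>2) powr (1 - \<delta>) * (cmod (fn (Fo u) xi))\<^sup>2) \<partial>lborel)
   <= (\<integral>\<^sup>+xi. ennreal ((cmod (fn (Fo u) xi))\<^sup>2) + 3 * (ennreal ((cmod (fn (Fo (toL gf)) xi))\<^sup>2) +
     ennreal ((1 / N)\<^sup>2) * (\<Phi> xi)\<^sup>2 + ennreal ((B / N)\<^sup>2) * ?tail xi) \<partial>lborel)" by (rule nn_integral_mono_AE[OF pw])
  also have "... = ennreal ((norm u)\<^sup>2) + 3 * (ennreal ((norm (toL gf))\<^sup>2) +
     ennreal ((1 / N)\<^sup>2) * (\<integral>\<^sup>+xi. (\<Phi> xi)\<^sup>2 \<partial>lborel) + ennreal ((B / N)\<^sup>2) * (\<integral>\<^sup>+xi. ?tail xi \<partial>lborel))"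
   by (simp add: nn_integral_add nn_integral_cmult nn_integral_norm_l2 Fo_norm)
  also have "... <= ennreal ((norm u)\<^sup>2) + 3 * (ennreal (2 * (norm G)\<^sup>2) +
     ennreal ((1 / N)\<^sup>2) * ennreal (\<kappa>\<^sup>2 * (2 * (norm G)\<^sup>2)) + ennreal ((B / N)\<^sup>2) * ennreal l)"
   by (intro add_mono mult_left_mono I1 I3 l order_refl) auto
  also have "... = ennreal ((norm u)\<^sup>2 + 3 * (2 * (norm G)\<^sup>2 + (1 / N)\<^sup>2 * (\<kappa>\<^sup>2 * (2 * (norm G)\<^sup>2)) + (B / N)\<^sup>2 * l))"
  proof -
   have conv: "ennreal x + 3 * (ennreal a + ennreal p * ennreal b + ennreal q * ennreal l)
     = ennreal (x + 3 * (a + p * b + q * l))"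
    if "0 <= x" "0 <= a" "0 <= b" "0 <= p" "0 <= q" for x a b p q :: real
    using that l by (simp add: ennreal_plus ennreal_mult)
   show ?thesis by (rule conv) simp_all
  qed
  also have "... <= ennreal (C * ((norm G)\<^sup>2 + (norm u)\<^sup>2))" proof (rule ennreal_leI)
   have "(B / N)\<^sup>2 * l = l / N\<^sup>2 * B\<^sup>2" by (simp add: power_divide)
   also have "... <= l / N\<^sup>2 * (8 * (norm u)\<^sup>2 + 32 * (norm G)\<^sup>2)" by (rule mult_left_mono[OF B]) (use l in simp)
   also have "... <= l / N\<^sup>2 * (32 * ((norm G)\<^sup>2 + (norm u)\<^sup>2))" by (rule mult_left_mono) (use l in auto)
   finally have 1: "(B / N)\<^sup>2 * l <= 32 * (l / N\<^sup>2) * ((norm G)\<^sup>2 + (norm u)\<^sup>2)" by (simp only: mult_ac)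
   have "(1 / N)\<^sup>2 * (\<kappa>\<^sup>2 * (2 * (norm G)\<^sup>2)) = 2 * (\<kappa> / N)\<^sup>2 * (norm G)\<^sup>2" by (simp add: power_divide)
   also have "... <= 2 * (\<kappa> / N)\<^sup>2 * ((norm G)\<^sup>2 + (norm u)\<^sup>2)" by (intro mult_left_mono) auto
   finally have 2: "(1 / N)\<^sup>2 * (\<kappa>\<^sup>2 * (2 * (norm G)\<^sup>2)) <= 2 * (\<kappa> / N)\<^sup>2 * ((norm G)\<^sup>2 + (norm u)\<^sup>2)" .
   have 3: "(norm u)\<^sup>2 <= (norm G)\<^sup>2 + (norm u)\<^sup>2" "2 * (norm G)\<^sup>2 <= 2 * ((norm G)\<^sup>2 + (norm u)\<^sup>2)" by auto
   have "(norm u)\<^sup>2 + 3 * (2 * (norm G)\<^sup>2 + (1 / N)\<^sup>2 * (\<kappa>\<^sup>2 * (2 * (norm G)\<^sup>2)) + (B / N)\<^sup>2 * l)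
     <= ((norm G)\<^sup>2 + (norm u)\<^sup>2) + 3 * (2 * ((norm G)\<^sup>2 + (norm u)\<^sup>2) + 2 * (\<kappa> / N)\<^sup>2 * ((norm G)\<^sup>2 + (norm u)\<^sup>2)
      + 32 * (l / N\<^sup>2) * ((norm G)\<^sup>2 + (norm u)\<^sup>2))" using 1 2 3 by (intro add_mono mult_left_mono) auto
   also have "... = C * ((norm G)\<^sup>2 + (norm u)\<^sup>2)" unfolding C_def by (simp only: distrib_right distrib_left mult_1 mult.assoc)
   finally show "(norm u)\<^sup>2 + 3 * (2 * (norm G)\<^sup>2 + (1 / N)\<^sup>2 * (\<kappa>\<^sup>2 * (2 * (norm G)\<^sup>2)) + (B / N)\<^sup>2 * l) <= C * ((norm G)\<^sup>2 + (norm u)\<^sup>2)" .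
  qed
  finally show ?thesis by (simp add: G_def)
 qed
 then show ?thesis using C by blast
qed

text \<open>The right-hand side is continuous in the pair and the left-hand side lower
  semicontinuous, so the bound passes to the closure.\<close>

lemma M_fourier_bound:
 "\<exists>C\<ge>0. \<forall>u G. (u, G) \<in> M --> (\<integral>\<^sup>+xi. ennreal ((xi\<^sup>2) powr (1 - \<delta>) * (cmod (fn (Fo u) xi))\<^sup>2) \<partial>lborel)
   <= ennreal (C * ((norm G)\<^sup>2 + (norm u)\<^sup>2))"
proof -
 obtain C where C: "0 <= C" "!!u g. (u, g) \<in> W ==> (\<integral>\<^sup>+xi. ennreal ((xi\<^sup>2) powr (1 - \<delta>) * (cmod (fn (Fo u) xi))\<^sup>2) \<partial>lborel)
   <= ennreal (C * ((norm (mlt sc g))\<^sup>2 + (norm u)\<^sup>2))" using W_fourier_bound by blast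
 have "(\<integral>\<^sup>+xi. ennreal ((xi\<^sup>2) powr (1 - \<delta>) * (cmod (fn (Fo u) xi))\<^sup>2) \<partial>lborel) <= ennreal (C * ((norm G)\<^sup>2 + (norm u)\<^sup>2))"
  if m: "(u, G) \<in> M" for u G
 proof -
  have "(u, G) \<in> closure (gr sc)" using m by (simp add: M_def)
  then obtain z where z: "!!n. z n \<in> gr sc" "z ----> (u, G)" unfolding closure_sequential by blast
  have z1: "(%n. fst (z n)) ----> u" and z2: "(%n. snd (z n)) ----> G"
   using tendsto_fst[OF z(2)] tendsto_snd[OF z(2)] by simp_all
  show ?thesis proof (rule nn_integral_l2_lower_semicontinuous)
   show "(%n. Fo (fst (z n))) ----> Fo u" using continuous_on_tendsto_compose[OF Fo_continuous(1)[of UNIV] z1] by simp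
   show "(\<integral>\<^sup>+xi. ennreal ((xi\<^sup>2) powr (1 - \<delta>) * (cmod (fn (Fo (fst (z n))) xi))\<^sup>2) \<partial>lborel)
     <= ennreal (C * ((norm (snd (z n)))\<^sup>2 + (norm (fst (z n)))\<^sup>2))" for n
   proof -
    obtain v g where "(v, g) \<in> W" "z n = (v, mlt sc g)" using z(1)[of n] by (auto simp: gr_def)
    then show ?thesis using C(2) by simp
   qed
   show "(%n. C * ((norm (snd (z n)))\<^sup>2 + (norm (fst (z n)))\<^sup>2)) ----> C * ((norm G)\<^sup>2 + (norm u)\<^sup>2)"
    by (intro tendsto_intros z1 z2)
  qed measurable
 qed
 then show ?thesis using C(1) by blast
qed

end

context viscosity
begin

text \<open>Cutting s at n^2 is cutting sqrt(s) at n. The energy of the truncated vector is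
  therefore the squared norm of a truncation of \<open>v\<close>, the image of \<open>u\<close>
  under the square root; this connects the operator power with the form closure
  \<open>M\<close>.\<close>

lemma sqrt_domain_approx:
 assumes uv: "(u, v) \<in> sop (%s. s powr (1 / 2))"
 defines "h n \<equiv> indicator {0..(real n)\<^sup>2} :: real => real"
 shows "\<exists>G. (T (h n) u, G) \<in> M & norm G <= norm v" and "norm (T (h n) u) <= norm u" and "(%n. T (h n) u) ----> u"
proof -
 have fm: "(%s::real. s powr (1 / 2)) \<in> borel_measurable borel" by measurable
 have hb: "bounded_borel (h n)" for n unfolding h_def by (rule bounded_borel_indicator) simp
 show "norm (T (h n) u) <= norm u"
  using norm_T_le[OF bounded_borel_measurable[OF hb], of n 1 u] by (simp add: h_def indicator_def)
 have "T (h n) u = P {..(real n)\<^sup>2} u" for n unfolding T_indicator[of "{..(real n)\<^sup>2}", symmetric, simplified] h_def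
  by (rule T_cong) (auto simp: indicator_def)
 moreover have "(%n. P {..(real n)\<^sup>2} u) ----> u" proof (rule P_incseq_tendsto)
  show "(\<Union>n. {..(real n)\<^sup>2}) = UNIV" proof (intro equalityI subsetI UNIV_I)
   fix x :: real
   obtain m where "x <= real m" using real_arch_simple by blast
   also have "real m <= 1 * real (Suc m)" by simp
   also have "... <= real (Suc m) * real (Suc m)" by (rule mult_right_mono) auto
   finally show "x \<in> (\<Union>n. {..(real n)\<^sup>2})" by (auto simp: power2_eq_square intro!: exI[of _ "Suc m"])
  qed
  show "incseq (%n. {..(real n)\<^sup>2})" unfolding incseq_def by (auto intro!: order_trans[OF _ power_mono])
 qed simp
 ultimately show "(%n. T (h n) u) ----> u" by simp
 define p where "p s = (if 0 <= s & s <= (real n)\<^sup>2 then sqrt s else 0)" for s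
 have pb: "bounded_borel p" proof (rule bounded_borelI[of _ "real n"])
  show "\<bar>p s\<bar> <= real n" for s by (auto simp: p_def intro: real_le_lsqrt)
  show "p \<in> borel_measurable borel" unfolding p_def[abs_def] by measurable
 qed
 have pp: "p s * p s = s * h n s" "p s * h n s = p s" for s by (auto simp: p_def h_def indicator_def)
 have shb: "bounded_borel (%s. s * h n s)" using bounded_borel_mult[OF pb pb] by (simp add: pp)
 have "(T (h n) u, T (%s. s * h n s) u) \<in> H" by (rule T_in_sop[OF id_borel hb shb])
 then obtain G where G: "hm (T (h n) u) (T (%s. s * h n s) u) G" using H_hm by blast
 have "(norm G)\<^sup>2 = inner (T p (T p u)) (T (h n) u)" unfolding hm_energy[OF G] T_mult[OF pb pb] pp ..
 also have "... = inner (T p u) (T p u)" unfolding T_sym[OF pb, of "T p u"] T_mult[OF pb hb] pp ..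
 finally have "norm G = norm (T p u)" by (simp add: norm_eq_sqrt_inner)
 also have "T p u = T (trunc (%s. s powr (1 / 2)) n) u" proof (rule T_cong)
  fix s :: real assume s: "0 <= s"
  have "sqrt s <= real n \<longleftrightarrow> s <= (real n)\<^sup>2" using s power_mono[of "sqrt s" "real n" 2] by (auto intro: real_le_lsqrt)
  then show "p s = trunc (%s. s powr (1 / 2)) n s" using s by (simp add: p_def trunc_def powr_half_sqrt)
 qed (simp_all add: pb bounded_borel_trunc[OF fm])
 also have "... = T (indicator {x. \<bar>x powr (1 / 2)\<bar> <= real n}) v"
  using uv unfolding sop_iff[OF fm] T_indicator[OF level_sets[OF fm]] by simp
 also have "norm ... <= 1 * norm v" by (rule norm_T_le) (use level_sets[OF fm, of n] in \<open>auto simp: indicator_def\<close>)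
 finally have "norm G <= norm v" by simp
 then show "\<exists>G. (T (h n) u, G) \<in> M & norm G <= norm v" using G by (auto simp: hm_def)
qed

end

text \<open>Spectral truncations lie in the form domain and obey the Fourier bound, which passes to
  \<open>phi\<close> by lower semicontinuity. The constants are 1 / (C + 1) and 1; the added 1
  covers the case C = 0.\<close>

theorem viscosity_subelliptic:
 assumes \<delta>: "1/2 < \<delta>" "\<delta> < 1" and visc: "is_viscosity_operator (c_coeff \<delta>) H0"
 shows "subelliptic H0 (1 - \<delta>)"
proof -
 interpret coefficient \<delta> by unfold_locales (use \<delta> in auto)
 obtain C where C: "0 <= C" and b: "!!u G. (u, G) \<in> M ==> (\<integral>\<^sup>+xi. ennreal ((xi\<^sup>2) powr (1 - \<delta>) * (cmod (fn (Fo u) xi))\<^sup>2) \<partial>lborel)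
   <= ennreal (C * ((norm G)\<^sup>2 + (norm u)\<^sup>2))" using M_fourier_bound by blast
 have "\<exists>g. (phi, g) \<in> op_power laplacian ((1 - \<delta>) / 2) &
   1 / (C + 1) * (l2_norm g)\<^sup>2 <= (l2_norm f)\<^sup>2 + 1 * (l2_norm phi)\<^sup>2" if pf: "(phi, f) \<in> op_power H0 (1 / 2)" for phi f
 proof -
  obtain E where E: "pvm E" "H0 = spectral_op E (%s. s)" "(phi, f) \<in> spectral_op E (%s. s powr (1 / 2))"
   using pf by (auto simp: op_power_def spectral_resolution_def)
  interpret V: viscosity \<delta> E by unfold_locales (use E visc in auto)
  have uv: "phi \<in> L2" "f \<in> L2" "(toL phi, toL f) \<in> V.sop (%s. s powr (1 / 2))"
   using E(3) by (auto simp: V.spectral_op_iff)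
  let ?I = "%u. \<integral>\<^sup>+xi. ennreal ((xi\<^sup>2) powr (1 - \<delta>) * (cmod (fn (Fo u) xi))\<^sup>2) \<partial>lborel"
  let ?h = "%n. indicator {0..(real n)\<^sup>2} :: real => real"
  let ?B = "C * ((norm (toL f))\<^sup>2 + (norm (toL phi))\<^sup>2)"
  have I: "?I (toL phi) <= ennreal ?B" proof (rule nn_integral_l2_lower_semicontinuous)
   show "(%n. Fo (V.T (?h n) (toL phi))) ----> Fo (toL phi)"
    using continuous_on_tendsto_compose[OF Fo_continuous(1)[of UNIV] V.sqrt_domain_approx(3)[OF uv(3)]] by simp
   show "?I (V.T (?h n) (toL phi)) <= ennreal ?B" for n proof -
    obtain G where G: "(V.T (?h n) (toL phi), G) \<in> M" "norm G <= norm (toL f)"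
     using V.sqrt_domain_approx(1)[OF uv(3)] by blast
    have "?I (V.T (?h n) (toL phi)) <= ennreal (C * ((norm G)\<^sup>2 + (norm (V.T (?h n) (toL phi)))\<^sup>2))" by (rule b[OF G(1)])
    also have "... <= ennreal ?B"
     by (intro ennreal_leI mult_left_mono add_mono power_mono G V.sqrt_domain_approx(2)[OF uv(3)] C) auto
    finally show ?thesis .
   qed
   show "(%xi::real. (xi\<^sup>2) powr (1 - \<delta>)) \<in> borel_measurable borel" by measurable
  qed simp
  define k where "k xi = cor ((xi\<^sup>2) powr ((1 - \<delta>) / 2)) * fn (Fo (toL phi)) xi" for xi :: real
  have km: "k \<in> borel_measurable borel" unfolding k_def[abs_def] by measurable
  have "(cmod (k xi))\<^sup>2 = (xi\<^sup>2) powr (1 - \<delta>) * (cmod (fn (Fo (toL phi)) xi))\<^sup>2" for xi proof -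
   have "((xi\<^sup>2) powr ((1 - \<delta>) / 2))\<^sup>2 = (xi\<^sup>2) powr (1 - \<delta>)"
    by (simp add: power2_eq_square[of "_ powr _"] flip: powr_add)
   then show ?thesis by (simp add: k_def norm_mult power_mult_distrib)
  qed
  then have kI: "(\<integral>\<^sup>+xi. ennreal ((cmod (k xi))\<^sup>2) \<partial>lborel) <= ennreal ?B" using I by simp
  then have kL: "k \<in> L2" by (intro L2I_nn km) (auto intro: le_less_trans)
  have B: "0 <= ?B" using C by simp
  have kn: "(norm (toL k))\<^sup>2 <= ?B" using kI B unfolding nn_integral_norm_toL[OF kL] by simp
  obtain g where g: "(phi, g) \<in> op_power laplacian ((1 - \<delta>) / 2)" "(l2_norm g)\<^sup>2 = (norm (toL k))\<^sup>2"
   using op_power_laplacianI[OF uv(1) kL[unfolded k_def[abs_def]]] unfolding k_def[abs_def, symmetric] by blast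
  have "(l2_norm g)\<^sup>2 <= C * ((l2_norm f)\<^sup>2 + (l2_norm phi)\<^sup>2)" using kn uv unfolding g(2) by (simp add: norm_toL)
  moreover have "0 <= (l2_norm f)\<^sup>2 + (l2_norm phi)\<^sup>2" by simp
  ultimately have "(l2_norm g)\<^sup>2 <= (C + 1) * ((l2_norm f)\<^sup>2 + (l2_norm phi)\<^sup>2)"
   unfolding distrib_right mult_1 by linarith
  then have "1 / (C + 1) * (l2_norm g)\<^sup>2 <= (l2_norm f)\<^sup>2 + 1 * (l2_norm phi)\<^sup>2"
   using C by (simp add: pos_divide_le_eq mult.commute)
  then show ?thesis using g(1) by blast
 qed
 then show ?thesis unfolding subelliptic_def using \<delta> C by (intro conjI exI[of _ "1 / (C + 1)"] exI[of _ 1]) auto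
qed

theorem mainTheorem6:
 fixes \<delta> :: real and H0 :: l2_op and S :: "real \<Rightarrow> (real \<Rightarrow> complex) \<Rightarrow> (real \<Rightarrow> complex)"
 assumes "1/2 < \<delta>" and "\<delta> < 1" and "is_viscosity_operator (c_coeff \<delta>) H0" and "is_exp_semigroup H0 S"
 shows "(\<forall>x. c_coeff \<delta> differentiable (at x))
  \<and> deriv (c_coeff \<delta>) \<in> holder_space (2 * \<delta> - 1)
  \<and> subelliptic H0 (1 - \<delta>)
  \<and> (\<forall>t>0. \<exists>K. is_kernel (S t) K \<and> bounded_kernel K)
  \<and> (\<forall>t>0. \<not> positivity_improving (S t)
     \<and> (\<forall>K. is_kernel (S t) K \<longrightarrow>
        \<not> strictly_positive_kernel K \<and> \<not> continuous_kernel K))"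
proof -
 \<comment> \<open>A single resolution serves all times t and also represents \<open>H0\<close>, so
   one interpretation of the locale suffices.\<close>
 obtain E where E: "pvm E" "H0 = spectral_op E (\<lambda>s. s)"
  and S: "\<And>t \<phi>. 0 \<le> t \<Longrightarrow> \<phi> \<in> L2 \<Longrightarrow> (\<phi>, S t \<phi>) \<in> spectral_op E (\<lambda>s. exp (- t * s))"
  using assms(4) by (auto simp: is_exp_semigroup_def spectral_resolution_def)
 interpret V: viscosity \<delta> E by unfold_locales (use E assms in auto)
 have "c_coeff \<delta> differentiable (at x)" for x using V.c_has_deriv[of x] by (auto simp: real_differentiable_def)
 moreover have "deriv (c_coeff \<delta>) \<in> holder_space (2 * \<delta> - 1)" unfolding V.deriv_c by (rule V.c'_holder)
 moreover have "subelliptic H0 (1 - \<delta>)" by (rule viscosity_subelliptic[OF assms(1-3)])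
 moreover have "\<exists>K. is_kernel (S t) K \<and> bounded_kernel K" if "0 < t" for t
  by (rule V.kernel_exists[OF that S]) (use that in auto)
 moreover have "\<not> positivity_improving (S t)" if "0 < t" for t
  by (rule V.not_positivity_improving[OF that S]) (use that in auto)
 moreover have "\<not> strictly_positive_kernel K \<and> \<not> continuous_kernel K"
  if "0 < t" "is_kernel (S t) K" for t K
 proof
  show "\<not> strictly_positive_kernel K"
   by (rule V.not_strictly_positive_kernel[OF that(1) S that(2)]) (use that in auto)
  show "\<not> continuous_kernel K" by (rule V.not_continuous_kernel[OF that(1) S that(2)]) (use that in auto)
 qed
 ultimately show ?thesis by blast
qed

end
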